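(* Let $s\in(0,1)$, let $\bar r\in Z_{ad}$ be the optimal control of the truncated optimal control problem (see context) and let $\bar p$ be the corresponding truncated optimal adjoint state. Let $\Omega$ be a convex domain and $A\in C^{0,1}(\bar\Omega)$. If $a<0<b$ and $u_d\in\mathbb H^{1-s}(\Omega)$, then $\bar r\in H^1_0(\Omega)$. If, in addition, $u_d\in H^1_0(\Omega)$, then $\mathrm{tr}_\Omega\,\bar p\in\mathbb H^{\kappa}(\Omega)$, where $\kappa=\min\{1+2s,2\}$.
   Context: $\Omega\subset\mathbb R^n$ ($n\ge1$) is open, bounded, connected, with Lipschitz boundary. $\mathcal L w=-\mathrm{div}(A\nabla w)$ with homogeneous Dirichlet boundary conditions, where $A$ is a symmetric, bounded, measurable, uniformly elliptic matrix field on $\Omega$. Let $\{(\lambda_k,\varphi_k)\}_{k\ge1}$ be its eigenpairs, with $\{\varphi_k\}$ an orthonormal basis of $L^2(\Omega)$. For $r\ge0$, $\mathbb H^r(\Omega)=\{w=\sum_k w_k\varphi_k:\ \sum_k\lambda_k^{r}w_k^2<\infty\}$, with norm $(\sum_k\lambda_k^r w_k^2)^{1/2}$; for $r\in(1,2]$ and $\Omega$ convex (with $A$ Lipschitz) this space is $H^r(\Omega)\cap H^1_0(\Omega)$. The dual of $\mathbb H^s(\Omega)$ is $\mathbb H^{-s}(\Omega)$. Let $s\in(0,1)$, $\alpha=1-2s$, $d_s=2^{\alpha}\Gamma(1-s)/\Gamma(s)$, and let $Y\ge1$ be a truncation parameter. Points of $\mathbb R^{n+1}$ are written $(x',y)$.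 Put $\mathcal C_Y=\Omega\times(0,Y)$, and let $\mathring H^1_L(y^\alpha,\mathcal C_Y)$ be the space of $v\in H^1(y^\alpha,\mathcal C_Y)$ (i.e. $\int_{\mathcal C_Y}y^\alpha(v^2+|\nabla v|^2)<\infty$) vanishing on $(\partial\Omega\times[0,Y])\cup(\Omega\times\{Y\})$. $\mathrm{tr}_\Omega$ denotes the trace on $\Omega\times\{0\}$, which maps this space into $\mathbb H^s(\Omega)$. Let $\mathbf A(x',y)=\mathrm{diag}\{A(x'),1\}$ and $a_Y(w,\phi)=\frac1{d_s}\int_{\mathcal C_Y}y^\alpha\mathbf A\nabla w\cdot\nabla\phi$. Truncated optimal control problem: given $\vartheta>0$, $u_d\in L^2(\Omega)$ and real numbers $a<b$, minimize $\tfrac12\|\mathrm{tr}_\Omega v-u_d\|_{L^2(\Omega)}^2+\tfrac\vartheta2\|r\|_{L^2(\Omega)}^2$ over $r\in Z_{ad}=\{w\in L^2(\Omega): a\le w\le b\text{ a.e.}\}$, where $v=v(r)\in\mathring H^1_L(y^\alpha,\mathcal C_Y)$ solves $a_Y(v,\phi)=\langle r,\mathrm{tr}_\Omega\phi\rangle_{\mathbb H^{-s}(\Omega)\times\mathbb H^s(\Omega)}$ for all $\phi\in\mathring H^1_L(y^\alpha,\mathcal C_Y)$. It has a unique solution $(\bar v,\bar r)$, $\bar v=v(\bar r)$. The truncated optimal adjoint state $\bar p\in\mathring H^1_L(y^\alpha,\mathcal C_Y)$ is the solution of $a_Y(\phi,\bar p)=(\mathrm{tr}_\Omega\bar v-u_d,\mathrm{tr}_\Omega\phi)_{L^2(\Omega)}$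 for all $\phi\in\mathring H^1_L(y^\alpha,\mathcal C_Y)$. *)

theory Defs
  imports "HOL-Analysis.Analysis"
begin

text \<open>Locally, in an orthonormal frame whose last direction is \<open>e\<close>, the set is the strict
  epigraph of a Lipschitz function of the remaining coordinates \<open>z - (z \<bullet> e) *\<^sub>R e\<close>.\<close>

definition lipschitz_boundary :: "'a::euclidean_space set \<Rightarrow> bool" where
  "lipschitz_boundary U \<longleftrightarrow>
     (\<forall>x\<in>frontier U. \<exists>r>0. \<exists>e \<gamma> L. norm e = 1 \<and> L-lipschitz_on UNIV \<gamma> \<and>
        U \<inter> ball x r = {z \<in> ball x r. \<gamma> (z - (z \<bullet> e) *\<^sub>R e) < z \<bullet> e})"

definition elliptic_coefficients :: "(real^'n) set \<Rightarrow> (real^'n \<Rightarrow> real^'n^'n) \<Rightarrow> bool" where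
  "elliptic_coefficients \<Omega> A \<longleftrightarrow>
     A \<in> borel_measurable (lebesgue_on \<Omega>) \<and>
     (AE x in lebesgue_on \<Omega>. transpose (A x) = A x) \<and>
     (\<exists>M. AE x in lebesgue_on \<Omega>. norm (A x) \<le> M) \<and>
     (\<exists>c>0. AE x in lebesgue_on \<Omega>. \<forall>\<xi>. c * (norm \<xi>)\<^sup>2 \<le> \<xi> \<bullet> (A x *v \<xi>))"

text \<open>Elements of function spaces are represented by total functions, of which only the
  almost-everywhere class on the underlying set matters.\<close>

primrec Ck :: "nat \<Rightarrow> ('a::euclidean_space \<Rightarrow> real) \<Rightarrow> bool" where
  "Ck 0 f \<longleftrightarrow> continuous_on UNIV f"
| "Ck (Suc k) f \<longleftrightarrow> (\<forall>x. f differentiable (at x)) \<and>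
     (\<forall>i\<in>Basis. Ck k (\<lambda>x. frechet_derivative f (at x) i))"

definition smooth :: "('a::euclidean_space \<Rightarrow> real) \<Rightarrow> bool" where
  "smooth f \<longleftrightarrow> (\<forall>k. Ck k f)"

definition grad :: "('a::euclidean_space \<Rightarrow> real) \<Rightarrow> 'a \<Rightarrow> 'a" where
  "grad f x = (\<Sum>i\<in>Basis. frechet_derivative f (at x) i *\<^sub>R i)"

definition supp :: "('a::topological_space \<Rightarrow> real) \<Rightarrow> 'a set" where
  "supp f = closure {x. f x \<noteq> 0}"

definition test_function :: "'a::euclidean_space set \<Rightarrow> ('a \<Rightarrow> real) \<Rightarrow> bool" where
  "test_function U \<phi> \<longleftrightarrow> smooth \<phi> \<and> compact (supp \<phi>) \<and> supp \<phi> \<subseteq> U"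

definition locally_integrable ::
    "'a::euclidean_space set \<Rightarrow> ('a \<Rightarrow> 'b::euclidean_space) \<Rightarrow> bool" where
  "locally_integrable U f \<longleftrightarrow> (\<forall>K. compact K \<and> K \<subseteq> U \<longrightarrow> integrable (lebesgue_on K) f)"

definition has_weak_gradient ::
    "'a::euclidean_space set \<Rightarrow> ('a \<Rightarrow> real) \<Rightarrow> ('a \<Rightarrow> 'a) \<Rightarrow> bool" where
  "has_weak_gradient U w g \<longleftrightarrow> locally_integrable U w \<and> locally_integrable U g \<and>
     (\<forall>\<phi>. test_function U \<phi> \<longrightarrow> (\<forall>i\<in>Basis.
        (LINT x|lebesgue_on U. w x * (grad \<phi> x \<bullet> i)) =
        - (LINT x|lebesgue_on U. (g x \<bullet> i) * \<phi> x)))"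

text \<open>Weak gradients are unique almost everywhere, so the choice of representative is harmless.\<close>

definition weak_grad :: "'a::euclidean_space set \<Rightarrow> ('a \<Rightarrow> real) \<Rightarrow> 'a \<Rightarrow> 'a" where
  "weak_grad U w = (SOME g. has_weak_gradient U w g)"

definition L2 :: "'a measure \<Rightarrow> ('a \<Rightarrow> 'b::euclidean_space) set" where
  "L2 M = {f \<in> borel_measurable M. integrable M (\<lambda>x. (norm (f x))\<^sup>2)}"

definition weighted :: "('a::euclidean_space \<Rightarrow> real) \<Rightarrow> 'a set \<Rightarrow> 'a measure" where
  "weighted \<rho> U = density (lebesgue_on U) (\<lambda>x. ennreal (\<rho> x))"

definition H1 :: "('a::euclidean_space \<Rightarrow> real) \<Rightarrow> 'a set \<Rightarrow> ('a \<Rightarrow> real) set" where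
  "H1 \<rho> U = {w \<in> L2 (weighted \<rho> U). \<exists>g \<in> L2 (weighted \<rho> U). has_weak_gradient U w g}"

text \<open>Convergence in the norm of \<open>H1 \<rho> U\<close> of (restrictions to \<open>U\<close> of) smooth functions.\<close>

definition H1_approx ::
    "('a::euclidean_space \<Rightarrow> real) \<Rightarrow> 'a set \<Rightarrow> (nat \<Rightarrow> 'a \<Rightarrow> real) \<Rightarrow> ('a \<Rightarrow> real) \<Rightarrow> bool" where
  "H1_approx \<rho> U \<psi> w \<longleftrightarrow>
     (\<forall>k. smooth (\<psi> k) \<and> \<psi> k \<in> L2 (weighted \<rho> U) \<and> grad (\<psi> k) \<in> L2 (weighted \<rho> U)) \<and>
     (\<lambda>k. LINT x|weighted \<rho> U. (\<psi> k x - w x)\<^sup>2 + (norm (grad (\<psi> k) x - weak_grad U w x))\<^sup>2)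
        \<longlonglongrightarrow> 0"

definition H10 :: "'a::euclidean_space set \<Rightarrow> ('a \<Rightarrow> real) set" where
  "H10 U = {w \<in> H1 (\<lambda>_. 1) U. \<exists>\<psi>. (\<forall>k. test_function U (\<psi> k)) \<and> H1_approx (\<lambda>_. 1) U \<psi> w}"

definition inner_L2 :: "'a::euclidean_space set \<Rightarrow> ('a \<Rightarrow> real) \<Rightarrow> ('a \<Rightarrow> real) \<Rightarrow> real" where
  "inner_L2 U f g = (LINT x|lebesgue_on U. f x * g x)"

definition norm_L2 :: "'a::euclidean_space set \<Rightarrow> ('a \<Rightarrow> real) \<Rightarrow> real" where
  "norm_L2 U f = sqrt (inner_L2 U f f)"

definition orthonormal_basis_L2 :: "'a::euclidean_space set \<Rightarrow> (nat \<Rightarrow> 'a \<Rightarrow> real) \<Rightarrow> bool" where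
  "orthonormal_basis_L2 U \<phi> \<longleftrightarrow>
     (\<forall>k. \<phi> k \<in> L2 (lebesgue_on U)) \<and>
     (\<forall>j k. inner_L2 U (\<phi> j) (\<phi> k) = (if j = k then 1 else 0)) \<and>
     (\<forall>w \<in> L2 (lebesgue_on U).
        (\<lambda>N. norm_L2 U (\<lambda>x. w x - (\<Sum>k<N. inner_L2 U w (\<phi> k) * \<phi> k x))) \<longlonglongrightarrow> 0)"

text \<open>Eigenpairs of \<open>w \<mapsto> - div (A \<nabla>w)\<close> with homogeneous Dirichlet conditions, in the weak sense.\<close>

definition dirichlet_eigenpair ::
    "(real^'n) set \<Rightarrow> (real^'n \<Rightarrow> real^'n^'n) \<Rightarrow> real \<Rightarrow> (real^'n \<Rightarrow> real) \<Rightarrow> bool" where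
  "dirichlet_eigenpair \<Omega> A l f \<longleftrightarrow>
     f \<in> H10 \<Omega> \<and> \<not> (AE x in lebesgue_on \<Omega>. f x = 0) \<and>
     (\<forall>w \<in> H10 \<Omega>. (LINT x|lebesgue_on \<Omega>. (A x *v weak_grad \<Omega> f x) \<bullet> weak_grad \<Omega> w x) =
                    l * inner_L2 \<Omega> f w)"

definition dirichlet_eigenbasis ::
    "(real^'n) set \<Rightarrow> (real^'n \<Rightarrow> real^'n^'n) \<Rightarrow> (nat \<Rightarrow> real) \<Rightarrow> (nat \<Rightarrow> real^'n \<Rightarrow> real) \<Rightarrow> bool"
  where
  "dirichlet_eigenbasis \<Omega> A lam \<phi> \<longleftrightarrow>
     (\<forall>k. dirichlet_eigenpair \<Omega> A (lam k) (\<phi> k)) \<and> orthonormal_basis_L2 \<Omega> \<phi>"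

text \<open>The space of \<open>w = (\<Sum>k. w\<^sub>k \<phi>\<^sub>k)\<close> with \<open>(\<Sum>k. \<lambda>\<^sub>k\<^sup>r w\<^sub>k\<^sup>2) < \<infinity>\<close>, for \<open>r \<ge> 0\<close>.\<close>

definition spectral_space ::
    "(real^'n) set \<Rightarrow> (nat \<Rightarrow> real) \<Rightarrow> (nat \<Rightarrow> real^'n \<Rightarrow> real) \<Rightarrow> real \<Rightarrow> (real^'n \<Rightarrow> real) set" where
  "spectral_space \<Omega> lam \<phi> r =
     {w \<in> L2 (lebesgue_on \<Omega>). summable (\<lambda>k. lam k powr r * (inner_L2 \<Omega> w (\<phi> k))\<^sup>2)}"

definition cylinder :: "(real^'n) set \<Rightarrow> real \<Rightarrow> ((real^'n) \<times> real) set" where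
  "cylinder \<Omega> Y = \<Omega> \<times> {0<..<Y}"

definition dirichlet_part :: "(real^'n) set \<Rightarrow> real \<Rightarrow> ((real^'n) \<times> real) set" where
  "dirichlet_part \<Omega> Y = frontier \<Omega> \<times> {0..Y} \<union> \<Omega> \<times> {Y}"

definition y_weight :: "real \<Rightarrow> (real^'n) \<times> real \<Rightarrow> real" where
  "y_weight s z = snd z powr (1 - 2 * s)"

text \<open>Vanishing on the Dirichlet part of the boundary is understood as for \<open>H10\<close>: membership in
  the closure of the smooth functions (up to the boundary) vanishing near that part.\<close>

definition H1L :: "real \<Rightarrow> (real^'n) set \<Rightarrow> real \<Rightarrow> ((real^'n) \<times> real \<Rightarrow> real) set" where
  "H1L s \<Omega> Y = {v \<in> H1 (y_weight s) (cylinder \<Omega> Y).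
     \<exists>\<psi>. (\<forall>k. supp (\<psi> k) \<inter> dirichlet_part \<Omega> Y = {}) \<and>
          H1_approx (y_weight s) (cylinder \<Omega> Y) \<psi> v}"

text \<open>The trace on \<open>\<Omega> \<times> {0}\<close> is the continuous extension to \<open>H1\<close> of the restriction of functions
  that are smooth up to the boundary; it is unique as an element of \<open>L2\<close>.\<close>

definition has_trace ::
    "real \<Rightarrow> (real^'n) set \<Rightarrow> real \<Rightarrow> ((real^'n) \<times> real \<Rightarrow> real) \<Rightarrow> (real^'n \<Rightarrow> real) \<Rightarrow> bool" where
  "has_trace s \<Omega> Y v t \<longleftrightarrow> t \<in> L2 (lebesgue_on \<Omega>) \<and>
     (\<exists>\<psi>. H1_approx (y_weight s) (cylinder \<Omega> Y) \<psi> v \<and>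
          (\<lambda>k. norm_L2 \<Omega> (\<lambda>x. \<psi> k (x, 0) - t x)) \<longlonglongrightarrow> 0)"

definition tr ::
    "real \<Rightarrow> (real^'n) set \<Rightarrow> real \<Rightarrow> ((real^'n) \<times> real \<Rightarrow> real) \<Rightarrow> real^'n \<Rightarrow> real" where
  "tr s \<Omega> Y v = (SOME t. has_trace s \<Omega> Y v t)"

definition d_const :: "real \<Rightarrow> real" where
  "d_const s = 2 powr (1 - 2 * s) * Gamma (1 - s) / Gamma s"

definition bold_A :: "(real^'n \<Rightarrow> real^'n^'n) \<Rightarrow> (real^'n) \<times> real \<Rightarrow> (real^'n) \<times> real \<Rightarrow> (real^'n) \<times> real"
  where "bold_A A z \<xi> = (A (fst z) *v fst \<xi>, snd \<xi>)"

definition a_Y ::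
    "real \<Rightarrow> (real^'n) set \<Rightarrow> (real^'n \<Rightarrow> real^'n^'n) \<Rightarrow> real \<Rightarrow>
     ((real^'n) \<times> real \<Rightarrow> real) \<Rightarrow> ((real^'n) \<times> real \<Rightarrow> real) \<Rightarrow> real" where
  "a_Y s \<Omega> A Y w \<phi> = 1 / d_const s *
     (LINT z|lebesgue_on (cylinder \<Omega> Y). y_weight s z *
        (bold_A A z (weak_grad (cylinder \<Omega> Y) w z) \<bullet> weak_grad (cylinder \<Omega> Y) \<phi> z))"

definition Z_ad :: "(real^'n) set \<Rightarrow> real \<Rightarrow> real \<Rightarrow> (real^'n \<Rightarrow> real) set" where
  "Z_ad \<Omega> a b = {w \<in> L2 (lebesgue_on \<Omega>). AE x in lebesgue_on \<Omega>. a \<le> w x \<and> w x \<le> b}"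

text \<open>Controls lie in \<open>L2\<close>, which embeds into the dual of the spectral space of order \<open>s\<close> through
  the inner product of \<open>L2\<close>; hence the duality pairing on the right-hand side is \<open>inner_L2\<close>.\<close>

definition is_state ::
    "real \<Rightarrow> (real^'n) set \<Rightarrow> (real^'n \<Rightarrow> real^'n^'n) \<Rightarrow> real \<Rightarrow>
     (real^'n \<Rightarrow> real) \<Rightarrow> ((real^'n) \<times> real \<Rightarrow> real) \<Rightarrow> bool" where
  "is_state s \<Omega> A Y r v \<longleftrightarrow> v \<in> H1L s \<Omega> Y \<and>
     (\<forall>\<phi> \<in> H1L s \<Omega> Y. a_Y s \<Omega> A Y v \<phi> = inner_L2 \<Omega> r (tr s \<Omega> Y \<phi>))"

definition cost ::
    "real \<Rightarrow> (real^'n) set \<Rightarrow> real \<Rightarrow> real \<Rightarrow> (real^'n \<Rightarrow> real) \<Rightarrow>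
     ((real^'n) \<times> real \<Rightarrow> real) \<Rightarrow> (real^'n \<Rightarrow> real) \<Rightarrow> real" where
  "cost s \<Omega> Y \<theta> u\<^sub>d v r =
     1/2 * (norm_L2 \<Omega> (\<lambda>x. tr s \<Omega> Y v x - u\<^sub>d x))\<^sup>2 + \<theta>/2 * (norm_L2 \<Omega> r)\<^sup>2"

definition is_optimal_pair ::
    "real \<Rightarrow> (real^'n) set \<Rightarrow> (real^'n \<Rightarrow> real^'n^'n) \<Rightarrow> real \<Rightarrow> real \<Rightarrow> (real^'n \<Rightarrow> real) \<Rightarrow>
     real \<Rightarrow> real \<Rightarrow> ((real^'n) \<times> real \<Rightarrow> real) \<Rightarrow> (real^'n \<Rightarrow> real) \<Rightarrow> bool" where
  "is_optimal_pair s \<Omega> A Y \<theta> u\<^sub>d a b v r \<longleftrightarrow>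
     r \<in> Z_ad \<Omega> a b \<and> is_state s \<Omega> A Y r v \<and>
     (\<forall>r' \<in> Z_ad \<Omega> a b. \<forall>v'. is_state s \<Omega> A Y r' v' \<longrightarrow>
        cost s \<Omega> Y \<theta> u\<^sub>d v r \<le> cost s \<Omega> Y \<theta> u\<^sub>d v' r')"

definition is_adjoint_state ::
    "real \<Rightarrow> (real^'n) set \<Rightarrow> (real^'n \<Rightarrow> real^'n^'n) \<Rightarrow> real \<Rightarrow> (real^'n \<Rightarrow> real) \<Rightarrow>
     ((real^'n) \<times> real \<Rightarrow> real) \<Rightarrow> ((real^'n) \<times> real \<Rightarrow> real) \<Rightarrow> bool" where
  "is_adjoint_state s \<Omega> A Y u\<^sub>d v p \<longleftrightarrow> p \<in> H1L s \<Omega> Y \<and>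
     (\<forall>\<phi> \<in> H1L s \<Omega> Y.
        a_Y s \<Omega> A Y \<phi> p = inner_L2 \<Omega> (\<lambda>x. tr s \<Omega> Y v x - u\<^sub>d x) (tr s \<Omega> Y \<phi>))"

end

theory Submission
  imports Defs "HOL-Real_Asymp.Real_Asymp"
begin

text \<open>Separation of variables diagonalizes the control-to-trace map: with the profile \<open>\<chi>\<^sub>k\<close> solving
  \<open>(y powr \<alpha> * \<chi>')' = \<lambda>\<^sub>k * y powr \<alpha> * \<chi>\<close>, \<open>\<chi>(Y) = 0\<close> and normalized flux at \<open>0\<close>, the function
  \<open>\<chi>\<^sub>k(y) * \<phi>\<^sub>k(x')\<close> is the state of the control \<open>\<phi>\<^sub>k\<close>, so the trace of the state of \<open>r\<close> has the
  coefficients \<open>\<sigma>\<^sub>k * r\<^sub>k\<close> with \<open>\<sigma>\<^sub>k = \<chi>\<^sub>k(0)\<close>, and both \<open>\<sigma>\<^sub>k\<close> and \<open>\<lambda>\<^sub>k powr s * \<sigma>\<^sub>k\<close> are bounded.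

  Instead of bootstrapping the projection formula, the variational inequality is tested with the resolvent
  \<open>z = (1 + \<epsilon> \<L>)\<^sup>-\<^sup>1 r\<close>. Since \<open>a < 0 < b\<close>, the maximum principle makes \<open>z\<close> admissible. As the resolvent is
  diagonal in the same basis, the quadratic contribution of the state has a favourable sign, and what is left is
  \<open>\<theta> * (\<Sum>k. m\<^sub>k * r\<^sub>k\<^sup>2) \<le> (\<Sum>k. m\<^sub>k * \<sigma>\<^sub>k * u\<^sub>k * r\<^sub>k)\<close> with \<open>m\<^sub>k = \<epsilon> \<lambda>\<^sub>k / (1 + \<epsilon> \<lambda>\<^sub>k)\<close>. Dividing by
  \<open>\<epsilon>\<close> and letting \<open>\<epsilon> \<rightarrow> 0\<close> gives \<open>(\<Sum>k. \<lambda>\<^sub>k * r\<^sub>k\<^sup>2) < \<infinity>\<close>. The adjoint trace has the coefficients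
  \<open>\<sigma>\<^sub>k * (\<sigma>\<^sub>k * r\<^sub>k - u\<^sub>k)\<close>, and the second claim follows from the decay of \<open>\<sigma>\<^sub>k\<close>.\<close>

subsection \<open>The space of square integrable functions\<close>

text \<open>Why \<open>\<lambda>\<^sub>k powr s * \<sigma>\<^sub>k\<close> is bounded: the flux of
  \<chi> never exceeds its value d at 0, so \<chi> stays above half of \<sigma> = \<chi>(0) on an
  interval (0,h) with h powr (2s) of order \<sigma>. The flux lost there is at least a multiple of
  \<lambda> \<sigma> h powr (2 - 2s), hence of \<lambda> \<sigma> powr (1/s), and it cannot exceed
  d. No Bessel asymptotics enter. Young's inequality leaves \<lambda> \<sigma>^2 u^2, and \<lambda>
  \<sigma>^2 is at most a constant times \<lambda> powr (1 - s): this is the origin of the order 1 -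
  s required of the desired state. The obstacle in justifying separation of variables is that
  \<chi>' may blow up at 0 and \<phi> is only a limit of test functions, whereas the Sobolev spaces
  and the trace are defined by closure of smooth functions. Hence products are built from smoothed
  profiles and test functions first, and the residual of the eigenvalue equation is shown to vanish
  in the limit. Weak gradients and traces are choices, so their identities hold only almost
  everywhere.\<close>

definition ip :: "'a measure \<Rightarrow> ('a \<Rightarrow> 'b::euclidean_space) \<Rightarrow> ('a \<Rightarrow> 'b) \<Rightarrow> real" where
  "ip M f g = (LINT x|M. f x \<bullet> g x)"

definition nrm :: "'a measure \<Rightarrow> ('a \<Rightarrow> 'b::euclidean_space) \<Rightarrow> real" where
  "nrm M f = sqrt (ip M f f)"

lemma lim0_squeeze:
  fixes a b :: "nat \<Rightarrow> real"
  assumes "\<And>n. \<bar>a n\<bar> \<le> b n" "b \<longlonglongrightarrow> 0"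
  shows "a \<longlonglongrightarrow> 0"
  by (rule Lim_null_comparison[OF _ assms(2)]) (use assms(1) in auto)

text \<open>The bridge to the given definitions. \<open>ip\<close> and \<open>nrm\<close> allow any
  measure and vector values, so that one theory serves \<Omega>, the weighted interval, the weighted
  cylinder and gradient fields.\<close>

lemma inner_L2_eq_ip: "inner_L2 U f g = ip (lebesgue_on U) f g"
  by (simp add: inner_L2_def ip_def)

lemma norm_L2_eq_nrm: "norm_L2 U f = nrm (lebesgue_on U) f"
  by (simp add: norm_L2_def nrm_def inner_L2_eq_ip)

lemma L2_measurable: "f \<in> L2 M \<Longrightarrow> f \<in> borel_measurable M"
  by (simp add: L2_def)

lemma L2_integrable_norm: "f \<in> L2 M \<Longrightarrow> integrable M (\<lambda>x. (norm (f x))\<^sup>2)"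
  by (simp add: L2_def)

lemma L2_dominated:
  assumes "g \<in> borel_measurable M" "integrable M h" "AE x in M. (norm (g x))\<^sup>2 \<le> h x"
  shows "g \<in> L2 M"
  unfolding L2_def
  using assms by (auto intro!: Bochner_Integration.integrable_bound[OF assms(2)] elim: eventually_mono)

lemma L2_inner_integrable:
  assumes "f \<in> L2 M" "g \<in> L2 M"
  shows "integrable M (\<lambda>x. f x \<bullet> g x)"
proof (rule Bochner_Integration.integrable_bound)
  show "integrable M (\<lambda>x. (norm (f x))\<^sup>2 + (norm (g x))\<^sup>2)"
    using assms by (auto simp: L2_def)
  show "(\<lambda>x. f x \<bullet> g x) \<in> borel_measurable M"
    using assms[THEN L2_measurable] by measurable
  have "\<bar>f x \<bullet> g x\<bar> \<le> (norm (f x))\<^sup>2 + (norm (g x))\<^sup>2" for x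
  proof -
    have "2 * (norm (f x) * norm (g x)) \<le> (norm (f x))\<^sup>2 + (norm (g x))\<^sup>2"
      using sum_squares_bound[of "norm (f x)" "norm (g x)"] by (simp add: mult.assoc)
    moreover have "0 \<le> norm (f x) * norm (g x)" by simp
    ultimately show ?thesis using Cauchy_Schwarz_ineq2[of "f x" "g x"] by linarith
  qed
  then show "AE x in M. norm (f x \<bullet> g x) \<le> norm ((norm (f x))\<^sup>2 + (norm (g x))\<^sup>2)"
    by auto
qed

lemma L2_zero [simp]: "(\<lambda>x. 0) \<in> L2 M"
  by (simp add: L2_def)

lemma L2_add:
  assumes "f \<in> L2 M" "g \<in> L2 M"
  shows "(\<lambda>x. f x + g x) \<in> L2 M"
proof (rule L2_dominated)
  show "(\<lambda>x. f x + g x) \<in> borel_measurable M"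
    using assms[THEN L2_measurable] by measurable
  show "integrable M (\<lambda>x. 2 * (norm (f x))\<^sup>2 + 2 * (norm (g x))\<^sup>2)"
    using assms by (auto simp: L2_def)
  have "(norm (f x + g x))\<^sup>2 \<le> 2 * (norm (f x))\<^sup>2 + 2 * (norm (g x))\<^sup>2" for x
  proof -
    have "(norm (f x + g x))\<^sup>2 \<le> (norm (f x) + norm (g x))\<^sup>2"
      by (intro power_mono norm_triangle_ineq) auto
    then show ?thesis
      using sum_squares_bound[of "norm (f x)" "norm (g x)"] by (simp add: power2_sum)
  qed
  then show "AE x in M. (norm (f x + g x))\<^sup>2 \<le> 2 * (norm (f x))\<^sup>2 + 2 * (norm (g x))\<^sup>2" by simp
qed

lemma L2_scaleR: "f \<in> L2 M \<Longrightarrow> (\<lambda>x. c *\<^sub>R f x) \<in> L2 M"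
  by (auto simp: L2_def power_mult_distrib)

lemma L2_cmult: "f \<in> L2 M \<Longrightarrow> (\<lambda>x. c * f x) \<in> L2 M" for f :: "'a \<Rightarrow> real"
  using L2_scaleR[of f M c] by simp

lemma L2_diff:
  assumes "f \<in> L2 M" "g \<in> L2 M"
  shows "(\<lambda>x. f x - g x) \<in> L2 M"
  using L2_add[OF assms(1) L2_scaleR[OF assms(2), of "-1"]] by simp

lemma L2_sum: "(\<And>i. i \<in> I \<Longrightarrow> f i \<in> L2 M) \<Longrightarrow> (\<lambda>x. \<Sum>i\<in>I. f i x) \<in> L2 M"
  by (induction I rule: infinite_finite_induct) (auto intro: L2_add)

lemma L2_AE_cong:
  assumes "f \<in> L2 M" "g \<in> borel_measurable M" "AE x in M. f x = g x"
  shows "g \<in> L2 M"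
  by (rule L2_dominated[OF assms(2) L2_integrable_norm[OF assms(1)]]) (use assms(3) in auto)

lemma ip_commute: "ip M f g = ip M g f"
  by (simp add: ip_def inner_commute)

lemma ip_add_left:
  "f \<in> L2 M \<Longrightarrow> g \<in> L2 M \<Longrightarrow> h \<in> L2 M \<Longrightarrow> ip M (\<lambda>x. f x + g x) h = ip M f h + ip M g h"
  unfolding ip_def inner_add_left
  by (intro Bochner_Integration.integral_add L2_inner_integrable)

lemma ip_add_right:
  "f \<in> L2 M \<Longrightarrow> g \<in> L2 M \<Longrightarrow> h \<in> L2 M \<Longrightarrow> ip M h (\<lambda>x. f x + g x) = ip M h f + ip M h g"
  using ip_add_left[of f M g h] by (simp add: ip_commute)

lemma ip_diff_left:
  "f \<in> L2 M \<Longrightarrow> g \<in> L2 M \<Longrightarrow> h \<in> L2 M \<Longrightarrow> ip M (\<lambda>x. f x - g x) h = ip M f h - ip M g h"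
  unfolding ip_def inner_diff_left
  by (intro Bochner_Integration.integral_diff L2_inner_integrable)

lemma ip_scaleR_left: "ip M (\<lambda>x. c *\<^sub>R f x) g = c * ip M f g"
  by (simp add: ip_def)

lemma ip_scaleR_right: "ip M f (\<lambda>x. c *\<^sub>R g x) = c * ip M f g"
  by (simp add: ip_def)

lemma ip_cmult_left: "ip M (\<lambda>x. c * f x) g = c * ip M f g" for f :: "'a \<Rightarrow> real"
  using ip_scaleR_left[of M c f g] by simp

lemma ip_cmult_right: "ip M g (\<lambda>x. c * f x) = c * ip M g f" for f :: "'a \<Rightarrow> real"
  using ip_scaleR_right[of M g c f] by simp

lemma ip_sum_left:
  assumes "\<And>i. i \<in> I \<Longrightarrow> f i \<in> L2 M" "g \<in> L2 M"
  shows "ip M (\<lambda>x. \<Sum>i\<in>I. f i x) g = (\<Sum>i\<in>I. ip M (f i) g)"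
  unfolding ip_def inner_sum_left
  by (rule Bochner_Integration.integral_sum) (use assms in \<open>auto intro: L2_inner_integrable\<close>)

lemma ip_cong_AE:
  assumes "f \<in> borel_measurable M" "f' \<in> borel_measurable M" "AE x in M. f x = f' x"
    "g \<in> borel_measurable M" "g' \<in> borel_measurable M" "AE x in M. g x = g' x"
  shows "ip M f g = ip M f' g'"
  unfolding ip_def by (rule integral_cong_AE) (use assms in auto)

lemma ip_self_nonneg: "0 \<le> ip M f f"
  by (simp add: ip_def)

lemma nrm_nonneg [simp]: "0 \<le> nrm M f"
  by (simp add: nrm_def ip_self_nonneg)

lemma nrm_power2: "(nrm M f)\<^sup>2 = ip M f f"
  by (simp add: nrm_def ip_self_nonneg)

lemma nrm_eq_LINT: "(nrm M f)\<^sup>2 = (LINT x|M. (norm (f x))\<^sup>2)"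
  by (simp add: nrm_power2 ip_def power2_norm_eq_inner)

lemma nrm_cong_AE:
  assumes "f \<in> borel_measurable M" "f' \<in> borel_measurable M" "AE x in M. f x = f' x"
  shows "nrm M f = nrm M f'"
  unfolding nrm_def using ip_cong_AE[OF assms assms] by simp

text \<open>The discriminant of the nonnegative quadratic polynomial in t given by the square norm
  of f + t g.\<close>

lemma ip_Cauchy_Schwarz:
  assumes "f \<in> L2 M" "g \<in> L2 M"
  shows "\<bar>ip M f g\<bar> \<le> nrm M f * nrm M g"
proof -
  have q: "0 \<le> ip M f f + 2 * t * ip M f g + t\<^sup>2 * ip M g g" for t
  proof -
    have "ip M (\<lambda>x. f x + t *\<^sub>R g x) (\<lambda>x. f x + t *\<^sub>R g x) = ip M f f + 2 * t * ip M f g + t\<^sup>2 * ip M g g"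
      using assms
      by (simp add: ip_add_left ip_add_right ip_scaleR_left ip_scaleR_right L2_add L2_scaleR
          ip_commute[of M g f] power2_eq_square algebra_simps)
    then show ?thesis using ip_self_nonneg by metis
  qed
  have "(ip M f g)\<^sup>2 \<le> ip M f f * ip M g g"
  proof (cases "ip M g g = 0")
    case True
    have "ip M f g = 0"
    proof (rule ccontr)
      assume nz: "ip M f g \<noteq> 0"
      show False
        \<comment> \<open>Without its leading coefficient the polynomial is affine, and at this t it
          would have the value -1.\<close>
        using q[of "- (ip M f f + 1) / (2 * ip M f g)"] True nz by (simp add: field_simps)
    qed
    then show ?thesis using True by simp
  next
    case False
    then have pos: "0 < ip M g g" using ip_self_nonneg[of M g] by simp
    show ?thesis
      using q[of "- ip M f g / ip M g g"] pos
      by (simp add: field_simps power2_eq_square)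
  qed
  then have "sqrt ((ip M f g)\<^sup>2) \<le> sqrt (ip M f f * ip M g g)"
    by (rule real_sqrt_le_mono)
  then show ?thesis by (simp add: nrm_def real_sqrt_mult)
qed

lemma nrm_triangle:
  assumes "f \<in> L2 M" "g \<in> L2 M"
  shows "nrm M (\<lambda>x. f x + g x) \<le> nrm M f + nrm M g"
proof (rule power2_le_imp_le)
  have "(nrm M (\<lambda>x. f x + g x))\<^sup>2 = ip M f f + 2 * ip M f g + ip M g g"
    using assms by (simp add: nrm_power2 ip_add_left ip_add_right L2_add ip_commute[of M g f])
  also have "\<dots> \<le> ip M f f + 2 * (nrm M f * nrm M g) + ip M g g"
    using ip_Cauchy_Schwarz[OF assms] by linarith
  also have "\<dots> = (nrm M f + nrm M g)\<^sup>2"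
    by (simp add: power2_sum nrm_power2)
  finally show "(nrm M (\<lambda>x. f x + g x))\<^sup>2 \<le> (nrm M f + nrm M g)\<^sup>2" .
qed auto

lemma nrm_scaleR: "nrm M (\<lambda>x. c *\<^sub>R f x) = \<bar>c\<bar> * nrm M f"
proof -
  have "nrm M (\<lambda>x. c *\<^sub>R f x) = sqrt (c\<^sup>2 * ip M f f)"
    by (simp add: nrm_def ip_scaleR_left ip_scaleR_right power2_eq_square mult.assoc)
  then show ?thesis by (simp add: nrm_def real_sqrt_mult)
qed

lemma nrm_minus_commute: "nrm M (\<lambda>x. f x - g x) = nrm M (\<lambda>x. g x - f x)"
  using nrm_scaleR[of M "-1" "\<lambda>x. f x - g x"] by simp

lemma nrm_triangle_diff:
  assumes "f \<in> L2 M" "g \<in> L2 M" "h \<in> L2 M"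
  shows "nrm M (\<lambda>x. f x - h x) \<le> nrm M (\<lambda>x. f x - g x) + nrm M (\<lambda>x. g x - h x)"
  using nrm_triangle[of "\<lambda>x. f x - g x" M "\<lambda>x. g x - h x"] assms by (simp add: L2_diff)

lemma nrm_le_diff:
  assumes "f \<in> L2 M" "g \<in> L2 M"
  shows "nrm M f \<le> nrm M g + nrm M (\<lambda>x. f x - g x)"
  using nrm_triangle[of g M "\<lambda>x. f x - g x"] assms by (simp add: L2_diff)

lemma nrm_mono:
  assumes "f \<in> borel_measurable M" "g \<in> L2 M" "AE x in M. norm (f x) \<le> norm (g x)"
  shows "nrm M f \<le> nrm M g"
proof (rule power2_le_imp_le)
  have "f \<in> L2 M"
    using assms by (intro L2_dominated[OF assms(1) L2_integrable_norm[OF assms(2)]]) (auto intro: power_mono)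
  then show "(nrm M f)\<^sup>2 \<le> (nrm M g)\<^sup>2"
    unfolding nrm_eq_LINT using assms by (intro integral_mono_AE) (auto simp: L2_def intro: power_mono)
qed auto

lemma nrm_zero_AE:
  assumes "f \<in> L2 M" "nrm M f = 0"
  shows "AE x in M. f x = 0"
proof -
  have "(LINT x|M. (norm (f x))\<^sup>2) = 0"
    using nrm_eq_LINT[of M f] assms(2) by simp
  then show ?thesis
    using assms(1) by (subst (asm) integral_nonneg_eq_0_iff_AE) (auto simp: L2_def)
qed

lemma nrm_limit_unique:
  assumes L2: "\<And>n. f n \<in> L2 M" "g \<in> L2 M" "h \<in> L2 M"
    and lim: "(\<lambda>n. nrm M (\<lambda>x. f n x - g x)) \<longlonglongrightarrow> 0" "(\<lambda>n. nrm M (\<lambda>x. f n x - h x)) \<longlonglongrightarrow> 0"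
  shows "AE x in M. g x = h x"
proof -
  have le: "nrm M (\<lambda>x. g x - h x) \<le> nrm M (\<lambda>x. f n x - g x) + nrm M (\<lambda>x. f n x - h x)" for n
    using nrm_triangle_diff[OF L2(2) L2(1) L2(3), of n] nrm_minus_commute[of M g "f n"] by simp
  have "(\<lambda>n. nrm M (\<lambda>x. f n x - g x) + nrm M (\<lambda>x. f n x - h x)) \<longlonglongrightarrow> 0"
    using tendsto_add[OF lim] by simp
  then have "nrm M (\<lambda>x. g x - h x) \<le> 0"
    by (rule LIMSEQ_le_const) (use le in auto)
  then have "nrm M (\<lambda>x. g x - h x) = 0" using nrm_nonneg[of M "\<lambda>x. g x - h x"] by simp
  from nrm_zero_AE[OF L2_diff[OF L2(2,3)] this] show ?thesis by simp
qed

lemma ip_tendsto: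
  assumes "\<And>n. f n \<in> L2 M" "g \<in> L2 M" "h \<in> L2 M"
    and lim: "(\<lambda>n. nrm M (\<lambda>x. f n x - g x)) \<longlonglongrightarrow> 0"
  shows "(\<lambda>n. ip M (f n) h) \<longlonglongrightarrow> ip M g h"
proof -
  have "(\<lambda>n. ip M (f n) h - ip M g h) \<longlonglongrightarrow> 0"
  proof (rule lim0_squeeze)
    show "(\<lambda>n. nrm M (\<lambda>x. f n x - g x) * nrm M h) \<longlonglongrightarrow> 0"
      using tendsto_mult_right[OF lim, of "nrm M h"] by simp
    show "\<bar>ip M (f n) h - ip M g h\<bar> \<le> nrm M (\<lambda>x. f n x - g x) * nrm M h" for n
      using ip_Cauchy_Schwarz[OF L2_diff[OF assms(1,2)] assms(3), of n] ip_diff_left[OF assms(1,2,3)] by simp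
  qed
  then show ?thesis by (simp add: LIM_zero_iff)
qed

lemma nrm_tendsto:
  assumes "\<And>n. f n \<in> L2 M" "g \<in> L2 M"
    and lim: "(\<lambda>n. nrm M (\<lambda>x. f n x - g x)) \<longlonglongrightarrow> 0"
  shows "(\<lambda>n. nrm M (f n)) \<longlonglongrightarrow> nrm M g"
proof -
  have "(\<lambda>n. nrm M (f n) - nrm M g) \<longlonglongrightarrow> 0"
  proof (rule lim0_squeeze[OF _ lim])
    show "\<bar>nrm M (f n) - nrm M g\<bar> \<le> nrm M (\<lambda>x. f n x - g x)" for n
      using nrm_le_diff[OF assms(1,2), of n] nrm_le_diff[OF assms(2,1), of n] nrm_minus_commute[of M g "f n"]
      by simp
  qed
  then show ?thesis by (simp add: LIM_zero_iff)
qed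

lemma nrm_lim_add:
  assumes "\<And>n. f n \<in> L2 M" "\<And>n. f' n \<in> L2 M" "g \<in> L2 M" "g' \<in> L2 M"
    and "(\<lambda>n. nrm M (\<lambda>x. f n x - g x)) \<longlonglongrightarrow> 0" "(\<lambda>n. nrm M (\<lambda>x. f' n x - g' x)) \<longlonglongrightarrow> 0"
  shows "(\<lambda>n. nrm M (\<lambda>x. (f n x + f' n x) - (g x + g' x))) \<longlonglongrightarrow> 0"
proof (rule lim0_squeeze)
  show "(\<lambda>n. nrm M (\<lambda>x. f n x - g x) + nrm M (\<lambda>x. f' n x - g' x)) \<longlonglongrightarrow> 0"
    using tendsto_add[OF assms(5,6)] by simp
  show "\<bar>nrm M (\<lambda>x. (f n x + f' n x) - (g x + g' x))\<bar> \<le> nrm M (\<lambda>x. f n x - g x) + nrm M (\<lambda>x. f' n x - g' x)" for n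
    using nrm_triangle[OF L2_diff[OF assms(1,3)] L2_diff[OF assms(2,4)], of n n] by (simp add: algebra_simps)
qed

lemma nrm_lim_scaleR:
  assumes "(\<lambda>n. nrm M (\<lambda>x. f n x - g x)) \<longlonglongrightarrow> 0"
  shows "(\<lambda>n. nrm M (\<lambda>x. c *\<^sub>R f n x - c *\<^sub>R g x)) \<longlonglongrightarrow> 0"
  using tendsto_mult_left[OF assms, of "\<bar>c\<bar>"] by (simp add: scaleR_diff_right[symmetric] nrm_scaleR)

lemma L2_imp_integrable:
  assumes "finite_measure M" "f \<in> L2 M"
  shows "integrable M f"
proof (rule Bochner_Integration.integrable_bound)
  show "integrable M (\<lambda>x. 1 + (norm (f x))\<^sup>2)"
    using assms by (auto simp: L2_def intro: finite_measure.integrable_const)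
  show "f \<in> borel_measurable M" using assms by (simp add: L2_def)
  have "norm (f x) \<le> 1 + (norm (f x))\<^sup>2" for x
    using sum_squares_bound[of 1 "norm (f x)"] norm_ge_zero[of "f x"] by (simp del: norm_ge_zero)
  then show "AE x in M. norm (f x) \<le> norm (1 + (norm (f x))\<^sup>2)" by (auto simp: add_nonneg_nonneg)
qed

text \<open>Riesz-Fischer. The increments of a rapidly Cauchy subsequence have summable L1 norms
  (Cauchy-Schwarz against 1, which is where finiteness of the measure enters), so the subsequence
  converges almost everywhere; Fatou's lemma upgrades this to convergence of the whole sequence in
  norm.\<close>

lemma L2_complete:
  fixes f :: "nat \<Rightarrow> 'a \<Rightarrow> 'b::euclidean_space"
  assumes fin: "finite_measure M" and L2: "\<And>n. f n \<in> L2 M"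
    and cau: "\<And>e. 0 < e \<Longrightarrow> \<exists>N. \<forall>m\<ge>N. \<forall>n\<ge>N. nrm M (\<lambda>x. f m x - f n x) < e"
  obtains g where "g \<in> L2 M" "(\<lambda>n. nrm M (\<lambda>x. f n x - g x)) \<longlonglongrightarrow> 0"
proof -
  interpret finite_measure M by (rule fin)
  have "\<exists>r. strict_mono r \<and> (\<forall>k. \<forall>m\<ge>r k. \<forall>n\<ge>r k. nrm M (\<lambda>x. f m x - f n x) < (1/2)^k)"
  proof -
    have ex: "\<exists>N. \<forall>m\<ge>N. \<forall>n\<ge>N. nrm M (\<lambda>x. f m x - f n x) < (1/2)^k" for k
      by (rule cau) simp
    define N where "N k = (SOME N. \<forall>m\<ge>N. \<forall>n\<ge>N. nrm M (\<lambda>x. f m x - f n x) < (1/2)^k)" for k :: nat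
    have N: "\<forall>m\<ge>N k. \<forall>n\<ge>N k. nrm M (\<lambda>x. f m x - f n x) < (1/2)^k" for k
      unfolding N_def by (rule someI_ex[OF ex])
    \<comment> \<open>The sum dominates every \<open>N k\<close>, and the summand k makes the
      sequence strictly increasing.\<close>
    define r where "r k = (\<Sum>i\<le>k. N i) + k" for k
    have "strict_mono r" by (rule strict_mono_Suc_iff[THEN iffD2]) (simp add: r_def)
    moreover have "N k \<le> r k" for k
      unfolding r_def using member_le_sum[of k "{..k}" N] by simp
    ultimately show ?thesis using N by (intro exI[of _ r]) (meson order_trans)
  qed
  then obtain r :: "nat \<Rightarrow> nat" where r: "strict_mono r"
    and rc: "\<And>k m n. m \<ge> r k \<Longrightarrow> n \<ge> r k \<Longrightarrow> nrm M (\<lambda>x. f m x - f n x) < (1/2)^k"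
    by blast
  define d where "d k x = f (r (Suc k)) x - f (r k) x" for k x
  have dL2: "d k \<in> L2 M" for k unfolding d_def by (rule L2_diff[OF L2 L2])
  have rS: "r k \<le> r (Suc k)" for k using strict_mono_less_eq[OF r] by simp
  have dn: "nrm M (d k) < (1/2)^k" for k
    unfolding d_def using rS by (intro rc) auto
  have d1: "(LINT x|M. norm (d k x)) \<le> (1/2)^k * sqrt (measure M (space M))" for k
  proof -
    have "(\<lambda>x. norm (d k x)) \<in> L2 M" "(\<lambda>x. 1::real) \<in> L2 M"
      using dL2[of k] by (auto simp: L2_def)
    from ip_Cauchy_Schwarz[OF this]
    have "\<bar>LINT x|M. norm (d k x)\<bar> \<le> nrm M (d k) * sqrt (measure M (space M))"
      by (simp add: ip_def nrm_def power2_eq_square[symmetric] power2_norm_eq_inner)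
    then show ?thesis
      using mult_right_mono[OF less_imp_le[OF dn[of k]], of "sqrt (measure M (space M))"] by simp
  qed
  have int: "integrable M (\<lambda>x. norm (d k x))" for k
    using L2_imp_integrable[OF fin dL2] by simp
  have "(\<integral>\<^sup>+x. (\<Sum>k. ennreal (norm (d k x))) \<partial>M) < \<infinity>"
  proof -
    have [measurable]: "(\<lambda>x. norm (d k x)) \<in> borel_measurable M" for k
      using int by blast
    have sm: "summable (\<lambda>k. (1/2)^k * sqrt (measure M (space M)))"
      by (intro summable_mult2 summable_geometric) simp
    have "(\<integral>\<^sup>+x. (\<Sum>k. ennreal (norm (d k x))) \<partial>M) = (\<Sum>k. \<integral>\<^sup>+x. ennreal (norm (d k x)) \<partial>M)"
      by (rule nn_integral_suminf) simp
    also have "\<dots> = (\<Sum>k. ennreal (LINT x|M. norm (d k x)))"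
      using int by (simp add: nn_integral_eq_integral)
    also have "\<dots> \<le> (\<Sum>k. ennreal ((1/2)^k * sqrt (measure M (space M))))"
      using d1 by (intro suminf_le) (auto intro!: ennreal_leI)
    also have "\<dots> = ennreal (\<Sum>k. (1/2)^k * sqrt (measure M (space M)))"
      by (rule suminf_ennreal2[OF _ sm]) simp
    finally show ?thesis by (simp add: order_le_less_trans[OF _ ennreal_less_top])
  qed
  moreover have "(\<lambda>x. \<Sum>k. ennreal (norm (d k x))) \<in> borel_measurable M"
    using dL2[THEN L2_measurable] by measurable
  ultimately have "AE x in M. (\<Sum>k. ennreal (norm (d k x))) \<noteq> \<infinity>"
    by (intro nn_integral_noteq_infinite) auto
  then have conv: "AE x in M. convergent (\<lambda>k. f (r k) x)"
  proof (eventually_elim)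
    fix x assume "(\<Sum>k. ennreal (norm (d k x))) \<noteq> \<infinity>"
    then have "summable (\<lambda>k. norm (d k x))"
      by (intro summable_suminf_not_top) auto
    then have "summable (\<lambda>k. d k x)" by (rule summable_norm_cancel)
    then have "convergent (\<lambda>n. \<Sum>k<n. d k x)" by (simp add: summable_iff_convergent)
    then have "convergent (\<lambda>n. f (r n) x - f (r 0) x)"
      using sum_lessThan_telescope[of "\<lambda>n. f (r n) x"] by (simp add: d_def)
    then have "convergent (\<lambda>n. (f (r n) x - f (r 0) x) + f (r 0) x)"
      by (intro convergent_add convergent_const)
    then show "convergent (\<lambda>n. f (r n) x)" by simp
  qed
  define g where "g x = lim (\<lambda>k. f (r k) x)" for x
  have [measurable]: "f n \<in> borel_measurable M" for n using L2 by (simp add: L2_def)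
  have g[measurable]: "g \<in> borel_measurable M"
    unfolding g_def by (rule borel_measurable_lim_metric) simp
  have lim: "AE x in M. (\<lambda>k. f (r k) x) \<longlonglongrightarrow> g x"
    using conv by eventually_elim (simp add: g_def convergent_LIMSEQ_iff)
  have main: "(\<integral>\<^sup>+x. ennreal ((norm (f n x - g x))\<^sup>2) \<partial>M) \<le> ennreal (((1/2)^k)\<^sup>2)" if n: "n \<ge> r k" for n k
  proof -
    have "(\<integral>\<^sup>+x. ennreal ((norm (f n x - g x))\<^sup>2) \<partial>M)
        = (\<integral>\<^sup>+x. liminf (\<lambda>l. ennreal ((norm (f n x - f (r l) x))\<^sup>2)) \<partial>M)"
    proof (rule nn_integral_cong_AE)
      show "AE x in M. ennreal ((norm (f n x - g x))\<^sup>2) = liminf (\<lambda>l. ennreal ((norm (f n x - f (r l) x))\<^sup>2))"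
        using lim
      proof eventually_elim
        fix x assume "(\<lambda>k. f (r k) x) \<longlonglongrightarrow> g x"
        then have "(\<lambda>l. ennreal ((norm (f n x - f (r l) x))\<^sup>2)) \<longlonglongrightarrow> ennreal ((norm (f n x - g x))\<^sup>2)"
          by (intro tendsto_ennrealI tendsto_intros)
        then show "ennreal ((norm (f n x - g x))\<^sup>2) = liminf (\<lambda>l. ennreal ((norm (f n x - f (r l) x))\<^sup>2))"
          using lim_imp_Liminf[of sequentially] by force
      qed
    qed
    also have "\<dots> \<le> liminf (\<lambda>l. \<integral>\<^sup>+x. ennreal ((norm (f n x - f (r l) x))\<^sup>2) \<partial>M)"
      by (rule nn_integral_liminf) simp
    also have "\<dots> \<le> ennreal (((1/2)^k)\<^sup>2)"
    proof (rule Liminf_le[OF _ ])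
      have "(\<integral>\<^sup>+x. ennreal ((norm (f n x - f (r l) x))\<^sup>2) \<partial>M) \<le> ennreal (((1/2)^k)\<^sup>2)" if "l \<ge> k" for l
      proof -
        have "(\<integral>\<^sup>+x. ennreal ((norm (f n x - f (r l) x))\<^sup>2) \<partial>M) = ennreal ((nrm M (\<lambda>x. f n x - f (r l) x))\<^sup>2)"
          unfolding nrm_eq_LINT using L2_diff[OF L2 L2, of n "r l"]
          by (intro nn_integral_eq_integral) (auto simp: L2_def)
        also have "\<dots> \<le> ennreal (((1/2)^k)\<^sup>2)"
          using rc[of k n "r l"] n that strict_mono_less_eq[OF r]
          by (intro ennreal_leI power_mono) auto
        finally show ?thesis .
      qed
      then show "\<forall>\<^sub>F l in sequentially. (\<integral>\<^sup>+x. ennreal ((norm (f n x - f (r l) x))\<^sup>2) \<partial>M) \<le> ennreal (((1/2)^k)\<^sup>2)"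
        unfolding eventually_sequentially by blast
    qed simp
    finally show ?thesis .
  qed
  have dgL2: "(\<lambda>x. f n x - g x) \<in> L2 M" if "n \<ge> r k" for n k
    unfolding L2_def
    using main[OF that] by (auto intro!: integrableI_bounded simp: less_top[symmetric] top_unique)
  have gL2: "g \<in> L2 M"
    using L2_diff[OF L2 dgL2[OF order_refl, of 0], of "r 0"] by simp
  moreover have "(\<lambda>n. nrm M (\<lambda>x. f n x - g x)) \<longlonglongrightarrow> 0"
  proof (rule LIMSEQ_I)
    fix e :: real assume "0 < e"
    then obtain k where k: "(1/2)^k < e" using real_arch_pow_inv[of e "1/2"] by auto
    have "norm (nrm M (\<lambda>x. f n x - g x) - 0) < e" if "n \<ge> r k" for n
    proof -
      have "ennreal ((nrm M (\<lambda>x. f n x - g x))\<^sup>2) = (\<integral>\<^sup>+x. ennreal ((norm (f n x - g x))\<^sup>2) \<partial>M)"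
        unfolding nrm_eq_LINT using dgL2[OF that]
        by (intro nn_integral_eq_integral[symmetric]) (auto simp: L2_def)
      also have "\<dots> \<le> ennreal (((1/2)^k)\<^sup>2)" by (rule main[OF that])
      finally have "(nrm M (\<lambda>x. f n x - g x))\<^sup>2 \<le> ((1/2)^k)\<^sup>2" by (subst (asm) ennreal_le_iff) auto
      then have "nrm M (\<lambda>x. f n x - g x) \<le> (1/2)^k" by (rule power2_le_imp_le) simp
      then show ?thesis using k by simp
    qed
    then show "\<exists>no. \<forall>n\<ge>no. norm (nrm M (\<lambda>x. f n x - g x) - 0) < e" by blast
  qed
  ultimately show ?thesis by (rule that)
qed

subsection \<open>Calculus of smooth functions\<close>

lemma Ck_SucI:
  assumes "\<And>x. (f has_derivative D x) (at x)" "\<And>i. i \<in> Basis \<Longrightarrow> Ck k (\<lambda>x. D x i)"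
  shows "Ck (Suc k) f"
proof -
  have "frechet_derivative f (at x) = D x" for x
    using frechet_derivative_at[OF assms(1)] by simp
  then show ?thesis using assms by (auto simp: differentiable_def)
qed

lemma Ck_Suc_has_derivative: "Ck (Suc k) f \<Longrightarrow> (f has_derivative frechet_derivative f (at x)) (at x)"
  by (simp add: frechet_derivative_works)

lemma Ck_SucD: "Ck (Suc k) f \<Longrightarrow> Ck k f"
proof (induction k arbitrary: f)
  case 0
  then show ?case
    by (auto simp: continuous_on_eq_continuous_at differentiable_imp_continuous_within)
qed auto

lemma Ck_const [simp]: "Ck k (\<lambda>x. c)"
proof (induction k arbitrary: c)
  case (Suc k)
  show ?case by (rule Ck_SucI[where D = "\<lambda>_ _. 0"]) (auto intro: Suc)
qed auto

lemma Ck_add: "Ck k f \<Longrightarrow> Ck k g \<Longrightarrow> Ck k (\<lambda>x. f x + g x)"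
proof (induction k arbitrary: f g)
  case (Suc k)
  show ?case
    by (rule Ck_SucI[OF has_derivative_add[OF Suc.prems[THEN Ck_Suc_has_derivative]]])
      (use Suc in auto)
qed (auto intro: continuous_on_add)

lemma Ck_mult: "Ck k f \<Longrightarrow> Ck k g \<Longrightarrow> Ck k (\<lambda>x. f x * g x)"
proof (induction k arbitrary: f g)
  case (Suc k)
  show ?case
    by (rule Ck_SucI[OF has_derivative_mult[OF Suc.prems[THEN Ck_Suc_has_derivative]]])
      (intro Ck_add Suc.IH Ck_SucD[OF Suc.prems(1)] Ck_SucD[OF Suc.prems(2)]; use Suc.prems in simp)
qed (auto intro: continuous_on_mult)

lemma Ck_sum: "(\<And>i. i \<in> I \<Longrightarrow> Ck k (f i)) \<Longrightarrow> Ck k (\<lambda>x. \<Sum>i\<in>I. f i x)"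
  by (induction I rule: infinite_finite_induct) (auto intro: Ck_add)

lemma Ck_prod: "(\<And>i. i \<in> I \<Longrightarrow> Ck k (f i)) \<Longrightarrow> Ck k (\<lambda>x. \<Prod>i\<in>I. f i x)"
  by (induction I rule: infinite_finite_induct) (auto intro: Ck_mult)

lemma Ck_inner_left: "Ck k (\<lambda>x. x \<bullet> v)"
proof (cases k)
  case (Suc n)
  show ?thesis unfolding Suc
    by (rule Ck_SucI[where D = "\<lambda>_ y. y \<bullet> v"]) (auto intro!: derivative_eq_intros)
qed (auto intro!: continuous_intros)

lemma frechet_derivative_Basis_sum:
  fixes f :: "'a::euclidean_space \<Rightarrow> real"
  assumes "f differentiable (at x)"
  shows "frechet_derivative f (at x) v = (\<Sum>i\<in>Basis. (v \<bullet> i) * frechet_derivative f (at x) i)"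
proof -
  have lin: "linear (frechet_derivative f (at x))"
    by (rule linear_frechet_derivative[OF assms])
  have "frechet_derivative f (at x) v = frechet_derivative f (at x) (\<Sum>i\<in>Basis. (v \<bullet> i) *\<^sub>R i)"
    by (simp add: euclidean_representation)
  then show ?thesis by (simp add: linear_sum[OF lin] linear_scale[OF lin])
qed

lemma Ck_affine:
  fixes f :: "'b::euclidean_space \<Rightarrow> real" and L :: "'a::euclidean_space \<Rightarrow> 'b"
  assumes L: "bounded_linear L"
  shows "Ck k f \<Longrightarrow> Ck k (\<lambda>x. f (L x + c))"
proof (induction k arbitrary: f)
  case 0
  have "continuous_on UNIV (\<lambda>x. L x + c)"
    by (intro continuous_intros linear_continuous_on L)
  with 0 show ?case
    using continuous_on_compose2[of UNIV f UNIV "\<lambda>x. L x + c"] by simp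
next
  case (Suc k)
  have "(f has_derivative frechet_derivative f (at (L x + c))) (at (L x + c))" for x
    by (rule Ck_Suc_has_derivative[OF Suc.prems])
  then have d: "((\<lambda>x. f (L x + c)) has_derivative (\<lambda>v. frechet_derivative f (at (L x + c)) (L v))) (at x)" for x
    by (rule has_derivative_compose[rotated])
      (auto intro!: derivative_eq_intros bounded_linear.has_derivative[OF L])
  \<comment> \<open>\<open>L i\<close> is in general not a basis vector, whereas \<open>Ck\<close>
    speaks only of basis directions.\<close>
  have eq: "frechet_derivative f (at y) v = (\<Sum>j\<in>Basis. (v \<bullet> j) * frechet_derivative f (at y) j)" for y v
    using Suc.prems by (intro frechet_derivative_Basis_sum) auto
  show ?case
  proof (rule Ck_SucI[OF d])
    fix i :: 'a assume "i \<in> Basis"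
    show "Ck k (\<lambda>x. frechet_derivative f (at (L x + c)) (L i))"
      unfolding eq[of _ "L i"]
      using Suc.prems by (intro Ck_sum Ck_mult Ck_const Suc.IH) auto
  qed
qed

lemma Ck_compose:
  fixes h :: "real \<Rightarrow> real" and f :: "'a::euclidean_space \<Rightarrow> real"
  shows "Ck k h \<Longrightarrow> Ck k f \<Longrightarrow> Ck k (\<lambda>x. h (f x))"
proof (induction k arbitrary: h f)
  case 0
  then show ?case using continuous_on_compose2[of UNIV h UNIV f] by simp
next
  case (Suc k)
  have d: "((\<lambda>x. h (f x)) has_derivative
      (\<lambda>v. frechet_derivative h (at (f x)) (frechet_derivative f (at x) v))) (at x)" for x
    by (rule has_derivative_compose[OF Suc.prems(2,1)[THEN Ck_Suc_has_derivative]])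
  have eq: "frechet_derivative h (at y) v = v * frechet_derivative h (at y) 1" for y v
    using Suc.prems(1) frechet_derivative_Basis_sum[of h y v] by simp
  show ?case
  proof (rule Ck_SucI[OF d])
    fix i :: 'a assume i: "i \<in> Basis"
    have "Ck k (\<lambda>x. frechet_derivative f (at x) i * frechet_derivative h (at (f x)) 1)"
      using Suc.prems i Ck_SucD[OF Suc.prems(2)]
      by (intro Ck_mult Suc.IH[of "\<lambda>y. frechet_derivative h (at y) 1" f]) auto
    then show "Ck k (\<lambda>x. frechet_derivative h (at (f x)) (frechet_derivative f (at x) i))"
      by (subst eq)
  qed
qed

lemma Ck_SucI_real:
  fixes f :: "real \<Rightarrow> real"
  assumes "\<And>t. (f has_real_derivative f' t) (at t)" "Ck k f'"
  shows "Ck (Suc k) f"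
  by (rule Ck_SucI[OF assms(1)[unfolded has_field_derivative_def]]) (use assms(2) in auto)

lemma smooth_Ck: "smooth f \<Longrightarrow> Ck k f"
  by (simp add: smooth_def)

lemma smooth_const [simp]: "smooth (\<lambda>x. c)"
  by (simp add: smooth_def)

lemma smooth_add: "smooth f \<Longrightarrow> smooth g \<Longrightarrow> smooth (\<lambda>x. f x + g x)"
  by (simp add: smooth_def Ck_add)

lemma smooth_mult: "smooth f \<Longrightarrow> smooth g \<Longrightarrow> smooth (\<lambda>x. f x * g x)"
  by (simp add: smooth_def Ck_mult)

lemma smooth_affine:
  "bounded_linear L \<Longrightarrow> smooth f \<Longrightarrow> smooth (\<lambda>x. f (L x + c))"
  by (simp add: smooth_def Ck_affine)

lemma smooth_affine_real: "smooth (\<lambda>t::real. p * t + q)"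
  using smooth_affine[of "\<lambda>t::real. p * t" "\<lambda>x. x" q] Ck_inner_left[of _ "1::real"]
  by (simp add: smooth_def bounded_linear_mult_right)

lemma smooth_compose: "smooth h \<Longrightarrow> smooth f \<Longrightarrow> smooth (\<lambda>x. h (f x))" for h :: "real \<Rightarrow> real"
  by (simp add: smooth_def Ck_compose)

lemma smooth_has_derivative_grad:
  assumes "smooth f"
  shows "(f has_derivative (\<lambda>v. grad f x \<bullet> v)) (at x)"
proof -
  have d: "(f has_derivative frechet_derivative f (at x)) (at x)"
    by (rule Ck_Suc_has_derivative[OF smooth_Ck[OF assms]])
  have "frechet_derivative f (at x) v = grad f x \<bullet> v" for v
    using frechet_derivative_Basis_sum[OF differentiableI[OF d], of v]
    by (simp add: grad_def inner_commute[of _ v] inner_sum_right mult.commute)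
  then have "frechet_derivative f (at x) = (\<lambda>v. grad f x \<bullet> v)" by auto
  with d show ?thesis by simp
qed

lemma grad_eqI:
  assumes "(f has_derivative (\<lambda>v. g \<bullet> v)) (at x)"
  shows "grad f x = g"
proof -
  have "frechet_derivative f (at x) = (\<lambda>v. g \<bullet> v)"
    using frechet_derivative_at[OF assms] by simp
  then show ?thesis by (simp add: grad_def euclidean_representation)
qed

lemma grad_inner_Basis:
  assumes "i \<in> Basis"
  shows "grad f x \<bullet> i = frechet_derivative f (at x) i"
  using assms by (simp add: grad_def inner_sum_left inner_Basis if_distrib cong: if_cong)

lemma smooth_grad_inner:
  assumes "smooth f" "i \<in> Basis"
  shows "smooth (\<lambda>x. grad f x \<bullet> i)"
  unfolding smooth_def
proof
  fix k
  show "Ck k (\<lambda>x. grad f x \<bullet> i)"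
    using smooth_Ck[OF assms(1), of "Suc k"] assms(2) by (simp add: grad_inner_Basis)
qed

lemma smooth_continuous: "smooth f \<Longrightarrow> continuous_on S f"
  using smooth_Ck[of f 0] continuous_on_subset by auto

lemma smooth_grad_continuous:
  assumes "smooth f" shows "continuous_on S (grad f)"
proof -
  have "continuous_on S (\<lambda>x. \<Sum>i\<in>Basis. (grad f x \<bullet> i) *\<^sub>R i)"
    by (intro continuous_intros smooth_continuous smooth_grad_inner assms)
  then show ?thesis by (simp add: euclidean_representation)
qed

lemma grad_add:
  assumes "smooth f" "smooth g"
  shows "grad (\<lambda>x. f x + g x) x = grad f x + grad g x"
  by (rule grad_eqI)
    (use assms[THEN smooth_has_derivative_grad] in \<open>auto intro!: derivative_eq_intros simp: inner_add_left\<close>)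

lemma grad_mult:
  assumes "smooth f" "smooth g"
  shows "grad (\<lambda>x. f x * g x) x = f x *\<^sub>R grad g x + g x *\<^sub>R grad f x"
  by (rule grad_eqI)
    (use assms[THEN smooth_has_derivative_grad] in
      \<open>auto intro!: derivative_eq_intros simp: inner_add_left mult.commute\<close>)

lemma grad_cmult:
  assumes "smooth f"
  shows "grad (\<lambda>x. c * f x) x = c *\<^sub>R grad f x"
  by (rule grad_eqI)
    (use smooth_has_derivative_grad[OF assms] in \<open>auto intro!: derivative_eq_intros\<close>)

lemma smooth_diff: "smooth f \<Longrightarrow> smooth g \<Longrightarrow> smooth (\<lambda>x. f x - g x)"
  using smooth_add[of f "\<lambda>x. (-1) * g x"] smooth_mult[of "\<lambda>_. -1" g] by simp

lemma grad_diff: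
  assumes "smooth f" "smooth g"
  shows "grad (\<lambda>x. f x - g x) x = grad f x - grad g x"
  by (rule grad_eqI)
    (use assms[THEN smooth_has_derivative_grad] in \<open>auto intro!: derivative_eq_intros simp: inner_diff_left\<close>)

lemma grad_compose:
  fixes h :: "real \<Rightarrow> real"
  assumes "(h has_real_derivative h') (at (f x))" "smooth f"
  shows "grad (\<lambda>x. h (f x)) x = h' *\<^sub>R grad f x"
  by (rule grad_eqI)
    (use has_derivative_compose[OF smooth_has_derivative_grad[OF assms(2)]
        assms(1)[unfolded has_field_derivative_def]] in simp)

lemma not_in_supp: "x \<notin> supp f \<Longrightarrow> f x = 0"
  using closure_subset[of "{x. f x \<noteq> 0}"] by (auto simp: supp_def)

lemma closed_supp: "closed (supp f)"
  by (simp add: supp_def)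

lemma supp_subsetI: "closed C \<Longrightarrow> (\<And>x. x \<notin> C \<Longrightarrow> f x = 0) \<Longrightarrow> supp f \<subseteq> C"
  unfolding supp_def by (intro closure_minimal) auto

lemma grad_not_in_supp:
  assumes "x \<notin> supp f"
  shows "grad f x = 0"
proof (rule grad_eqI)
  have "open (- supp f)" by (simp add: open_Compl closed_supp)
  have "((\<lambda>_. 0) has_derivative (\<lambda>v. 0 \<bullet> v)) (at x)" by simp
  then show "(f has_derivative (\<lambda>v. 0 \<bullet> v)) (at x)"
    by (rule has_derivative_transform_within_open[OF _ \<open>open (- supp f)\<close>])
      (use assms not_in_supp in auto)
qed

lemma supp_add: "supp (\<lambda>x. f x + g x) \<subseteq> supp f \<union> supp g" for f :: "'a::topological_space \<Rightarrow> real"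
  by (rule supp_subsetI) (auto simp: closed_supp not_in_supp)

lemma supp_mult_right: "supp (\<lambda>x. f x * g x) \<subseteq> supp g"
  by (rule supp_subsetI) (auto simp: closed_supp not_in_supp)

lemma supp_compose: "h 0 = 0 \<Longrightarrow> supp (\<lambda>x. h (f x)) \<subseteq> supp f"
  by (rule supp_subsetI) (auto simp: closed_supp not_in_supp)

lemma test_function_subset_supp:
  assumes "test_function U f" "smooth g" "supp g \<subseteq> supp f"
  shows "test_function U g"
  using assms compact_Int_closed[of "supp f" "supp g"] closed_supp[of g]
  by (auto simp: test_function_def inf.absorb2)

lemma test_function_smooth: "test_function U f \<Longrightarrow> smooth f"
  by (simp add: test_function_def)

lemma test_function_add:
  assumes "test_function U f" "test_function U g"
  shows "test_function U (\<lambda>x. f x + g x)"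
proof -
  have "compact (supp f \<union> supp g)" using assms by (auto simp: test_function_def)
  then have "compact (supp (\<lambda>x. f x + g x))"
    using supp_add[of f g] closed_supp by (metis compact_Int_closed inf.absorb2)
  then show ?thesis using assms supp_add[of f g]
    by (auto simp: test_function_def intro: smooth_add)
qed

lemma test_function_mult: "smooth f \<Longrightarrow> test_function U g \<Longrightarrow> test_function U (\<lambda>x. f x * g x)"
  by (rule test_function_subset_supp[of U g])
    (auto intro!: smooth_mult supp_mult_right dest: test_function_smooth)

lemma test_function_cmult: "test_function U g \<Longrightarrow> test_function U (\<lambda>x. c * g x)"
  by (rule test_function_mult) auto

lemma test_function_compose:
  assumes "smooth h" "h 0 = 0" "test_function U f"
  shows "test_function U (\<lambda>x. h (f x))"
  by (rule test_function_subset_supp[OF assms(3)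
        smooth_compose[OF assms(1) test_function_smooth[OF assms(3)]] supp_compose[of h, OF assms(2)]])

lemma test_function_outside: "test_function U f \<Longrightarrow> x \<notin> U \<Longrightarrow> f x = 0 \<and> grad f x = 0"
  using not_in_supp[of x f] grad_not_in_supp[of x f] by (auto simp: test_function_def)

text \<open>The open sets U and \<open>- K\<close> cover the space, and on each of them the
  extension by zero is visibly smooth. It turns slices of functions on the cylinder into test
  functions.\<close>

lemma Ck_glue:
  fixes g :: "'a::euclidean_space \<Rightarrow> real"
  assumes U: "open U" and K: "closed K" "K \<subseteq> U"
  shows "Ck k g \<Longrightarrow> (\<And>x. x \<in> U \<Longrightarrow> x \<notin> K \<Longrightarrow> g x = 0) \<Longrightarrow> Ck k (\<lambda>x. if x \<in> U then g x else 0)"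
proof (induction k arbitrary: g)
  case 0
  have "continuous_on (U \<union> - K) (\<lambda>x. if x \<in> U then g x else 0)"
  proof (rule continuous_on_cases_local_open)
    show "openin (top_of_set (U \<union> - K)) U" "openin (top_of_set (U \<union> - K)) (- K)"
      using U K by (auto intro: open_openin_trans open_Compl)
  qed (use 0 K in \<open>auto intro: continuous_on_subset\<close>)
  moreover have "U \<union> - K = UNIV" using K by auto
  ultimately show ?case by simp
next
  case (Suc k)
  have z: "frechet_derivative g (at x) = (\<lambda>v. 0)" if "x \<in> U" "x \<notin> K" for x
  proof (rule frechet_derivative_at[symmetric])
    have "((\<lambda>_. 0) has_derivative (\<lambda>v. 0)) (at x)" by simp
    then show "(g has_derivative (\<lambda>v. 0)) (at x)"
      by (rule has_derivative_transform_within_open[of _ _ _ _ "U - K"])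
        (use U K that Suc.prems(2) in \<open>auto simp: open_Diff\<close>)
  qed
  define D where "D x = (if x \<in> U then frechet_derivative g (at x) else (\<lambda>v. 0))" for x
  have d: "((\<lambda>x. if x \<in> U then g x else 0) has_derivative D x) (at x)" for x
  proof (cases "x \<in> U")
    case True
    then show ?thesis
      unfolding D_def
      by (auto intro!: has_derivative_transform_within_open[OF Ck_Suc_has_derivative[OF Suc.prems(1)] U True])
  next
    case False
    have "((\<lambda>_. 0) has_derivative (\<lambda>v. 0)) (at x)" by simp
    then have "((\<lambda>x. if x \<in> U then g x else 0) has_derivative (\<lambda>v. 0)) (at x)"
      by (rule has_derivative_transform_within_open[of _ _ _ _ "- K"])
        (use K False Suc.prems(2) in \<open>auto simp: open_Compl\<close>)
    then show ?thesis using False by (simp add: D_def)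
  qed
  show ?case
  proof (rule Ck_SucI[OF d])
    fix i :: 'a assume i: "i \<in> Basis"
    have "Ck k (\<lambda>x. if x \<in> U then frechet_derivative g (at x) i else 0)"
      by (rule Suc.IH) (use Suc.prems i z in auto)
    moreover have "(\<lambda>x. if x \<in> U then frechet_derivative g (at x) i else 0) = (\<lambda>x. D x i)"
      by (auto simp: D_def)
    ultimately show "Ck k (\<lambda>x. D x i)" by simp
  qed
qed

lemma grad_cong_open:
  assumes "open U" "x \<in> U" "\<And>y. y \<in> U \<Longrightarrow> f y = g y" "smooth g"
  shows "grad f x = grad g x"
  by (rule grad_eqI, rule has_derivative_transform_within_open[OF smooth_has_derivative_grad[OF assms(4)] assms(1,2)])
    (use assms(3) in simp)

subsection \<open>Integration by parts\<close>

lemma lborel_integral_translate: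
  fixes f :: "'a::euclidean_space \<Rightarrow> real"
  assumes "f \<in> borel_measurable borel"
  shows "(LINT x|lborel. f (x + c)) = (LINT x|lborel. f x)"
proof -
  have "(LINT x|lborel. f x) = (LINT x|distr lborel borel ((+) c). f x)"
    by (simp add: lborel_distr_plus)
  also have "\<dots> = (LINT x|lborel. f (c + x))"
    using assms by (intro integral_distr) auto
  finally show ?thesis by (simp add: add.commute)
qed

lemma continuous_compact_support_bounded:
  fixes f :: "'a::euclidean_space \<Rightarrow> 'b::euclidean_space"
  assumes "continuous_on UNIV f" "compact K" "\<And>x. x \<notin> K \<Longrightarrow> f x = 0"
  obtains B where "0 < B" "\<And>x. norm (f x) \<le> B"
proof -
  have "compact (f ` K)"
    using assms by (intro compact_continuous_image) (auto intro: continuous_on_subset)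
  then obtain B where B: "0 < B" "\<And>y. y \<in> f ` K \<Longrightarrow> norm y \<le> B"
    using compact_imp_bounded bounded_pos by metis
  have "norm (f x) \<le> B" for x
    using B assms(3)[of x] by (cases "x \<in> K") auto
  with B(1) show ?thesis by (rule that)
qed

lemma integrable_compact_support:
  fixes f :: "'a::euclidean_space \<Rightarrow> real"
  assumes "continuous_on UNIV f" "compact K" "\<And>x. x \<notin> K \<Longrightarrow> f x = 0"
  shows "integrable lborel f"
proof -
  obtain B where B: "0 < B" "\<And>x. norm (f x) \<le> B"
    using continuous_compact_support_bounded[OF assms] by blast
  have fin: "emeasure lborel K < \<infinity>"
    using assms(2) by (rule emeasure_compact_finite)
  have m: "f \<in> borel_measurable lborel"
    using assms(1) by (simp add: borel_measurable_continuous_onI)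
  show ?thesis
  proof (rule Bochner_Integration.integrable_bound)
    show "integrable lborel (\<lambda>x. indicator K x * B)"
      using fin assms(2) by (intro integrable_mult_left integrable_real_indicator) (auto simp: compact_imp_closed)
    show "AE x in lborel. norm (f x) \<le> norm (indicator K x * B)"
      using B assms(3) by (intro AE_I2) (auto simp: indicator_def)
  qed (rule m)
qed

text \<open>Difference quotients integrate to zero by translation invariance. Dominated convergence
  applies because the mean value theorem bounds them by the maximum of the derivative.\<close>

lemma integral_partial_derivative_zero:
  fixes f :: "'a::euclidean_space \<Rightarrow> real"
  assumes f: "smooth f" "compact (supp f)"
  shows "(LINT x|lborel. grad f x \<bullet> v) = 0"
proof -
  have contg: "continuous_on UNIV (\<lambda>x. grad f x \<bullet> v)"
    by (intro continuous_intros smooth_grad_continuous f)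
  obtain B where B: "0 < B" "\<And>x. norm (grad f x \<bullet> v) \<le> B"
    using continuous_compact_support_bounded[OF contg f(2)] grad_not_in_supp[of _ f]
    by (metis inner_zero_left)
  obtain R where R: "\<And>x. x \<in> supp f \<Longrightarrow> norm x \<le> R"
    using compact_imp_bounded[OF f(2)] bounded_iff by blast
  define t where "t n = inverse (real (Suc n))" for n
  define h where "h n x = (f (x + t n *\<^sub>R v) - f x) / t n" for n x
  have t: "0 < t n" "t n \<le> 1" for n
    using inverse_le_1_iff[of "real (Suc n)"] by (auto simp: t_def)
  have fm[measurable]: "f \<in> borel_measurable borel"
    using smooth_continuous[OF f(1)] by (rule borel_measurable_continuous_onI)
  have line: "((\<lambda>s. f (x + s *\<^sub>R v)) has_real_derivative (grad f (x + s *\<^sub>R v) \<bullet> v)) (at s)" for x s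
  proof -
    have "((\<lambda>s. f (x + s *\<^sub>R v)) has_derivative (\<lambda>r. grad f (x + s *\<^sub>R v) \<bullet> (r *\<^sub>R v))) (at s)"
      by (rule has_derivative_compose[OF _ smooth_has_derivative_grad[OF f(1)]])
        (auto intro!: derivative_eq_intros)
    moreover have "(\<lambda>r. grad f (x + s *\<^sub>R v) \<bullet> (r *\<^sub>R v)) = (*) (grad f (x + s *\<^sub>R v) \<bullet> v)"
      by (simp add: fun_eq_iff)
    ultimately show ?thesis by (simp add: has_field_derivative_def)
  qed
  have hb: "\<bar>h n x\<bar> \<le> B" for n x
  proof -
    obtain z where "0 < z" "z < t n" "f (x + t n *\<^sub>R v) - f (x + 0 *\<^sub>R v) = (t n - 0) * (grad f (x + z *\<^sub>R v) \<bullet> v)"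
      using MVT2[of 0 "t n" "\<lambda>s. f (x + s *\<^sub>R v)" "\<lambda>s. grad f (x + s *\<^sub>R v) \<bullet> v"] line t by auto
    then have "h n x = grad f (x + z *\<^sub>R v) \<bullet> v" using t[of n] by (simp add: h_def)
    then show ?thesis using B(2) by simp
  qed
  \<comment> \<open>Since \<open>t n \<le> 1\<close>, one ball contains the supports of all the
    quotients.\<close>
  have h0: "h n x = 0" if "norm x > R + norm v" for n x
  proof -
    have "norm x \<le> norm (x + t n *\<^sub>R v) + norm (t n *\<^sub>R v)"
      using norm_triangle_ineq4[of "x + t n *\<^sub>R v" "t n *\<^sub>R v"] by simp
    moreover have "norm (t n *\<^sub>R v) \<le> norm v" using t[of n] by (simp add: mult_left_le_one_le)
    ultimately have "x + t n *\<^sub>R v \<notin> supp f" "x \<notin> supp f"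
      using R[of x] R[of "x + t n *\<^sub>R v"] that norm_ge_zero[of v] by fastforce+
    then show ?thesis by (simp add: h_def not_in_supp)
  qed
  have "(\<lambda>n. LINT x|lborel. h n x) \<longlonglongrightarrow> (LINT x|lborel. grad f x \<bullet> v)"
  proof (rule integral_dominated_convergence)
    show "integrable lborel (\<lambda>x. indicator (cball 0 (R + norm v)) x * B)"
      by (intro integrable_mult_left integrable_real_indicator emeasure_compact_finite) auto
    show "AE x in lborel. norm (h n x) \<le> indicator (cball 0 (R + norm v)) x * B" for n
      using hb h0 by (intro AE_I2) (auto simp: indicator_def)
    show "AE x in lborel. (\<lambda>n. h n x) \<longlonglongrightarrow> grad f x \<bullet> v"
    proof (rule AE_I2)
      fix x
      have "((\<lambda>s. (f (x + s *\<^sub>R v) - f x) / s) \<longlongrightarrow> grad f x \<bullet> v) (at 0)"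
        using line[of x 0] by (simp add: DERIV_def)
      moreover have "filterlim t (at 0) sequentially"
        unfolding filterlim_at using t LIMSEQ_inverse_real_of_nat
        by (auto simp: t_def[abs_def])
      ultimately show "(\<lambda>n. h n x) \<longlonglongrightarrow> grad f x \<bullet> v"
        unfolding h_def by (rule filterlim_compose)
    qed
    show "h n \<in> borel_measurable lborel" for n unfolding h_def by measurable
    show "(\<lambda>x. grad f x \<bullet> v) \<in> borel_measurable lborel"
      using contg by (simp add: borel_measurable_continuous_onI)
  qed
  moreover have "(LINT x|lborel. h n x) = 0" for n
  proof -
    have i0: "integrable lborel f"
      by (rule integrable_compact_support[OF smooth_continuous[OF f(1)] f(2)]) (rule not_in_supp)
    have i1: "integrable lborel (\<lambda>x. f (x + t n *\<^sub>R v))"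
    proof (rule integrable_compact_support[of _ "cball 0 (R + norm v)"])
      show "continuous_on UNIV (\<lambda>x. f (x + t n *\<^sub>R v))"
        by (rule continuous_on_compose2[OF smooth_continuous[OF f(1), of UNIV]]) (auto intro!: continuous_intros)
      fix x :: 'a assume x: "x \<notin> cball 0 (R + norm v)"
      then have "norm x > R + norm v" by simp
      then have "x \<notin> supp f" using R[of x] norm_ge_zero[of v] by force
      then show "f (x + t n *\<^sub>R v) = 0"
        using h0[of x n] t[of n] not_in_supp[of x f] x by (simp add: h_def)
    qed simp
    have "(LINT x|lborel. h n x) = ((LINT x|lborel. f (x + t n *\<^sub>R v)) - (LINT x|lborel. f x)) / t n"
      unfolding h_def using i0 i1 by simp
    then show ?thesis by (simp add: lborel_integral_translate)
  qed
  ultimately show ?thesis by (simp add: LIMSEQ_const_iff)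
qed

lemma integral_lebesgue_on_lborel:
  fixes f :: "'a::euclidean_space \<Rightarrow> 'b::euclidean_space"
  assumes "U \<in> sets borel" "f \<in> borel_measurable borel"
  shows "(LINT x|lebesgue_on U. f x) = (LINT x|lborel. indicator U x *\<^sub>R f x)"
proof -
  have "(LINT x|lebesgue_on U. f x) = (LINT x|lebesgue. indicator U x *\<^sub>R f x)"
    using assms by (intro integral_restrict_space) auto
  also have "\<dots> = (LINT x|lborel. indicator U x *\<^sub>R f x)"
    using assms by (intro integral_completion) auto
  finally show ?thesis .
qed

lemma integrable_lebesgue_on_lborel:
  fixes f :: "'a::euclidean_space \<Rightarrow> 'b::euclidean_space"
  assumes "U \<in> sets borel" "f \<in> borel_measurable borel"
  shows "integrable (lebesgue_on U) f \<longleftrightarrow> integrable lborel (\<lambda>x. indicator U x *\<^sub>R f x)"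
proof -
  have "integrable (lebesgue_on U) f \<longleftrightarrow> integrable lebesgue (\<lambda>x. indicator U x *\<^sub>R f x)"
    using assms by (intro integrable_restrict_space) auto
  also have "\<dots> \<longleftrightarrow> integrable lborel (\<lambda>x. indicator U x *\<^sub>R f x)"
    using assms by (intro integrable_completion) auto
  finally show ?thesis .
qed

text \<open>The product \<open>f * \<phi>\<close> has compact support even if f does not, so its
  partial derivatives integrate to zero.\<close>

lemma integration_by_parts_test:
  fixes U :: "'a::euclidean_space set"
  assumes U: "open U" and f: "smooth f" and \<phi>: "test_function U \<phi>"
  shows "(LINT x|lebesgue_on U. f x * (grad \<phi> x \<bullet> v)) = - (LINT x|lebesgue_on U. (grad f x \<bullet> v) * \<phi> x)"
proof -
  note s = test_function_smooth[OF \<phi>]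
  have UB: "U \<in> sets borel" using U by simp
  have c: "continuous_on UNIV (\<lambda>x. f x * (grad \<phi> x \<bullet> v))" "continuous_on UNIV (\<lambda>x. (grad f x \<bullet> v) * \<phi> x)"
    by (intro continuous_intros smooth_continuous smooth_grad_continuous f s)+
  have K: "compact (supp \<phi>)" using \<phi> by (simp add: test_function_def)
  have i: "integrable lborel (\<lambda>x. f x * (grad \<phi> x \<bullet> v))" "integrable lborel (\<lambda>x. (grad f x \<bullet> v) * \<phi> x)"
    by (auto intro!: integrable_compact_support[OF _ K] c simp: not_in_supp grad_not_in_supp)
  have "(LINT x|lborel. grad (\<lambda>x. f x * \<phi> x) x \<bullet> v) = 0"
    using test_function_mult[OF f \<phi>] by (intro integral_partial_derivative_zero) (auto simp: test_function_def)
  then have z: "(LINT x|lborel. f x * (grad \<phi> x \<bullet> v)) + (LINT x|lborel. (grad f x \<bullet> v) * \<phi> x) = 0"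
    using i by (simp add: grad_mult f s inner_add_left mult.commute)
  have "(LINT x|lebesgue_on U. f x * (grad \<phi> x \<bullet> v)) = (LINT x|lborel. f x * (grad \<phi> x \<bullet> v))"
    "(LINT x|lebesgue_on U. (grad f x \<bullet> v) * \<phi> x) = (LINT x|lborel. (grad f x \<bullet> v) * \<phi> x)"
    using c[THEN borel_measurable_continuous_onI] test_function_outside[OF \<phi>]
    by (auto simp: integral_lebesgue_on_lborel[OF UB] indicator_def intro!: Bochner_Integration.integral_cong)
  with z show ?thesis by simp
qed

subsection \<open>Bump functions and the fundamental lemma of the calculus of variations\<close>

text \<open>The class of functions \<open>t powr -m * exp (-1/t)\<close> is closed under differentiation.\<close>

definition flat :: "nat \<Rightarrow> real \<Rightarrow> real" where
  "flat m t = (if 0 < t then inverse t ^ m * exp (- inverse t) else 0)"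

lemma flat_at_0: "(flat m \<longlongrightarrow> 0) (at_right 0)"
proof -
  have "((\<lambda>u::real. u ^ m / exp u) \<longlongrightarrow> 0) at_top" by (rule tendsto_power_div_exp_0)
  then have "((\<lambda>t. inverse t ^ m / exp (inverse t)) \<longlongrightarrow> 0) (at_right (0::real))"
    by (rule filterlim_compose[OF _ filterlim_inverse_at_top_right])
  then show ?thesis
    by (rule Lim_transform_eventually)
      (auto simp: eventually_at_right_field flat_def exp_minus divide_inverse intro!: exI[of _ 1])
qed

lemma flat_deriv:
  "(flat m has_real_derivative (flat (m + 2) t - real m * flat (m + 1) t)) (at t)"
proof (cases t "0 :: real" rule: linorder_cases)
  case less
  have "((\<lambda>_. 0) has_real_derivative 0) (at t)" by simp
  then have "(flat m has_real_derivative 0) (at t)"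
    by (rule has_field_derivative_transform_within_open[of _ _ _ "{..<0}"]) (use less in \<open>auto simp: flat_def\<close>)
  then show ?thesis using less by (simp add: flat_def)
next
  case greater
  have "((\<lambda>t. inverse t ^ m * exp (- inverse t)) has_real_derivative (flat (m + 2) t - real m * flat (m + 1) t)) (at t)"
  proof -
    have "((\<lambda>t. inverse t ^ m * exp (- inverse t)) has_real_derivative
        real m * inverse t ^ (m - 1) * (- (inverse t * inverse t)) * exp (- inverse t)
          + inverse t ^ m * (exp (- inverse t) * (inverse t * inverse t))) (at t)"
      using greater by (auto intro!: derivative_eq_intros)
    then show ?thesis
      using greater by (cases m) (simp_all add: flat_def algebra_simps)
  qed
  then show ?thesis
    by (rule has_field_derivative_transform_within_open[of _ _ _ "{0<..}"]) (use greater in \<open>auto simp: flat_def\<close>)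
next
  case equal
  \<comment> \<open>For small positive h the difference quotient is
    \<open>flat (m + 1) h\<close>.\<close>
  have r: "((\<lambda>h. flat m h / h) \<longlongrightarrow> 0) (at_right 0)"
    using flat_at_0[of "m + 1"]
    by (rule Lim_transform_eventually)
      (auto simp: eventually_at_right_field flat_def divide_inverse intro!: exI[of _ 1])
  have l: "((\<lambda>h. flat m h / h) \<longlongrightarrow> 0) (at_left 0)"
    by (rule Lim_transform_eventually[OF tendsto_const])
      (auto simp: eventually_at_left_field flat_def intro!: exI[of _ "-1"])
  have "((\<lambda>h. flat m h / h) \<longlongrightarrow> 0) (at 0)"
    using r l by (simp add: filterlim_split_at)
  then show ?thesis using equal by (simp add: DERIV_def flat_def)
qed

lemma smooth_flat: "smooth (flat m)"
proof -
  have "Ck k (flat m)" for k m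
  proof (induction k arbitrary: m)
    case 0
    show ?case
      unfolding Ck.simps by (rule DERIV_continuous_on, rule has_field_derivative_at_within, rule flat_deriv)
  next
    case (Suc k)
    have "Ck k (\<lambda>t. flat (m + 2) t + (- real m) * flat (m + 1) t)"
      by (intro Ck_add Ck_mult Ck_const Suc)
    then show ?case by (intro Ck_SucI_real[OF flat_deriv]) simp
  qed
  then show ?thesis by (simp add: smooth_def)
qed

lemma flat_0_bounds: "0 \<le> flat 0 t" "flat 0 t \<le> 1"
  by (auto simp: flat_def)

lemma flat_0_scaled_tendsto: "(\<lambda>n. flat 0 (real n * t)) \<longlonglongrightarrow> (if 0 < t then 1 else 0)"
proof (cases "0 < t")
  case True
  have "filterlim (\<lambda>n. real n * t) at_top sequentially"
    using True by (intro filterlim_at_top_mult_tendsto_pos[OF tendsto_const] filterlim_real_sequentially) auto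
  then have "(\<lambda>n. exp (- inverse (real n * t))) \<longlonglongrightarrow> exp (- 0)"
    by (intro tendsto_intros tendsto_inverse_0_at_top)
  moreover have "\<forall>\<^sub>F n in sequentially. exp (- inverse (real n * t)) = flat 0 (real n * t)"
    using eventually_gt_at_top[of 0] by eventually_elim (use True in \<open>auto simp: flat_def\<close>)
  ultimately show ?thesis using True by (auto intro: Lim_transform_eventually)
qed (auto simp: flat_def zero_less_mult_iff)

text \<open>A smooth function vanishing outside the open box; as n grows it tends pointwise to the
  indicator of the box while staying between 0 and 1.\<close>

definition box_bump :: "'a::euclidean_space \<Rightarrow> 'a \<Rightarrow> nat \<Rightarrow> 'a \<Rightarrow> real" where
  "box_bump a b n x = (\<Prod>i\<in>Basis. flat 0 (real n * ((x - a) \<bullet> i)) * flat 0 (real n * ((b - x) \<bullet> i)))"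

lemma smooth_box_bump: "smooth (box_bump a b n)"
proof -
  have 1: "Ck k (\<lambda>x::'a. flat 0 (real n * ((x - a) \<bullet> i)))" for i k
  proof -
    have "Ck k (\<lambda>x::'a. real n * (x \<bullet> i) + (- real n * (a \<bullet> i)))"
      by (intro Ck_add Ck_mult Ck_const Ck_inner_left)
    from Ck_compose[OF smooth_Ck[OF smooth_flat] this] show ?thesis by (simp add: inner_diff_left algebra_simps)
  qed
  have 2: "Ck k (\<lambda>x::'a. flat 0 (real n * ((b - x) \<bullet> i)))" for i k
  proof -
    have "Ck k (\<lambda>x::'a. - real n * (x \<bullet> i) + real n * (b \<bullet> i))"
      by (intro Ck_add Ck_mult Ck_const Ck_inner_left)
    from Ck_compose[OF smooth_Ck[OF smooth_flat] this] show ?thesis by (simp add: inner_diff_left algebra_simps)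
  qed
  show ?thesis unfolding smooth_def box_bump_def[abs_def] by (intro allI Ck_prod Ck_mult 1 2)
qed

lemma box_bump_outside:
  assumes "x \<notin> box a b"
  shows "box_bump a b n x = 0"
proof -
  obtain i where i: "i \<in> Basis" "\<not> a \<bullet> i < x \<bullet> i \<or> \<not> x \<bullet> i < b \<bullet> i"
    using assms by (auto simp: mem_box)
  then have "flat 0 (real n * ((x - a) \<bullet> i)) * flat 0 (real n * ((b - x) \<bullet> i)) = 0"
    by (auto simp: flat_def inner_diff_left zero_less_mult_iff)
  with i(1) show ?thesis unfolding box_bump_def by (intro prod_zero) auto
qed

lemma box_bump_bounds: "0 \<le> box_bump a b n x" "box_bump a b n x \<le> 1"
  unfolding box_bump_def by (auto intro!: prod_nonneg prod_le_1 mult_le_one flat_0_bounds mult_nonneg_nonneg)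

lemma box_bump_tendsto: "(\<lambda>n. box_bump a b n x) \<longlonglongrightarrow> indicator (box a b) x"
proof -
  have "(\<lambda>n. box_bump a b n x) \<longlonglongrightarrow>
    (\<Prod>i\<in>Basis. (if 0 < (x - a) \<bullet> i then 1 else 0) * (if 0 < (b - x) \<bullet> i then 1 else 0))"
    unfolding box_bump_def by (intro tendsto_prod tendsto_mult flat_0_scaled_tendsto)
  moreover have "(\<Prod>i\<in>Basis. (if 0 < (x - a) \<bullet> i then 1 else 0) * (if 0 < (b - x) \<bullet> i then 1 else 0 :: real))
      = indicator (box a b) x"
    by (auto simp: indicator_def mem_box inner_diff_left intro!: prod.neutral split: if_splits)
  ultimately show ?thesis by simp
qed

lemma test_function_box_bump:
  assumes "cbox a b \<subseteq> U"
  shows "test_function U (box_bump a b n)"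
proof -
  have "supp (box_bump a b n) \<subseteq> cbox a b"
    using box_subset_cbox[of a b] by (intro supp_subsetI) (auto intro!: box_bump_outside)
  then show ?thesis
    using assms smooth_box_bump[of a b n] closed_supp[of "box_bump a b n"]
      compact_Int_closed[OF compact_cbox[of a b] closed_supp[of "box_bump a b n"]]
    by (auto simp: test_function_def inf.absorb2)
qed

text \<open>Testing with the bumps shows that h has integral zero over every box whose closed box
  lies in U. Boxes are stable under intersection and generate the Borel sets, so the integral
  vanishes over every Borel subset of the given box.\<close>

lemma fundamental_lemma_box:
  fixes h :: "'a::euclidean_space \<Rightarrow> real"
  assumes U: "open U" and ab: "cbox a b \<subseteq> U" and h: "locally_integrable U h"
    and zero: "\<And>\<phi>. test_function U \<phi> \<Longrightarrow> (LINT x|lebesgue_on U. h x * \<phi> x) = 0"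
  shows "AE x in lebesgue. x \<in> box a b \<longrightarrow> h x = 0"
proof -
  have hK: "integrable lebesgue (\<lambda>x. indicator (cbox c d) x * h x)" if "cbox c d \<subseteq> U" for c d
    using h that integrable_restrict_space[of "cbox c d" lebesgue h]
    by (auto simp: locally_integrable_def)
  have box0: "(LINT x|lebesgue. indicator (box c d) x * h x) = 0" if cd: "cbox c d \<subseteq> U" for c d
  proof -
    have m: "(\<lambda>x. indicator (cbox c d) x * h x) \<in> borel_measurable lebesgue"
      using hK[OF cd] by auto
    have eq: "h x * box_bump c d n x = indicator (cbox c d) x * h x * box_bump c d n x" for n x
      using box_bump_outside[of x c d n] box_subset_cbox[of c d] by (auto simp: indicator_def)
    have mb: "box_bump c d n \<in> borel_measurable lebesgue" for n
      using smooth_continuous[OF smooth_box_bump, THEN borel_measurable_continuous_onI]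
      by (intro measurable_completion) simp
    have "(\<lambda>n. LINT x|lebesgue. indicator (cbox c d) x * h x * box_bump c d n x)
      \<longlonglongrightarrow> (LINT x|lebesgue. indicator (cbox c d) x * h x * indicator (box c d) x)"
    proof (rule integral_dominated_convergence)
      show "integrable lebesgue (\<lambda>x. norm (indicator (cbox c d) x * h x))" using hK[OF cd] by simp
      show "AE x in lebesgue. (\<lambda>n. indicator (cbox c d) x * h x * box_bump c d n x)
          \<longlonglongrightarrow> indicator (cbox c d) x * h x * indicator (box c d) x"
        by (intro AE_I2 tendsto_intros box_bump_tendsto)
      show "AE x in lebesgue. norm (indicator (cbox c d) x * h x * box_bump c d n x) \<le> norm (indicator (cbox c d) x * h x)" for n
        using box_bump_bounds[of c d n] by (intro AE_I2) (auto simp: abs_mult mult_right_le_one_le)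
    qed (use m mb in \<open>auto intro!: borel_measurable_times borel_measurable_indicator\<close>)
    moreover have "(LINT x|lebesgue. indicator (cbox c d) x * h x * box_bump c d n x) = 0" for n
    proof -
      have "(LINT x|lebesgue_on U. h x * box_bump c d n x) = (LINT x|lebesgue. indicator U x *\<^sub>R (h x * box_bump c d n x))"
        using U by (intro integral_restrict_space) auto
      also have "\<dots> = (LINT x|lebesgue. indicator (cbox c d) x * h x * box_bump c d n x)"
        using box_bump_outside[of _ c d n] box_subset_cbox[of c d] cd
        by (intro Bochner_Integration.integral_cong) (auto simp: indicator_def)
      finally show ?thesis using zero[OF test_function_box_bump[OF cd], of n] by simp
    qed
    ultimately have "(LINT x|lebesgue. indicator (cbox c d) x * h x * indicator (box c d) x) = 0"
      by (simp add: LIMSEQ_const_iff)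
    moreover have "indicator (cbox c d) x * h x * indicator (box c d) x = indicator (box c d) x * h x" for x
      using box_subset_cbox[of c d] by (auto simp: indicator_def)
    ultimately show ?thesis by simp
  qed
  have fi: "integrable lebesgue (\<lambda>x. indicator (box a b) x * h x)"
  proof -
    have "integrable lebesgue (\<lambda>x. indicator (box a b) x *\<^sub>R (indicator (cbox a b) x * h x))"
      using hK[OF ab] by (intro integrable_mult_indicator) auto
    moreover have "indicator (box a b) x *\<^sub>R (indicator (cbox a b) x * h x) = indicator (box a b) x * h x" for x
      using box_subset_cbox[of a b] by (auto simp: indicator_def)
    ultimately show ?thesis by (simp only:)
  qed
  \<comment> \<open>h is only Lebesgue measurable; a Borel representative is required for the
    argument over the sigma-algebra generated by the boxes.\<close>
  then obtain f where f[measurable]: "f \<in> borel_measurable lborel"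
    and ae: "AE x in lborel. indicator (box a b) x * h x = f x"
    using completion_ex_borel_measurable_real[of "\<lambda>x. indicator (box a b) x * h x" lborel]
      borel_measurable_integrable by blast
  have ae': "AE x in lebesgue. indicator (box a b) x * h x = f x"
    using ae by (rule AE_completion)
  have fint: "integrable lborel f"
  proof -
    have "integrable lebesgue f"
      using fi ae' measurable_completion[OF f] by (subst integrable_cong_AE[of _ _ "\<lambda>x. indicator (box a b) x * h x"]) auto
    then show ?thesis using integrable_completion[OF f] by simp
  qed
  have fbox: "(LINT x:A|lborel. f x) = 0" if rA: "A \<in> range (\<lambda>(c, d). box c d)" for A
  proof -
    obtain c d where A: "A = box c d" using rA by auto
    obtain c' d' where cd: "box c d \<inter> box a b = box c' d'" using box_Int_box[of c d a b] by blast
    have "(LINT x:A|lborel. f x) = (LINT x|lebesgue. indicator (box c d) x * f x)"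
      unfolding set_lebesgue_integral_def A
      by (subst integral_completion[symmetric]) auto
    also have "\<dots> = (LINT x|lebesgue. indicator (box c' d') x * h x)"
    proof (rule integral_cong_AE)
      show "AE x in lebesgue. indicator (box c d) x * f x = indicator (box c' d') x * h x"
        using ae' by eventually_elim (auto simp: cd[symmetric] indicator_def split: if_splits)
      have "(\<lambda>x. indicator (box c d) x * (indicator (box a b) x * h x)) \<in> borel_measurable lebesgue"
        by (rule borel_measurable_times[OF borel_measurable_indicator borel_measurable_integrable[OF fi]]) simp
      moreover have "indicator (box c d) x * (indicator (box a b) x * h x) = indicator (box c' d') x * h x" for x
        by (auto simp: cd[symmetric] indicator_def)
      ultimately show "(\<lambda>x. indicator (box c' d') x * h x) \<in> borel_measurable lebesgue" by simp
      show "(\<lambda>x. indicator (box c d) x * f x) \<in> borel_measurable lebesgue"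
        using measurable_completion[OF f] by (intro borel_measurable_times borel_measurable_indicator) auto
    qed
    also have "\<dots> = 0"
    proof (cases "box c' d' = {}")
      case True then show ?thesis by simp
    next
      case False
      have "cbox c' d' \<subseteq> cbox a b"
        using closure_mono[of "box c' d'" "box a b"] closure_box[OF False] cd False
        by (metis Int_lower2 closure_box inf.absorb_iff2 inf_bot_left)
      then show ?thesis using ab by (intro box0) auto
    qed
    finally show ?thesis .
  qed
  have total: "(LINT x|lborel. f x) = 0"
  proof -
    have "(LINT x|lborel. f x) = (LINT x|lebesgue. f x)" by (rule integral_completion[symmetric]) simp
    also have "\<dots> = (LINT x|lebesgue. indicator (box a b) x * h x)"
      by (rule integral_cong_AE) (use ae' fi measurable_completion[OF f] in auto)
    finally show ?thesis using box0[OF ab] by simp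
  qed
  have si: "set_integrable lborel A f" if "A \<in> sets borel" for A
    unfolding set_integrable_def using that fint by (intro integrable_mult_indicator) auto
  have sets: "sets (borel :: 'a measure) = sigma_sets UNIV (range (\<lambda>(c, d). box c d))"
    by (subst borel_eq_box) simp
  \<comment> \<open>Dynkin's argument; the complement case uses that the total integral is zero as
    well.\<close>
  have all0: "(LINT x:A|lborel. f x) = 0" if "A \<in> sigma_sets UNIV (range (\<lambda>(c, d). box c d))" for A
  proof (rule sigma_sets_induct_disjoint[OF _ _ that])
    show "Int_stable (range (\<lambda>(c, d). box c d :: 'a set))"
      unfolding Int_stable_def by (auto simp: box_Int_box)
    show "(LINT x:B|lborel. f x) = 0" if "B \<in> range (\<lambda>(c, d). box c d)" for B by (rule fbox[OF that])
    show "(LINT x:UNIV - B|lborel. f x) = 0"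
      if "B \<in> sigma_sets UNIV (range (\<lambda>(c, d). box c d))" "(LINT x:B|lborel. f x) = 0" for B
    proof -
      have B: "B \<in> sets borel" using that(1) by (simp add: sets)
      have "(LINT x:B \<union> (UNIV - B)|lborel. f x) = (LINT x:B|lborel. f x) + (LINT x:UNIV - B|lborel. f x)"
        using B by (intro set_integral_Un si) auto
      moreover have "B \<union> (UNIV - B) = UNIV" by auto
      ultimately show ?thesis using that(2) total by (simp add: set_lebesgue_integral_def)
    qed
    show "(LINT x:(\<Union>i. B i)|lborel. f x) = 0"
      if B: "disjoint_family B" "range B \<subseteq> sigma_sets UNIV (range (\<lambda>(c, d). box c d))" "\<And>i. (LINT x:B i|lborel. f x) = 0"
      for B :: "nat \<Rightarrow> 'a set"
    proof -
      have m: "B i \<in> sets borel" for i using B(2) sets by auto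
      have "(LINT x:(\<Union>i. B i)|lborel. f x) = (\<Sum>i. (LINT x:B i|lborel. f x))"
        using m B(1) by (intro lebesgue_integral_countable_add si) (auto simp: disjoint_family_on_def)
      then show ?thesis using B(3) by simp
    qed
  qed (auto simp: set_lebesgue_integral_def)
  have "AE x in lborel. f x = 0"
    by (rule sigma_finite_measure.density_zero[OF sigma_finite_lborel fint]) (use all0 sets in auto)
  then have "AE x in lebesgue. f x = 0" by (rule AE_completion)
  with ae' show ?thesis by eventually_elim (auto simp: indicator_def)
qed

text \<open>U is a countable union of closed boxes, whose frontiers are null sets.\<close>

lemma fundamental_lemma:
  fixes h :: "'a::euclidean_space \<Rightarrow> real"
  assumes U: "open U" and h: "locally_integrable U h"
    and zero: "\<And>\<phi>. test_function U \<phi> \<Longrightarrow> (LINT x|lebesgue_on U. h x * \<phi> x) = 0"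
  shows "AE x in lebesgue_on U. h x = 0"
proof -
  obtain \<D> where D: "countable \<D>" "\<D> \<subseteq> Pow U" "\<And>X. X \<in> \<D> \<Longrightarrow> \<exists>a b. X = cbox a b" "\<Union>\<D> = U"
    using open_countable_Union_open_cbox[OF U] by metis
  have one: "AE x in lebesgue. x \<in> X \<longrightarrow> h x = 0" if X: "X \<in> \<D>" for X
  proof -
    obtain a b where ab: "X = cbox a b" using D(3)[OF X] by blast
    have "AE x in lebesgue. x \<in> box a b \<longrightarrow> h x = 0"
      using X D(2) ab by (intro fundamental_lemma_box[OF U _ h zero]) auto
    moreover have "AE x in lebesgue. x \<notin> frontier (cbox a b)"
      using negligible_frontier_interval[of a b] frontier_def[of "cbox a b"]
      by (intro AE_not_in) (simp add: negligible_iff_null_sets[symmetric] interior_cbox)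
    ultimately show ?thesis
      by eventually_elim (auto simp: ab frontier_def interior_cbox)
  qed
  have "AE x in lebesgue. \<forall>X\<in>\<D>. x \<in> X \<longrightarrow> h x = 0"
    using one D(1) by (subst AE_ball_countable) auto
  then have "AE x in lebesgue. x \<in> U \<longrightarrow> h x = 0"
    by eventually_elim (use D(4) in blast)
  then show ?thesis using U by (simp add: AE_restrict_space_iff)
qed

subsection \<open>Weak gradients\<close>

text \<open>Integrability on compact sets gives measurability on each of the countably many closed
  boxes that make up U.\<close>

lemma locally_integrable_measurable:
  fixes f :: "'a::euclidean_space \<Rightarrow> 'b::euclidean_space"
  assumes "open U" "locally_integrable U f"
  shows "f \<in> borel_measurable (lebesgue_on U)"
proof -
  obtain \<D> where D: "countable \<D>" "\<D> \<subseteq> Pow U" "\<And>X. X \<in> \<D> \<Longrightarrow> \<exists>a b. X = cbox a b" "\<Union>\<D> = U"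
    using open_countable_Union_open_cbox[OF assms(1)] by metis
  show ?thesis
  proof (rule measurable_piecewise_restrict[OF D(1)])
    fix X assume X: "X \<in> \<D>"
    then obtain a b where ab: "X = cbox a b" using D(3) by blast
    have XU: "X \<subseteq> U" using X D(2) by auto
    show "X \<inter> space (lebesgue_on U) \<in> sets (lebesgue_on U)"
      using XU ab assms(1) by (auto simp: sets_restrict_space image_iff intro!: bexI[of _ X])
    have "integrable (lebesgue_on X) f"
      using assms(2) ab XU by (auto simp: locally_integrable_def)
    moreover have "restrict_space (lebesgue_on U) X = lebesgue_on X"
      using XU assms(1) ab by (subst restrict_restrict_space) (auto simp: inf.absorb2)
    ultimately show "f \<in> borel_measurable (restrict_space (lebesgue_on U) X)" by auto
  qed (use D(4) in auto)
qed

lemma locally_integrable_mult_test: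
  fixes f :: "'a::euclidean_space \<Rightarrow> 'b::euclidean_space"
  assumes U: "open U" and f: "locally_integrable U f"
    and \<phi>: "continuous_on UNIV \<phi>" "compact K" "K \<subseteq> U" "\<And>x. x \<notin> K \<Longrightarrow> \<phi> x = 0"
  shows "integrable (lebesgue_on U) (\<lambda>x. \<phi> x *\<^sub>R f x)"
proof -
  obtain B where B: "0 < B" "\<And>x. norm (\<phi> x :: real) \<le> B"
    using continuous_compact_support_bounded[OF \<phi>(1,2,4)] by blast
  have K: "K \<in> sets lebesgue" using \<phi>(2) by (auto simp: compact_imp_closed)
  have "integrable (lebesgue_on K) f" using f \<phi> by (auto simp: locally_integrable_def)
  then have i: "integrable lebesgue (\<lambda>x. indicator K x *\<^sub>R f x)"
    using K by (subst (asm) integrable_restrict_space) auto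
  have mm: "\<phi> \<in> borel_measurable lebesgue"
    using \<phi>(1) by (intro measurable_completion) (simp add: borel_measurable_continuous_onI)
  have "integrable lebesgue (\<lambda>x. \<phi> x *\<^sub>R (indicator K x *\<^sub>R f x))"
  proof (rule Bochner_Integration.integrable_bound)
    show "integrable lebesgue (\<lambda>x. B * norm (indicator K x *\<^sub>R f x))"
      by (intro integrable_mult_right integrable_norm i)
    show "(\<lambda>x. \<phi> x *\<^sub>R (indicator K x *\<^sub>R f x)) \<in> borel_measurable lebesgue"
      using mm borel_measurable_integrable[OF i] by (rule borel_measurable_scaleR)
    show "AE x in lebesgue. norm (\<phi> x *\<^sub>R (indicator K x *\<^sub>R f x)) \<le> norm (B * norm (indicator K x *\<^sub>R f x))"
      using B by (intro AE_I2) (auto simp: indicator_def abs_mult intro!: mult_right_mono)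
  qed
  moreover have "\<phi> x *\<^sub>R (indicator K x *\<^sub>R f x) = indicator U x *\<^sub>R (\<phi> x *\<^sub>R f x)" for x
    using \<phi>(3) \<phi>(4)[of x] by (cases "x \<in> K") auto
  ultimately have "integrable lebesgue (\<lambda>x. indicator U x *\<^sub>R (\<phi> x *\<^sub>R f x))" by (simp only:)
  then show ?thesis using U by (subst integrable_restrict_space) auto
qed

lemma locally_integrable_test_integrable:
  fixes f :: "'a::euclidean_space \<Rightarrow> real"
  assumes "open U" "locally_integrable U f" "test_function U \<phi>"
  shows "integrable (lebesgue_on U) (\<lambda>x. f x * \<phi> x)" "integrable (lebesgue_on U) (\<lambda>x. f x * (grad \<phi> x \<bullet> i))"
proof -
  note s = test_function_smooth[OF assms(3)]
  have K: "compact (supp \<phi>)" "supp \<phi> \<subseteq> U" using assms(3) by (auto simp: test_function_def)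
  show "integrable (lebesgue_on U) (\<lambda>x. f x * \<phi> x)"
    using locally_integrable_mult_test[OF assms(1,2) smooth_continuous[OF s] K]
    by (simp add: mult.commute not_in_supp)
  have "continuous_on UNIV (\<lambda>x. grad \<phi> x \<bullet> i)" by (intro continuous_intros smooth_grad_continuous s)
  from locally_integrable_mult_test[OF assms(1,2) this K]
  show "integrable (lebesgue_on U) (\<lambda>x. f x * (grad \<phi> x \<bullet> i))"
    by (simp add: mult.commute grad_not_in_supp)
qed

lemma locally_integrable_inner:
  "locally_integrable U f \<Longrightarrow> locally_integrable U (\<lambda>x. f x \<bullet> i)"
  by (auto simp: locally_integrable_def)

text \<open>Each component of \<open>g - g'\<close> integrates to zero against all test functions,
  so the fundamental lemma applies componentwise.\<close>

lemma weak_gradient_unique: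
  assumes U: "open U" and g: "has_weak_gradient U w g" and g': "has_weak_gradient U w' g'"
    and ae: "AE x in lebesgue_on U. w x = w' x"
  shows "AE x in lebesgue_on U. g x = g' x"
proof -
  have li: "locally_integrable U w" "locally_integrable U w'"
    "locally_integrable U g" "locally_integrable U g'"
    using g g' by (auto simp: has_weak_gradient_def)
  have "AE x in lebesgue_on U. (g x - g' x) \<bullet> i = 0" if i: "i \<in> Basis" for i
  proof (rule fundamental_lemma[OF U])
    show "locally_integrable U (\<lambda>x. (g x - g' x) \<bullet> i)"
      using li by (auto simp: locally_integrable_def)
    fix \<phi> assume \<phi>: "test_function U \<phi>"
    have gi: "integrable (lebesgue_on U) (\<lambda>x. (g x \<bullet> i) * \<phi> x)" "integrable (lebesgue_on U) (\<lambda>x. (g' x \<bullet> i) * \<phi> x)"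
      using locally_integrable_test_integrable[OF U locally_integrable_inner[OF li(3)] \<phi>]
        locally_integrable_test_integrable[OF U locally_integrable_inner[OF li(4)] \<phi>] by auto
    have "(LINT x|lebesgue_on U. ((g x - g' x) \<bullet> i) * \<phi> x) =
        (LINT x|lebesgue_on U. (g x \<bullet> i) * \<phi> x) - (LINT x|lebesgue_on U. (g' x \<bullet> i) * \<phi> x)"
      using gi by (simp add: inner_diff_left left_diff_distrib)
    also have "\<dots> = (LINT x|lebesgue_on U. w' x * (grad \<phi> x \<bullet> i)) - (LINT x|lebesgue_on U. w x * (grad \<phi> x \<bullet> i))"
      using g g' \<phi> i by (simp add: has_weak_gradient_def)
    also have "(LINT x|lebesgue_on U. w' x * (grad \<phi> x \<bullet> i)) = (LINT x|lebesgue_on U. w x * (grad \<phi> x \<bullet> i))"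
    proof (rule integral_cong_AE)
      show "AE x in lebesgue_on U. w' x * (grad \<phi> x \<bullet> i) = w x * (grad \<phi> x \<bullet> i)"
        using ae by eventually_elim simp
    qed (use locally_integrable_test_integrable[OF U li(1) \<phi>] locally_integrable_test_integrable[OF U li(2) \<phi>] in auto)
    finally show "(LINT x|lebesgue_on U. ((g x - g' x) \<bullet> i) * \<phi> x) = 0" by simp
  qed
  then have "AE x in lebesgue_on U. \<forall>i\<in>Basis. (g x - g' x) \<bullet> i = 0"
    by (subst AE_finite_all) auto
  then show ?thesis
    by eventually_elim (auto intro: euclidean_eqI simp: inner_diff_left)
qed

section \<open>Pairs of a value and a gradient\<close>

lemma L2_Pair:
  fixes f :: "'a \<Rightarrow> 'b::euclidean_space" and g :: "'a \<Rightarrow> 'c::euclidean_space"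
  assumes "f \<in> L2 M" "g \<in> L2 M"
  shows "(\<lambda>x. (f x, g x)) \<in> L2 M"
  using assms by (auto simp: L2_def norm_Pair)

lemma norm_fst_snd_le: "norm (fst p) \<le> norm p" "norm (snd p) \<le> norm p"
  using norm_fst_le[of "fst p" "snd p"] norm_snd_le[of "snd p" "fst p"] by auto

lemma L2_fst:
  fixes F :: "'a \<Rightarrow> 'b::euclidean_space \<times> 'c::euclidean_space"
  assumes "F \<in> L2 M" shows "(\<lambda>x. fst (F x)) \<in> L2 M"
  by (rule L2_dominated[OF _ L2_integrable_norm[OF assms]])
    (auto intro!: power_mono norm_fst_snd_le AE_I2
      borel_measurable_continuous_on[OF continuous_on_fst[OF continuous_on_id] L2_measurable[OF assms]])

lemma L2_snd:
  fixes F :: "'a \<Rightarrow> 'b::euclidean_space \<times> 'c::euclidean_space"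
  assumes "F \<in> L2 M" shows "(\<lambda>x. snd (F x)) \<in> L2 M"
  by (rule L2_dominated[OF _ L2_integrable_norm[OF assms]])
    (auto intro!: power_mono norm_fst_snd_le AE_I2
      borel_measurable_continuous_on[OF continuous_on_snd[OF continuous_on_id] L2_measurable[OF assms]])

lemma nrm_Pair:
  fixes f :: "'a \<Rightarrow> 'b::euclidean_space" and g :: "'a \<Rightarrow> 'c::euclidean_space"
  assumes "f \<in> L2 M" "g \<in> L2 M"
  shows "(nrm M (\<lambda>x. (f x, g x)))\<^sup>2 = (nrm M f)\<^sup>2 + (nrm M g)\<^sup>2"
  using assms by (auto simp: nrm_eq_LINT L2_def norm_Pair)

lemma nrm_fst_le:
  assumes "F \<in> L2 M" shows "nrm M (\<lambda>x. fst (F x)) \<le> nrm M F"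
  by (rule nrm_mono[OF L2_measurable[OF L2_fst[OF assms]] assms]) (simp add: norm_fst_snd_le)

lemma nrm_snd_le:
  assumes "F \<in> L2 M" shows "nrm M (\<lambda>x. snd (F x)) \<le> nrm M F"
  by (rule nrm_mono[OF L2_measurable[OF L2_snd[OF assms]] assms]) (simp add: norm_fst_snd_le)

text \<open>Storing value and gradient in one vector makes the weighted H1 norm an L2 norm, so that
  completeness and limits in H1 are inherited from L2. \<open>cjet\<close> uses the classical
  gradient, \<open>wjet\<close> the weak one.\<close>

definition cjet :: "('a::euclidean_space \<Rightarrow> real) \<Rightarrow> 'a \<Rightarrow> real \<times> 'a" where
  "cjet \<psi> x = (\<psi> x, grad \<psi> x)"

definition wjet :: "'a::euclidean_space set \<Rightarrow> ('a \<Rightarrow> real) \<Rightarrow> 'a \<Rightarrow> real \<times> 'a" where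
  "wjet U w x = (w x, weak_grad U w x)"

subsection \<open>Closed subspaces of weighted Sobolev spaces\<close>

text \<open>Used three times: \<Omega> with weight 1, the interval (0,Y) with the weight in y, and
  the cylinder. A continuous positive weight is bounded below on compact subsets of U, which is what
  links weighted L2 to weak derivatives; it may degenerate or blow up at the boundary.\<close>

locale weighted_domain =
  fixes \<rho> :: "'a::euclidean_space \<Rightarrow> real" and U :: "'a set"
  assumes open_U: "open U" and bounded_U: "bounded U"
    and cont_\<rho>: "continuous_on U \<rho>" and pos_\<rho>: "\<And>x. x \<in> U \<Longrightarrow> 0 < \<rho> x"
    and int_\<rho>: "integrable (lebesgue_on U) \<rho>"
begin

abbreviation "M \<equiv> weighted \<rho> U"

lemma U_sets: "U \<in> sets lebesgue" "U \<in> sets borel"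
  using open_U by auto

lemma meas_\<rho> [measurable]: "\<rho> \<in> borel_measurable (lebesgue_on U)"
  using int_\<rho> by auto

lemma sets_M: "sets M = sets (lebesgue_on U)"
  by (simp add: weighted_def)

lemma space_M: "space M = U"
  by (simp add: weighted_def)

lemma meas_M: "borel_measurable M = borel_measurable (lebesgue_on U)"
  by (rule measurable_cong_sets[OF sets_M refl])

lemma AE_M: "(AE x in M. P x) \<longleftrightarrow> (AE x in lebesgue_on U. P x)"
proof -
  have "(AE x in M. P x) \<longleftrightarrow> (AE x in lebesgue_on U. 0 < ennreal (\<rho> x) \<longrightarrow> P x)"
    unfolding weighted_def by (rule AE_density) simp
  also have "\<dots> \<longleftrightarrow> (AE x in lebesgue_on U. P x)"
    by (intro AE_cong) (auto simp: pos_\<rho>)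
  finally show ?thesis .
qed

lemma LINT_M:
  fixes f :: "'a \<Rightarrow> 'b::euclidean_space"
  assumes "f \<in> borel_measurable (lebesgue_on U)"
  shows "(LINT x|M. f x) = (LINT x|lebesgue_on U. \<rho> x *\<^sub>R f x)"
  unfolding weighted_def
  by (rule integral_density) (use assms pos_\<rho> in \<open>auto intro!: AE_I2 less_imp_le\<close>)

lemma integrable_M:
  fixes f :: "'a \<Rightarrow> 'b::euclidean_space"
  assumes "f \<in> borel_measurable (lebesgue_on U)"
  shows "integrable M f \<longleftrightarrow> integrable (lebesgue_on U) (\<lambda>x. \<rho> x *\<^sub>R f x)"
  unfolding weighted_def
  by (rule integrable_density) (use assms pos_\<rho> in \<open>auto intro!: AE_I2 less_imp_le\<close>)

lemma finite_M: "finite_measure M"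
proof
  have "emeasure M (space M) = (\<integral>\<^sup>+x. ennreal (\<rho> x) \<partial>lebesgue_on U)"
    unfolding weighted_def by (subst emeasure_density) (auto intro!: nn_integral_cong)
  also have "\<dots> = (\<integral>\<^sup>+x. ennreal (norm (\<rho> x)) \<partial>lebesgue_on U)"
    by (rule nn_integral_cong) (use pos_\<rho> in \<open>auto simp: less_imp_le\<close>)
  also have "\<dots> < \<infinity>" using int_\<rho> by (simp add: integrable_iff_bounded)
  finally show "emeasure M (space M) \<noteq> \<infinity>" by simp
qed

lemma bounded_L2:
  assumes "f \<in> borel_measurable (lebesgue_on U)" "\<And>x. x \<in> U \<Longrightarrow> norm (f x) \<le> B"
  shows "f \<in> L2 M"
proof (rule L2_dominated)
  show "f \<in> borel_measurable M" using assms(1) by (simp add: meas_M)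
  show "integrable M (\<lambda>_. B\<^sup>2)"
    using finite_M by (rule finite_measure.integrable_const)
  show "AE x in M. (norm (f x))\<^sup>2 \<le> B\<^sup>2"
    using assms(2) by (intro AE_I2) (auto simp: space_M intro: power_mono)
qed

lemma continuous_measurable:
  fixes f :: "'a \<Rightarrow> 'b::euclidean_space"
  assumes "continuous_on U f"
  shows "f \<in> borel_measurable (lebesgue_on U)"
  by (rule continuous_imp_measurable_on_sets_lebesgue[OF assms U_sets(1)])

lemma continuous_closure_L2:
  fixes f :: "'a \<Rightarrow> 'b::euclidean_space"
  assumes "continuous_on (closure U) f"
  shows "f \<in> L2 M"
proof -
  have "compact (closure U)" using bounded_U by simp
  then have "bounded (f ` closure U)"
    using assms compact_continuous_image compact_imp_bounded by blast
  then obtain B where "\<And>x. x \<in> closure U \<Longrightarrow> norm (f x) \<le> B" by (auto simp: bounded_iff)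
  then show ?thesis
    using closure_subset[of U] continuous_on_subset[OF assms closure_subset]
    by (intro bounded_L2 continuous_measurable) auto
qed

lemma smooth_L2: "smooth \<psi> \<Longrightarrow> \<psi> \<in> L2 M"
  by (rule continuous_closure_L2[OF smooth_continuous])

lemma smooth_grad_L2: "smooth \<psi> \<Longrightarrow> grad \<psi> \<in> L2 M"
  by (rule continuous_closure_L2[OF smooth_grad_continuous])

lemma cjet_L2: "smooth \<psi> \<Longrightarrow> cjet \<psi> \<in> L2 M"
  unfolding cjet_def[abs_def] by (intro L2_Pair smooth_L2 smooth_grad_L2)

lemma indicator_measurable:
  fixes f :: "'a \<Rightarrow> 'b::euclidean_space"
  shows "f \<in> borel_measurable (lebesgue_on U) \<Longrightarrow> (\<lambda>x. indicator U x *\<^sub>R f x) \<in> borel_measurable lebesgue"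
  using U_sets(1) by (subst borel_measurable_restrict_space_iff[symmetric]) auto

text \<open>On a compact subset of U the weight has a positive minimum c, and there norm f is at
  most 1 plus \<open>\<rho> * (norm f)^2 / c\<close>.\<close>

lemma L2_locally_integrable:
  fixes f :: "'a \<Rightarrow> 'b::euclidean_space"
  assumes f: "f \<in> L2 M"
  shows "locally_integrable U f"
  unfolding locally_integrable_def
proof (intro allI impI)
  fix K assume K: "compact K \<and> K \<subseteq> U"
  have Ks: "K \<in> sets lebesgue" using K by (auto simp: compact_imp_closed)
  have fm: "f \<in> borel_measurable (lebesgue_on U)" using L2_measurable[OF f] by (simp add: meas_M)
  obtain c where c: "0 < c" "\<And>x. x \<in> K \<Longrightarrow> c \<le> \<rho> x"
  proof (cases "K = {}")
    case True then show ?thesis using that[of 1] by auto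
  next
    case False
    then obtain x where "x \<in> K" "\<And>y. y \<in> K \<Longrightarrow> \<rho> x \<le> \<rho> y"
      using continuous_attains_inf[of K \<rho>] K continuous_on_subset[OF cont_\<rho>] by auto
    then show ?thesis using that[of "\<rho> x"] pos_\<rho> K by auto
  qed
  have "integrable M (\<lambda>x. (norm (f x))\<^sup>2)" using f by (rule L2_integrable_norm)
  then have "integrable (lebesgue_on U) (\<lambda>x. \<rho> x * (norm (f x))\<^sup>2)"
    using fm by (subst (asm) integrable_M) auto
  then have i: "integrable lebesgue (\<lambda>x. indicator U x * (\<rho> x * (norm (f x))\<^sup>2))"
    using U_sets by (subst (asm) integrable_restrict_space) auto
  have "integrable lebesgue (\<lambda>x. indicator K x *\<^sub>R f x)"
  proof (rule Bochner_Integration.integrable_bound)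
    show "integrable lebesgue (\<lambda>x. indicator K x + (indicator U x * (\<rho> x * (norm (f x))\<^sup>2)) / c)"
      using K i emeasure_compact_finite[of K] by (intro Bochner_Integration.integrable_add integrable_divide_zero integrable_real_indicator Ks)
        (auto simp: compact_imp_closed)
    have "(\<lambda>x. indicator K x *\<^sub>R (indicator U x *\<^sub>R f x)) \<in> borel_measurable lebesgue"
      using Ks by (intro borel_measurable_scaleR borel_measurable_indicator indicator_measurable fm)
    moreover have "indicator K x *\<^sub>R (indicator U x *\<^sub>R f x) = indicator K x *\<^sub>R f x" for x
      using K by (auto simp: indicator_def)
    ultimately show "(\<lambda>x. indicator K x *\<^sub>R f x) \<in> borel_measurable lebesgue" by (simp only:)
    have "norm (f x) \<le> 1 + \<rho> x * (norm (f x))\<^sup>2 / c" if "x \<in> K" for x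
    proof -
      have "norm (f x) \<le> 1 + (norm (f x))\<^sup>2"
        using sum_squares_bound[of 1 "norm (f x)"] norm_ge_zero[of "f x"] by (simp del: norm_ge_zero)
      also have "(norm (f x))\<^sup>2 \<le> \<rho> x * (norm (f x))\<^sup>2 / c"
        using c(1) c(2)[OF that] by (simp add: pos_le_divide_eq mult_right_mono mult.commute)
      finally show ?thesis by simp
    qed
    moreover have "0 \<le> indicator U x * (\<rho> x * (norm (f x))\<^sup>2) / c" for x
      using c(1) pos_\<rho>[of x] by (auto simp: indicator_def)
    ultimately show "AE x in lebesgue. norm (indicator K x *\<^sub>R f x) \<le>
        norm (indicator K x + (indicator U x * (\<rho> x * (norm (f x))\<^sup>2)) / c)"
      using K by (intro AE_I2) (force simp: indicator_def)
  qed
  then show "integrable (lebesgue_on K) f"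
    using Ks by (subst integrable_restrict_space) auto
qed

text \<open>Dividing by the weight turns the unweighted pairing with a test function into an inner
  product of the weighted space, which is continuous under weighted convergence.\<close>

lemma test_div_weight_L2:
  fixes \<phi> :: "'a \<Rightarrow> real"
  assumes "continuous_on UNIV \<phi>" "compact K" "K \<subseteq> U" "\<And>x. x \<notin> K \<Longrightarrow> \<phi> x = 0"
  shows "(\<lambda>x. \<phi> x / \<rho> x) \<in> L2 M"
proof -
  have c: "continuous_on U (\<lambda>x. \<phi> x / \<rho> x)"
    using continuous_on_subset[OF assms(1)] cont_\<rho> pos_\<rho> by (intro continuous_intros) force+
  have "bounded ((\<lambda>x. \<phi> x / \<rho> x) ` K)"
    using continuous_on_subset[OF c assms(3)] assms(2) compact_continuous_image compact_imp_bounded by blast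
  then obtain B where B: "\<And>x. x \<in> K \<Longrightarrow> norm (\<phi> x / \<rho> x) \<le> B" by (auto simp: bounded_iff)
  have "norm (\<phi> x / \<rho> x) \<le> max B 0" for x
    using B[of x] assms(4)[of x] by (cases "x \<in> K") auto
  then show ?thesis by (intro bounded_L2 continuous_measurable c) auto
qed

lemma LINT_test_eq_ip:
  fixes \<phi> :: "'a \<Rightarrow> real"
  assumes "f \<in> L2 M" "continuous_on UNIV \<phi>"
  shows "(LINT x|lebesgue_on U. f x * \<phi> x) = ip M f (\<lambda>x. \<phi> x / \<rho> x)"
proof -
  have fm: "f \<in> borel_measurable (lebesgue_on U)" using L2_measurable[OF assms(1)] by (simp add: meas_M)
  have pm: "\<phi> \<in> borel_measurable (lebesgue_on U)"
    using assms(2) by (intro continuous_measurable continuous_on_subset[OF assms(2)]) auto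
  have "ip M f (\<lambda>x. \<phi> x / \<rho> x) = (LINT x|lebesgue_on U. \<rho> x *\<^sub>R (f x * (\<phi> x / \<rho> x)))"
    unfolding ip_def inner_real_def using fm pm by (subst LINT_M) auto
  also have "\<dots> = (LINT x|lebesgue_on U. f x * \<phi> x)"
    by (rule Bochner_Integration.integral_cong) (use pos_\<rho> in \<open>auto dest: less_imp_neq[OF pos_\<rho>, THEN not_sym]\<close>)
  finally show ?thesis by simp
qed

text \<open>Weak differentiation is a closed relation: both sides of the defining identity are
  weighted inner products against a fixed function, hence pass to the limit.\<close>

lemma has_weak_gradient_limit:
  assumes wg: "\<And>n. has_weak_gradient U (w n) (g n)"
    and L2: "\<And>n. w n \<in> L2 M" "\<And>n. g n \<in> L2 M" "w' \<in> L2 M" "g' \<in> L2 M"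
    and lim: "(\<lambda>n. nrm M (\<lambda>x. w n x - w' x)) \<longlonglongrightarrow> 0" "(\<lambda>n. nrm M (\<lambda>x. g n x - g' x)) \<longlonglongrightarrow> 0"
  shows "has_weak_gradient U w' g'"
  unfolding has_weak_gradient_def
proof (intro conjI allI impI ballI L2_locally_integrable L2)
  fix \<phi> and i :: 'a assume \<phi>: "test_function U \<phi>" and i: "i \<in> Basis"
  note s = test_function_smooth[OF \<phi>]
  have K: "compact (supp \<phi>)" "supp \<phi> \<subseteq> U" using \<phi> by (auto simp: test_function_def)
  have c: "continuous_on UNIV \<phi>" "continuous_on UNIV (\<lambda>x. grad \<phi> x \<bullet> i)"
    by (intro continuous_intros smooth_continuous smooth_grad_continuous s)+
  have t: "(\<lambda>x. \<phi> x / \<rho> x) \<in> L2 M" "(\<lambda>x. (grad \<phi> x \<bullet> i) / \<rho> x) \<in> L2 M"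
    by (rule test_div_weight_L2[OF c(1) K], simp add: not_in_supp)
      (rule test_div_weight_L2[OF c(2) K], simp add: grad_not_in_supp)
  have gi: "(\<lambda>x. h x \<bullet> i) \<in> L2 M" if "h \<in> L2 M" for h :: "'a \<Rightarrow> 'a"
    by (rule L2_dominated[OF _ L2_integrable_norm[OF that]])
      (use L2_measurable[OF that] i in \<open>auto simp: Basis_le_norm abs_le_square_iff[symmetric]\<close>)
  have gl: "(\<lambda>n. nrm M (\<lambda>x. (g n x \<bullet> i) - (g' x \<bullet> i))) \<longlonglongrightarrow> 0"
  proof (rule lim0_squeeze[OF _ lim(2)])
    show "\<bar>nrm M (\<lambda>x. g n x \<bullet> i - g' x \<bullet> i)\<bar> \<le> nrm M (\<lambda>x. g n x - g' x)" for n
      using i L2_measurable[OF L2_diff[OF gi[OF L2(2)] gi[OF L2(4)]], of n]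
      by (auto intro!: nrm_mono L2_diff L2 simp: Basis_le_norm inner_diff_left[symmetric])
  qed
  have "(\<lambda>n. ip M (w n) (\<lambda>x. (grad \<phi> x \<bullet> i) / \<rho> x)) \<longlonglongrightarrow> ip M w' (\<lambda>x. (grad \<phi> x \<bullet> i) / \<rho> x)"
    by (rule ip_tendsto[OF L2(1,3) t(2) lim(1)])
  moreover have "(\<lambda>n. - ip M (\<lambda>x. g n x \<bullet> i) (\<lambda>x. \<phi> x / \<rho> x)) \<longlonglongrightarrow> - ip M (\<lambda>x. g' x \<bullet> i) (\<lambda>x. \<phi> x / \<rho> x)"
    by (intro tendsto_minus ip_tendsto[OF gi[OF L2(2)] gi[OF L2(4)] t(1) gl])
  moreover have "ip M (w n) (\<lambda>x. (grad \<phi> x \<bullet> i) / \<rho> x) = - ip M (\<lambda>x. g n x \<bullet> i) (\<lambda>x. \<phi> x / \<rho> x)" for n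
    using wg[of n] \<phi> i
    by (simp add: has_weak_gradient_def LINT_test_eq_ip[OF L2(1) c(2), symmetric]
        LINT_test_eq_ip[OF gi[OF L2(2)] c(1), symmetric])
  ultimately have "ip M w' (\<lambda>x. (grad \<phi> x \<bullet> i) / \<rho> x) = - ip M (\<lambda>x. g' x \<bullet> i) (\<lambda>x. \<phi> x / \<rho> x)"
    using LIMSEQ_unique by simp
  then show "(LINT x|lebesgue_on U. w' x * (grad \<phi> x \<bullet> i)) = - (LINT x|lebesgue_on U. (g' x \<bullet> i) * \<phi> x)"
    by (simp add: LINT_test_eq_ip[OF L2(3) c(2)] LINT_test_eq_ip[OF gi[OF L2(4)] c(1)])
qed

lemma smooth_has_weak_gradient:
  assumes "smooth \<psi>" shows "has_weak_gradient U \<psi> (grad \<psi>)"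
  unfolding has_weak_gradient_def
  by (auto intro!: L2_locally_integrable smooth_L2 smooth_grad_L2 assms integration_by_parts_test[OF open_U assms])

lemma weak_grad_eq:
  assumes "has_weak_gradient U w g"
  shows "has_weak_gradient U w (weak_grad U w)" "AE x in M. weak_grad U w x = g x"
    "weak_grad U w \<in> borel_measurable M"
proof -
  show 1: "has_weak_gradient U w (weak_grad U w)"
    unfolding weak_grad_def using assms by (rule someI[of "\<lambda>g. has_weak_gradient U w g"])
  show "AE x in M. weak_grad U w x = g x"
    unfolding AE_M by (rule weak_gradient_unique[OF open_U 1 assms]) simp
  show "weak_grad U w \<in> borel_measurable M"
    unfolding meas_M using 1
    by (intro locally_integrable_measurable open_U) (auto simp: has_weak_gradient_def)
qed

lemma weak_grad_smooth: "smooth \<psi> \<Longrightarrow> AE x in M. weak_grad U \<psi> x = grad \<psi> x"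
  by (rule weak_grad_eq[OF smooth_has_weak_gradient])

lemma H1D:
  assumes "w \<in> H1 \<rho> U"
  shows "w \<in> L2 M" "weak_grad U w \<in> L2 M" "has_weak_gradient U w (weak_grad U w)" "wjet U w \<in> L2 M"
proof -
  show 1: "w \<in> L2 M" using assms by (simp add: H1_def)
  obtain g where g: "g \<in> L2 M" "has_weak_gradient U w g" using assms by (auto simp: H1_def)
  show "has_weak_gradient U w (weak_grad U w)" by (rule weak_grad_eq[OF g(2)])
  show 2: "weak_grad U w \<in> L2 M"
    using weak_grad_eq(2)[OF g(2)]
    by (intro L2_AE_cong[OF g(1) weak_grad_eq(3)[OF g(2)]]) (auto elim: eventually_mono)
  show "wjet U w \<in> L2 M" unfolding wjet_def[abs_def] by (rule L2_Pair[OF 1 2])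
qed

lemma H1_approx_iff:
  assumes w: "w \<in> H1 \<rho> U"
  shows "H1_approx \<rho> U \<psi> w \<longleftrightarrow>
    (\<forall>k. smooth (\<psi> k)) \<and> (\<lambda>k. nrm M (\<lambda>x. cjet (\<psi> k) x - wjet U w x)) \<longlonglongrightarrow> 0"
proof -
  have eq: "(LINT x|M. (\<psi> k x - w x)\<^sup>2 + (norm (grad (\<psi> k) x - weak_grad U w x))\<^sup>2)
      = (nrm M (\<lambda>x. cjet (\<psi> k) x - wjet U w x))\<^sup>2" for k
    unfolding nrm_eq_LINT by (simp add: cjet_def wjet_def norm_Pair)
  have "(\<lambda>k. (nrm M (\<lambda>x. cjet (\<psi> k) x - wjet U w x))\<^sup>2) \<longlonglongrightarrow> 0 \<longleftrightarrow>
      (\<lambda>k. nrm M (\<lambda>x. cjet (\<psi> k) x - wjet U w x)) \<longlonglongrightarrow> 0"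
  proof
    assume "(\<lambda>k. (nrm M (\<lambda>x. cjet (\<psi> k) x - wjet U w x))\<^sup>2) \<longlonglongrightarrow> 0"
    from tendsto_real_sqrt[OF this] show "(\<lambda>k. nrm M (\<lambda>x. cjet (\<psi> k) x - wjet U w x)) \<longlonglongrightarrow> 0" by simp
  next
    assume "(\<lambda>k. nrm M (\<lambda>x. cjet (\<psi> k) x - wjet U w x)) \<longlonglongrightarrow> 0"
    from tendsto_power[OF this, of 2] show "(\<lambda>k. (nrm M (\<lambda>x. cjet (\<psi> k) x - wjet U w x))\<^sup>2) \<longlonglongrightarrow> 0" by simp
  qed
  then show ?thesis
    unfolding H1_approx_def eq using smooth_L2 smooth_grad_L2 by blast
qed

text \<open>The approximating class D is a parameter so that \<open>H10\<close> (test functions) and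
  \<open>H1L\<close> (functions vanishing near the Dirichlet part) share one theory.\<close>

definition Hcl :: "(('a \<Rightarrow> real) \<Rightarrow> bool) \<Rightarrow> ('a \<Rightarrow> real) set" where
  "Hcl D = {w \<in> H1 \<rho> U. \<exists>\<psi>. (\<forall>k. D (\<psi> k)) \<and> H1_approx \<rho> U \<psi> w}"

lemma Hcl_H1: "w \<in> Hcl D \<Longrightarrow> w \<in> H1 \<rho> U"
  by (simp add: Hcl_def)

lemmas Hcl_L2 = H1D[OF Hcl_H1]

lemma Hcl_approx:
  assumes "w \<in> Hcl D"
  obtains \<psi> where "\<And>k. smooth (\<psi> k)" "\<And>k. D (\<psi> k)" "(\<lambda>k. nrm M (\<lambda>x. cjet (\<psi> k) x - wjet U w x)) \<longlonglongrightarrow> 0"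
  using assms H1_approx_iff[OF Hcl_H1[OF assms]] by (auto simp: Hcl_def)

text \<open>The tool for membership: w is not assumed weakly differentiable; convergence of the jets
  identifies the limit g of the gradients as its weak gradient.\<close>

lemma Hcl_smooth_limit:
  assumes \<psi>: "\<And>n. smooth (\<psi> n)" "\<And>n. D (\<psi> n)" and L2: "w \<in> L2 M" "g \<in> L2 M"
    and lim: "(\<lambda>n. nrm M (\<lambda>x. cjet (\<psi> n) x - (w x, g x))) \<longlonglongrightarrow> 0"
  shows "w \<in> Hcl D" "AE x in M. weak_grad U w x = g x"
    "(\<lambda>n. nrm M (\<lambda>x. cjet (\<psi> n) x - wjet U w x)) \<longlonglongrightarrow> 0"
proof -
  have d: "(\<lambda>x. cjet (\<psi> n) x - (w x, g x)) \<in> L2 M" for n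
    by (intro L2_diff cjet_L2 \<psi> L2_Pair L2)
  have l1: "(\<lambda>n. nrm M (\<lambda>x. \<psi> n x - w x)) \<longlonglongrightarrow> 0"
    by (rule lim0_squeeze[OF _ lim]) (use nrm_fst_le[OF d] in \<open>simp add: cjet_def\<close>)
  have l2: "(\<lambda>n. nrm M (\<lambda>x. grad (\<psi> n) x - g x)) \<longlonglongrightarrow> 0"
    by (rule lim0_squeeze[OF _ lim]) (use nrm_snd_le[OF d] in \<open>simp add: cjet_def\<close>)
  have wg: "has_weak_gradient U w g"
    by (rule has_weak_gradient_limit[OF smooth_has_weak_gradient[OF \<psi>(1)] smooth_L2[OF \<psi>(1)]
          smooth_grad_L2[OF \<psi>(1)] L2 l1 l2])
  then have H1: "w \<in> H1 \<rho> U" using L2 by (auto simp: H1_def)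
  show ae: "AE x in M. weak_grad U w x = g x" by (rule weak_grad_eq[OF wg])
  have eq: "nrm M (\<lambda>x. cjet (\<psi> n) x - wjet U w x) = nrm M (\<lambda>x. cjet (\<psi> n) x - (w x, g x))" for n
    by (rule nrm_cong_AE[OF L2_measurable[OF L2_diff[OF cjet_L2[OF \<psi>(1)] H1D(4)[OF H1]]] L2_measurable[OF d]])
      (use ae in \<open>auto elim: eventually_mono simp: wjet_def\<close>)
  with lim show l: "(\<lambda>n. nrm M (\<lambda>x. cjet (\<psi> n) x - wjet U w x)) \<longlonglongrightarrow> 0" by simp
  show "w \<in> Hcl D"
    unfolding Hcl_def using H1 H1_approx_iff[OF H1, of \<psi>] \<psi> l by auto
qed

lemma Hcl_limit:
  assumes w: "\<And>n. w n \<in> Hcl D" and L2: "w' \<in> L2 M" "g' \<in> L2 M"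
    and lim: "(\<lambda>n. nrm M (\<lambda>x. wjet U (w n) x - (w' x, g' x))) \<longlonglongrightarrow> 0"
  shows "w' \<in> Hcl D" "AE x in M. weak_grad U w' x = g' x"
proof -
  \<comment> \<open>Diagonal choice: one smooth approximant of \<open>w n\<close> with error below
    1/(n+1).\<close>
  have "\<exists>\<psi>. smooth \<psi> \<and> D \<psi> \<and> nrm M (\<lambda>x. cjet \<psi> x - wjet U (w n) x) < inverse (real (Suc n))" for n
  proof -
    obtain \<psi> where p: "\<And>k. smooth (\<psi> k)" "\<And>k. D (\<psi> k)" "(\<lambda>k. nrm M (\<lambda>x. cjet (\<psi> k) x - wjet U (w n) x)) \<longlonglongrightarrow> 0"
      using Hcl_approx[OF w[of n]] by blast
    from order_tendstoD(2)[OF p(3), of "inverse (real (Suc n))"]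
    obtain k where "nrm M (\<lambda>x. cjet (\<psi> k) x - wjet U (w n) x) < inverse (real (Suc n))"
      by (auto simp: eventually_sequentially)
    with p show ?thesis by blast
  qed
  then obtain \<psi> where p: "\<And>n. smooth (\<psi> n)" "\<And>n. D (\<psi> n)"
    "\<And>n. nrm M (\<lambda>x. cjet (\<psi> n) x - wjet U (w n) x) < inverse (real (Suc n))" by metis
  have l: "(\<lambda>n. nrm M (\<lambda>x. cjet (\<psi> n) x - (w' x, g' x))) \<longlonglongrightarrow> 0"
  proof (rule lim0_squeeze)
    show "\<bar>nrm M (\<lambda>x. cjet (\<psi> n) x - (w' x, g' x))\<bar>
        \<le> inverse (real (Suc n)) + nrm M (\<lambda>x. wjet U (w n) x - (w' x, g' x))" for n
      using nrm_triangle_diff[OF cjet_L2[OF p(1)] Hcl_L2(4)[OF w] L2_Pair[OF L2], of n n] p(3)[of n] by simp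
    show "(\<lambda>n. inverse (real (Suc n)) + nrm M (\<lambda>x. wjet U (w n) x - (w' x, g' x))) \<longlonglongrightarrow> 0"
      using tendsto_add[OF LIMSEQ_inverse_real_of_nat lim] by simp
  qed
  show "w' \<in> Hcl D" "AE x in M. weak_grad U w' x = g' x"
    by (rule Hcl_smooth_limit[where D = D and \<psi> = \<psi> and w = w' and g = g', OF p(1,2) L2 l])+
qed

lemma Hcl_smooth:
  assumes "smooth \<psi>" "D \<psi>" shows "\<psi> \<in> Hcl D"
  by (rule Hcl_smooth_limit[of "\<lambda>_. \<psi>" D \<psi> "grad \<psi>"])
    (auto simp: assms smooth_L2 smooth_grad_L2 cjet_def[abs_def] nrm_def ip_def zero_prod_def[symmetric])

lemma Hcl_AE_cong:
  assumes w: "w \<in> Hcl D" and "w' \<in> borel_measurable M" "AE x in M. w x = w' x"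
  shows "w' \<in> Hcl D" "AE x in M. weak_grad U w' x = weak_grad U w x"
proof -
  have w': "w' \<in> L2 M" by (rule L2_AE_cong[OF Hcl_L2(1)[OF w] assms(2,3)])
  have "nrm M (\<lambda>x. wjet U w x - (w' x, weak_grad U w x)) = nrm M (\<lambda>x. 0 :: real \<times> 'a)"
    by (rule nrm_cong_AE[OF L2_measurable[OF L2_diff[OF Hcl_L2(4)[OF w] L2_Pair[OF w' Hcl_L2(2)[OF w]]]]])
      (use assms(3) in \<open>auto elim: eventually_mono simp: wjet_def zero_prod_def\<close>)
  also have "\<dots> = 0" by (simp add: nrm_def ip_def)
  finally have "(\<lambda>n::nat. nrm M (\<lambda>x. wjet U w x - (w' x, weak_grad U w x))) \<longlonglongrightarrow> 0" by simp
  from Hcl_limit[OF w w' Hcl_L2(2)[OF w] this]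
  show "w' \<in> Hcl D" "AE x in M. weak_grad U w' x = weak_grad U w x" by auto
qed

definition lin :: "(('a \<Rightarrow> real) \<Rightarrow> bool) \<Rightarrow> bool" where
  "lin D \<longleftrightarrow> (\<forall>f g. D f \<longrightarrow> D g \<longrightarrow> D (\<lambda>x. f x + g x)) \<and> (\<forall>c f. D f \<longrightarrow> D (\<lambda>x. c * f x)) \<and> D (\<lambda>_. 0)"

lemma Hcl_add:
  assumes D: "lin D" and u: "u \<in> Hcl D" and w: "w \<in> Hcl D"
  shows "(\<lambda>x. u x + w x) \<in> Hcl D" "AE x in M. weak_grad U (\<lambda>x. u x + w x) x = weak_grad U u x + weak_grad U w x"
proof -
  obtain \<psi> where p: "\<And>k. smooth (\<psi> k)" "\<And>k. D (\<psi> k)" "(\<lambda>k. nrm M (\<lambda>x. cjet (\<psi> k) x - wjet U u x)) \<longlonglongrightarrow> 0"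
    using Hcl_approx[OF u] by blast
  obtain \<eta> where q: "\<And>k. smooth (\<eta> k)" "\<And>k. D (\<eta> k)" "(\<lambda>k. nrm M (\<lambda>x. cjet (\<eta> k) x - wjet U w x)) \<longlonglongrightarrow> 0"
    using Hcl_approx[OF w] by blast
  have "(\<lambda>k. nrm M (\<lambda>x. (cjet (\<psi> k) x + cjet (\<eta> k) x) - (wjet U u x + wjet U w x))) \<longlonglongrightarrow> 0"
    by (rule nrm_lim_add[OF cjet_L2[OF p(1)] cjet_L2[OF q(1)] Hcl_L2(4)[OF u] Hcl_L2(4)[OF w] p(3) q(3)])
  then have l: "(\<lambda>k. nrm M (\<lambda>x. cjet (\<lambda>x. \<psi> k x + \<eta> k x) x - (u x + w x, weak_grad U u x + weak_grad U w x))) \<longlonglongrightarrow> 0"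
    by (simp add: cjet_def wjet_def grad_add p q)
  have "smooth (\<lambda>x. \<psi> k x + \<eta> k x)" "D (\<lambda>x. \<psi> k x + \<eta> k x)" for k
    using p q D by (auto intro: smooth_add simp: lin_def)
  from Hcl_smooth_limit[where D = D and \<psi> = "\<lambda>k x. \<psi> k x + \<eta> k x" and w = "\<lambda>x. u x + w x"
      and g = "\<lambda>x. weak_grad U u x + weak_grad U w x",
      OF this L2_add[OF Hcl_L2(1)[OF u] Hcl_L2(1)[OF w]] L2_add[OF Hcl_L2(2)[OF u] Hcl_L2(2)[OF w]] l]
  show "(\<lambda>x. u x + w x) \<in> Hcl D" "AE x in M. weak_grad U (\<lambda>x. u x + w x) x = weak_grad U u x + weak_grad U w x"
    by auto
qed

lemma Hcl_cmult:
  assumes D: "lin D" and u: "u \<in> Hcl D"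
  shows "(\<lambda>x. c * u x) \<in> Hcl D" "AE x in M. weak_grad U (\<lambda>x. c * u x) x = c *\<^sub>R weak_grad U u x"
proof -
  obtain \<psi> where p: "\<And>k. smooth (\<psi> k)" "\<And>k. D (\<psi> k)" "(\<lambda>k. nrm M (\<lambda>x. cjet (\<psi> k) x - wjet U u x)) \<longlonglongrightarrow> 0"
    using Hcl_approx[OF u] by blast
  have l: "(\<lambda>k. nrm M (\<lambda>x. cjet (\<lambda>x. c * \<psi> k x) x - (c * u x, c *\<^sub>R weak_grad U u x))) \<longlonglongrightarrow> 0"
    using nrm_lim_scaleR[OF p(3), of c] by (simp add: cjet_def wjet_def grad_cmult p)
  have "smooth (\<lambda>x. c * \<psi> k x)" "D (\<lambda>x. c * \<psi> k x)" for k
    using p D smooth_mult[of "\<lambda>_. c"] by (auto simp: lin_def)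
  from Hcl_smooth_limit[where D = D and \<psi> = "\<lambda>k x. c * \<psi> k x" and w = "\<lambda>x. c * u x" and g = "\<lambda>x. c *\<^sub>R weak_grad U u x",
      OF this L2_cmult[OF Hcl_L2(1)[OF u], of c] L2_scaleR[OF Hcl_L2(2)[OF u], of c] l]
  show "(\<lambda>x. c * u x) \<in> Hcl D" "AE x in M. weak_grad U (\<lambda>x. c * u x) x = c *\<^sub>R weak_grad U u x"
    by auto
qed

lemma Hcl_zero: "lin D \<Longrightarrow> (\<lambda>x. 0) \<in> Hcl D"
  by (rule Hcl_smooth) (auto simp: lin_def)

lemma Hcl_diff:
  assumes D: "lin D" and u: "u \<in> Hcl D" and w: "w \<in> Hcl D"
  shows "(\<lambda>x. u x - w x) \<in> Hcl D" "AE x in M. weak_grad U (\<lambda>x. u x - w x) x = weak_grad U u x - weak_grad U w x"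
proof -
  show "(\<lambda>x. u x - w x) \<in> Hcl D"
    using Hcl_add(1)[OF D u Hcl_cmult(1)[OF D w, of "-1"]] by simp
  show "AE x in M. weak_grad U (\<lambda>x. u x - w x) x = weak_grad U u x - weak_grad U w x"
    using Hcl_add(2)[OF D u Hcl_cmult(1)[OF D w, of "-1"]] Hcl_cmult(2)[OF D w, of "-1"]
    by eventually_elim simp
qed

lemma Hcl_sum:
  assumes D: "lin D" and u: "\<And>i. i \<in> I \<Longrightarrow> u i \<in> Hcl D"
  shows "(\<lambda>x. \<Sum>i\<in>I. c i * u i x) \<in> Hcl D"
  using u by (induction I rule: infinite_finite_induct) (auto simp: Hcl_zero[OF D] intro!: Hcl_add[OF D] Hcl_cmult[OF D])

lemma wjet_diff_AE:
  assumes "lin D" "u \<in> Hcl D" "w \<in> Hcl D"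
  shows "AE x in M. wjet U (\<lambda>x. u x - w x) x = wjet U u x - wjet U w x"
  using Hcl_diff(2)[OF assms] by eventually_elim (simp add: wjet_def)

text \<open>Completeness of L2 is applied to the jets; \<open>Hcl_limit\<close> then recognizes the
  second component of the limit as the weak gradient of the first.\<close>

lemma Hcl_complete:
  assumes D: "lin D" and w: "\<And>n. w n \<in> Hcl D"
    and cau: "\<And>e. 0 < e \<Longrightarrow> \<exists>N. \<forall>m\<ge>N. \<forall>n\<ge>N. nrm M (wjet U (\<lambda>x. w m x - w n x)) < e"
  obtains w' where "w' \<in> Hcl D" "(\<lambda>n. nrm M (\<lambda>x. wjet U (w n) x - wjet U w' x)) \<longlonglongrightarrow> 0"
proof -
  have eq: "nrm M (wjet U (\<lambda>x. w m x - w n x)) = nrm M (\<lambda>x. wjet U (w m) x - wjet U (w n) x)" for m n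
    by (rule nrm_cong_AE[OF L2_measurable[OF Hcl_L2(4)[OF Hcl_diff(1)[OF D w w]]]
          L2_measurable[OF L2_diff[OF Hcl_L2(4)[OF w] Hcl_L2(4)[OF w]]] wjet_diff_AE[OF D w w]])
  obtain F where F: "F \<in> L2 M" "(\<lambda>n. nrm M (\<lambda>x. wjet U (w n) x - F x)) \<longlonglongrightarrow> 0"
    using L2_complete[of M "\<lambda>n. wjet U (w n)", OF finite_M Hcl_L2(4)[OF w] cau[unfolded eq]] by blast
  have l: "(\<lambda>n. nrm M (\<lambda>x. wjet U (w n) x - (fst (F x), snd (F x)))) \<longlonglongrightarrow> 0" using F(2) by simp
  note lim = Hcl_limit[OF w L2_fst[OF F(1)] L2_snd[OF F(1)] l]
  have "nrm M (\<lambda>x. wjet U (w n) x - wjet U (\<lambda>x. fst (F x)) x) = nrm M (\<lambda>x. wjet U (w n) x - F x)" for n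
    by (rule nrm_cong_AE[OF L2_measurable[OF L2_diff[OF Hcl_L2(4)[OF w] Hcl_L2(4)[OF lim(1)]]]
          L2_measurable[OF L2_diff[OF Hcl_L2(4)[OF w] F(1)]]])
      (use lim(2) in \<open>auto elim: eventually_mono simp: wjet_def prod_eq_iff\<close>)
  with F(2) lim(1) show ?thesis by (intro that) auto
qed

end

subsection \<open>Energy forms\<close>

text \<open>Instantiated with A on \<Omega> and with \<open>bold_A\<close> on the cylinder. The
  conditions are imposed at every point of U; the final theorem supplies them from the continuity of
  A.\<close>

locale energy_form = weighted_domain \<rho> U for \<rho> :: "'a::euclidean_space \<Rightarrow> real" and U +
  fixes B :: "'a \<Rightarrow> 'a \<Rightarrow> 'a" and C c :: real and D :: "('a \<Rightarrow> real) \<Rightarrow> bool"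
  assumes linear_B: "\<And>x. x \<in> U \<Longrightarrow> linear (B x)"
    and bound_B: "\<And>x v. x \<in> U \<Longrightarrow> norm (B x v) \<le> C * norm v"
    and sym_B: "\<And>x v w. x \<in> U \<Longrightarrow> B x v \<bullet> w = v \<bullet> B x w"
    and coercive_B: "0 < c" "\<And>x v. x \<in> U \<Longrightarrow> c * (norm v)\<^sup>2 \<le> B x v \<bullet> v"
    and cont_B: "\<And>v. continuous_on U (\<lambda>x. B x v)"
    and lin_D: "lin D"
begin

abbreviation "H \<equiv> Hcl D"

text \<open>The form acts on arbitrary square integrable fields, so that a weak gradient can be
  exchanged for any field that agrees with it almost everywhere.\<close>

definition bf :: "('a \<Rightarrow> 'a) \<Rightarrow> ('a \<Rightarrow> 'a) \<Rightarrow> real" where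
  "bf f g = ip M (\<lambda>x. B x (f x)) g"

definition En :: "('a \<Rightarrow> real) \<Rightarrow> ('a \<Rightarrow> real) \<Rightarrow> real" where
  "En u w = bf (weak_grad U u) (weak_grad U w)"

lemma B_L2:
  assumes "f \<in> L2 M"
  shows "(\<lambda>x. B x (f x)) \<in> L2 M"
proof (rule L2_dominated)
  have fm: "f \<in> borel_measurable (lebesgue_on U)" using L2_measurable[OF assms] by (simp add: meas_M)
  have bm: "(\<lambda>x. B x i) \<in> borel_measurable (lebesgue_on U)" for i
    by (rule continuous_measurable[OF cont_B])
  \<comment> \<open>B is continuous in x only for a fixed vector, so measurability is read off the
    expansion of f in basis vectors.\<close>
  have "(\<lambda>x. \<Sum>i\<in>Basis. (f x \<bullet> i) *\<^sub>R B x i) \<in> borel_measurable (lebesgue_on U)"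
    using fm bm by measurable
  moreover have "(\<Sum>i\<in>Basis. (f x \<bullet> i) *\<^sub>R B x i) = B x (f x)" if "x \<in> U" for x
    using linear_sum[OF linear_B[OF that], of "\<lambda>i. (f x \<bullet> i) *\<^sub>R i" Basis] linear_scale[OF linear_B[OF that]]
    by (simp add: euclidean_representation)
  ultimately show "(\<lambda>x. B x (f x)) \<in> borel_measurable M"
    unfolding meas_M by (subst measurable_cong[of _ _ "\<lambda>x. \<Sum>i\<in>Basis. (f x \<bullet> i) *\<^sub>R B x i"]) auto
  show "integrable M (\<lambda>x. C\<^sup>2 * (norm (f x))\<^sup>2)" using assms by (simp add: L2_def)
  show "AE x in M. (norm (B x (f x)))\<^sup>2 \<le> C\<^sup>2 * (norm (f x))\<^sup>2"
    using bound_B by (intro AE_I2) (auto simp: space_M power_mult_distrib[symmetric] intro: power_mono)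
qed

lemma nrm_B_le:
  assumes "f \<in> L2 M"
  shows "nrm M (\<lambda>x. B x (f x)) \<le> \<bar>C\<bar> * nrm M f"
proof -
  have "nrm M (\<lambda>x. B x (f x)) \<le> nrm M (\<lambda>x. C *\<^sub>R f x)"
  proof (rule nrm_mono[OF L2_measurable[OF B_L2[OF assms]] L2_scaleR[OF assms]])
    have "norm (B x (f x)) \<le> \<bar>C\<bar> * norm (f x)" if "x \<in> U" for x
      using bound_B[OF that, of "f x"] mult_right_mono[OF abs_ge_self[of C] norm_ge_zero[of "f x"]] by linarith
    then show "AE x in M. norm (B x (f x)) \<le> norm (C *\<^sub>R f x)" by (intro AE_I2) (simp add: space_M)
  qed
  then show ?thesis by (simp add: nrm_scaleR)
qed

lemma bf_bound:
  assumes "f \<in> L2 M" "g \<in> L2 M"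
  shows "\<bar>bf f g\<bar> \<le> \<bar>C\<bar> * nrm M f * nrm M g"
  unfolding bf_def
  using ip_Cauchy_Schwarz[OF B_L2[OF assms(1)] assms(2)]
    mult_right_mono[OF nrm_B_le[OF assms(1)] nrm_nonneg[of M g]] by linarith

lemma bf_sym: "bf f g = bf g f"
  unfolding bf_def ip_def
  by (rule Bochner_Integration.integral_cong[OF refl]) (use sym_B inner_commute in \<open>metis space_M\<close>)

lemma bf_add_left:
  assumes "f \<in> L2 M" "g \<in> L2 M" "h \<in> L2 M"
  shows "bf (\<lambda>x. f x + g x) h = bf f h + bf g h"
proof -
  have "bf (\<lambda>x. f x + g x) h = ip M (\<lambda>x. B x (f x) + B x (g x)) h"
    unfolding bf_def ip_def
    by (rule Bochner_Integration.integral_cong) (auto simp: space_M linear_add[OF linear_B])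
  then show ?thesis using assms by (simp add: ip_add_left B_L2 bf_def)
qed

lemma bf_scaleR_left: "bf (\<lambda>x. t *\<^sub>R f x) h = t * bf f h"
proof -
  have "bf (\<lambda>x. t *\<^sub>R f x) h = ip M (\<lambda>x. t *\<^sub>R B x (f x)) h"
    unfolding bf_def ip_def
    by (rule Bochner_Integration.integral_cong) (auto simp: space_M linear_scale[OF linear_B])
  then show ?thesis by (simp add: ip_scaleR_left bf_def)
qed

lemma bf_cong_AE:
  assumes "f \<in> L2 M" "f' \<in> L2 M" "AE x in M. f x = f' x" "g \<in> L2 M"
  shows "bf f g = bf f' g"
  unfolding bf_def
  by (rule ip_cong_AE) (use assms(3) L2_measurable[OF B_L2[OF assms(1)]] L2_measurable[OF B_L2[OF assms(2)]]
      L2_measurable[OF assms(4)] in \<open>auto elim: eventually_mono\<close>)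

lemma bf_diff_left:
  assumes "f \<in> L2 M" "g \<in> L2 M" "h \<in> L2 M"
  shows "bf (\<lambda>x. f x - g x) h = bf f h - bf g h"
  using bf_add_left[OF assms(1) L2_scaleR[OF assms(2), of "-1"] assms(3)] bf_scaleR_left[of "-1" g h] by simp

lemma bf_tendsto:
  assumes "\<And>n. f n \<in> L2 M" "g \<in> L2 M" "h \<in> L2 M" "(\<lambda>n. nrm M (\<lambda>x. f n x - g x)) \<longlonglongrightarrow> 0"
  shows "(\<lambda>n. bf (f n) h) \<longlonglongrightarrow> bf g h"
proof -
  have "(\<lambda>n. bf (f n) h - bf g h) \<longlonglongrightarrow> 0"
  proof (rule lim0_squeeze)
    show "\<bar>bf (f n) h - bf g h\<bar> \<le> \<bar>C\<bar> * nrm M h * nrm M (\<lambda>x. f n x - g x)" for n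
      using bf_bound[OF L2_diff[OF assms(1,2)] assms(3), of n] bf_diff_left[OF assms(1,2,3), of n]
      by (simp add: mult_ac)
    show "(\<lambda>n. \<bar>C\<bar> * nrm M h * nrm M (\<lambda>x. f n x - g x)) \<longlonglongrightarrow> 0"
      using tendsto_mult_left[OF assms(4)] by simp
  qed
  then show ?thesis by (simp add: LIM_zero_iff)
qed

lemma bf_coercive:
  assumes "f \<in> L2 M" shows "c * (nrm M f)\<^sup>2 \<le> bf f f"
proof -
  have "c * (nrm M f)\<^sup>2 = (LINT x|M. c * (norm (f x))\<^sup>2)" by (simp add: nrm_eq_LINT)
  also have "\<dots> \<le> (LINT x|M. B x (f x) \<bullet> f x)"
  proof (rule integral_mono)
    show "integrable M (\<lambda>x. c * (norm (f x))\<^sup>2)" using assms by (simp add: L2_def)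
    show "integrable M (\<lambda>x. B x (f x) \<bullet> f x)" by (rule L2_inner_integrable[OF B_L2[OF assms] assms])
  qed (auto simp: space_M coercive_B)
  finally show ?thesis by (simp add: bf_def ip_def)
qed

lemma En_sym: "En u w = En w u"
  by (simp add: En_def bf_sym)

lemma En_add_left:
  assumes "u \<in> H" "v \<in> H" "w \<in> H"
  shows "En (\<lambda>x. u x + v x) w = En u w + En v w"
proof -
  have "En (\<lambda>x. u x + v x) w = bf (\<lambda>x. weak_grad U u x + weak_grad U v x) (weak_grad U w)"
    unfolding En_def
    by (rule bf_cong_AE[OF Hcl_L2(2)[OF Hcl_add(1)[OF lin_D assms(1,2)]]
          L2_add[OF Hcl_L2(2)[OF assms(1)] Hcl_L2(2)[OF assms(2)]] Hcl_add(2)[OF lin_D assms(1,2)] Hcl_L2(2)[OF assms(3)]])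
  then show ?thesis using assms[THEN Hcl_L2(2)] by (simp add: bf_add_left En_def)
qed

lemma En_cmult_left:
  assumes "u \<in> H" "w \<in> H"
  shows "En (\<lambda>x. t * u x) w = t * En u w"
proof -
  have "En (\<lambda>x. t * u x) w = bf (\<lambda>x. t *\<^sub>R weak_grad U u x) (weak_grad U w)"
    unfolding En_def
    by (rule bf_cong_AE[OF Hcl_L2(2)[OF Hcl_cmult(1)[OF lin_D assms(1)]]
          L2_scaleR[OF Hcl_L2(2)[OF assms(1)]] Hcl_cmult(2)[OF lin_D assms(1)] Hcl_L2(2)[OF assms(2)]])
  then show ?thesis by (simp add: bf_scaleR_left En_def)
qed

lemma En_diff_left:
  assumes "u \<in> H" "v \<in> H" "w \<in> H"
  shows "En (\<lambda>x. u x - v x) w = En u w - En v w"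
  using En_add_left[OF assms(1) Hcl_cmult(1)[OF lin_D assms(2), of "-1"] assms(3)]
    En_cmult_left[OF assms(2,3), of "-1"] by simp

lemma En_sum_left:
  assumes "\<And>i. i \<in> I \<Longrightarrow> u i \<in> H" "w \<in> H"
  shows "En (\<lambda>x. \<Sum>i\<in>I. t i * u i x) w = (\<Sum>i\<in>I. t i * En (u i) w)"
  using assms(1)
proof (induction I rule: infinite_finite_induct)
  case (insert i I)
  have "En (\<lambda>x. \<Sum>i\<in>insert i I. t i * u i x) w = En (\<lambda>x. t i * u i x + (\<Sum>i\<in>I. t i * u i x)) w"
    using insert.hyps by simp
  also have "\<dots> = En (\<lambda>x. t i * u i x) w + En (\<lambda>x. \<Sum>i\<in>I. t i * u i x) w"
    using insert.prems assms(2) by (intro En_add_left Hcl_cmult[OF lin_D] Hcl_sum[OF lin_D]) auto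
  finally show ?case using insert assms(2) by (simp add: En_cmult_left)
next
  case empty
  have "En (\<lambda>x. 0 * 0) w = 0 * En (\<lambda>x. 0) w" by (rule En_cmult_left[OF Hcl_zero[OF lin_D] assms(2)])
  then show ?case by simp
next
  case (infinite A)
  have "En (\<lambda>x. 0 * 0) w = 0 * En (\<lambda>x. 0) w" by (rule En_cmult_left[OF Hcl_zero[OF lin_D] assms(2)])
  then show ?case using infinite by simp
qed

lemma En_tendsto:
  assumes "\<And>n. u n \<in> H" "v \<in> H" "w \<in> H" "(\<lambda>n. nrm M (\<lambda>x. wjet U (u n) x - wjet U v x)) \<longlonglongrightarrow> 0"
  shows "(\<lambda>n. En (u n) w) \<longlonglongrightarrow> En v w"
  unfolding En_def
proof (rule bf_tendsto[OF Hcl_L2(2)[OF assms(1)] Hcl_L2(2)[OF assms(2)] Hcl_L2(2)[OF assms(3)]])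
  show "(\<lambda>n. nrm M (\<lambda>x. weak_grad U (u n) x - weak_grad U v x)) \<longlonglongrightarrow> 0"
    by (rule lim0_squeeze[OF _ assms(4)])
      (use nrm_snd_le[OF L2_diff[OF Hcl_L2(4)[OF assms(1)] Hcl_L2(4)[OF assms(2)]]] in \<open>simp add: wjet_def\<close>)
qed

lemma En_coercive: "u \<in> H \<Longrightarrow> c * (nrm M (weak_grad U u))\<^sup>2 \<le> En u u"
  unfolding En_def by (rule bf_coercive[OF Hcl_L2(2)])

lemma En_nonneg: "u \<in> H \<Longrightarrow> 0 \<le> En u u"
  using En_coercive[of u] coercive_B(1)
  by (meson order_trans mult_nonneg_nonneg less_imp_le zero_le_power2)

lemma En_bound:
  "u \<in> H \<Longrightarrow> w \<in> H \<Longrightarrow> \<bar>En u w\<bar> \<le> \<bar>C\<bar> * nrm M (weak_grad U u) * nrm M (weak_grad U w)"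
  unfolding En_def by (intro bf_bound Hcl_L2(2))

end

subsection \<open>Integration over the cylinder\<close>

lemma integrable_powr_Ioo:
  fixes a c :: real
  assumes "-1 < a" "0 \<le> c"
  shows "integrable (lebesgue_on {0<..<c}) (\<lambda>t. t powr a)"
    "(LINT t|lebesgue_on {0<..<c}. t powr a) = c powr (a + 1) / (a + 1)"
proof -
  have hi: "((\<lambda>t. t powr a) has_integral (c powr (a+1) / (a+1))) {0<..<c}"
    using has_integral_powr_from_0[OF assms] by (simp add: has_integral_Icc_iff_Ioo)
  then have "(\<lambda>t. t powr a) absolutely_integrable_on {0<..<c}"
    by (intro nonnegative_absolutely_integrable_1) auto
  then show i: "integrable (lebesgue_on {0<..<c}) (\<lambda>t. t powr a)"
    by (intro absolutely_integrable_imp_integrable) auto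
  show "(LINT t|lebesgue_on {0<..<c}. t powr a) = c powr (a + 1) / (a + 1)"
    using lebesgue_integral_eq_integral[OF i] integral_unique[OF hi] by simp
qed

lemma lborel_integrable_prod:
  fixes u :: "'a::euclidean_space \<Rightarrow> real" and h :: "'b::euclidean_space \<Rightarrow> real"
  assumes u: "integrable lborel u" and h: "integrable lborel h"
  shows "integrable lborel (\<lambda>z. u (fst z) * h (snd z))"
    "(LINT z|lborel. u (fst z) * h (snd z)) = (LINT x|lborel. u x) * (LINT y|lborel. h y)"
proof -
  have [measurable]: "u \<in> borel_measurable lborel" "h \<in> borel_measurable lborel" using u h by auto
  have i: "integrable (lborel \<Otimes>\<^sub>M lborel) (\<lambda>(x, y). u x * h y)"
  proof (rule lborel_pair.Fubini_integrable)
    show "integrable lborel (\<lambda>x. LINT y|lborel. norm (case (x, y) of (x, y) \<Rightarrow> u x * h y))"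
      using u by (simp add: abs_mult)
    show "AE x in lborel. integrable lborel (\<lambda>y. case (x, y) of (x, y) \<Rightarrow> u x * h y)"
      using h by simp
  qed measurable
  then show "integrable lborel (\<lambda>z. u (fst z) * h (snd z))"
    by (simp add: lborel_prod split_beta')
  have "(LINT z|lborel. u (fst z) * h (snd z)) = (LINT x|lborel. LINT y|lborel. u x * h y)"
    using lborel_pair.integral_fst[OF i] by (simp add: lborel_prod split_beta')
  then show "(LINT z|lborel. u (fst z) * h (snd z)) = (LINT x|lborel. u x) * (LINT y|lborel. h y)"
    by simp
qed

lemma (in weighted_domain) LINT_M_lborel:
  fixes f :: "'a \<Rightarrow> real"
  assumes "\<rho> \<in> borel_measurable borel" "f \<in> borel_measurable borel"
  shows "(LINT x|M. f x) = (LINT x|lborel. indicator U x * (\<rho> x * f x))"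
    "integrable M f \<longleftrightarrow> integrable lborel (\<lambda>x. indicator U x * (\<rho> x * f x))"
proof -
  have m: "f \<in> borel_measurable (lebesgue_on U)"
    using assms(2) by (simp add: measurable_completion measurable_restrict_space1)
  have m2: "(\<lambda>x. \<rho> x * f x) \<in> borel_measurable borel" using assms by measurable
  show "(LINT x|M. f x) = (LINT x|lborel. indicator U x * (\<rho> x * f x))"
    using LINT_M[OF m] integral_lebesgue_on_lborel[OF U_sets(2) m2] by simp
  show "integrable M f \<longleftrightarrow> integrable lborel (\<lambda>x. indicator U x * (\<rho> x * f x))"
    using integrable_M[OF m] integrable_lebesgue_on_lborel[OF U_sets(2) m2] by simp
qed

lemma borel_measurable_M:
  "f \<in> borel_measurable borel \<Longrightarrow> f \<in> borel_measurable (weighted \<rho> U)"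
  by (simp add: weighted_def measurable_completion measurable_restrict_space1)

lemma weighted_one: "weighted (\<lambda>_. 1) U = lebesgue_on U"
  by (simp add: weighted_def density_1)

lemma weighted_domain_one: "open U \<Longrightarrow> bounded U \<Longrightarrow> weighted_domain (\<lambda>_. 1) U"
proof
  assume U: "open U" "bounded U"
  have "finite_measure (lebesgue_on U)"
    using U bounded_set_imp_lmeasurable[of U] by (intro finite_measure_lebesgue_on) auto
  then show "integrable (lebesgue_on U) (\<lambda>_. 1 :: real)"
    by (rule finite_measure.integrable_const)
qed auto

locale cyl_domain =
  fixes \<Omega> :: "(real^'n) set" and s Y :: real
  assumes open_\<Omega>: "open \<Omega>" and bounded_\<Omega>: "bounded \<Omega>" and s: "0 < s" "s < 1" and Y: "0 < Y"
begin

sublocale W: weighted_domain "\<lambda>t. t powr (1 - 2 * s)" "{0<..<Y}"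
proof
  show "integrable (lebesgue_on {0<..<Y}) (\<lambda>t. t powr (1 - 2 * s))"
    using s Y by (intro integrable_powr_Ioo) auto
qed (auto intro!: continuous_intros)

sublocale G: weighted_domain "\<lambda>_. 1" \<Omega>
  by (rule weighted_domain_one[OF open_\<Omega> bounded_\<Omega>])

abbreviation "N \<equiv> lebesgue_on \<Omega>"

lemma G_M: "G.M = N"
  by (rule weighted_one)

lemma finite_N: "finite_measure N"
  using G.finite_M by (simp add: G_M)

lemma cylinder_indicator: "indicator (cylinder \<Omega> Y) z = indicator \<Omega> (fst z) * (indicator {0<..<Y} (snd z) :: real)"
  by (cases z) (auto simp: cylinder_def indicator_def)

lemma y_weight_measurable: "y_weight s \<in> borel_measurable borel"
proof -
  have "(snd :: (real^'a) \<times> real \<Rightarrow> real) \<in> borel_measurable borel"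
    by (intro borel_measurable_continuous_onI continuous_intros)
  then show ?thesis unfolding y_weight_def[abs_def] by measurable
qed

lemma powr_measurable: "(\<lambda>t::real. t powr (1 - 2 * s)) \<in> borel_measurable borel"
  by measurable

sublocale Z: weighted_domain "y_weight s" "cylinder \<Omega> Y"
proof
  show "open (cylinder \<Omega> Y)" unfolding cylinder_def using open_\<Omega> by (intro open_Times) auto
  show "bounded (cylinder \<Omega> Y)" unfolding cylinder_def using bounded_\<Omega> by (intro bounded_Times) auto
  show "continuous_on (cylinder \<Omega> Y) (y_weight s)"
    unfolding y_weight_def[abs_def] by (intro continuous_intros) (auto simp: cylinder_def)
  show "0 < y_weight s z" if "z \<in> cylinder \<Omega> Y" for z
    using that by (auto simp: y_weight_def cylinder_def)
  have "integrable lborel (\<lambda>x. indicator \<Omega> x * (1 * 1 :: real))"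
    using finite_measure.integrable_const[OF G.finite_M, of "1::real"]
    by (subst (asm) G.LINT_M_lborel(2)) auto
  moreover have "integrable lborel (\<lambda>t. indicator {0<..<Y} t * (t powr (1 - 2 * s) * 1 :: real))"
    using finite_measure.integrable_const[OF W.finite_M, of "1::real"] powr_measurable
    by (subst (asm) W.LINT_M_lborel(2)) auto
  ultimately have "integrable lborel (\<lambda>z :: (real^'n) \<times> real. indicator \<Omega> (fst z) * (1 * 1) *
      (indicator {0<..<Y} (snd z) * (snd z powr (1 - 2 * s) * 1)))"
    by (rule lborel_integrable_prod(1))
  then have "integrable lborel (\<lambda>z. indicator (cylinder \<Omega> Y) z *\<^sub>R y_weight s z)"
    by (simp add: cylinder_indicator y_weight_def mult.assoc)
  then show "integrable (lebesgue_on (cylinder \<Omega> Y)) (y_weight s)"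
    using \<open>open (cylinder \<Omega> Y)\<close> y_weight_measurable by (subst integrable_lebesgue_on_lborel) auto
qed

abbreviation "CY \<equiv> cylinder \<Omega> Y"

lemma fst_measurable: "f \<in> borel_measurable borel \<Longrightarrow> (\<lambda>z :: (real^'n) \<times> real. f (fst z)) \<in> borel_measurable borel"
  by (rule measurable_compose[of fst borel borel f])
    (auto intro!: borel_measurable_continuous_onI continuous_intros)

lemma snd_measurable: "f \<in> borel_measurable borel \<Longrightarrow> (\<lambda>z :: (real^'n) \<times> real. f (snd z)) \<in> borel_measurable borel"
  by (rule measurable_compose[of snd borel borel f])
    (auto intro!: borel_measurable_continuous_onI continuous_intros)

lemma section_measurable:
  "f \<in> borel_measurable borel \<Longrightarrow> (\<lambda>y :: real. f (x :: real^'n, y)) \<in> borel_measurable borel"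
  "f \<in> borel_measurable borel \<Longrightarrow> (\<lambda>x :: real^'n. f (x, y :: real)) \<in> borel_measurable borel"
  by (rule measurable_compose[of _ borel borel f];
    auto intro!: borel_measurable_continuous_onI continuous_intros)+

text \<open>The integrals are transported to \<open>lborel\<close>, whose product measure is
  available. Borel measurability is assumed because it passes to every section, which Lebesgue
  measurability does not.\<close>

lemma fubini:
  fixes f :: "(real^'n) \<times> real \<Rightarrow> real"
  assumes f: "f \<in> borel_measurable borel" and i: "integrable Z.M f"
  shows "(LINT z|Z.M. f z) = (LINT x|N. LINT y|W.M. f (x, y))"
    "(LINT z|Z.M. f z) = (LINT y|W.M. LINT x|N. f (x, y))"
    "integrable N (\<lambda>x. LINT y|W.M. f (x, y))"
    "integrable W.M (\<lambda>y. LINT x|N. f (x, y))"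
proof -
  define P where "P = (\<lambda>(x, y). indicator \<Omega> x * (indicator {0<..<Y} y * (y powr (1 - 2 * s) * f (x, y))))"
  have Pz: "indicator CY z * (y_weight s z * f z) = P z" for z
    by (cases z) (simp add: P_def cylinder_indicator y_weight_def)
  have iP: "integrable (lborel \<Otimes>\<^sub>M lborel) (case_prod (\<lambda>x y. P (x, y)))"
    using i Z.LINT_M_lborel(2)[OF y_weight_measurable f] by (simp add: lborel_prod Pz)
  have LP: "(LINT z|Z.M. f z) = integral\<^sup>L (lborel \<Otimes>\<^sub>M lborel) (case_prod (\<lambda>x y. P (x, y)))"
    using Z.LINT_M_lborel(1)[OF y_weight_measurable f] by (simp add: lborel_prod Pz)
  have inner1: "(LINT y|lborel. P (x, y)) = indicator \<Omega> x * (LINT y|W.M. f (x, y))" for x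
    using W.LINT_M_lborel(1)[OF powr_measurable section_measurable(1)[OF f]] by (simp add: P_def)
  have inner2: "(LINT x|lborel. P (x, y)) = indicator {0<..<Y} y * (y powr (1 - 2 * s) * (LINT x|N. f (x, y)))" for y
  proof -
    have "(LINT x|lborel. P (x, y)) = (LINT x|lborel. (indicator {0<..<Y} y * y powr (1 - 2 * s)) * (indicator \<Omega> x * (1 * f (x, y))))"
      by (simp add: P_def mult_ac)
    also have "\<dots> = (indicator {0<..<Y} y * y powr (1 - 2 * s)) * (LINT x|G.M. f (x, y))"
      using G.LINT_M_lborel(1)[OF _ section_measurable(2)[OF f]] by simp
    finally show ?thesis by (simp add: G_M)
  qed
  have f': "(\<lambda>(x, y). f (x, y)) \<in> borel_measurable (borel \<Otimes>\<^sub>M borel)"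
    using f by (simp add: borel_prod case_prod_beta)
  have Wb: "(LINT y|W.M. f (x, y)) = (LINT y|lborel. indicator {0<..<Y} y * (y powr (1 - 2 * s) * f (x, y)))" for x
    by (rule W.LINT_M_lborel(1)[OF powr_measurable section_measurable(1)[OF f]])
  have Nb: "(LINT x|N. f (x, y)) = (LINT x|lborel. indicator \<Omega> x * f (x, y))" for y
    using G.LINT_M_lborel(1)[OF _ section_measurable(2)[OF f], of y] by (simp add: G_M)
  have m1: "(\<lambda>x. LINT y|W.M. f (x, y)) \<in> borel_measurable borel"
  proof -
    have "(\<lambda>(x, y). indicator {0<..<Y} y * (y powr (1 - 2 * s) * f (x, y))) \<in> borel_measurable (borel \<Otimes>\<^sub>M lborel)"
      using f' by measurable
    from lborel.borel_measurable_lebesgue_integral[OF this] show ?thesis by (simp only: Wb)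
  qed
  have m2: "(\<lambda>y. LINT x|N. f (x, y)) \<in> borel_measurable borel"
  proof -
    have f'': "(\<lambda>(y, x). f (x, y)) \<in> borel_measurable (borel \<Otimes>\<^sub>M borel)"
      using f' by measurable
    have [measurable]: "\<Omega> \<in> sets borel" using open_\<Omega> by simp
    have "(\<lambda>(y, x). indicator \<Omega> x * f (x, y)) \<in> borel_measurable (borel \<Otimes>\<^sub>M lborel)"
      using f'' by measurable
    from lborel.borel_measurable_lebesgue_integral[OF this] show ?thesis by (simp only: Nb)
  qed
  show "(LINT z|Z.M. f z) = (LINT x|N. LINT y|W.M. f (x, y))"
    using lborel_pair.integral_fst[OF iP] G.LINT_M_lborel(1)[OF _ m1] by (simp add: inner1 LP G_M)
  show "integrable N (\<lambda>x. LINT y|W.M. f (x, y))"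
    using lborel_pair.integrable_fst[OF iP] G.LINT_M_lborel(2)[OF _ m1] by (simp add: inner1 G_M)
  show "(LINT z|Z.M. f z) = (LINT y|W.M. LINT x|N. f (x, y))"
    using lborel_pair.integral_snd[OF iP] W.LINT_M_lborel(1)[OF powr_measurable m2] by (simp add: inner2 LP)
  show "integrable W.M (\<lambda>y. LINT x|N. f (x, y))"
    using lborel_pair.integrable_snd[OF iP] W.LINT_M_lborel(2)[OF powr_measurable m2] by (simp add: inner2)
qed

lemma integrable_prod:
  fixes u :: "real^'n \<Rightarrow> real" and h :: "real \<Rightarrow> real"
  assumes u: "u \<in> borel_measurable borel" "integrable N u" and h: "h \<in> borel_measurable borel" "integrable W.M h"
  shows "integrable Z.M (\<lambda>z. u (fst z) * h (snd z))"
    "(LINT z|Z.M. u (fst z) * h (snd z)) = (LINT x|N. u x) * (LINT y|W.M. h y)"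
proof -
  have m: "(\<lambda>z. u (fst z) * h (snd z)) \<in> borel_measurable borel"
    by (intro borel_measurable_times fst_measurable snd_measurable u h)
  have i1: "integrable lborel (\<lambda>x. indicator \<Omega> x * (1 * u x))"
    using u G.LINT_M_lborel(2)[OF _ u(1)] by (simp add: G_M)
  have i2: "integrable lborel (\<lambda>t. indicator {0<..<Y} t * (t powr (1 - 2 * s) * h t))"
    using h W.LINT_M_lborel(2)[OF powr_measurable h(1)] by simp
  have eq: "indicator CY z * (y_weight s z * (u (fst z) * h (snd z))) =
      (indicator \<Omega> (fst z) * (1 * u (fst z))) * (indicator {0<..<Y} (snd z) * (snd z powr (1 - 2 * s) * h (snd z)))" for z
    by (simp add: cylinder_indicator y_weight_def mult_ac)
  show "integrable Z.M (\<lambda>z. u (fst z) * h (snd z))"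
    unfolding Z.LINT_M_lborel(2)[OF y_weight_measurable m] eq by (rule lborel_integrable_prod[OF i1 i2])
  show "(LINT z|Z.M. u (fst z) * h (snd z)) = (LINT x|N. u x) * (LINT y|W.M. h y)"
    unfolding Z.LINT_M_lborel(1)[OF y_weight_measurable m] eq lborel_integrable_prod(2)[OF i1 i2]
    using G.LINT_M_lborel(1)[OF _ u(1)] W.LINT_M_lborel(1)[OF powr_measurable h(1)] by (simp add: G_M)
qed

lemma L2_prod:
  fixes u :: "real^'n \<Rightarrow> 'b::euclidean_space" and h :: "real \<Rightarrow> real"
  assumes u: "u \<in> borel_measurable borel" "u \<in> L2 N" and h: "h \<in> borel_measurable borel" "h \<in> L2 W.M"
  shows "(\<lambda>z. h (snd z) *\<^sub>R u (fst z)) \<in> L2 Z.M"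
    "nrm Z.M (\<lambda>z. h (snd z) *\<^sub>R u (fst z)) = nrm W.M h * nrm N u"
proof -
  have m: "(\<lambda>z. h (snd z) *\<^sub>R u (fst z)) \<in> borel_measurable borel"
    by (intro borel_measurable_scaleR fst_measurable snd_measurable u h)
  have eq: "(norm (h (snd z) *\<^sub>R u (fst z)))\<^sup>2 = (norm (u (fst z)))\<^sup>2 * (norm (h (snd z)))\<^sup>2" for z
    by (simp add: power_mult_distrib)
  have uu: "(\<lambda>x. (norm (u x))\<^sup>2) \<in> borel_measurable borel" "integrable N (\<lambda>x. (norm (u x))\<^sup>2)"
    using u by (auto simp: L2_def)
  have hh: "(\<lambda>x. (norm (h x))\<^sup>2) \<in> borel_measurable borel" "integrable W.M (\<lambda>x. (norm (h x))\<^sup>2)"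
    using h by (auto simp: L2_def)
  show "(\<lambda>z. h (snd z) *\<^sub>R u (fst z)) \<in> L2 Z.M"
    unfolding L2_def mem_Collect_eq eq by (rule conjI[OF borel_measurable_M[OF m] integrable_prod(1)[OF uu hh]])
  have "(nrm Z.M (\<lambda>z. h (snd z) *\<^sub>R u (fst z)))\<^sup>2 = (nrm W.M h * nrm N u)\<^sup>2"
    unfolding power_mult_distrib nrm_eq_LINT eq using integrable_prod(2)[OF uu hh] by simp
  then show "nrm Z.M (\<lambda>z. h (snd z) *\<^sub>R u (fst z)) = nrm W.M h * nrm N u"
    by (rule power2_eq_imp_eq) auto
qed

subsection \<open>Trace and Poincare inequalities\<close>

text \<open>The integral over (0,Y) of the inverse weight \<open>y powr (2 * s - 1)\<close>, finite
  since s is positive.\<close>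

definition K :: real where "K = Y powr (2 * s) / (2 * s)"

lemma K_pos: "0 < K"
  using s Y by (simp add: K_def)

lemma inverse_weight_L2:
  "(\<lambda>t. t powr (2 * s - 1)) \<in> L2 W.M" "(nrm W.M (\<lambda>t. t powr (2 * s - 1)))\<^sup>2 = K"
proof -
  have pm: "(\<lambda>t::real. t powr a) \<in> borel_measurable borel" for a by measurable
  have sq: "(\<lambda>t::real. (norm (t powr (2 * s - 1)))\<^sup>2) \<in> borel_measurable (lebesgue_on {0<..<Y})"
    by (rule measurable_restrict_space1, rule measurable_completion) measurable
  have eq: "t powr (1 - 2 * s) *\<^sub>R (norm (t powr (2 * s - 1)))\<^sup>2 = t powr (2 * s - 1)" if "t \<in> {0<..<Y}" for t
    using that by (simp add: power2_eq_square powr_add[symmetric])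
  have i: "integrable (lebesgue_on {0<..<Y}) (\<lambda>t. t powr (2 * s - 1))"
    "(LINT t|lebesgue_on {0<..<Y}. t powr (2 * s - 1)) = K"
    using integrable_powr_Ioo[of "2 * s - 1" Y] s Y by (simp_all add: K_def)
  have "integrable (lebesgue_on {0<..<Y}) (\<lambda>t. t powr (1 - 2 * s) *\<^sub>R (norm (t powr (2 * s - 1)))\<^sup>2)"
    using i(1) by (subst Bochner_Integration.integrable_cong[OF refl eq]) auto
  then have "integrable W.M (\<lambda>t. (norm (t powr (2 * s - 1)))\<^sup>2)"
    unfolding W.integrable_M[OF sq] .
  then show "(\<lambda>t. t powr (2 * s - 1)) \<in> L2 W.M"
    unfolding L2_def using borel_measurable_M[OF pm] by auto
  have "(LINT t|lebesgue_on {0<..<Y}. t powr (1 - 2 * s) *\<^sub>R (norm (t powr (2 * s - 1)))\<^sup>2) = K"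
    using i(2) by (subst Bochner_Integration.integral_cong[OF refl eq]) auto
  then show "(nrm W.M (\<lambda>t. t powr (2 * s - 1)))\<^sup>2 = K"
    unfolding nrm_eq_LINT W.LINT_M[OF sq] .
qed

text \<open>Since f vanishes at Y, it is bounded by the integral of the absolute value of f';
  inserting weight times inverse weight and applying Cauchy-Schwarz gives the factor K.
  Differentiability is asked only inside the interval because profiles may have an unbounded
  derivative at 0.\<close>

lemma fiber_bound_Ioo:
  fixes f f' :: "real \<Rightarrow> real"
  assumes d: "\<And>t. 0 < t \<Longrightarrow> t < Y \<Longrightarrow> (f has_real_derivative f' t) (at t)" and c: "continuous_on {0..Y} f"
    and f': "f' \<in> L2 W.M" and fY: "f Y = 0" and y: "0 \<le> y" "y \<le> Y"
  shows "(f y)\<^sup>2 \<le> K * (nrm W.M f')\<^sup>2"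
proof -
  have f'L2: "(\<lambda>t. \<bar>f' t\<bar>) \<in> L2 W.M" using f' by (auto simp: L2_def)
  have m: "(\<lambda>t. t powr (2 * s - 1) * \<bar>f' t\<bar>) \<in> borel_measurable (lebesgue_on {0<..<Y})"
    using L2_measurable[OF inverse_weight_L2(1)] L2_measurable[OF f'L2] unfolding W.meas_M by measurable
  have eq: "t powr (1 - 2 * s) *\<^sub>R (t powr (2 * s - 1) * \<bar>f' t\<bar>) = \<bar>f' t\<bar>" if "t \<in> {0<..<Y}" for t
    using that by (simp add: mult.assoc[symmetric] powr_add[symmetric])
  have "integrable W.M (\<lambda>t. t powr (2 * s - 1) * \<bar>f' t\<bar>)"
    using L2_inner_integrable[OF inverse_weight_L2(1) f'L2] by simp
  then have "integrable (lebesgue_on {0<..<Y}) (\<lambda>t. t powr (1 - 2 * s) *\<^sub>R (t powr (2 * s - 1) * \<bar>f' t\<bar>))"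
    unfolding W.integrable_M[OF m] .
  then have i1: "integrable (lebesgue_on {0<..<Y}) (\<lambda>t. \<bar>f' t\<bar>)"
    by (subst (asm) Bochner_Integration.integrable_cong[OF refl eq]) auto
  have i0: "integrable (lebesgue_on {0<..<Y}) f'"
    by (rule Bochner_Integration.integrable_bound[OF i1]) (use L2_measurable[OF f'] W.meas_M in auto)
  have "f' absolutely_integrable_on {0<..<Y}"
    unfolding set_integrable_def
    using i0 by (subst (asm) integrable_restrict_space) auto
  then have ai: "f' absolutely_integrable_on {0..Y}"
    by (simp only: absolutely_integrable_on_Icc_iff_Ioo)
  then have ay: "f' absolutely_integrable_on {y..Y}"
    by (rule absolutely_integrable_on_subinterval) (use y in auto)
  have "(f' has_integral (f Y - f y)) {y..Y}"
    using y by (intro fundamental_theorem_of_calculus_interior continuous_on_subset[OF c])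
      (auto intro!: d simp: has_real_derivative_iff_has_vector_derivative[symmetric])
  then have "f y = - integral {y..Y} f'" using fY by (simp add: integral_unique)
  then have "\<bar>f y\<bar> \<le> integral {y..Y} (\<lambda>t. \<bar>f' t\<bar>)"
    using integral_norm_bound_integral[of f' "{y..Y}" "\<lambda>t. \<bar>f' t\<bar>"] ay
    by (auto simp: absolutely_integrable_on_def)
  also have "\<dots> \<le> integral {0..Y} (\<lambda>t. \<bar>f' t\<bar>)"
    using y ai ay by (intro integral_subset_le) (auto simp: absolutely_integrable_on_def)
  also have "\<dots> = integral {0<..<Y} (\<lambda>t. \<bar>f' t\<bar>)"
    by (simp add: integral_open_interval_real)
  also have "\<dots> = (LINT t|lebesgue_on {0<..<Y}. \<bar>f' t\<bar>)"
    by (intro lebesgue_integral_eq_integral[symmetric] i1) auto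
  also have "\<dots> = ip W.M (\<lambda>t. t powr (2 * s - 1)) (\<lambda>t. \<bar>f' t\<bar>)"
    unfolding ip_def inner_real_def W.LINT_M[OF m]
    by (rule Bochner_Integration.integral_cong) (use eq in auto)
  also have "\<dots> \<le> nrm W.M (\<lambda>t. t powr (2 * s - 1)) * nrm W.M (\<lambda>t. \<bar>f' t\<bar>)"
    using ip_Cauchy_Schwarz[OF inverse_weight_L2(1) f'L2] by linarith
  finally have "\<bar>f y\<bar>\<^sup>2 \<le> (nrm W.M (\<lambda>t. t powr (2 * s - 1)) * nrm W.M (\<lambda>t. \<bar>f' t\<bar>))\<^sup>2"
    by (intro power_mono) auto
  then show ?thesis
    unfolding power_mult_distrib inverse_weight_L2(2) by (simp add: nrm_eq_LINT)
qed

lemma fiber_bound: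
  fixes f f' :: "real \<Rightarrow> real"
  assumes d: "\<And>t. (f has_real_derivative f' t) (at t)" and c: "continuous_on UNIV f'"
    and fY: "f Y = 0" and y: "0 \<le> y" "y \<le> Y"
  shows "(f y)\<^sup>2 \<le> K * (LINT t|W.M. (f' t)\<^sup>2)"
proof -
  have "continuous_on {0..Y} f"
    by (rule DERIV_continuous_on, rule has_field_derivative_at_within, rule d)
  moreover have "f' \<in> L2 W.M"
    by (rule W.continuous_closure_L2[OF continuous_on_subset[OF c]]) simp
  ultimately show ?thesis
    using fiber_bound_Ioo[of f f' y] d fY y by (simp add: nrm_eq_LINT)
qed

text \<open>Multiplying by the cut-off \<open>1 - t / Y\<close> reduces the general case to the previous one.\<close>

lemma fiber_trace:
  fixes f f' :: "real \<Rightarrow> real"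
  assumes d: "\<And>t. (f has_real_derivative f' t) (at t)" and c: "continuous_on UNIV f'"
  shows "(f 0)\<^sup>2 \<le> 2 * K * (1 + 1 / Y\<^sup>2) * (LINT t|W.M. (f t)\<^sup>2 + (f' t)\<^sup>2)"
proof -
  define g' where "g' t = (1 - t / Y) * f' t - f t / Y" for t
  have cf: "continuous_on UNIV f"
    by (rule DERIV_continuous_on, rule has_field_derivative_at_within, rule d)
  have "((1 - 0 / Y) * f 0)\<^sup>2 \<le> K * (LINT t|W.M. (g' t)\<^sup>2)"
  proof (rule fiber_bound[where f = "\<lambda>t. (1 - t / Y) * f t" and y = 0])
    show "((\<lambda>t. (1 - t / Y) * f t) has_real_derivative g' t) (at t)" for t
      unfolding g'_def using Y by (auto intro!: derivative_eq_intros d simp: field_simps)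
    show "continuous_on UNIV g'" unfolding g'_def using Y by (intro continuous_intros c cf) auto
  qed (use Y in auto)
  also have "\<dots> \<le> K * (LINT t|W.M. 2 * (1 + 1 / Y\<^sup>2) * ((f t)\<^sup>2 + (f' t)\<^sup>2))"
  proof (rule mult_left_mono[OF integral_mono])
    have i: "integrable W.M (\<lambda>t. (h t)\<^sup>2)" if "continuous_on UNIV h" for h :: "real \<Rightarrow> real"
      using L2_integrable_norm[OF W.continuous_closure_L2[OF continuous_on_subset[OF that]]] by simp
    show "integrable W.M (\<lambda>t. (g' t)\<^sup>2)"
      unfolding g'_def using Y by (intro i continuous_intros c cf) auto
    show "integrable W.M (\<lambda>t. 2 * (1 + 1 / Y\<^sup>2) * ((f t)\<^sup>2 + (f' t)\<^sup>2))"
      by (intro integrable_mult_right Bochner_Integration.integrable_add i c cf)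
    fix t assume "t \<in> space W.M"
    then have t: "0 < t" "t < Y" by (auto simp: W.space_M)
    have sq: "(a - b)\<^sup>2 \<le> 2 * a\<^sup>2 + 2 * b\<^sup>2" for a b :: real
      using sum_squares_bound[of a "-b"] by (simp add: power2_diff)
    have "((1 - t / Y) * f' t)\<^sup>2 \<le> 1 * (f' t)\<^sup>2"
      unfolding power_mult_distrib using t Y by (intro mult_right_mono power_le_one) (auto simp: field_simps)
    then have "(g' t)\<^sup>2 \<le> 2 * (f' t)\<^sup>2 + 2 * (f t / Y)\<^sup>2"
      unfolding g'_def using sq[of "(1 - t / Y) * f' t" "f t / Y"] by linarith
    also have "\<dots> \<le> 2 * (1 + 1 / Y\<^sup>2) * ((f t)\<^sup>2 + (f' t)\<^sup>2)"
      by (simp add: power_divide algebra_simps add_increasing)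
    finally show "(g' t)\<^sup>2 \<le> 2 * (1 + 1 / Y\<^sup>2) * ((f t)\<^sup>2 + (f' t)\<^sup>2)" .
  qed (use K_pos in auto)
  finally have "(f 0)\<^sup>2 \<le> K * (2 * (1 + 1 / Y\<^sup>2) * (LINT t|W.M. (f t)\<^sup>2 + (f' t)\<^sup>2))"
    by simp
  then show ?thesis by (simp only: mult_ac)
qed

lemma smooth_line_derivative:
  fixes \<psi> :: "(real^'n) \<times> real \<Rightarrow> real"
  assumes "smooth \<psi>"
  shows "((\<lambda>t. \<psi> (x, t)) has_real_derivative snd (grad \<psi> (x, t))) (at t)"
proof -
  have "((\<lambda>t. \<psi> (x, t)) has_derivative (\<lambda>r. grad \<psi> (x, t) \<bullet> (0, r))) (at t)"
    by (rule has_derivative_compose[OF _ smooth_has_derivative_grad[OF assms]])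
      (auto intro!: derivative_eq_intros)
  moreover have "(\<lambda>r. grad \<psi> (x, t) \<bullet> (0, r)) = (*) (snd (grad \<psi> (x, t)))"
    by (auto simp: fun_eq_iff inner_prod_def)
  ultimately show ?thesis by (simp add: has_field_derivative_def)
qed

lemma smooth_line_continuous:
  fixes \<psi> :: "(real^'n) \<times> real \<Rightarrow> real"
  assumes "smooth \<psi>" shows "continuous_on S (\<lambda>t. snd (grad \<psi> (x, t)))"
  by (intro continuous_intros continuous_on_compose2[OF smooth_grad_continuous[OF assms, of UNIV]]) auto

lemma smooth_slice:
  fixes \<psi> :: "(real^'n) \<times> real \<Rightarrow> real"
  assumes "smooth \<psi>"
  shows "smooth (\<lambda>x. \<psi> (x, y))" "grad (\<lambda>x. \<psi> (x, y)) x = fst (grad \<psi> (x, y))"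
proof -
  have "bounded_linear (\<lambda>x::real^'n. (x, 0::real))"
    by (intro bounded_linear_Pair bounded_linear_ident bounded_linear_zero)
  from smooth_affine[OF this assms, of "(0, y)"] show "smooth (\<lambda>x. \<psi> (x, y))" by simp
  show "grad (\<lambda>x. \<psi> (x, y)) x = fst (grad \<psi> (x, y))"
  proof (rule grad_eqI)
    have "((\<lambda>x. \<psi> (x, y)) has_derivative (\<lambda>r. grad \<psi> (x, y) \<bullet> (r, 0))) (at x)"
      by (rule has_derivative_compose[OF _ smooth_has_derivative_grad[OF assms]])
        (auto intro!: derivative_eq_intros)
    then show "((\<lambda>x. \<psi> (x, y)) has_derivative (\<bullet>) (fst (grad \<psi> (x, y)))) (at x)"
      by (simp add: inner_prod_def)
  qed
qed

lemma continuous_Z_integrable: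
  fixes f :: "(real^'n) \<times> real \<Rightarrow> real"
  assumes "continuous_on UNIV f" shows "integrable Z.M f" "f \<in> borel_measurable borel"
  using L2_imp_integrable[OF Z.finite_M Z.continuous_closure_L2[OF continuous_on_subset[OF assms]]]
    borel_measurable_continuous_onI[OF assms] by auto

lemma continuous_N_L2:
  fixes f :: "real^'n \<Rightarrow> 'b::euclidean_space"
  assumes "continuous_on UNIV f" shows "f \<in> L2 N"
  using G.continuous_closure_L2[OF continuous_on_subset[OF assms]] by (simp add: G_M)

lemma smooth_trace_L2:
  fixes \<psi> :: "(real^'n) \<times> real \<Rightarrow> real"
  assumes "smooth \<psi>" shows "(\<lambda>x. \<psi> (x, y)) \<in> L2 N"
  by (rule continuous_N_L2[OF smooth_continuous[OF smooth_slice(1)[OF assms]]])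

definition Ct :: real where "Ct = sqrt (2 * K * (1 + 1 / Y\<^sup>2))"

text \<open>\<open>fiber_trace\<close> on each vertical line, integrated over \<Omega> by Fubini;
  the vertical derivative is one component of the gradient.\<close>

lemma trace_inequality:
  assumes \<psi>: "smooth \<psi>"
  shows "nrm N (\<lambda>x. \<psi> (x, 0)) \<le> Ct * nrm Z.M (cjet \<psi>)"
proof -
  define f where "f z = (\<psi> z)\<^sup>2 + (snd (grad \<psi> z))\<^sup>2" for z
  have f: "integrable Z.M f" "f \<in> borel_measurable borel"
    unfolding f_def[abs_def]
    by (intro continuous_Z_integrable continuous_intros smooth_continuous smooth_grad_continuous \<psi>)+
  have pos: "0 \<le> 2 * K * (1 + 1 / Y\<^sup>2)" using K_pos by (simp add: add_nonneg_nonneg)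
  have "(nrm N (\<lambda>x. \<psi> (x, 0)))\<^sup>2 = (LINT x|N. (\<psi> (x, 0))\<^sup>2)" by (simp add: nrm_eq_LINT)
  also have "\<dots> \<le> (LINT x|N. 2 * K * (1 + 1 / Y\<^sup>2) * (LINT y|W.M. f (x, y)))"
  proof (rule integral_mono)
    show "integrable N (\<lambda>x. (\<psi> (x, 0))\<^sup>2)" using L2_integrable_norm[OF smooth_trace_L2[OF \<psi>]] by simp
    show "integrable N (\<lambda>x. 2 * K * (1 + 1 / Y\<^sup>2) * (LINT y|W.M. f (x, y)))"
      by (intro integrable_mult_right fubini(3) f)
    show "(\<psi> (x, 0))\<^sup>2 \<le> 2 * K * (1 + 1 / Y\<^sup>2) * (LINT y|W.M. f (x, y))" for x
      unfolding f_def by (rule fiber_trace[OF smooth_line_derivative[OF \<psi>] smooth_line_continuous[OF \<psi>]])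
  qed
  also have "\<dots> = 2 * K * (1 + 1 / Y\<^sup>2) * (LINT z|Z.M. f z)"
    by (simp add: fubini(1)[OF f(2,1)])
  also have "\<dots> \<le> 2 * K * (1 + 1 / Y\<^sup>2) * (nrm Z.M (cjet \<psi>))\<^sup>2"
    unfolding nrm_eq_LINT
  proof (intro mult_left_mono integral_mono f pos)
    show "integrable Z.M (\<lambda>z. (norm (cjet \<psi> z))\<^sup>2)" by (rule L2_integrable_norm[OF Z.cjet_L2[OF \<psi>]])
    show "f z \<le> (norm (cjet \<psi> z))\<^sup>2" for z
      by (cases "grad \<psi> z") (auto simp: f_def cjet_def norm_Pair)
  qed
  also have "\<dots> = (Ct * nrm Z.M (cjet \<psi>))\<^sup>2"
    using pos by (simp add: Ct_def power_mult_distrib)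
  finally show ?thesis
    by (rule power2_le_imp_le) (simp add: Ct_def pos)
qed

text \<open>Vanishing on the top face already bounds the function on each vertical line by its
  vertical derivative; integrating this uniform bound in y produces the weighted length of
  (0,Y).\<close>

lemma poincare_smooth:
  assumes \<psi>: "smooth \<psi>" and z: "\<And>x. x \<in> \<Omega> \<Longrightarrow> \<psi> (x, Y) = 0"
  shows "(nrm Z.M \<psi>)\<^sup>2 \<le> K * (LINT y|W.M. 1) * (nrm Z.M (grad \<psi>))\<^sup>2"
proof -
  define f where "f z = (snd (grad \<psi> z))\<^sup>2" for z
  have f: "integrable Z.M f" "f \<in> borel_measurable borel"
    unfolding f_def[abs_def]
    by (intro continuous_Z_integrable continuous_intros smooth_grad_continuous \<psi>)+
  have p: "integrable Z.M (\<lambda>z. (\<psi> z)\<^sup>2)" "(\<lambda>z. (\<psi> z)\<^sup>2) \<in> borel_measurable borel"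
    by (intro continuous_Z_integrable continuous_intros smooth_continuous \<psi>)+
  have "(nrm Z.M \<psi>)\<^sup>2 = (LINT x|N. LINT y|W.M. (\<psi> (x, y))\<^sup>2)"
    using fubini(1)[OF p(2,1)] by (simp add: nrm_eq_LINT)
  also have "\<dots> \<le> (LINT x|N. K * (LINT y|W.M. 1) * (LINT y|W.M. f (x, y)))"
  proof (rule integral_mono)
    show "integrable N (\<lambda>x. LINT y|W.M. (\<psi> (x, y))\<^sup>2)" by (rule fubini(3)[OF p(2,1)])
    show "integrable N (\<lambda>x. K * (LINT y|W.M. 1) * (LINT y|W.M. f (x, y)))"
      by (intro integrable_mult_right fubini(3) f)
    fix x assume "x \<in> space N"
    then have x: "x \<in> \<Omega>" by simp
    have "(LINT y|W.M. (\<psi> (x, y))\<^sup>2) \<le> (LINT y|W.M. K * (LINT y|W.M. f (x, y)))"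
    proof (rule integral_mono)
      have "continuous_on UNIV (\<lambda>y. \<psi> (x, y))"
        by (rule DERIV_continuous_on, rule has_field_derivative_at_within, rule smooth_line_derivative[OF \<psi>])
      from L2_integrable_norm[OF W.continuous_closure_L2[OF continuous_on_subset[OF this]]]
      show "integrable W.M (\<lambda>y. (\<psi> (x, y))\<^sup>2)" by simp
      show "integrable W.M (\<lambda>y. K * (LINT y|W.M. f (x, y)))"
        by (rule finite_measure.integrable_const[OF W.finite_M])
      show "(\<psi> (x, y))\<^sup>2 \<le> K * (LINT y|W.M. f (x, y))" if "y \<in> space W.M" for y
        unfolding f_def using that z[OF x]
        by (intro fiber_bound[OF smooth_line_derivative[OF \<psi>] smooth_line_continuous[OF \<psi>]]) (auto simp: W.space_M)
    qed
    then show "(LINT y|W.M. (\<psi> (x, y))\<^sup>2) \<le> K * (LINT y|W.M. 1) * (LINT y|W.M. f (x, y))"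
      by (simp add: mult_ac)
  qed
  also have "\<dots> = K * (LINT y|W.M. 1) * (LINT z|Z.M. f z)"
    by (simp add: fubini(1)[OF f(2,1)])
  also have "\<dots> \<le> K * (LINT y|W.M. 1) * (nrm Z.M (grad \<psi>))\<^sup>2"
    unfolding nrm_eq_LINT
  proof (intro mult_left_mono integral_mono f)
    show "integrable Z.M (\<lambda>z. (norm (grad \<psi> z))\<^sup>2)" by (rule L2_integrable_norm[OF Z.smooth_grad_L2[OF \<psi>]])
    show "f z \<le> (norm (grad \<psi> z))\<^sup>2" for z
      by (cases "grad \<psi> z") (auto simp: f_def norm_Pair)
  qed (use K_pos in auto)
  finally show ?thesis .
qed

subsection \<open>Traces\<close>

definition DL :: "((real^'n) \<times> real \<Rightarrow> real) \<Rightarrow> bool" where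
  "DL \<psi> \<longleftrightarrow> supp \<psi> \<inter> dirichlet_part \<Omega> Y = {}"

lemma lin_DL: "Z.lin DL"
proof -
  have "supp (\<lambda>x. 0 :: real) = {}" by (simp add: supp_def)
  moreover have "DL (\<lambda>x. f x + g x)" if "DL f" "DL g" for f g
    using that supp_add[of f g] unfolding DL_def by auto
  moreover have "DL (\<lambda>x. c * f x)" if "DL f" for c f
    using that supp_mult_right[of "\<lambda>_. c" f] unfolding DL_def by auto
  ultimately show ?thesis unfolding Z.lin_def DL_def by auto
qed

lemma H1L_eq: "H1L s \<Omega> Y = Z.Hcl DL"
  by (simp add: H1L_def Z.Hcl_def DL_def)

lemma DL_top: "DL \<psi> \<Longrightarrow> x \<in> \<Omega> \<Longrightarrow> \<psi> (x, Y) = 0"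
  by (rule not_in_supp) (auto simp: DL_def dirichlet_part_def)

lemma poincare:
  assumes "w \<in> Z.Hcl DL"
  shows "(nrm Z.M w)\<^sup>2 \<le> K * (LINT y|W.M. 1) * (nrm Z.M (weak_grad CY w))\<^sup>2"
proof -
  obtain \<psi> where p: "\<And>k. smooth (\<psi> k)" "\<And>k. DL (\<psi> k)" "(\<lambda>k. nrm Z.M (\<lambda>x. cjet (\<psi> k) x - wjet CY w x)) \<longlonglongrightarrow> 0"
    using Z.Hcl_approx[OF assms] by blast
  have d: "(\<lambda>x. cjet (\<psi> n) x - wjet CY w x) \<in> L2 Z.M" for n
    by (intro L2_diff Z.cjet_L2 p Z.Hcl_L2(4)[OF assms])
  have l1: "(\<lambda>n. nrm Z.M (\<lambda>x. \<psi> n x - w x)) \<longlonglongrightarrow> 0"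
    by (rule lim0_squeeze[OF _ p(3)]) (use nrm_fst_le[OF d] in \<open>simp add: cjet_def wjet_def\<close>)
  have l2: "(\<lambda>n. nrm Z.M (\<lambda>x. grad (\<psi> n) x - weak_grad CY w x)) \<longlonglongrightarrow> 0"
    by (rule lim0_squeeze[OF _ p(3)]) (use nrm_snd_le[OF d] in \<open>simp add: cjet_def wjet_def\<close>)
  show ?thesis
  proof (rule LIMSEQ_le)
    show "(\<lambda>n. (nrm Z.M (\<psi> n))\<^sup>2) \<longlonglongrightarrow> (nrm Z.M w)\<^sup>2"
      by (intro tendsto_power nrm_tendsto[OF Z.smooth_L2[OF p(1)] Z.Hcl_L2(1)[OF assms] l1])
    show "(\<lambda>n. K * (LINT y|W.M. 1) * (nrm Z.M (grad (\<psi> n)))\<^sup>2) \<longlonglongrightarrow>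
        K * (LINT y|W.M. 1) * (nrm Z.M (weak_grad CY w))\<^sup>2"
      by (intro tendsto_intros nrm_tendsto[OF Z.smooth_grad_L2[OF p(1)] Z.Hcl_L2(2)[OF assms] l2])
    show "\<exists>N. \<forall>n\<ge>N. (nrm Z.M (\<psi> n))\<^sup>2 \<le> K * (LINT y|W.M. 1) * (nrm Z.M (grad (\<psi> n)))\<^sup>2"
      using poincare_smooth[OF p(1)] DL_top[OF p(2)] by blast
  qed
qed

lemma has_trace_iff:
  assumes w: "w \<in> H1 (y_weight s) CY"
  shows "has_trace s \<Omega> Y w t \<longleftrightarrow> t \<in> L2 N \<and>
    (\<exists>\<psi>. (\<forall>k. smooth (\<psi> k)) \<and> (\<lambda>k. nrm Z.M (\<lambda>x. cjet (\<psi> k) x - wjet CY w x)) \<longlonglongrightarrow> 0 \<and>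
      (\<lambda>k. nrm N (\<lambda>x. \<psi> k (x, 0) - t x)) \<longlonglongrightarrow> 0)"
  unfolding has_trace_def Z.H1_approx_iff[OF w] norm_L2_eq_nrm by blast

lemma trace_diff_le:
  assumes "smooth f" "smooth g" "F \<in> L2 Z.M"
  shows "nrm N (\<lambda>x. f (x, 0) - g (x, 0)) \<le> Ct * (nrm Z.M (\<lambda>x. cjet f x - F x) + nrm Z.M (\<lambda>x. cjet g x - F x))"
proof -
  have "nrm N (\<lambda>x. f (x, 0) - g (x, 0)) \<le> Ct * nrm Z.M (cjet (\<lambda>z. f z - g z))"
    using trace_inequality[OF smooth_diff[OF assms(1,2)]] by simp
  also have "cjet (\<lambda>z. f z - g z) = (\<lambda>z. cjet f z - cjet g z)"
    by (auto simp: cjet_def grad_diff assms)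
  also have "nrm Z.M (\<lambda>z. cjet f z - cjet g z) \<le> nrm Z.M (\<lambda>x. cjet f x - F x) + nrm Z.M (\<lambda>x. cjet g x - F x)"
    using nrm_triangle_diff[OF Z.cjet_L2[OF assms(1)] assms(3) Z.cjet_L2[OF assms(2)]]
      nrm_minus_commute[of Z.M F "cjet g"] by simp
  finally show ?thesis
    using K_pos by (simp add: Ct_def mult_left_mono add_nonneg_nonneg)
qed

text \<open>\<open>has_trace\<close> asserts convergence for one approximating sequence only. The
  trace inequality for the difference of two sequences transfers it to any other one, which makes
  the choice in \<open>tr\<close> harmless.\<close>

lemma has_trace_limit:
  assumes w: "w \<in> H1 (y_weight s) CY" and t: "has_trace s \<Omega> Y w t"
    and p: "\<And>k. smooth (\<psi> k)" "(\<lambda>k. nrm Z.M (\<lambda>x. cjet (\<psi> k) x - wjet CY w x)) \<longlonglongrightarrow> 0"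
  shows "(\<lambda>k. nrm N (\<lambda>x. \<psi> k (x, 0) - t x)) \<longlonglongrightarrow> 0"
proof -
  obtain \<eta> where q: "\<And>k. smooth (\<eta> k)" "(\<lambda>k. nrm Z.M (\<lambda>x. cjet (\<eta> k) x - wjet CY w x)) \<longlonglongrightarrow> 0"
    "(\<lambda>k. nrm N (\<lambda>x. \<eta> k (x, 0) - t x)) \<longlonglongrightarrow> 0" and t2: "t \<in> L2 N"
    using t unfolding has_trace_iff[OF w] by blast
  show ?thesis
  proof (rule lim0_squeeze)
    show "\<bar>nrm N (\<lambda>x. \<psi> k (x, 0) - t x)\<bar> \<le> Ct * (nrm Z.M (\<lambda>x. cjet (\<psi> k) x - wjet CY w x) + nrm Z.M (\<lambda>x. cjet (\<eta> k) x - wjet CY w x))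
        + nrm N (\<lambda>x. \<eta> k (x, 0) - t x)" for k
      using nrm_triangle_diff[OF smooth_trace_L2[OF p(1)] smooth_trace_L2[OF q(1)] t2, of k 0 k 0]
        trace_diff_le[OF p(1) q(1) Z.H1D(4)[OF w], of k k] by simp
    show "(\<lambda>k. Ct * (nrm Z.M (\<lambda>x. cjet (\<psi> k) x - wjet CY w x) + nrm Z.M (\<lambda>x. cjet (\<eta> k) x - wjet CY w x))
        + nrm N (\<lambda>x. \<eta> k (x, 0) - t x)) \<longlonglongrightarrow> 0"
      using tendsto_add[OF tendsto_mult_left[OF tendsto_add[OF p(2) q(2)], of Ct] q(3)] by simp
  qed
qed

lemma has_trace_exists:
  assumes w: "w \<in> Z.Hcl D"
  shows "\<exists>t. has_trace s \<Omega> Y w t"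
proof -
  obtain \<psi> where p1: "\<And>k. smooth (\<psi> k)" and "\<And>k. D (\<psi> k)"
    and p2: "(\<lambda>k. nrm Z.M (\<lambda>x. cjet (\<psi> k) x - wjet CY w x)) \<longlonglongrightarrow> 0"
    using Z.Hcl_approx[OF w] by blast
  note p = p1 p2
  obtain t where t: "t \<in> L2 N" "(\<lambda>k. nrm N (\<lambda>x. \<psi> k (x, 0) - t x)) \<longlonglongrightarrow> 0"
  proof (rule L2_complete[OF finite_N, of "\<lambda>k x. \<psi> k (x, 0)"])
    show "(\<lambda>x. \<psi> k (x, 0)) \<in> L2 N" for k by (rule smooth_trace_L2[OF p(1)])
    fix e :: real assume e: "0 < e"
    have ct: "0 \<le> Ct" using K_pos by (simp add: Ct_def add_nonneg_nonneg)
    \<comment> \<open>Two errors of this size, multiplied by \<open>Ct\<close>, stay below e; the 1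
      keeps the denominator positive in every case.\<close>
    then have "0 < e / (2 * (Ct + 1))" using e by simp
    from order_tendstoD(2)[OF p(2) this]
    obtain m where m: "\<And>k. k \<ge> m \<Longrightarrow> nrm Z.M (\<lambda>x. cjet (\<psi> k) x - wjet CY w x) < e / (2 * (Ct + 1))"
      by (auto simp: eventually_sequentially)
    define a where "a = e / (2 * (Ct + 1))"
    have a: "2 * (Ct + 1) * a = e" "0 < a" using e ct by (simp_all add: a_def)
    have "nrm N (\<lambda>x. \<psi> i (x, 0) - \<psi> j (x, 0)) < e" if "i \<ge> m" "j \<ge> m" for i j
    proof -
      have "nrm N (\<lambda>x. \<psi> i (x, 0) - \<psi> j (x, 0)) \<le> Ct * (a + a)"
        unfolding a_def
        using trace_diff_le[OF p(1) p(1) Z.Hcl_L2(4)[OF w], of i j] m[OF that(1)] m[OF that(2)] ct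
        by (smt (verit) mult_left_mono)
      also have "\<dots> < e" using a by (simp add: algebra_simps)
      finally show ?thesis .
    qed
    then show "\<exists>N'. \<forall>m\<ge>N'. \<forall>n\<ge>N'. nrm N (\<lambda>x. \<psi> m (x, 0) - \<psi> n (x, 0)) < e" by blast
  qed
  with p show ?thesis unfolding has_trace_iff[OF Z.Hcl_H1[OF w]] by blast
qed

abbreviation "T \<equiv> tr s \<Omega> Y"

lemma tr_has_trace: "w \<in> Z.Hcl D \<Longrightarrow> has_trace s \<Omega> Y w (T w)"
  unfolding tr_def by (rule someI_ex[OF has_trace_exists])

lemma tr_L2: "w \<in> Z.Hcl D \<Longrightarrow> T w \<in> L2 N"
  using tr_has_trace by (auto simp: has_trace_def)

lemma tr_limit:
  assumes "w \<in> Z.Hcl D" "\<And>k. smooth (\<psi> k)" "(\<lambda>k. nrm Z.M (\<lambda>x. cjet (\<psi> k) x - wjet CY w x)) \<longlonglongrightarrow> 0"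
  shows "(\<lambda>k. nrm N (\<lambda>x. \<psi> k (x, 0) - T w x)) \<longlonglongrightarrow> 0"
  by (rule has_trace_limit[OF Z.Hcl_H1[OF assms(1)] tr_has_trace[OF assms(1)] assms(2,3)])

lemma tr_eqI:
  assumes "w \<in> Z.Hcl D" "\<And>k. smooth (\<psi> k)" "(\<lambda>k. nrm Z.M (\<lambda>x. cjet (\<psi> k) x - wjet CY w x)) \<longlonglongrightarrow> 0"
    "t \<in> L2 N" "(\<lambda>k. nrm N (\<lambda>x. \<psi> k (x, 0) - t x)) \<longlonglongrightarrow> 0"
  shows "AE x in N. T w x = t x"
  by (rule nrm_limit_unique[OF smooth_trace_L2[OF assms(2)] tr_L2[OF assms(1)] assms(4) tr_limit[OF assms(1-3)] assms(5)])

lemma tr_add: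
  assumes D: "Z.lin D" and u: "u \<in> Z.Hcl D" and w: "w \<in> Z.Hcl D"
  shows "AE x in N. T (\<lambda>z. u z + w z) x = T u x + T w x"
proof -
  obtain \<psi> where p1: "\<And>k. smooth (\<psi> k)" and "\<And>k. D (\<psi> k)"
    and p2: "(\<lambda>k. nrm Z.M (\<lambda>x. cjet (\<psi> k) x - wjet CY u x)) \<longlonglongrightarrow> 0"
    using Z.Hcl_approx[OF u] by blast
  note p = p1 p2
  obtain \<eta> where q1: "\<And>k. smooth (\<eta> k)" and "\<And>k. D (\<eta> k)"
    and q2: "(\<lambda>k. nrm Z.M (\<lambda>x. cjet (\<eta> k) x - wjet CY w x)) \<longlonglongrightarrow> 0"
    using Z.Hcl_approx[OF w] by blast
  note q = q1 q2
  note uw = Z.Hcl_add[OF D u w]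
  have "(\<lambda>k. nrm Z.M (\<lambda>x. (cjet (\<psi> k) x + cjet (\<eta> k) x) - (wjet CY u x + wjet CY w x))) \<longlonglongrightarrow> 0"
    by (rule nrm_lim_add[OF Z.cjet_L2[OF p(1)] Z.cjet_L2[OF q(1)] Z.Hcl_L2(4)[OF u] Z.Hcl_L2(4)[OF w] p(2) q(2)])
  moreover have "nrm Z.M (\<lambda>x. (cjet (\<psi> k) x + cjet (\<eta> k) x) - (wjet CY u x + wjet CY w x)) =
      nrm Z.M (\<lambda>x. cjet (\<lambda>z. \<psi> k z + \<eta> k z) x - wjet CY (\<lambda>z. u z + w z) x)" for k
  proof (rule nrm_cong_AE)
    show "AE x in Z.M. (cjet (\<psi> k) x + cjet (\<eta> k) x) - (wjet CY u x + wjet CY w x) =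
        cjet (\<lambda>z. \<psi> k z + \<eta> k z) x - wjet CY (\<lambda>z. u z + w z) x"
      using uw(2) by eventually_elim (simp add: cjet_def wjet_def grad_add p q)
  qed (auto intro!: L2_measurable L2_diff L2_add Z.cjet_L2 smooth_add p q Z.Hcl_L2(4)[OF u] Z.Hcl_L2(4)[OF w] Z.Hcl_L2(4)[OF uw(1)])
  ultimately have l: "(\<lambda>k. nrm Z.M (\<lambda>x. cjet (\<lambda>z. \<psi> k z + \<eta> k z) x - wjet CY (\<lambda>z. u z + w z) x)) \<longlonglongrightarrow> 0" by simp
  show ?thesis
    by (rule tr_eqI[OF uw(1) smooth_add[OF p(1) q(1)] l L2_add[OF tr_L2[OF u] tr_L2[OF w]]
          nrm_lim_add[OF smooth_trace_L2[OF p(1)] smooth_trace_L2[OF q(1)] tr_L2[OF u] tr_L2[OF w] tr_limit[OF u p] tr_limit[OF w q]]])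
qed

lemma tr_cmult:
  assumes D: "Z.lin D" and u: "u \<in> Z.Hcl D"
  shows "AE x in N. T (\<lambda>z. c * u z) x = c * T u x"
proof -
  obtain \<psi> where p1: "\<And>k. smooth (\<psi> k)" and "\<And>k. D (\<psi> k)"
    and p2: "(\<lambda>k. nrm Z.M (\<lambda>x. cjet (\<psi> k) x - wjet CY u x)) \<longlonglongrightarrow> 0"
    using Z.Hcl_approx[OF u] by blast
  note p = p1 p2
  note cu = Z.Hcl_cmult[OF D u, of c]
  have sm: "smooth (\<lambda>z. c * \<psi> k z)" for k by (intro smooth_mult p) auto
  have "(\<lambda>k. nrm Z.M (\<lambda>x. c *\<^sub>R cjet (\<psi> k) x - c *\<^sub>R wjet CY u x)) \<longlonglongrightarrow> 0"
    by (rule nrm_lim_scaleR[OF p(2)])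
  moreover have "nrm Z.M (\<lambda>x. c *\<^sub>R cjet (\<psi> k) x - c *\<^sub>R wjet CY u x) =
      nrm Z.M (\<lambda>x. cjet (\<lambda>z. c * \<psi> k z) x - wjet CY (\<lambda>z. c * u z) x)" for k
  proof (rule nrm_cong_AE)
    show "AE x in Z.M. c *\<^sub>R cjet (\<psi> k) x - c *\<^sub>R wjet CY u x =
        cjet (\<lambda>z. c * \<psi> k z) x - wjet CY (\<lambda>z. c * u z) x"
      using cu(2) by eventually_elim (simp add: cjet_def wjet_def grad_cmult p)
  qed (auto intro!: L2_measurable L2_diff L2_scaleR Z.cjet_L2 sm p Z.Hcl_L2(4)[OF u] Z.Hcl_L2(4)[OF cu(1)])
  ultimately have l: "(\<lambda>k. nrm Z.M (\<lambda>x. cjet (\<lambda>z. c * \<psi> k z) x - wjet CY (\<lambda>z. c * u z) x)) \<longlonglongrightarrow> 0" by simp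
  have l2: "(\<lambda>k. nrm N (\<lambda>x. c * \<psi> k (x, 0) - c * T u x)) \<longlonglongrightarrow> 0"
    using nrm_lim_scaleR[OF tr_limit[OF u p], of c] by simp
  show ?thesis by (rule tr_eqI[OF cu(1) sm l L2_cmult[OF tr_L2[OF u]] l2])
qed

end

subsection \<open>The extension profile\<close>

text \<open>Up to normalization, \<open>hyp0 \<nu> (t\<^sup>2 / 4)\<close> is \<open>t powr (1 - \<nu>)\<close> times the modified Bessel
  function of the first kind of order \<open>\<nu> - 1\<close>.\<close>

definition hyp0_coeff :: "real \<Rightarrow> nat \<Rightarrow> real" where
  "hyp0_coeff \<nu> m = inverse (fact m * pochhammer \<nu> m)"

definition hyp0 :: "real \<Rightarrow> real \<Rightarrow> real" where
  "hyp0 \<nu> t = (\<Sum>m. hyp0_coeff \<nu> m * t ^ m)"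

lemma hyp0_coeff_pos: "0 < \<nu> \<Longrightarrow> 0 < hyp0_coeff \<nu> m"
  by (simp add: hyp0_coeff_def pochhammer_pos)

text \<open>A lower bound independent of m, which makes the exponential series a majorant of
  \<open>hyp0\<close>; the minimum covers the empty product, which is 1.\<close>

lemma pochhammer_ge_min:
  fixes \<nu> :: real
  assumes "0 < \<nu>"
  shows "min 1 \<nu> \<le> pochhammer \<nu> m"
proof (cases m)
  case (Suc n)
  have "1 \<le> pochhammer (\<nu> + 1) n"
  proof (induction n)
    case (Suc n)
    have "1 * 1 \<le> pochhammer (\<nu> + 1) n * (\<nu> + 1 + real n)"
      using Suc assms by (intro mult_mono) auto
    then show ?case by (simp add: pochhammer_Suc)
  qed simp
  then have "\<nu> * 1 \<le> \<nu> * pochhammer (\<nu> + 1) n" using assms by (intro mult_left_mono) auto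
  then show ?thesis by (simp add: Suc pochhammer_rec)
qed simp

lemma summable_hyp0:
  assumes "0 < \<nu>"
  shows "summable (\<lambda>m. hyp0_coeff \<nu> m * t ^ m)"
proof (rule summable_comparison_test)
  have "norm (hyp0_coeff \<nu> m * t ^ m) \<le> inverse (min 1 \<nu>) * (inverse (fact m) * \<bar>t\<bar> ^ m)" for m
  proof -
    have "inverse (pochhammer \<nu> m) \<le> inverse (min 1 \<nu>)"
      using pochhammer_ge_min[OF assms] assms by (intro le_imp_inverse_le) auto
    then have "inverse (pochhammer \<nu> m) * (inverse (fact m) * \<bar>t\<bar> ^ m) \<le> inverse (min 1 \<nu>) * (inverse (fact m) * \<bar>t\<bar> ^ m)"
      by (intro mult_right_mono) auto
    then show ?thesis
      using pochhammer_pos[OF assms, of m] by (simp add: hyp0_coeff_def abs_mult power_abs mult_ac)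
  qed
  then show "\<exists>N. \<forall>n\<ge>N. norm (hyp0_coeff \<nu> n * t ^ n) \<le> inverse (min 1 \<nu>) * (inverse (fact n) * \<bar>t\<bar> ^ n)"
    by blast
  show "summable (\<lambda>n. inverse (min 1 \<nu>) * (inverse (fact n) * \<bar>t\<bar> ^ n))"
    by (intro summable_mult summable_exp)
qed

lemma hyp0_coeff_Suc:
  "0 < \<nu> \<Longrightarrow> real (Suc n) * hyp0_coeff \<nu> (Suc n) = hyp0_coeff (\<nu> + 1) n / \<nu>"
  using pochhammer_pos[of "\<nu> + 1" n]
  by (simp add: hyp0_coeff_def pochhammer_rec field_simps del: of_nat_Suc)

lemma hyp0_deriv:
  assumes "0 < \<nu>"
  shows "(hyp0 \<nu> has_real_derivative hyp0 (\<nu> + 1) t / \<nu>) (at t)"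
proof -
  have "((\<lambda>t. \<Sum>m. hyp0_coeff \<nu> m * t ^ m) has_real_derivative (\<Sum>m. diffs (hyp0_coeff \<nu>) m * t ^ m)) (at t)"
    by (rule termdiffs_strong_converges_everywhere[OF summable_hyp0[OF assms]])
  moreover have "(\<Sum>m. diffs (hyp0_coeff \<nu>) m * t ^ m) = (\<Sum>m. (hyp0_coeff (\<nu> + 1) m * t ^ m) / \<nu>)"
    unfolding diffs_def using hyp0_coeff_Suc[OF assms] by (simp del: of_nat_Suc)
  moreover have "\<dots> = hyp0 (\<nu> + 1) t / \<nu>"
    unfolding hyp0_def by (rule suminf_divide[OF summable_hyp0]) (use assms in simp)
  ultimately show ?thesis unfolding hyp0_def[abs_def] by simp
qed

lemma hyp0_at_0 [simp]: "hyp0 \<nu> 0 = 1"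
  using powser_zero[of "hyp0_coeff \<nu>"] by (simp add: hyp0_def hyp0_coeff_def)

lemma hyp0_pos:
  assumes "0 < \<nu>" "0 \<le> t"
  shows "0 < hyp0 \<nu> t"
  unfolding hyp0_def
  by (rule suminf_pos2[OF summable_hyp0[OF assms(1)], where i = 0])
    (use assms(2) hyp0_coeff_pos[OF assms(1)] in \<open>auto intro!: mult_nonneg_nonneg simp: less_imp_le\<close>)

text \<open>The three-term recurrence of modified Bessel functions in terms of their power series.
  It lets the derivative in \<open>hyp0_powr_deriv\<close> collapse to a single term.\<close>

lemma hyp0_contiguous:
  assumes "0 < \<nu>"
  shows "hyp0 \<nu> t = hyp0 (\<nu> + 1) t + t / (\<nu> * (\<nu> + 1)) * hyp0 (\<nu> + 2) t"
proof -
  have s1: "summable (\<lambda>m. hyp0_coeff (\<nu> + 1) m * t ^ m)" "summable (\<lambda>m. hyp0_coeff (\<nu> + 2) m * t ^ m)"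
    using assms by (intro summable_hyp0; simp)+
  \<comment> \<open>The last series multiplied by t, shifted by one index so that equal powers of t
    stand at equal indices.\<close>
  define c where "c m = (case m of 0 \<Rightarrow> 0 | Suc n \<Rightarrow> t / (\<nu> * (\<nu> + 1)) * (hyp0_coeff (\<nu> + 2) n * t ^ n))" for m
  have "(\<lambda>n. c (Suc n)) sums (t / (\<nu> * (\<nu> + 1)) * hyp0 (\<nu> + 2) t)"
    unfolding c_def hyp0_def nat.case by (intro sums_mult summable_sums s1)
  then have c: "c sums (t / (\<nu> * (\<nu> + 1)) * hyp0 (\<nu> + 2) t)"
    using sums_Suc_iff[of c] by (simp add: c_def)
  have "(\<lambda>m. hyp0_coeff (\<nu> + 1) m * t ^ m + c m) sums (hyp0 (\<nu> + 1) t + t / (\<nu> * (\<nu> + 1)) * hyp0 (\<nu> + 2) t)"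
    by (intro sums_add c) (simp add: hyp0_def summable_sums s1)
  moreover have "hyp0_coeff (\<nu> + 1) m * t ^ m + c m = hyp0_coeff \<nu> m * t ^ m" for m
  proof (cases m)
    case 0
    then show ?thesis by (simp add: c_def hyp0_coeff_def)
  next
    case (Suc n)
    define p where "p = pochhammer (\<nu> + 2) n"
    have p: "0 < p" unfolding p_def using assms by (intro pochhammer_pos) simp
    have 1: "pochhammer (\<nu> + 1) (Suc n) = (\<nu> + 1) * p"
      using pochhammer_rec[of "\<nu> + 1" n] by (simp add: p_def add.assoc)
    have 2: "pochhammer \<nu> (Suc n) * (\<nu> + real n + 1) = \<nu> * ((\<nu> + 1) * p)"
    proof -
      have "pochhammer \<nu> (Suc n) * (\<nu> + real (Suc n)) = pochhammer \<nu> (Suc (Suc n))"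
        by (rule pochhammer_Suc[symmetric])
      also have "\<dots> = \<nu> * ((\<nu> + 1) * p)"
        by (simp only: pochhammer_rec[of \<nu>] 1)
      finally show ?thesis by (simp add: algebra_simps)
    qed
    have q: "0 < pochhammer \<nu> (Suc n)" using assms by (rule pochhammer_pos)
    have z: "inverse (fact (Suc n) * ((\<nu> + 1) * p)) + inverse (\<nu> * (\<nu> + 1)) * inverse (fact n * p)
        = inverse (fact (Suc n) * pochhammer \<nu> (Suc n))"
    proof -
      have "\<nu> + real n + 1 > 0" using assms by simp
      then have "pochhammer \<nu> (Suc n) = \<nu> * ((\<nu> + 1) * p) / (\<nu> + real n + 1)"
        using 2 by (simp add: field_simps)
      then have "inverse (fact (Suc n) * pochhammer \<nu> (Suc n)) = (\<nu> + real n + 1) / (fact (Suc n) * (\<nu> * ((\<nu> + 1) * p)))"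
        by (simp add: field_simps)
      also have "\<dots> = \<nu> / (fact (Suc n) * (\<nu> * ((\<nu> + 1) * p))) + (real (Suc n)) / (fact (Suc n) * (\<nu> * ((\<nu> + 1) * p)))"
        by (simp add: add_divide_distrib[symmetric] algebra_simps)
      also have "\<nu> / (fact (Suc n) * (\<nu> * ((\<nu> + 1) * p))) = inverse (fact (Suc n) * ((\<nu> + 1) * p))"
      proof -
        have "\<nu> / (F * (\<nu> * X)) = inverse (F * X)" for F X :: real
          using assms by (simp add: divide_simps)
        then show ?thesis by blast
      qed
      also have "(real (Suc n)) / (fact (Suc n) * (\<nu> * ((\<nu> + 1) * p))) = inverse (\<nu> * (\<nu> + 1)) * inverse (fact n * p)"
      proof -
        have "r / (r * F * (\<nu> * ((\<nu> + 1) * p))) = inverse (\<nu> * (\<nu> + 1)) * inverse (F * p)" if "r \<noteq> 0" for r F :: real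
          using that by (simp add: divide_simps)
        from this[of "real (Suc n)" "fact n"] show ?thesis by (simp only: fact_Suc of_nat_neq_0 not_False_eq_True of_nat_mult)
      qed
      finally show ?thesis by simp
    qed
    have "hyp0_coeff (\<nu> + 1) m * t ^ m + c m = t ^ Suc n *
        (inverse (fact (Suc n) * ((\<nu> + 1) * p)) + inverse (\<nu> * (\<nu> + 1)) * inverse (fact n * p))"
      by (simp only: Suc c_def hyp0_coeff_def 1 p_def[symmetric] nat.case)
        (simp add: divide_inverse algebra_simps del: fact_Suc)
    then show ?thesis unfolding z by (simp add: hyp0_coeff_def Suc mult.commute del: fact_Suc)
  qed
  ultimately have "(\<lambda>m. hyp0_coeff \<nu> m * t ^ m) sums (hyp0 (\<nu> + 1) t + t / (\<nu> * (\<nu> + 1)) * hyp0 (\<nu> + 2) t)" by simp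
  then show ?thesis unfolding hyp0_def[of \<nu>] by (rule sums_unique[symmetric])
qed

lemma hyp0_scaled_deriv:
  assumes "0 < \<nu>"
  shows "((\<lambda>y. hyp0 \<nu> (lam * y\<^sup>2 / 4)) has_real_derivative lam * y / (2 * \<nu>) * hyp0 (\<nu> + 1) (lam * y\<^sup>2 / 4)) (at y)"
  by (rule DERIV_chain2[OF hyp0_deriv[OF assms], THEN DERIV_cong])
    (auto intro!: derivative_eq_intros simp: field_simps)

text \<open>With \<nu> = 1 - s this is the equation for the flux of the first fundamental solution
  below, with \<nu> = s it gives the derivative of the second one.\<close>

lemma hyp0_powr_deriv:
  assumes "0 < \<nu>" "0 < y"
  shows "((\<lambda>y. y powr (2 * \<nu>) * hyp0 (\<nu> + 1) (lam * y\<^sup>2 / 4)) has_real_derivative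
    2 * \<nu> * y powr (2 * \<nu> - 1) * hyp0 \<nu> (lam * y\<^sup>2 / 4)) (at y)"
proof -
  have p: "y powr (2 * \<nu>) = y powr (2 * \<nu> - 1) * y"
    using assms(2) powr_add[of y "2 * \<nu> - 1" 1] by simp
  have "((\<lambda>y. y powr (2 * \<nu>) * hyp0 (\<nu> + 1) (lam * y\<^sup>2 / 4)) has_real_derivative
      2 * \<nu> * y powr (2 * \<nu> - 1) * hyp0 (\<nu> + 1) (lam * y\<^sup>2 / 4)
      + lam * y / (2 * (\<nu> + 1)) * hyp0 (\<nu> + 1 + 1) (lam * y\<^sup>2 / 4) * y powr (2 * \<nu>)) (at y)"
    using assms by (intro DERIV_mult hyp0_scaled_deriv has_real_derivative_powr) auto
  moreover have "2 * \<nu> * y powr (2 * \<nu> - 1) * hyp0 (\<nu> + 1) (lam * y\<^sup>2 / 4)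
      + lam * y / (2 * (\<nu> + 1)) * hyp0 (\<nu> + 1 + 1) (lam * y\<^sup>2 / 4) * y powr (2 * \<nu>)
      = 2 * \<nu> * y powr (2 * \<nu> - 1) * hyp0 \<nu> (lam * y\<^sup>2 / 4)"
  proof -
    have "\<nu> \<noteq> 0" "\<nu> + 1 \<noteq> 0" using assms by auto
    then show ?thesis
      unfolding hyp0_contiguous[OF assms(1), of "lam * y\<^sup>2 / 4"] p
      by (simp add: add.assoc) (simp add: divide_simps, simp add: algebra_simps power2_eq_square)
  qed
  ultimately show ?thesis by simp
qed

text \<open>Monotonicity with derivatives required only inside the interval, as the profile
  equations hold only for positive y.\<close>

lemma deriv_nonneg_le:
  fixes f :: "real \<Rightarrow> real"
  assumes "a \<le> b" "continuous_on {a..b} f"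
    and "\<And>x. a < x \<Longrightarrow> x < b \<Longrightarrow> (f has_real_derivative f' x) (at x) \<and> 0 \<le> f' x"
  shows "f a \<le> f b"
proof (cases "a = b")
  case False
  then have "a < b" using assms(1) by simp
  have "\<exists>z. a < z \<and> z < b \<and> f b - f a = (b - a) * f' z"
    using MVT[OF \<open>a < b\<close> assms(2)] assms(3) by (metis DERIV_unique real_differentiable_def)
  then obtain z where "a < z" "z < b" "f b - f a = (b - a) * f' z" by blast
  then have "0 \<le> f b - f a" using assms(3)[of z] \<open>a < b\<close> by simp
  then show ?thesis by simp
qed simp

text \<open>\<open>g\<close> is the weighted flux \<open>- y powr (1 - 2s) * f'\<close>, so that the second order equation for \<open>f\<close>
  becomes a first order system.\<close>

definition profile :: "real \<Rightarrow> real \<Rightarrow> real \<Rightarrow> real \<Rightarrow> (real \<Rightarrow> real) \<Rightarrow> (real \<Rightarrow> real) \<Rightarrow> bool" where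
  "profile s Y d lam f g \<longleftrightarrow> continuous_on {0..} f \<and> continuous_on {0..} g \<and>
     (\<forall>y>0. (f has_real_derivative - (y powr (2 * s - 1)) * g y) (at y)) \<and>
     (\<forall>y>0. (g has_real_derivative - lam * y powr (1 - 2 * s) * f y) (at y)) \<and>
     (\<forall>y\<in>{0..Y}. 0 \<le> f y \<and> 0 \<le> g y \<and> g y \<le> d) \<and> f Y = 0 \<and> g 0 = d"

text \<open>A combination of two fundamental solutions is chosen to vanish at Y and normalized at 0.
  All sign conditions come from their constant Wronskian and from the positivity of the Bessel-type
  series.\<close>

lemma profile_exists:
  assumes s: "0 < s" "s < 1" and Y: "0 < Y" and d: "0 < d" and lam: "0 \<le> lam"
  shows "\<exists>f g. profile s Y d lam f g"
proof -
  define \<tau> where "\<tau> y = lam * y\<^sup>2 / 4" for y :: real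
  have \<tau>0: "0 \<le> \<tau> y" for y using lam by (simp add: \<tau>_def)
  \<comment> \<open>The solution with value 1 and flux 0 at 0; \<open>g1\<close> is its
    flux.\<close>
  define f1 where "f1 y = hyp0 (1 - s) (\<tau> y)" for y
  define g1 where "g1 y = - (lam / (2 * (1 - s))) * (y powr (2 * (1 - s)) * hyp0 (1 - s + 1) (\<tau> y))" for y
  \<comment> \<open>The solution with value 0 and flux -2s at 0; \<open>g2\<close> is its
    flux.\<close>
  define f2 where "f2 y = y powr (2 * s) * hyp0 (s + 1) (\<tau> y)" for y
  define g2 where "g2 y = - 2 * s * hyp0 s (\<tau> y)" for y
  have hc: "continuous_on S (\<lambda>y. hyp0 \<nu> (\<tau> y))" if "0 < \<nu>" for \<nu> S
    unfolding \<tau>_def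
    by (rule DERIV_continuous_on, rule has_field_derivative_at_within, rule hyp0_scaled_deriv[OF that])
  have pc: "continuous_on {0..} (\<lambda>y::real. y powr a)" if "0 < a" for a
    using that by (intro continuous_on_powr' continuous_intros) auto
  have c1: "continuous_on {0..} f1" "continuous_on {0..} g1" "continuous_on {0..} f2" "continuous_on {0..} g2"
    unfolding f1_def g1_def f2_def g2_def using s by (intro continuous_intros hc pc; simp)+
  have df1: "(f1 has_real_derivative - (y powr (2 * s - 1)) * g1 y) (at y)" if "0 < y" for y
  proof -
    have "y powr (2 * s - 1) * y powr (2 * (1 - s)) = y"
      using that by (simp add: powr_add[symmetric])
    then have "- (y powr (2 * s - 1)) * g1 y = lam * y / (2 * (1 - s)) * hyp0 (1 - s + 1) (\<tau> y)"
      by (simp add: g1_def mult_ac)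
    then show ?thesis
      using hyp0_scaled_deriv[of "1 - s" lam y] s unfolding f1_def[abs_def] \<tau>_def by simp
  qed
  have dg1: "(g1 has_real_derivative - lam * y powr (1 - 2 * s) * f1 y) (at y)" if "0 < y" for y
  proof -
    have "(g1 has_real_derivative - (lam / (2 * (1 - s))) * (2 * (1 - s) * y powr (2 * (1 - s) - 1) * hyp0 (1 - s) (\<tau> y))) (at y)"
      unfolding g1_def[abs_def] \<tau>_def using s that by (intro DERIV_cmult hyp0_powr_deriv) auto
    moreover have "- (lam / (2 * (1 - s))) * (2 * (1 - s) * y powr (2 * (1 - s) - 1) * hyp0 (1 - s) (\<tau> y))
        = - lam * y powr (1 - 2 * s) * f1 y"
    proof -
      have "- (lam / a) * (a * P * H) = - lam * P * H" if "a \<noteq> 0" for a P H :: real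
        using that by simp
      from this[of "2 * (1 - s)"] show ?thesis using s by (simp add: f1_def)
    qed
    ultimately show ?thesis by simp
  qed
  have df2: "(f2 has_real_derivative - (y powr (2 * s - 1)) * g2 y) (at y)" if "0 < y" for y
    using hyp0_powr_deriv[OF s(1) that, of lam] unfolding f2_def[abs_def] g2_def \<tau>_def by (simp add: mult_ac)
  have dg2: "(g2 has_real_derivative - lam * y powr (1 - 2 * s) * f2 y) (at y)" if "0 < y" for y
  proof -
    have "(g2 has_real_derivative - 2 * s * (lam * y / (2 * s) * hyp0 (s + 1) (\<tau> y))) (at y)"
      unfolding g2_def[abs_def] \<tau>_def by (intro DERIV_cmult hyp0_scaled_deriv s)
    moreover have "y powr (1 - 2 * s) * y powr (2 * s) = y" using that by (simp add: powr_add[symmetric])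
    then have "- 2 * s * (lam * y / (2 * s) * hyp0 (s + 1) (\<tau> y)) = - lam * y powr (1 - 2 * s) * f2 y"
      using s by (simp add: f2_def mult.assoc[symmetric])
    ultimately show ?thesis by simp
  qed
  have f1pos: "0 < f1 y" for y unfolding f1_def using s \<tau>0 by (intro hyp0_pos) auto
  have f2pos: "0 < f2 y" if "0 < y" for y
    unfolding f2_def using s \<tau>0 that by (intro mult_pos_pos hyp0_pos) auto
  \<comment> \<open>The weighted Wronskian is constant by the first order system and is evaluated at
    0.\<close>
  have W: "g1 y * f2 y - g2 y * f1 y = 2 * s" if y: "0 < y" for y
  proof -
    have "g1 y * f2 y - g2 y * f1 y = g1 0 * f2 0 - g2 0 * f1 0"
    proof (rule DERIV_isconst_end[OF y])
      show "continuous_on {0..y} (\<lambda>y. g1 y * f2 y - g2 y * f1 y)"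
        by (intro continuous_intros continuous_on_subset[OF c1(1)] continuous_on_subset[OF c1(2)]
            continuous_on_subset[OF c1(3)] continuous_on_subset[OF c1(4)]) auto
      fix x assume "0 < x" "x < y"
      show "((\<lambda>y. g1 y * f2 y - g2 y * f1 y) has_real_derivative 0) (at x)"
        by (rule DERIV_cong[OF DERIV_diff[OF DERIV_mult[OF dg1[OF \<open>0 < x\<close>] df2[OF \<open>0 < x\<close>]]
              DERIV_mult[OF dg2[OF \<open>0 < x\<close>] df1[OF \<open>0 < x\<close>]]]]) (simp add: algebra_simps)
    qed
    then show ?thesis using s by (simp add: g1_def f2_def g2_def f1_def \<tau>_def)
  qed
  \<comment> \<open>Chosen so that the flux at 0, which is \<open>k * 2 * s * f1 Y\<close>, equals
    d.\<close>
  define k where "k = d / (2 * s * f1 Y)"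
  have k: "0 < k" using d s f1pos[of Y] by (simp add: k_def)
  define f where "f y = k * (f2 Y * f1 y - f1 Y * f2 y)" for y
  define g where "g y = k * (f2 Y * g1 y - f1 Y * g2 y)" for y
  have fc: "continuous_on {0..} f" "continuous_on {0..} g"
    unfolding f_def g_def by (intro continuous_intros c1)+
  have df: "(f has_real_derivative - (y powr (2 * s - 1)) * g y) (at y)" if "0 < y" for y
    unfolding f_def[abs_def]
    by (rule DERIV_cong[OF DERIV_cmult[OF DERIV_diff[OF DERIV_cmult[OF df1[OF that]] DERIV_cmult[OF df2[OF that]]]]])
      (simp add: g_def algebra_simps)
  have dg: "(g has_real_derivative - lam * y powr (1 - 2 * s) * f y) (at y)" if "0 < y" for y
    unfolding g_def[abs_def]
    by (rule DERIV_cong[OF DERIV_cmult[OF DERIV_diff[OF DERIV_cmult[OF dg1[OF that]] DERIV_cmult[OF dg2[OF that]]]]])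
      (simp add: f_def algebra_simps)
  have g0: "g 0 = d" using f1pos[of Y] s by (simp add: g_def g1_def g2_def \<tau>_def k_def)
  have fY: "f Y = 0" by (simp add: f_def)
  \<comment> \<open>Nonnegativity of f means that \<open>f2 / f1\<close> is increasing; by the
    Wronskian its derivative is a positive multiple of a power of x.\<close>
  have f0: "0 \<le> f y" if "0 \<le> y" "y \<le> Y" for y
  proof -
    have "f2 y / f1 y \<le> f2 Y / f1 Y"
    proof (rule deriv_nonneg_le[OF that(2)])
      show "continuous_on {y..Y} (\<lambda>x. f2 x / f1 x)"
        using f1pos that(1) by (intro continuous_intros continuous_on_subset[OF c1(1)] continuous_on_subset[OF c1(3)])
          (auto simp: less_imp_neq[OF f1pos, THEN not_sym])
      fix x assume x: "y < x" "x < Y"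
      then have x0: "0 < x" using that by simp
      have "((\<lambda>x. f2 x / f1 x) has_real_derivative
          ((- (x powr (2 * s - 1)) * g2 x) * f1 x - f2 x * (- (x powr (2 * s - 1)) * g1 x)) / (f1 x * f1 x)) (at x)"
        using f1pos[of x] by (intro DERIV_divide df1 df2 x0) simp
      moreover have "(- (x powr (2 * s - 1)) * g2 x) * f1 x - f2 x * (- (x powr (2 * s - 1)) * g1 x)
          = x powr (2 * s - 1) * (2 * s)"
        unfolding W[OF x0, symmetric] by (simp add: algebra_simps)
      ultimately have "((\<lambda>x. f2 x / f1 x) has_real_derivative x powr (2 * s - 1) * (2 * s) / (f1 x * f1 x)) (at x)"
        by simp
      moreover have "0 \<le> x powr (2 * s - 1) * (2 * s) / (f1 x * f1 x)" using s f1pos[of x] by simp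
      ultimately show "((\<lambda>x. f2 x / f1 x) has_real_derivative x powr (2 * s - 1) * (2 * s) / (f1 x * f1 x)) (at x) \<and>
          0 \<le> x powr (2 * s - 1) * (2 * s) / (f1 x * f1 x)" by simp
    qed
    then have "f2 y * f1 Y \<le> f2 Y * f1 y"
      using f1pos[of y] f1pos[of Y] by (simp add: divide_le_eq le_divide_eq mult_ac)
    then show ?thesis using k by (simp add: f_def mult_ac)
  qed
  have gmono: "g z \<le> g y" if "0 \<le> y" "y \<le> z" "z \<le> Y" for y z
  proof -
    have "- g y \<le> - g z"
    proof (rule deriv_nonneg_le[OF that(2), of "\<lambda>x. - g x" "\<lambda>x. lam * x powr (1 - 2 * s) * f x"])
      show "continuous_on {y..z} (\<lambda>x. - g x)"
        by (intro continuous_intros continuous_on_subset[OF fc(2)]) (use that in auto)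
      fix x assume x: "y < x" "x < z"
      then have "0 < x" "x \<le> Y" using that by auto
      have "((\<lambda>x. - g x) has_real_derivative lam * x powr (1 - 2 * s) * f x) (at x)"
        by (rule DERIV_cong[OF DERIV_minus[OF dg[OF \<open>0 < x\<close>]]]) simp
      then show "((\<lambda>x. - g x) has_real_derivative lam * x powr (1 - 2 * s) * f x) (at x) \<and>
          0 \<le> lam * x powr (1 - 2 * s) * f x"
        using f0[of x] \<open>0 < x\<close> \<open>x \<le> Y\<close> lam by simp
    qed
    then show ?thesis by simp
  qed
  \<comment> \<open>At Y the combination defining g is k times the Wronskian. As the flux is
    nonincreasing, it is then nonnegative on the whole interval.\<close>
  have gY: "0 \<le> g Y" using W[OF Y] k s by (simp add: g_def mult_ac)
  have "0 \<le> f y \<and> 0 \<le> g y \<and> g y \<le> d" if "y \<in> {0..Y}" for y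
    using f0[of y] gmono[of y Y] gmono[of 0 y] gY g0 that by auto
  then have "profile s Y d lam f g"
    unfolding profile_def using fc df dg fY g0 by auto
  then show ?thesis by blast
qed

text \<open>The flux lies between 0 and d. The upper bound limits how fast f can fall from f 0 to f
  Y = 0, which gives the first claim; the resulting lower bound on f near 0 forces a loss of flux
  proportional to \<open>lam\<close>, which gives the second.\<close>

lemma profile_bounds:
  assumes s: "0 < s" "s < 1" and Y: "0 < Y" and d: "0 < d" and lam: "0 \<le> lam" and p: "profile s Y d lam f g"
  shows "f 0 \<le> d * Y powr (2 * s) / (2 * s)"
    "lam powr s * f 0 \<le> (4 * (1 - s) * d * (d / s) powr ((1 - s) / s)) powr s"
    "\<And>y. y \<in> {0..Y} \<Longrightarrow> f y \<le> f 0"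
proof -
  have fc: "continuous_on {0..} f" and gc: "continuous_on {0..} g"
    and df: "\<And>y. 0 < y \<Longrightarrow> (f has_real_derivative - (y powr (2 * s - 1)) * g y) (at y)"
    and dg: "\<And>y. 0 < y \<Longrightarrow> (g has_real_derivative - lam * y powr (1 - 2 * s) * f y) (at y)"
    and pos: "\<And>y. 0 \<le> y \<Longrightarrow> y \<le> Y \<Longrightarrow> 0 \<le> f y \<and> 0 \<le> g y \<and> g y \<le> d"
    and fY: "f Y = 0" and g0: "g 0 = d"
    using p by (auto simp: profile_def)
  have pc: "continuous_on {0..} (\<lambda>y::real. y powr a)" if "0 < a" for a
    using that by (intro continuous_on_powr' continuous_intros) auto
  have low: "f 0 - d * y powr (2 * s) / (2 * s) \<le> f y" if y: "0 \<le> y" "y \<le> Y" for y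
  proof -
    have "f 0 + d / (2 * s) * 0 powr (2 * s) \<le> f y + d / (2 * s) * y powr (2 * s)"
    proof (rule deriv_nonneg_le[OF y(1), of "\<lambda>y. f y + d / (2 * s) * y powr (2 * s)" "\<lambda>y. y powr (2 * s - 1) * (d - g y)"])
      show "continuous_on {0..y} (\<lambda>y. f y + d / (2 * s) * y powr (2 * s))"
        using s by (intro continuous_intros continuous_on_subset[OF fc] continuous_on_subset[OF pc]) auto
      fix x assume x: "0 < x" "x < y"
      have "((\<lambda>y. f y + d / (2 * s) * y powr (2 * s)) has_real_derivative
          - (x powr (2 * s - 1)) * g x + d / (2 * s) * (2 * s * x powr (2 * s - 1))) (at x)"
        by (intro DERIV_add DERIV_cmult df has_real_derivative_powr x)
      moreover have "- (x powr (2 * s - 1)) * g x + d / (2 * s) * (2 * s * x powr (2 * s - 1)) = x powr (2 * s - 1) * (d - g x)"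
        using s by (simp add: algebra_simps)
      ultimately show "((\<lambda>y. f y + d / (2 * s) * y powr (2 * s)) has_real_derivative x powr (2 * s - 1) * (d - g x)) (at x) \<and>
          0 \<le> x powr (2 * s - 1) * (d - g x)"
        using pos[of x] x y by simp
    qed
    then show ?thesis using s by simp
  qed
  show b1: "f 0 \<le> d * Y powr (2 * s) / (2 * s)" using low[of Y] fY Y by simp
  show "f y \<le> f 0" if y: "y \<in> {0..Y}" for y
  proof -
    have "- f 0 \<le> - f y"
    proof (rule deriv_nonneg_le[of 0 y "\<lambda>y. - f y" "\<lambda>y. y powr (2 * s - 1) * g y"])
      show "continuous_on {0..y} (\<lambda>y. - f y)" by (intro continuous_intros continuous_on_subset[OF fc]) auto
      fix x assume x: "0 < x" "x < y"
      have "((\<lambda>x. - f x) has_real_derivative x powr (2 * s - 1) * g x) (at x)"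
        by (rule DERIV_cong[OF DERIV_minus[OF df[OF x(1)]]]) simp
      then show "((\<lambda>x. - f x) has_real_derivative x powr (2 * s - 1) * g x) (at x) \<and> 0 \<le> x powr (2 * s - 1) * g x"
        using pos[of x] x y by simp
    qed (use y in auto)
    then show ?thesis by simp
  qed
  define \<sigma> where "\<sigma> = f 0"
  have \<sigma>0: "0 \<le> \<sigma>" using pos[of 0] Y by (simp add: \<sigma>_def)
  show "lam powr s * f 0 \<le> (4 * (1 - s) * d * (d / s) powr ((1 - s) / s)) powr s"
  proof (cases "\<sigma> = 0")
    case True
    then show ?thesis by (simp add: \<sigma>_def)
  next
    case False
    with \<sigma>0 have \<sigma>: "0 < \<sigma>" by simp
    \<comment> \<open>The height at which the largest possible drop
      \<open>d * h powr (2 * s) / (2 * s)\<close> equals half of \<sigma>.\<close>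
    define h where "h = (s * \<sigma> / d) powr (1 / (2 * s))"
    have hp: "h powr (2 * s) = s * \<sigma> / d" "0 < h"
      using s \<sigma> d by (auto simp: h_def powr_powr)
    \<comment> \<open>The first bound, rearranged: it shows that h does not exceed Y.\<close>
    have "2 * (s * \<sigma> / d) \<le> Y powr (2 * s)"
      using b1 s d by (simp add: \<sigma>_def field_simps)
    moreover have "x \<le> z" if "2 * x \<le> z" "0 \<le> x" for x z :: real
      using that by simp
    moreover have "0 \<le> s * \<sigma> / d" using s d \<sigma> by simp
    ultimately have "h powr (2 * s) \<le> Y powr (2 * s)"
      unfolding hp(1) by blast
    then have hY: "h \<le> Y"
      using powr_less_mono2[of "2 * s" Y h] s Y by (meson linorder_not_le mult_pos_pos zero_less_numeral less_imp_le)
    have fh: "\<sigma> / 2 \<le> f y" if y: "0 \<le> y" "y \<le> h" for y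
    proof -
      have "y powr (2 * s) \<le> h powr (2 * s)" using y s by (intro powr_mono2) auto
      then have "d * y powr (2 * s) / (2 * s) \<le> d * (s * \<sigma> / d) / (2 * s)"
        using s d unfolding hp(1) by (intro divide_right_mono mult_left_mono) auto
      also have "\<dots> = \<sigma> / 2" using s d by simp
      finally show ?thesis using low[of y] y hY by (simp add: \<sigma>_def)
    qed
    \<comment> \<open>\<open>q * h powr (2 * (1 - s))\<close> is the integral over (0,h) of
      \<open>lam * y powr (1 - 2 * s) * \<sigma> / 2\<close>, a lower bound for the flux lost
      there.\<close>
    define q where "q = lam * (\<sigma> / 2) / (2 * (1 - s))"
    have "- g 0 - q * 0 powr (2 * (1 - s)) \<le> - g h - q * h powr (2 * (1 - s))"
    proof (rule deriv_nonneg_le[of 0 h "\<lambda>y. - g y - q * y powr (2 * (1 - s))"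
          "\<lambda>y. lam * y powr (1 - 2 * s) * (f y - \<sigma> / 2)"])
      show "continuous_on {0..h} (\<lambda>y. - g y - q * y powr (2 * (1 - s)))"
        using s by (intro continuous_intros continuous_on_subset[OF gc] continuous_on_subset[OF pc]) auto
      fix x assume x: "0 < x" "x < h"
      have "((\<lambda>y. - g y - q * y powr (2 * (1 - s))) has_real_derivative
          - (- lam * x powr (1 - 2 * s) * f x) - q * (2 * (1 - s) * x powr (2 * (1 - s) - 1))) (at x)"
        by (intro DERIV_diff DERIV_minus DERIV_cmult dg has_real_derivative_powr x)
      moreover have "- (- lam * x powr (1 - 2 * s) * f x) - q * (2 * (1 - s) * x powr (2 * (1 - s) - 1))
          = lam * x powr (1 - 2 * s) * (f x - \<sigma> / 2)"
      proof -
        have "l / a * a = l" if "a \<noteq> 0" for l a :: real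
          using that by simp
        from this[of "2 * (1 - s)"] have "q * (2 * (1 - s)) = lam * (\<sigma> / 2)" using s unfolding q_def by (metis diff_gt_0_iff_gt less_irrefl mult_eq_0_iff zero_neq_numeral)
        then have "q * (2 * (1 - s) * P) = lam * (\<sigma> / 2) * P" for P
          by (simp only: mult.assoc[symmetric])
        moreover have "2 * (1 - s) - 1 = 1 - 2 * s" by simp
        ultimately have "q * (2 * (1 - s) * x powr (2 * (1 - s) - 1)) = lam * (\<sigma> / 2) * x powr (1 - 2 * s)"
          by (simp only:)
        then show ?thesis by (simp only:) (simp add: algebra_simps)
      qed
      ultimately show "((\<lambda>y. - g y - q * y powr (2 * (1 - s))) has_real_derivative lam * x powr (1 - 2 * s) * (f x - \<sigma> / 2)) (at x) \<and>
          0 \<le> lam * x powr (1 - 2 * s) * (f x - \<sigma> / 2)"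
        using fh[of x] x lam by simp
    qed (use hp in auto)
    moreover have "0 \<le> g h" using pos[of h] hp hY by simp
    ultimately have qd: "q * h powr (2 * (1 - s)) \<le> d" using g0 s by simp
    have hh: "h powr (2 * (1 - s)) = (s * \<sigma> / d) powr ((1 - s) / s)"
    proof -
      have "1 / (2 * s) * (2 * (1 - s)) = (1 - s) / s" using s by (simp add: divide_simps)
      then show ?thesis unfolding h_def powr_powr by (simp only:)
    qed
    \<comment> \<open>Expressing the power of h through \<sigma> turns the flux bound into a bound
      for \<open>lam * \<sigma> powr (1 / s)\<close>, of which the s-th power is taken.\<close>
    have "lam * \<sigma> powr (1 / s) = lam * \<sigma> * \<sigma> powr ((1 - s) / s)"
    proof -
      have "\<sigma> powr (1 / s) = \<sigma> powr (1 + (1 - s) / s)" using s by (simp add: field_simps)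
      then show ?thesis using \<sigma> by (simp add: powr_add)
    qed
    also have "\<sigma> powr ((1 - s) / s) = (d / s) powr ((1 - s) / s) * (s * \<sigma> / d) powr ((1 - s) / s)"
      using s d \<sigma> by (simp add: powr_mult[symmetric])
    also have "lam * \<sigma> * ((d / s) powr ((1 - s) / s) * (s * \<sigma> / d) powr ((1 - s) / s))
        = (d / s) powr ((1 - s) / s) * (4 * (1 - s)) * (q * h powr (2 * (1 - s)))"
    proof -
      have "4 * a * (lam * (\<sigma> / 2) / (2 * a)) = lam * \<sigma>" if "a \<noteq> 0" for a
        using that by simp
      from this[of "1 - s"] have "4 * (1 - s) * q = lam * \<sigma>" using s
        unfolding q_def by (metis diff_gt_0_iff_gt less_irrefl)
      then show ?thesis unfolding hh \<open>4 * (1 - s) * q = lam * \<sigma>\<close>[symmetric] by (simp only: mult_ac)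
    qed
    also have "\<dots> \<le> (d / s) powr ((1 - s) / s) * (4 * (1 - s)) * d"
      using s by (intro mult_left_mono qd) auto
    finally have "(lam * \<sigma> powr (1 / s)) powr s \<le> ((d / s) powr ((1 - s) / s) * (4 * (1 - s)) * d) powr s"
      using lam s by (intro powr_mono2) auto
    moreover have "(lam * \<sigma> powr (1 / s)) powr s = lam powr s * \<sigma>"
      using lam s \<sigma> by (simp add: powr_mult powr_powr)
    ultimately show ?thesis by (simp add: \<sigma>_def mult_ac)
  qed
qed

section \<open>Continuity of the trace operator\<close>

context cyl_domain
begin

lemma tr_bound:
  assumes "w \<in> Z.Hcl D"
  shows "nrm N (T w) \<le> Ct * nrm Z.M (wjet CY w)"
proof -
  obtain \<psi> where p: "\<And>k. smooth (\<psi> k)" "\<And>k. D (\<psi> k)" "(\<lambda>k. nrm Z.M (\<lambda>x. cjet (\<psi> k) x - wjet CY w x)) \<longlonglongrightarrow> 0"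
    using Z.Hcl_approx[OF assms] by blast
  show ?thesis
  proof (rule LIMSEQ_le)
    show "(\<lambda>k. nrm N (\<lambda>x. \<psi> k (x, 0))) \<longlonglongrightarrow> nrm N (T w)"
      by (rule nrm_tendsto[OF smooth_trace_L2[OF p(1)] tr_L2[OF assms] tr_limit[OF assms p(1,3)]])
    show "(\<lambda>k. Ct * nrm Z.M (cjet (\<psi> k))) \<longlonglongrightarrow> Ct * nrm Z.M (wjet CY w)"
      by (intro tendsto_intros nrm_tendsto[OF Z.cjet_L2[OF p(1)] Z.Hcl_L2(4)[OF assms] p(3)])
    show "\<exists>N'. \<forall>n\<ge>N'. nrm N (\<lambda>x. \<psi> n (x, 0)) \<le> Ct * nrm Z.M (cjet (\<psi> n))"
      using trace_inequality[OF p(1)] by blast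
  qed
qed

lemma tr_tendsto:
  assumes D: "Z.lin D" and w: "\<And>n. w n \<in> Z.Hcl D" "v \<in> Z.Hcl D"
    and lim: "(\<lambda>n. nrm Z.M (\<lambda>x. wjet CY (w n) x - wjet CY v x)) \<longlonglongrightarrow> 0"
  shows "(\<lambda>n. nrm N (\<lambda>x. T (w n) x - T v x)) \<longlonglongrightarrow> 0"
proof (rule lim0_squeeze)
  show "(\<lambda>n. Ct * nrm Z.M (\<lambda>x. wjet CY (w n) x - wjet CY v x)) \<longlonglongrightarrow> 0"
    using tendsto_mult_left[OF lim] by simp
  fix n
  have h: "(\<lambda>x. w n x - v x) \<in> Z.Hcl D" by (rule Z.Hcl_diff(1)[OF D w])
  have "AE x in N. T (w n) x - T v x = T (\<lambda>x. w n x - v x) x"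
    using tr_add[OF D h w(2)] by eventually_elim simp
  then have "nrm N (\<lambda>x. T (w n) x - T v x) = nrm N (T (\<lambda>x. w n x - v x))"
    by (rule nrm_cong_AE[OF L2_measurable[OF L2_diff[OF tr_L2[OF w(1)] tr_L2[OF w(2)]]] L2_measurable[OF tr_L2[OF h]]])
  also have "\<dots> \<le> Ct * nrm Z.M (wjet CY (\<lambda>x. w n x - v x))" by (rule tr_bound[OF h])
  also have "nrm Z.M (wjet CY (\<lambda>x. w n x - v x)) = nrm Z.M (\<lambda>x. wjet CY (w n) x - wjet CY v x)"
    by (rule nrm_cong_AE[OF L2_measurable[OF Z.Hcl_L2(4)[OF h]]
          L2_measurable[OF L2_diff[OF Z.Hcl_L2(4)[OF w(1)] Z.Hcl_L2(4)[OF w(2)]]] Z.wjet_diff_AE[OF D w]])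
  finally show "\<bar>nrm N (\<lambda>x. T (w n) x - T v x)\<bar> \<le> Ct * nrm Z.M (\<lambda>x. wjet CY (w n) x - wjet CY v x)" by simp
qed

subsection \<open>Products of functions of \<open>x'\<close> and of \<open>y\<close>\<close>

text \<open>The jet of c(y) u(x'), with G for the gradient of u and c' for the derivative of c.
  These are separate arguments since the profile has its derivative only for y > 0.\<close>

definition prod_jet :: "(real^'n \<Rightarrow> real) \<Rightarrow> (real^'n \<Rightarrow> real^'n) \<Rightarrow> (real \<Rightarrow> real) \<Rightarrow> (real \<Rightarrow> real) \<Rightarrow>
    (real^'n) \<times> real \<Rightarrow> real \<times> ((real^'n) \<times> real)" where
  "prod_jet u G c c' z = (c (snd z) *\<^sub>R u (fst z), (c (snd z) *\<^sub>R G (fst z), c' (snd z) *\<^sub>R u (fst z)))"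

lemma prod_jet_L2:
  assumes u: "u \<in> borel_measurable borel" "u \<in> L2 N" and G: "G \<in> borel_measurable borel" "G \<in> L2 N"
    and c: "c \<in> borel_measurable borel" "c \<in> L2 W.M" and c': "c' \<in> borel_measurable borel" "c' \<in> L2 W.M"
  shows "prod_jet u G c c' \<in> L2 Z.M"
    "(nrm Z.M (prod_jet u G c c'))\<^sup>2 = (nrm W.M c)\<^sup>2 * ((nrm N u)\<^sup>2 + (nrm N G)\<^sup>2) + (nrm W.M c')\<^sup>2 * (nrm N u)\<^sup>2"
proof -
  note p = L2_prod[OF u c] L2_prod[OF G c] L2_prod[OF u c']
  show "prod_jet u G c c' \<in> L2 Z.M"
    unfolding prod_jet_def[abs_def] by (intro L2_Pair p)
  show "(nrm Z.M (prod_jet u G c c'))\<^sup>2 = (nrm W.M c)\<^sup>2 * ((nrm N u)\<^sup>2 + (nrm N G)\<^sup>2) + (nrm W.M c')\<^sup>2 * (nrm N u)\<^sup>2"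
    unfolding prod_jet_def[abs_def] nrm_Pair[OF p(1) L2_Pair[OF p(3,5)]] nrm_Pair[OF p(3,5)] p(2,4,6)
    by (simp add: power_mult_distrib algebra_simps)
qed

lemma smooth_prod:
  assumes u: "smooth u" and c: "smooth c"
  shows "smooth (\<lambda>z :: (real^'n) \<times> real. c (snd z) * u (fst z))"
    "(c has_real_derivative c') (at (snd z)) \<Longrightarrow>
      cjet (\<lambda>z :: (real^'n) \<times> real. c (snd z) * u (fst z)) z = prod_jet u (grad u) c (\<lambda>_. c') z"
proof -
  have 1: "smooth (\<lambda>z :: (real^'n) \<times> real. c (snd z))" "smooth (\<lambda>z :: (real^'n) \<times> real. u (fst z))"
    using smooth_affine[OF bounded_linear_snd c, of 0] smooth_affine[OF bounded_linear_fst u, of 0] by auto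
  then show "smooth (\<lambda>z :: (real^'n) \<times> real. c (snd z) * u (fst z))" by (rule smooth_mult)
  assume c': "(c has_real_derivative c') (at (snd z))"
  have "grad (\<lambda>z :: (real^'n) \<times> real. c (snd z) * u (fst z)) z = (c (snd z) *\<^sub>R grad u (fst z), c' *\<^sub>R u (fst z))"
  proof (rule grad_eqI)
    have dc: "((\<lambda>z :: (real^'n) \<times> real. c (snd z)) has_derivative (\<lambda>v. c' * snd v)) (at z)"
      using has_derivative_compose[OF bounded_linear.has_derivative[OF bounded_linear_snd has_derivative_ident]
          c'[unfolded has_field_derivative_def]] by simp
    have du: "((\<lambda>z :: (real^'n) \<times> real. u (fst z)) has_derivative (\<lambda>v. grad u (fst z) \<bullet> fst v)) (at z)"
      using has_derivative_compose[OF bounded_linear.has_derivative[OF bounded_linear_fst has_derivative_ident]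
          smooth_has_derivative_grad[OF u], of z] by simp
    show "((\<lambda>z. c (snd z) * u (fst z)) has_derivative (\<bullet>) (c (snd z) *\<^sub>R grad u (fst z), c' *\<^sub>R u (fst z))) (at z)"
      by (rule has_derivative_eq_rhs[OF has_derivative_mult[OF dc du]])
        (auto simp: fun_eq_iff inner_prod_def mult_ac)
  qed
  then show "cjet (\<lambda>z :: (real^'n) \<times> real. c (snd z) * u (fst z)) z = prod_jet u (grad u) c (\<lambda>_. c') z"
    by (simp add: cjet_def prod_jet_def)
qed

end

subsection \<open>Smooth approximation of the profile\<close>

text \<open>\<open>b\<close> runs through the smooth functions vanishing near \<open>0\<close>, and \<open>h\<close> is the derivative of \<open>f\<close>: by the
  differential equation the products \<open>b * f / y ^ m\<close> and \<open>b * h / y ^ m\<close> are closed under differentiation.\<close>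

lemma Ck_cutoff_profile:
  fixes f h :: "real \<Rightarrow> real"
  assumes df: "\<And>y. 0 < y \<Longrightarrow> (f has_real_derivative h y) (at y)"
    and dh: "\<And>y. 0 < y \<Longrightarrow> (h has_real_derivative lam * f y - a * inverse y * h y) (at y)"
    and \<delta>: "0 < \<delta>"
  shows "\<forall>b m. smooth b \<longrightarrow> (\<forall>y<\<delta>. b y = 0) \<longrightarrow>
    Ck k (\<lambda>y. b y * inverse y ^ m * f y) \<and> Ck k (\<lambda>y. b y * inverse y ^ m * h y)"
proof (induction k)
  case 0
  have *: "continuous_on UNIV (\<lambda>y. b y * inverse y ^ m * q y)"
    if b: "smooth b" "\<forall>y<\<delta>. b y = 0" and q: "continuous_on {0<..} q" for b q :: "real \<Rightarrow> real" and m
  proof -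
    have "continuous_on ({0<..} \<union> {..<\<delta>}) (\<lambda>y. b y * inverse y ^ m * q y)"
    proof (rule continuous_on_open_Un)
      show "continuous_on {0<..} (\<lambda>y. b y * inverse y ^ m * q y)"
        by (intro continuous_intros smooth_continuous b q) auto
      show "continuous_on {..<\<delta>} (\<lambda>y. b y * inverse y ^ m * q y)"
        using b(2) by (subst continuous_on_cong[OF refl, of _ _ "\<lambda>_. 0"]) auto
    qed auto
    moreover have "{0<..} \<union> {..<\<delta>} = UNIV" using \<delta> by auto
    ultimately show ?thesis by simp
  qed
  have "continuous_on {0<..} f" "continuous_on {0<..} h"
    by (rule DERIV_continuous_on, rule has_field_derivative_at_within, rule df, simp)
      (rule DERIV_continuous_on, rule has_field_derivative_at_within, rule dh, simp)
  then show ?case using * by simp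
next
  case (Suc k)
  show ?case
  proof (intro allI impI)
    fix b :: "real \<Rightarrow> real" and m assume b: "smooth b" "\<forall>y<\<delta>. b y = 0"
    define b' where "b' = grad b"
    have db: "(b has_real_derivative b' y) (at y)" for y
      using smooth_has_derivative_grad[OF b(1), of y]
      by (simp add: has_field_derivative_def b'_def mult_commute_abs)
    have sb': "smooth b'"
      using smooth_grad_inner[OF b(1), of 1] by (simp add: b'_def)
    have z: "((\<lambda>y. b y * q y) has_real_derivative 0) (at y)" if "y < \<delta>" for q :: "real \<Rightarrow> real" and y
    proof -
      have "((\<lambda>_. 0) has_real_derivative 0) (at y)" by simp
      then show ?thesis
        by (rule has_field_derivative_transform_within_open[of _ _ _ "{..<\<delta>}"]) (use that b(2) in auto)
    qed
    have b'0: "\<forall>y<\<delta>. b' y = 0"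
      using z[of _ "\<lambda>_. 1"] DERIV_unique[OF db] by auto
    have dp: "((\<lambda>y. inverse y ^ m) has_real_derivative - real m * inverse y ^ (m + 1)) (at y)" if "0 < y" for y :: real
    proof (cases m)
      case (Suc n)
      have "((\<lambda>y. inverse y ^ m) has_real_derivative real m * (inverse y ^ (m - 1) * (- (inverse y * inverse y)))) (at y)"
        using that by (auto intro!: derivative_eq_intros)
      then show ?thesis by (rule DERIV_cong) (simp add: Suc algebra_simps)
    qed auto
    have Df: "((\<lambda>y. b y * inverse y ^ m * f y) has_real_derivative
        (b' y * inverse y ^ m * f y + (- real m) * (b y * inverse y ^ (m + 1) * f y)) + b y * inverse y ^ m * h y) (at y)" for y
    proof (cases "0 < y")
      case True
      show ?thesis
        by (rule DERIV_cong[OF DERIV_mult[OF DERIV_mult[OF db dp[OF True]] df[OF True]]]) (simp add: algebra_simps)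
    next
      case False
      then show ?thesis using z[of y "\<lambda>y. inverse y ^ m * f y"] b'0 b(2) \<delta> by (simp add: mult.assoc)
    qed
    have Dh: "((\<lambda>y. b y * inverse y ^ m * h y) has_real_derivative
        (b' y * inverse y ^ m * h y + (- real m - a) * (b y * inverse y ^ (m + 1) * h y)) + lam * (b y * inverse y ^ m * f y)) (at y)" for y
    proof (cases "0 < y")
      case True
      show ?thesis
        by (rule DERIV_cong[OF DERIV_mult[OF DERIV_mult[OF db dp[OF True]] dh[OF True]]]) (simp add: algebra_simps)
    next
      case False
      then show ?thesis using z[of y "\<lambda>y. inverse y ^ m * h y"] b'0 b(2) \<delta> by (simp add: mult.assoc)
    qed
    show "Ck (Suc k) (\<lambda>y. b y * inverse y ^ m * f y) \<and> Ck (Suc k) (\<lambda>y. b y * inverse y ^ m * h y)"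
      using Suc b sb' b'0
      by (intro conjI Ck_SucI_real[OF Df] Ck_SucI_real[OF Dh] Ck_add Ck_mult[of k "\<lambda>_. _"] Ck_const) blast+
  qed
qed

lemma smooth_antiderivative:
  fixes h :: "real \<Rightarrow> real"
  assumes "smooth h"
  obtains c where "smooth c" "\<And>t. (c has_real_derivative h t) (at t)" "c Y = 0"
proof -
  have "isCont h x" for x
    using smooth_continuous[OF assms, of UNIV] by (simp add: continuous_on_eq_continuous_at)
  then obtain F where F: "\<And>x. (F has_vector_derivative h x) (at x)"
    using einterval_antiderivative[of "-\<infinity>" "\<infinity>" h] by auto
  then have d: "((\<lambda>t. F t - F Y) has_real_derivative h t) (at t)" for t
    using DERIV_diff[OF F[unfolded has_real_derivative_iff_has_vector_derivative[symmetric]] DERIV_const] by simp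
  have "Ck k (\<lambda>t. F t - F Y)" for k
    using Ck_SucI_real[OF d smooth_Ck[OF assms, of k]] Ck_SucD by blast
  then have "smooth (\<lambda>t. F t - F Y)" by (simp add: smooth_def)
  then show ?thesis using that d by simp
qed

text \<open>Vanishes within distance 1/j of either end of (0,Y), takes values in [0,1] and tends to
  1 inside.\<close>

definition cutoff :: "real \<Rightarrow> nat \<Rightarrow> real \<Rightarrow> real" where
  "cutoff Y j t = flat 0 (real j * t - 1) * flat 0 (real j * (Y - t) - 1)"

lemma smooth_cutoff: "smooth (cutoff Y j)"
proof -
  have "smooth (\<lambda>t. flat 0 (real j * t + (- 1)) * flat 0 ((- real j) * t + (real j * Y - 1)))"
    by (intro smooth_mult smooth_compose[OF smooth_flat smooth_affine_real])
  then show ?thesis unfolding cutoff_def[abs_def] by (simp add: algebra_simps)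
qed

lemma cutoff_bounds: "0 \<le> cutoff Y j t" "cutoff Y j t \<le> 1"
  unfolding cutoff_def by (auto intro!: mult_nonneg_nonneg mult_le_one flat_0_bounds)

lemma cutoff_zero:
  assumes "0 < j"
  shows "t \<le> 1 / real j \<Longrightarrow> cutoff Y j t = 0" "Y - 1 / real j \<le> t \<Longrightarrow> cutoff Y j t = 0"
  using assms by (auto simp: cutoff_def flat_def field_simps)

lemma cutoff_tendsto:
  assumes "0 < t" "t < Y"
  shows "(\<lambda>j. cutoff Y j t) \<longlonglongrightarrow> 1"
proof -
  have *: "(\<lambda>j. flat 0 (real j * a - 1)) \<longlonglongrightarrow> 1" if "0 < a" for a
  proof -
    have l: "filterlim (\<lambda>j. real j * a - 1) at_top sequentially"
      using that by real_asymp
    have "(\<lambda>j. exp (- inverse (real j * a - 1))) \<longlonglongrightarrow> exp (- 0)"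
      by (intro tendsto_intros tendsto_inverse_0_at_top l)
    moreover have "\<forall>\<^sub>F j in sequentially. exp (- inverse (real j * a - 1)) = flat 0 (real j * a - 1)"
      using filterlim_at_top_dense[THEN iffD1, OF l, rule_format, of 0]
      by eventually_elim (simp add: flat_def)
    ultimately show ?thesis by (auto intro: Lim_transform_eventually)
  qed
  have "(\<lambda>j. flat 0 (real j * t - 1) * flat 0 (real j * (Y - t) - 1)) \<longlonglongrightarrow> 1 * 1"
    using assms by (intro tendsto_mult *) auto
  then show ?thesis by (simp add: cutoff_def)
qed

text \<open>Continuing f and g by their values at 0 to negative y makes them continuous on the whole
  line, hence Borel functions.\<close>

lemma profile_extend:
  assumes "profile s Y d lam f g" "0 < Y"
  obtains f' g' where "profile s Y d lam f' g'" "continuous_on UNIV f'" "continuous_on UNIV g'"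
proof -
  define e where "e q y = q (max 0 y)" for q :: "real \<Rightarrow> real" and y
  have c: "continuous_on UNIV (e q)" if "continuous_on {0..} q" for q
    unfolding e_def[abs_def] by (rule continuous_on_compose2[OF that]) (auto intro!: continuous_intros)
  have d: "(e q has_real_derivative D) (at y)" if "(q has_real_derivative D) (at y)" "0 < y" for q D y
    by (rule has_field_derivative_transform_within_open[OF that(1), of "{0<..}"]) (use that(2) in \<open>auto simp: e_def\<close>)
  have eq: "e q y = q y" if "0 \<le> y" for q y using that by (simp add: e_def)
  have "profile s Y d lam (e f) (e g)"
    using assms unfolding profile_def by (auto simp: eq intro!: d continuous_on_subset[OF c])
  then show ?thesis using that[of "e f" "e g"] c assms(1) by (auto simp: profile_def)
qed

section \<open>Lifting functions from \<Omega> to the cylinder by a profile\<close>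

locale cyl_profile = cyl_domain \<Omega> s Y for \<Omega> :: "(real^'n) set" and s Y +
  fixes d lam :: real and f g :: "real \<Rightarrow> real"
  assumes d: "0 < d" and lam: "0 \<le> lam" and prof: "profile s Y d lam f g"
    and cont_f: "continuous_on UNIV f" and cont_g: "continuous_on UNIV g"
begin

definition h :: "real \<Rightarrow> real" where "h y = - (y powr (2 * s - 1)) * g y"

lemma df: "0 < y \<Longrightarrow> (f has_real_derivative h y) (at y)"
  using prof by (simp add: profile_def h_def)

lemma dg: "0 < y \<Longrightarrow> (g has_real_derivative - lam * y powr (1 - 2 * s) * f y) (at y)"
  using prof by (simp add: profile_def)

lemma prof_bounds:
  assumes "0 \<le> y" "y \<le> Y"
  shows "0 \<le> f y" "f y \<le> f 0" "0 \<le> g y" "g y \<le> d"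
  using assms prof profile_bounds(3)[OF s Y d lam prof, of y] by (auto simp: profile_def)

lemma fY: "f Y = 0" and g0: "g 0 = d"
  using prof by (auto simp: profile_def)

lemma dh: "0 < y \<Longrightarrow> (h has_real_derivative lam * f y - (1 - 2 * s) * inverse y * h y) (at y)"
proof -
  assume y: "0 < y"
  have p: "((\<lambda>y. - (y powr (2 * s - 1))) has_real_derivative - ((2 * s - 1) * y powr (2 * s - 1 - 1))) (at y)"
    by (intro DERIV_minus has_real_derivative_powr y)
  have 1: "y powr (2 * s - 1 - 1) = y powr (2 * s - 1) * inverse y"
    unfolding powr_diff[of y "2 * s - 1" 1] using y by (simp add: divide_inverse)
  have 2: "y powr (2 * s - 1) * y powr (1 - 2 * s) = 1"
    using y by (simp add: powr_add[symmetric])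
  show ?thesis
    unfolding h_def[abs_def]
  proof (rule DERIV_cong[OF DERIV_mult[OF p dg[OF y]]])
    have "- (y powr (2 * s - 1)) * (- lam * y powr (1 - 2 * s) * f y) = (y powr (2 * s - 1) * y powr (1 - 2 * s)) * (lam * f y)"
      by (simp add: mult_ac)
    then have 3: "- (y powr (2 * s - 1)) * (- lam * y powr (1 - 2 * s) * f y) = lam * f y" unfolding 2 by simp
    show "- ((2 * s - 1) * y powr (2 * s - 1 - 1)) * g y + (- lam * y powr (1 - 2 * s) * f y) * - (y powr (2 * s - 1))
        = lam * f y - (1 - 2 * s) * inverse y * (- (y powr (2 * s - 1)) * g y)"
      unfolding 1 mult.commute[of "- lam * y powr (1 - 2 * s) * f y"] 3 by (simp add: algebra_simps)
  qed
qed

lemma f_borel: "f \<in> borel_measurable borel" and g_borel: "g \<in> borel_measurable borel"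
  by (intro borel_measurable_continuous_onI cont_f cont_g)+

lemma h_borel: "h \<in> borel_measurable borel"
  unfolding h_def[abs_def] using g_borel by measurable

lemma f_L2: "f \<in> L2 W.M"
  by (rule W.continuous_closure_L2[OF continuous_on_subset[OF cont_f]]) simp

text \<open>The flux bound dominates h by d times the inverse weight, which is square integrable in
  the weighted space even where h is unbounded at 0.\<close>

lemma h_L2: "h \<in> L2 W.M"
proof (rule L2_dominated)
  show "h \<in> borel_measurable W.M" by (rule borel_measurable_M[OF h_borel])
  show "integrable W.M (\<lambda>t. d\<^sup>2 * (norm (t powr (2 * s - 1)))\<^sup>2)"
    by (intro integrable_mult_right L2_integrable_norm inverse_weight_L2)
  have "(norm (h t))\<^sup>2 \<le> d\<^sup>2 * (norm (t powr (2 * s - 1)))\<^sup>2" if "t \<in> {0<..<Y}" for t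
  proof -
    have "(g t)\<^sup>2 \<le> d\<^sup>2" using prof_bounds(3,4)[of t] that by (intro power_mono) auto
    then show ?thesis by (simp add: h_def power_mult_distrib mult.commute mult_right_mono)
  qed
  then show "AE t in W.M. (norm (h t))\<^sup>2 \<le> d\<^sup>2 * (norm (t powr (2 * s - 1)))\<^sup>2"
    by (intro AE_I2) (simp add: W.space_M)
qed

definition hc :: "nat \<Rightarrow> real \<Rightarrow> real" where "hc j t = cutoff Y (Suc j) t * h t"

lemma smooth_hc: "smooth (hc j)"
proof -
  have "Ck k (\<lambda>y. cutoff Y (Suc j) y * inverse y ^ 0 * h y)" for k
  proof -
    have "\<forall>y<1 / real (Suc j). cutoff Y (Suc j) y = 0" using cutoff_zero(1)[of "Suc j" _ Y] by auto
    moreover have "0 < 1 / real (Suc j)" by simp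
    ultimately show ?thesis
      using Ck_cutoff_profile[OF df dh, of "1 / real (Suc j)" k] smooth_cutoff[of Y "Suc j"] by blast
  qed
  then show ?thesis by (simp add: smooth_def hc_def[abs_def])
qed

text \<open>Smoothing cuts off the derivative h and integrates back from Y, instead of cutting off
  f: the derivative of a cut-off times f would not be controlled near 0, where f is not small. As
  \<open>hc j\<close> vanishes near Y, so does \<open>fc j\<close>, as membership in
  \<open>DL\<close> demands.\<close>

definition fc :: "nat \<Rightarrow> real \<Rightarrow> real" where
  "fc j = (SOME c. smooth c \<and> (\<forall>t. (c has_real_derivative hc j t) (at t)) \<and> c Y = 0)"

lemma fc: "smooth (fc j)" "(fc j has_real_derivative hc j t) (at t)" "fc j Y = 0"
proof -
  have "\<exists>c. smooth c \<and> (\<forall>t. (c has_real_derivative hc j t) (at t)) \<and> c Y = 0"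
    using smooth_antiderivative[OF smooth_hc, of j Y] by metis
  from someI_ex[OF this] show "smooth (fc j)" "(fc j has_real_derivative hc j t) (at t)" "fc j Y = 0"
    by (auto simp: fc_def)
qed

lemma fc_zero:
  assumes "Y - 1 / real (Suc j) \<le> t" shows "fc j t = 0"
proof -
  have "\<exists>c. \<forall>x\<in>{Y - 1 / real (Suc j)..}. fc j x = c"
  proof (rule has_field_derivative_zero_constant)
    fix x assume "x \<in> {Y - 1 / real (Suc j)..}"
    then have "hc j x = 0" using cutoff_zero(2)[of "Suc j" Y x] by (simp add: hc_def del: of_nat_Suc)
    then show "(fc j has_real_derivative 0) (at x within {Y - 1 / real (Suc j)..})"
      using fc(2)[of j x] by (simp add: has_field_derivative_at_within)
  qed simp
  then obtain c where c: "\<And>x. Y - 1 / real (Suc j) \<le> x \<Longrightarrow> fc j x = c" by auto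
  have "Y - 1 / real (Suc j) \<le> Y" by simp
  then show ?thesis using c[OF assms] c[of Y] fc(3) by simp
qed

lemma hc_borel: "hc j \<in> borel_measurable borel" and fc_borel: "fc j \<in> borel_measurable borel"
  by (intro borel_measurable_continuous_onI smooth_continuous smooth_hc fc)+

lemma hc_L2: "hc j \<in> L2 W.M" and fc_L2: "fc j \<in> L2 W.M"
  by (intro W.smooth_L2 smooth_hc fc)+

lemma hc_tendsto: "(\<lambda>j. nrm W.M (\<lambda>t. hc j t - h t)) \<longlonglongrightarrow> 0"
proof -
  have "(\<lambda>j. LINT t|W.M. (norm (hc j t - h t))\<^sup>2) \<longlonglongrightarrow> (LINT t|W.M. 0 :: real)"
  proof (rule integral_dominated_convergence)
    show "integrable W.M (\<lambda>t. (norm (h t))\<^sup>2)" by (rule L2_integrable_norm[OF h_L2])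
    show "AE t in W.M. (\<lambda>j. (norm (hc j t - h t))\<^sup>2) \<longlonglongrightarrow> 0"
    proof (rule AE_I2)
      fix t assume "t \<in> space W.M"
      then have "(\<lambda>j. cutoff Y (Suc j) t) \<longlonglongrightarrow> 1"
        by (intro LIMSEQ_Suc cutoff_tendsto) (auto simp: W.space_M)
      then have "(\<lambda>j. (norm (cutoff Y (Suc j) t * h t - h t))\<^sup>2) \<longlonglongrightarrow> (norm (1 * h t - h t))\<^sup>2"
        by (intro tendsto_intros)
      then show "(\<lambda>j. (norm (hc j t - h t))\<^sup>2) \<longlonglongrightarrow> 0" by (simp add: hc_def)
    qed
    show "AE t in W.M. norm ((norm (hc j t - h t))\<^sup>2) \<le> (norm (h t))\<^sup>2" for j
    proof (rule AE_I2)
      fix t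
      have "hc j t - h t = - ((1 - cutoff Y (Suc j) t) * h t)" by (simp add: hc_def algebra_simps)
      moreover have "(1 - cutoff Y (Suc j) t)\<^sup>2 * (h t)\<^sup>2 \<le> 1 * (h t)\<^sup>2"
        using cutoff_bounds[of Y "Suc j" t] by (intro mult_right_mono power_le_one) auto
      ultimately show "norm ((norm (hc j t - h t))\<^sup>2) \<le> (norm (h t))\<^sup>2"
        by (simp add: power_mult_distrib)
    qed
    show "(\<lambda>t. (norm (hc j t - h t))\<^sup>2) \<in> borel_measurable W.M" for j
      using L2_integrable_norm[OF L2_diff[OF hc_L2 h_L2]] by auto
  qed simp
  then have "(\<lambda>j. (nrm W.M (\<lambda>t. hc j t - h t))\<^sup>2) \<longlonglongrightarrow> 0" by (simp add: nrm_eq_LINT)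
  from tendsto_real_sqrt[OF this] show ?thesis by simp
qed

text \<open>The fibre bound for \<open>fc j - f\<close>, which vanishes at Y. Uniformity in y gives
  both convergence in the weighted space and convergence of the values at 0, that is, of the
  traces.\<close>

lemma fc_diff_le:
  assumes "0 \<le> y" "y \<le> Y"
  shows "\<bar>fc j y - f y\<bar> \<le> sqrt K * nrm W.M (\<lambda>t. hc j t - h t)"
proof -
  have "(fc j y - f y)\<^sup>2 \<le> K * (nrm W.M (\<lambda>t. hc j t - h t))\<^sup>2"
  proof (rule fiber_bound_Ioo[of "\<lambda>t. fc j t - f t"])
    show "((\<lambda>t. fc j t - f t) has_real_derivative hc j t - h t) (at t)" if "0 < t" for t
      by (intro DERIV_diff fc df that)
    show "continuous_on {0..Y} (\<lambda>t. fc j t - f t)"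
      by (intro continuous_intros smooth_continuous fc continuous_on_subset[OF cont_f]) auto
  qed (use assms fc fY in \<open>auto intro: L2_diff hc_L2 h_L2\<close>)
  then have "(fc j y - f y)\<^sup>2 \<le> (sqrt K * nrm W.M (\<lambda>t. hc j t - h t))\<^sup>2"
    using K_pos by (simp add: power_mult_distrib)
  then show ?thesis
    using K_pos power2_le_imp_le[of "\<bar>fc j y - f y\<bar>" "sqrt K * nrm W.M (\<lambda>t. hc j t - h t)"] by simp
qed

lemma fc_tendsto: "(\<lambda>j. nrm W.M (\<lambda>t. fc j t - f t)) \<longlonglongrightarrow> 0"
proof (rule lim0_squeeze)
  have one: "(\<lambda>_. 1 :: real) \<in> L2 W.M" by (rule W.bounded_L2[of _ 1]) auto
  show "\<bar>nrm W.M (\<lambda>t. fc j t - f t)\<bar> \<le> sqrt K * nrm W.M (\<lambda>t. hc j t - h t) * nrm W.M (\<lambda>_. 1 :: real)" for j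
  proof -
    have "nrm W.M (\<lambda>t. fc j t - f t) \<le> nrm W.M (\<lambda>t. (sqrt K * nrm W.M (\<lambda>t. hc j t - h t)) *\<^sub>R (1 :: real))"
      by (rule nrm_mono[OF L2_measurable[OF L2_diff[OF fc_L2 f_L2]] L2_scaleR[OF one]])
        (use fc_diff_le K_pos in \<open>auto intro!: AE_I2 simp: W.space_M abs_mult\<close>)
    then show ?thesis unfolding nrm_scaleR using K_pos by (simp add: abs_mult)
  qed
  show "(\<lambda>j. sqrt K * nrm W.M (\<lambda>t. hc j t - h t) * nrm W.M (\<lambda>_. 1 :: real)) \<longlonglongrightarrow> 0"
    using tendsto_mult_right[OF tendsto_mult_left[OF hc_tendsto]] by simp
qed

definition lift :: "(real^'n \<Rightarrow> real) \<Rightarrow> (real^'n) \<times> real \<Rightarrow> real" where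
  "lift u z = f (snd z) * u (fst z)"

lemma smooth_borel_L2:
  assumes "smooth u"
  shows "u \<in> borel_measurable borel" "u \<in> L2 N" "grad u \<in> borel_measurable borel" "grad u \<in> L2 N"
  using G.smooth_L2[OF assms] G.smooth_grad_L2[OF assms]
  by (auto simp: weighted_one intro!: borel_measurable_continuous_onI smooth_continuous smooth_grad_continuous assms)

text \<open>Approximation by \<open>fc j\<close> times u, which is smooth and supported away from
  the lateral boundary and from the top. The error splits by \<open>prod_jet_L2\<close> into the
  errors of \<open>fc j\<close> and \<open>hc j\<close>.\<close>

lemma lift_test:
  assumes u: "test_function \<Omega> u"
  shows "lift u \<in> Z.Hcl DL" "AE z in Z.M. weak_grad CY (lift u) z = snd (prod_jet u (grad u) f h z)"
    "AE x in N. T (lift u) x = f 0 * u x"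
proof -
  note su = test_function_smooth[OF u]
  note uL = smooth_borel_L2[OF su]
  define \<psi> where "\<psi> j z = fc j (snd z) * u (fst z)" for j and z :: "(real^'n) \<times> real"
  have sm: "smooth (\<psi> j)" for j unfolding \<psi>_def[abs_def] by (rule smooth_prod(1)[OF su fc(1)])
  have DLp: "DL (\<psi> j)" for j
  proof -
    have "supp (\<psi> j) \<subseteq> supp u \<times> {..Y - 1 / real (Suc j)}"
    proof (rule supp_subsetI)
      fix z assume "z \<notin> supp u \<times> {..Y - 1 / real (Suc j)}"
      then have "fst z \<notin> supp u \<or> Y - 1 / real (Suc j) \<le> snd z" by (cases z) auto
      then show "\<psi> j z = 0" using not_in_supp[of "fst z" u] fc_zero[of j "snd z"] by (auto simp: \<psi>_def)
    qed (simp add: closed_supp closed_Times)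
    moreover have "supp u \<subseteq> \<Omega>" using u by (simp add: test_function_def)
    moreover have "\<Omega> \<inter> frontier \<Omega> = {}" using open_\<Omega> by (simp add: frontier_def interior_open)
    ultimately show ?thesis unfolding DL_def dirichlet_part_def by fastforce
  qed
  have J: "cjet (\<psi> j) z = prod_jet u (grad u) (fc j) (hc j) z" for j z
    using smooth_prod(2)[OF su fc(1,2)] unfolding \<psi>_def[abs_def] by (simp add: prod_jet_def)
  have P: "prod_jet u (grad u) f h \<in> L2 Z.M" by (rule prod_jet_L2(1)[OF uL f_borel f_L2 h_borel h_L2])
  have diff: "(\<lambda>z. cjet (\<psi> j) z - prod_jet u (grad u) f h z) = prod_jet u (grad u) (\<lambda>t. fc j t - f t) (\<lambda>t. hc j t - h t)" for j
    by (auto simp: J prod_jet_def algebra_simps)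
  have "(nrm Z.M (\<lambda>z. cjet (\<psi> j) z - prod_jet u (grad u) f h z))\<^sup>2 =
      (nrm W.M (\<lambda>t. fc j t - f t))\<^sup>2 * ((nrm N u)\<^sup>2 + (nrm N (grad u))\<^sup>2)
      + (nrm W.M (\<lambda>t. hc j t - h t))\<^sup>2 * (nrm N u)\<^sup>2" for j
    unfolding diff
    by (rule prod_jet_L2(2)[OF uL borel_measurable_diff[OF fc_borel f_borel] L2_diff[OF fc_L2 f_L2]
          borel_measurable_diff[OF hc_borel h_borel] L2_diff[OF hc_L2 h_L2]])
  moreover have "(\<lambda>j. (nrm W.M (\<lambda>t. fc j t - f t))\<^sup>2 * ((nrm N u)\<^sup>2 + (nrm N (grad u))\<^sup>2)
      + (nrm W.M (\<lambda>t. hc j t - h t))\<^sup>2 * (nrm N u)\<^sup>2)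
      \<longlonglongrightarrow> 0\<^sup>2 * ((nrm N u)\<^sup>2 + (nrm N (grad u))\<^sup>2) + 0\<^sup>2 * (nrm N u)\<^sup>2"
    by (intro tendsto_intros fc_tendsto hc_tendsto)
  ultimately have "(\<lambda>j. (nrm Z.M (\<lambda>z. cjet (\<psi> j) z - prod_jet u (grad u) f h z))\<^sup>2) \<longlonglongrightarrow> 0" by simp
  from tendsto_real_sqrt[OF this]
  have "(\<lambda>j. nrm Z.M (\<lambda>z. cjet (\<psi> j) z - prod_jet u (grad u) f h z)) \<longlonglongrightarrow> 0" by simp
  moreover have "prod_jet u (grad u) f h = (\<lambda>z. (lift u z, snd (prod_jet u (grad u) f h z)))"
    by (auto simp: prod_jet_def lift_def)
  ultimately have lim: "(\<lambda>j. nrm Z.M (\<lambda>z. cjet (\<psi> j) z - (lift u z, snd (prod_jet u (grad u) f h z)))) \<longlonglongrightarrow> 0"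
    by metis
  have l2: "lift u \<in> L2 Z.M" using L2_fst[OF P] by (simp add: prod_jet_def lift_def[abs_def])
  note H = Z.Hcl_smooth_limit[where D = DL and \<psi> = \<psi> and w = "lift u" and g = "\<lambda>z. snd (prod_jet u (grad u) f h z)",
      OF sm DLp l2 L2_snd[OF P] lim]
  show "lift u \<in> Z.Hcl DL" "AE z in Z.M. weak_grad CY (lift u) z = snd (prod_jet u (grad u) f h z)"
    by (rule H(1), rule H(2))
  show "AE x in N. T (lift u) x = f 0 * u x"
  proof (rule tr_eqI[OF H(1) sm H(3)])
    show "(\<lambda>x. f 0 * u x) \<in> L2 N" by (rule L2_cmult[OF uL(2)])
    have "nrm N (\<lambda>x. \<psi> j (x, 0) - f 0 * u x) = \<bar>fc j 0 - f 0\<bar> * nrm N u" for j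
      using nrm_scaleR[of N "fc j 0 - f 0" u] by (simp add: \<psi>_def left_diff_distrib)
    moreover have "(\<lambda>j. \<bar>fc j 0 - f 0\<bar> * nrm N u) \<longlonglongrightarrow> 0"
    proof (rule lim0_squeeze)
      show "\<bar>\<bar>fc j 0 - f 0\<bar> * nrm N u\<bar> \<le> sqrt K * nrm W.M (\<lambda>t. hc j t - h t) * nrm N u" for j
        using fc_diff_le[of 0 j] Y by (auto simp: abs_mult intro!: mult_right_mono)
      show "(\<lambda>j. sqrt K * nrm W.M (\<lambda>t. hc j t - h t) * nrm N u) \<longlonglongrightarrow> 0"
        using tendsto_mult_right[OF tendsto_mult_left[OF hc_tendsto]] by simp
    qed
    ultimately show "(\<lambda>j. nrm N (\<lambda>x. \<psi> j (x, 0) - f 0 * u x)) \<longlonglongrightarrow> 0" by simp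
  qed
qed

text \<open>By \<open>prod_jet_L2\<close> lifting is bounded with respect to the H1 norms, so the
  lifts of the approximants form a Cauchy sequence. V is taken as their abstract limit, which avoids
  handling a product with a merely Lebesgue measurable \<phi>; only its trace has to be
  identified.\<close>

lemma lift_H10:
  assumes \<phi>: "\<phi> \<in> G.Hcl (test_function \<Omega>)"
    and u: "\<And>n. test_function \<Omega> (u n)" and lim: "(\<lambda>n. nrm N (\<lambda>x. cjet (u n) x - wjet \<Omega> \<phi> x)) \<longlonglongrightarrow> 0"
  obtains V where "V \<in> Z.Hcl DL" "(\<lambda>n. nrm Z.M (\<lambda>z. wjet CY (lift (u n)) z - wjet CY V z)) \<longlonglongrightarrow> 0"
    "AE x in N. T V x = f 0 * \<phi> x"
proof -
  note su = test_function_smooth[OF u]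
  have Jphi: "wjet \<Omega> \<phi> \<in> L2 N" using G.Hcl_L2(4)[OF \<phi>] by (simp add: weighted_one)
  have JL: "cjet (u n) \<in> L2 N" for n using G.cjet_L2[OF su] by (simp add: weighted_one)
  define B where "B = sqrt ((nrm W.M f)\<^sup>2 + (nrm W.M h)\<^sup>2)"
  have bound: "nrm Z.M (wjet CY (\<lambda>z. lift (u m) z - lift (u n) z)) \<le> B * nrm N (\<lambda>x. cjet (u m) x - cjet (u n) x)" for m n
  proof -
    define e where "e x = u m x - u n x" for x
    have te: "test_function \<Omega> e"
      using test_function_add[OF u[of m] test_function_cmult[OF u[of n], of "-1"]] by (simp add: e_def[abs_def])
    note eL = smooth_borel_L2[OF test_function_smooth[OF te]]
    have ge: "grad e x = grad (u m) x - grad (u n) x" for x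
      unfolding e_def[abs_def] by (rule grad_diff[OF su su])
    have lift_e: "(\<lambda>z. lift (u m) z - lift (u n) z) = lift e"
      by (auto simp: lift_def e_def algebra_simps)
    have "nrm Z.M (wjet CY (lift e)) = nrm Z.M (prod_jet e (grad e) f h)"
      by (rule nrm_cong_AE[OF L2_measurable[OF Z.Hcl_L2(4)[OF lift_test(1)[OF te]]]
            L2_measurable[OF prod_jet_L2(1)[OF eL f_borel f_L2 h_borel h_L2]]])
        (use lift_test(2)[OF te] in \<open>auto elim!: eventually_mono simp: wjet_def prod_jet_def lift_def\<close>)
    moreover have "(nrm Z.M (prod_jet e (grad e) f h))\<^sup>2 \<le> B\<^sup>2 * ((nrm N e)\<^sup>2 + (nrm N (grad e))\<^sup>2)"
      unfolding prod_jet_L2(2)[OF eL f_borel f_L2 h_borel h_L2] B_def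
      by (simp add: algebra_simps)
    moreover have "(nrm N (\<lambda>x. cjet (u m) x - cjet (u n) x))\<^sup>2 = (nrm N e)\<^sup>2 + (nrm N (grad e))\<^sup>2"
      using nrm_Pair[OF eL(2,4)] by (simp add: cjet_def ge e_def)
    ultimately have "(nrm Z.M (wjet CY (lift e)))\<^sup>2 \<le> (B * nrm N (\<lambda>x. cjet (u m) x - cjet (u n) x))\<^sup>2"
      by (simp add: power_mult_distrib)
    then show ?thesis unfolding lift_e by (rule power2_le_imp_le) (simp add: B_def)
  qed
  have B0: "0 \<le> B" by (simp add: B_def)
  obtain V where V: "V \<in> Z.Hcl DL" "(\<lambda>n. nrm Z.M (\<lambda>z. wjet CY (lift (u n)) z - wjet CY V z)) \<longlonglongrightarrow> 0"
  proof (rule Z.Hcl_complete[OF lin_DL lift_test(1)[OF u]])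
    fix e :: real assume e: "0 < e"
    define a where "a = e / (2 * (B + 1))"
    have a: "2 * (B + 1) * a = e" "0 < a" using e B0 by (simp_all add: a_def)
    from order_tendstoD(2)[OF lim a(2)]
    obtain M where M: "\<And>k. k \<ge> M \<Longrightarrow> nrm N (\<lambda>x. cjet (u k) x - wjet \<Omega> \<phi> x) < a"
      by (auto simp: eventually_sequentially)
    have "nrm Z.M (wjet CY (\<lambda>z. lift (u m) z - lift (u n) z)) < e" if "m \<ge> M" "n \<ge> M" for m n
    proof -
      have "nrm N (\<lambda>x. cjet (u m) x - cjet (u n) x) \<le> a + a"
        using nrm_triangle_diff[OF JL Jphi JL, of m n] nrm_minus_commute[of N "wjet \<Omega> \<phi>" "cjet (u n)"]
          M[OF that(1)] M[OF that(2)] by simp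
      then have "B * nrm N (\<lambda>x. cjet (u m) x - cjet (u n) x) \<le> B * (a + a)" using B0 by (rule mult_left_mono)
      also have "\<dots> < e" using a by (simp add: algebra_simps)
      finally show ?thesis using bound[of m n] by simp
    qed
    then show "\<exists>M. \<forall>m\<ge>M. \<forall>n\<ge>M. nrm Z.M (wjet CY (\<lambda>z. lift (u m) z - lift (u n) z)) < e" by blast
  qed
  moreover have "AE x in N. T V x = f 0 * \<phi> x"
  proof (rule nrm_limit_unique[OF tr_L2[OF lift_test(1)[OF u]] tr_L2[OF V(1)]])
    have phL: "\<phi> \<in> L2 N" using G.Hcl_L2(1)[OF \<phi>] by (simp add: weighted_one)
    then show "(\<lambda>x. f 0 * \<phi> x) \<in> L2 N" by (rule L2_cmult)
    show "(\<lambda>n. nrm N (\<lambda>x. T (lift (u n)) x - T V x)) \<longlonglongrightarrow> 0"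
      by (rule tr_tendsto[OF lin_DL lift_test(1)[OF u] V])
    have uL: "u n \<in> L2 N" for n by (rule smooth_borel_L2(2)[OF su])
    have l: "(\<lambda>n. nrm N (\<lambda>x. u n x - \<phi> x)) \<longlonglongrightarrow> 0"
      by (rule lim0_squeeze[OF _ lim]) (use nrm_fst_le[OF L2_diff[OF JL Jphi]] in \<open>simp add: cjet_def wjet_def\<close>)
    have "nrm N (\<lambda>x. T (lift (u n)) x - f 0 * \<phi> x) = nrm N (\<lambda>x. f 0 *\<^sub>R u n x - f 0 *\<^sub>R \<phi> x)" for n
      by (rule nrm_cong_AE[OF L2_measurable[OF L2_diff[OF tr_L2[OF lift_test(1)[OF u]] L2_cmult[OF phL]]]
            L2_measurable[OF L2_diff[OF L2_scaleR[OF uL] L2_scaleR[OF phL]]]])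
        (use lift_test(3)[OF u] in \<open>auto elim!: eventually_mono\<close>)
    then show "(\<lambda>n. nrm N (\<lambda>x. T (lift (u n)) x - f 0 * \<phi> x)) \<longlonglongrightarrow> 0"
      using nrm_lim_scaleR[OF l, of "f 0"] by simp
  qed
  ultimately show ?thesis by (rule that)
qed

text \<open>The weighted integrand is the derivative of \<open>- (g * q)\<close>. The boundary term
  at Y vanishes with q, and the one at 0 is \<open>d * q 0\<close> because the flux is normalized to
  d.\<close>

lemma profile_weak_fiber:
  fixes q q' :: "real \<Rightarrow> real"
  assumes dq: "\<And>t. (q has_real_derivative q' t) (at t)" and cq: "continuous_on UNIV q'" and qY: "q Y = 0"
  shows "(LINT t|W.M. lam * f t * q t + h t * q' t) = d * q 0"
proof -
  have cq0: "continuous_on UNIV q"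
    by (rule DERIV_continuous_on, rule has_field_derivative_at_within, rule dq)
  define F where "F t = t powr (1 - 2 * s) * (lam * f t * q t + h t * q' t)" for t
  have m: "(\<lambda>t. lam * f t * q t + h t * q' t) \<in> borel_measurable (lebesgue_on {0<..<Y})"
    using L2_measurable[OF f_L2] L2_measurable[OF h_L2]
      W.continuous_measurable[OF continuous_on_subset[OF cq]] W.continuous_measurable[OF continuous_on_subset[OF cq0]]
    unfolding W.meas_M by measurable
  have qL: "q \<in> L2 W.M" "q' \<in> L2 W.M"
    by (auto intro!: W.continuous_closure_L2 continuous_on_subset[OF cq] continuous_on_subset[OF cq0])
  have "integrable W.M (\<lambda>t. lam * f t * q t + h t * q' t)"
    using L2_inner_integrable[OF f_L2 qL(1)] L2_inner_integrable[OF h_L2 qL(2)] by (simp add: mult.assoc)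
  then have iF: "integrable (lebesgue_on {0<..<Y}) F"
    unfolding W.integrable_M[OF m] by (simp add: F_def[abs_def])
  have FF: "F t = - (- lam * t powr (1 - 2 * s) * f t * q t + q' t * g t)" if "0 < t" for t
  proof -
    have "t powr (1 - 2 * s) * t powr (2 * s - 1) = 1" using that by (simp add: powr_add[symmetric])
    then have "t powr (1 - 2 * s) * h t = - g t" by (simp add: h_def mult.assoc[symmetric])
    then show ?thesis by (simp add: F_def distrib_left mult.assoc[symmetric])
  qed
  have "(F has_integral (- (g Y * q Y) - - (g 0 * q 0))) {0..Y}"
  proof (rule fundamental_theorem_of_calculus_interior)
    show "continuous_on {0..Y} (\<lambda>t. - (g t * q t))"
      by (intro continuous_intros continuous_on_subset[OF cont_g] continuous_on_subset[OF cq0]) auto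
    fix t assume "t \<in> {0<..<Y}"
    then have t: "0 < t" by simp
    show "((\<lambda>t. - (g t * q t)) has_vector_derivative F t) (at t)"
      unfolding has_real_derivative_iff_has_vector_derivative[symmetric]
      by (rule DERIV_cong[OF DERIV_minus[OF DERIV_mult[OF dg[OF t] dq]]]) (simp add: FF[OF t])
  qed (use Y in simp)
  then have "(F has_integral (d * q 0)) {0<..<Y}"
    using qY g0 by (simp add: has_integral_Icc_iff_Ioo)
  moreover have "(LINT t|W.M. lam * f t * q t + h t * q' t) = (LINT t|lebesgue_on {0<..<Y}. F t)"
    unfolding W.LINT_M[OF m] by (simp add: F_def)
  ultimately show ?thesis using lebesgue_integral_eq_integral[OF iF] by (simp add: integral_unique)
qed

end

lemma continuous_on_matrix_vector_mult:
  fixes A :: "'a::topological_space \<Rightarrow> real^'m^'n"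
  assumes "continuous_on S A" "continuous_on S v"
  shows "continuous_on S (\<lambda>x. A x *v v x)"
proof -
  have "continuous_on S (\<lambda>x. \<chi> i. \<Sum>j\<in>UNIV. A x $ i $ j * v x $ j)"
    by (intro continuous_intros assms)
  then show ?thesis by (simp add: matrix_vector_mult_def[abs_def])
qed

subsection \<open>The energy of liftings\<close>

locale cyl_coeff = cyl_domain \<Omega> s Y for \<Omega> :: "(real^'n) set" and s Y +
  fixes A :: "real^'n \<Rightarrow> real^'n^'n" and C c :: real
  assumes cont_A: "continuous_on \<Omega> A" and C_nonneg: "0 \<le> C"
    and sym_A: "\<And>x v w. x \<in> \<Omega> \<Longrightarrow> (A x *v v) \<bullet> w = v \<bullet> (A x *v w)"
    and bound_A: "\<And>x v. x \<in> \<Omega> \<Longrightarrow> norm (A x *v v) \<le> C * norm v"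
    and coercive_A: "0 < c" "\<And>x v. x \<in> \<Omega> \<Longrightarrow> c * (norm v)\<^sup>2 \<le> (A x *v v) \<bullet> v"
begin

lemma lin_test: "G.lin (test_function \<Omega>)"
proof -
  have "test_function \<Omega> (\<lambda>_. 0)" by (simp add: test_function_def supp_def)
  then show ?thesis
    unfolding G.lin_def by (auto intro: test_function_add test_function_cmult)
qed

sublocale E: energy_form "\<lambda>_. 1" \<Omega> "\<lambda>x v. A x *v v" C c "test_function \<Omega>"
proof
  show "continuous_on \<Omega> (\<lambda>x. A x *v v)" for v
    by (intro continuous_on_matrix_vector_mult cont_A continuous_intros)
qed (use sym_A bound_A coercive_A lin_test in \<open>auto simp: matrix_vector_right_distrib matrix_vector_mult_scaleR\<close>)

text \<open>The constants reflect the block structure of \<open>bold_A\<close>, whose last diagonal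
  entry is 1.\<close>

sublocale F: energy_form "y_weight s" CY "bold_A A" "C + 1" "min c 1" DL
proof
  fix z assume z: "z \<in> CY"
  then have x: "fst z \<in> \<Omega>" by (auto simp: cylinder_def)
  show "bold_A A z (v + w) = bold_A A z v + bold_A A z w" "bold_A A z (r *\<^sub>R v) = r *\<^sub>R bold_A A z v" for v w r
    by (auto simp: bold_A_def matrix_vector_right_distrib matrix_vector_mult_scaleR)
  show "norm (bold_A A z v) \<le> (C + 1) * norm v" for v
  proof -
    have "norm (bold_A A z v) \<le> norm (A (fst z) *v fst v) + norm (snd v)"
      unfolding bold_A_def by (rule norm_Pair_le)
    also have "\<dots> \<le> C * norm (fst v) + norm (snd v)" using bound_A[OF x] by simp
    also have "\<dots> \<le> C * norm v + norm v"
      using norm_fst_snd_le[of v] C_nonneg by (intro add_mono mult_left_mono) auto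
    finally show ?thesis by (simp add: algebra_simps)
  qed
  show "bold_A A z v \<bullet> w = v \<bullet> bold_A A z w" for v w
    using sym_A[OF x] by (simp add: bold_A_def inner_prod_def)
  show "min c 1 * (norm v)\<^sup>2 \<le> bold_A A z v \<bullet> v" for v
  proof -
    have "(norm v)\<^sup>2 = (norm (fst v))\<^sup>2 + (snd v)\<^sup>2"
      by (cases v) (simp add: norm_Pair)
    then have "min c 1 * (norm v)\<^sup>2 = min c 1 * (norm (fst v))\<^sup>2 + min c 1 * (snd v)\<^sup>2"
      by (simp add: distrib_left)
    also have "\<dots> \<le> c * (norm (fst v))\<^sup>2 + 1 * (snd v)\<^sup>2"
      by (intro add_mono mult_right_mono) auto
    also have "\<dots> \<le> bold_A A z v \<bullet> v"
      using coercive_A(2)[OF x, of "fst v"] by (simp add: bold_A_def inner_prod_def power2_eq_square)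
    finally show ?thesis .
  qed
next
  have "continuous_on CY (\<lambda>z. A (fst z))"
    by (rule continuous_on_compose2[OF cont_A]) (auto intro!: continuous_intros simp: cylinder_def)
  then show "continuous_on CY (\<lambda>z. bold_A A z v)" for v
    unfolding bold_A_def
    by (intro continuous_on_Pair continuous_on_matrix_vector_mult continuous_on_const)
qed (use coercive_A(1) lin_DL in auto)

text \<open>A function in \<open>DL\<close> may fail to vanish outside \<open>\<Omega>\<close>; its slices are test functions only after
  being cut off there.\<close>

definition slice :: "((real^'n) \<times> real \<Rightarrow> real) \<Rightarrow> real \<Rightarrow> real^'n \<Rightarrow> real" where
  "slice \<psi> y x = (if x \<in> \<Omega> then \<psi> (x, y) else 0)"

text \<open>The support of \<psi> misses the lateral boundary at height y, so its section,
  intersected with the closure of \<Omega>, is a compact subset of \<Omega> and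
  \<open>Ck_glue\<close> applies.\<close>

lemma slice_test:
  assumes \<psi>: "smooth \<psi>" "DL \<psi>" and y: "0 \<le> y" "y \<le> Y"
  shows "test_function \<Omega> (slice \<psi> y)" "x \<in> \<Omega> \<Longrightarrow> grad (slice \<psi> y) x = fst (grad \<psi> (x, y))"
proof -
  define Kc where "Kc = {x. (x, y) \<in> supp \<psi>} \<inter> closure \<Omega>"
  have cl: "closed {x. (x, y) \<in> supp \<psi>}"
  proof -
    have "continuous_on UNIV (\<lambda>x :: real^'n. (x, y))" by (intro continuous_intros)
    from closed_vimage[OF closed_supp this, of \<psi>] show ?thesis by (simp add: vimage_def)
  qed
  have Kc: "closed Kc" "compact Kc"
    unfolding Kc_def using cl bounded_\<Omega> by (auto intro: closed_Int_compact)
  have sub: "Kc \<subseteq> \<Omega>"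
  proof
    fix x assume x: "x \<in> Kc"
    then have "x \<notin> frontier \<Omega>" using \<psi>(2) y by (auto simp: Kc_def DL_def dirichlet_part_def)
    then show "x \<in> \<Omega>" using x open_\<Omega> by (auto simp: Kc_def frontier_def interior_open)
  qed
  have z: "\<psi> (x, y) = 0" if "x \<in> \<Omega>" "x \<notin> Kc" for x
    using that closure_subset[of \<Omega>] not_in_supp[of "(x, y)" \<psi>] by (auto simp: Kc_def)
  have sm: "smooth (slice \<psi> y)"
    unfolding smooth_def slice_def[abs_def]
    using Ck_glue[OF open_\<Omega> Kc(1) sub smooth_Ck[OF smooth_slice(1)[OF \<psi>(1)]] z] by blast
  have "supp (slice \<psi> y) \<subseteq> Kc"
    by (rule supp_subsetI[OF Kc(1)]) (auto simp: slice_def z)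
  then show "test_function \<Omega> (slice \<psi> y)"
    using sm Kc(2) sub closed_supp[of "slice \<psi> y"] compact_Int_closed[of Kc "supp (slice \<psi> y)"]
    by (auto simp: test_function_def inf.absorb2)
  show "grad (slice \<psi> y) x = fst (grad \<psi> (x, y))" if "x \<in> \<Omega>"
    using grad_cong_open[OF open_\<Omega> that, of "slice \<psi> y" "\<lambda>x. \<psi> (x, y)"] smooth_slice[OF \<psi>(1)]
    by (simp add: slice_def)
qed

lemma En_smooth:
  assumes "test_function \<Omega> u" "test_function \<Omega> v"
  shows "E.En u v = (LINT x|N. (A x *v grad u x) \<bullet> grad v x)"
proof -
  note su = test_function_smooth[OF assms(1)] and sv = test_function_smooth[OF assms(2)]
  have H: "u \<in> E.H" "v \<in> E.H" by (rule G.Hcl_smooth[where D = "test_function \<Omega>", OF su assms(1)], rule G.Hcl_smooth[where D = "test_function \<Omega>", OF sv assms(2)])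
  have "E.En u v = E.bf (grad u) (weak_grad \<Omega> v)"
    unfolding E.En_def
    by (rule E.bf_cong_AE[OF G.Hcl_L2(2)[OF H(1)] G.smooth_grad_L2[OF su] G.weak_grad_smooth[OF su] G.Hcl_L2(2)[OF H(2)]])
  also have "\<dots> = E.bf (weak_grad \<Omega> v) (grad u)" by (rule E.bf_sym)
  also have "\<dots> = E.bf (grad v) (grad u)"
    by (rule E.bf_cong_AE[OF G.Hcl_L2(2)[OF H(2)] G.smooth_grad_L2[OF sv] G.weak_grad_smooth[OF sv] G.smooth_grad_L2[OF su]])
  also have "\<dots> = E.bf (grad u) (grad v)" by (rule E.bf_sym)
  finally show ?thesis by (simp add: E.bf_def ip_def weighted_one)
qed

end

locale lifting = cyl_coeff \<Omega> s Y A C c + cyl_profile \<Omega> s Y d lam f g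
  for \<Omega> :: "(real^'n) set" and s Y A C c d lam f g
begin

text \<open>Separation of variables for a test function u that need not be an eigenfunction:
  integrating first over \<Omega> produces the horizontal energy of u against the slices,
  integrating first over y the boundary term at 0. The remaining integral is the residual of the
  eigenvalue equation.\<close>

lemma energy_lift_smooth:
  assumes u: "test_function \<Omega> u" and \<psi>: "smooth \<psi>" "DL \<psi>"
  shows "F.En (lift u) \<psi> = d * ip N u (\<lambda>x. \<psi> (x, 0)) +
      (LINT y|W.M. f y * (E.En u (slice \<psi> y) - lam * ip N u (slice \<psi> y)))"
    "integrable W.M (\<lambda>y. f y * (E.En u (slice \<psi> y) - lam * ip N u (slice \<psi> y)))"
proof -
  note su = test_function_smooth[OF u] and uL = smooth_borel_L2[OF test_function_smooth[OF u]]
  \<comment> \<open>Extension by zero makes the field Borel on the whole space, as the product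
    lemmas require, although A is controlled only on \<Omega>.\<close>
  define q where "q x = indicator \<Omega> x *\<^sub>R (A x *v grad u x)" for x
  have qb: "q \<in> borel_measurable borel"
    unfolding q_def[abs_def] using open_\<Omega>
    by (intro borel_measurable_continuous_on_indicator continuous_on_matrix_vector_mult cont_A smooth_grad_continuous su) auto
  have qL: "q \<in> L2 N"
    by (rule L2_AE_cong[OF E.B_L2[OF G.smooth_grad_L2[OF su], unfolded weighted_one]])
      (use borel_measurable_M[OF qb, of "\<lambda>_. 1" \<Omega>] in \<open>auto simp: weighted_one q_def intro!: AE_I2\<close>)
  define gx where "gx z = fst (grad \<psi> z)" for z
  define gy where "gy z = snd (grad \<psi> z)" for z
  have cgx: "continuous_on S gx" and cgy: "continuous_on S gy" and cp: "continuous_on S \<psi>" for S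
    unfolding gx_def[abs_def] gy_def[abs_def]
    by (intro continuous_intros smooth_grad_continuous smooth_continuous \<psi>)+
  have L: "gx \<in> L2 Z.M" "gy \<in> L2 Z.M" "\<psi> \<in> L2 Z.M"
    by (intro Z.continuous_closure_L2 cgx cgy cp)+
  have B: "gx \<in> borel_measurable borel" "gy \<in> borel_measurable borel" "\<psi> \<in> borel_measurable borel"
    by (intro borel_measurable_continuous_onI cgx cgy cp)+
  \<comment> \<open>\<open>Q1\<close> and \<open>Q2\<close> are the horizontal and vertical energy
    densities. The zeroth order term \<open>lam * Q3\<close> is added and subtracted: with
    \<open>Q2\<close> it forms the profile equation, with \<open>Q1\<close> the residual.\<close>
  define Q1 where "Q1 z = f (snd z) * (q (fst z) \<bullet> gx z)" for z
  define Q2 where "Q2 z = h (snd z) * (u (fst z) * gy z)" for z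
  define Q3 where "Q3 z = f (snd z) * (u (fst z) * \<psi> z)" for z
  have m: "Q1 \<in> borel_measurable borel" "Q2 \<in> borel_measurable borel" "Q3 \<in> borel_measurable borel"
    unfolding Q1_def[abs_def] Q2_def[abs_def] Q3_def[abs_def]
    by (intro borel_measurable_times borel_measurable_inner fst_measurable snd_measurable f_borel h_borel qb uL B)+
  have i: "integrable Z.M Q1" "integrable Z.M Q2" "integrable Z.M Q3"
    unfolding Q1_def[abs_def] Q2_def[abs_def] Q3_def[abs_def]
    using L2_inner_integrable[OF L2_prod(1)[OF qb qL f_borel f_L2] L(1)]
      L2_inner_integrable[OF L2_prod(1)[OF uL(1,2) h_borel h_L2] L(2)]
      L2_inner_integrable[OF L2_prod(1)[OF uL(1,2) f_borel f_L2] L(3)]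
    by (simp_all add: mult.assoc)
  have PL: "(\<lambda>z. snd (prod_jet u (grad u) f h z)) \<in> L2 Z.M"
    by (rule L2_snd[OF prod_jet_L2(1)[OF uL f_borel f_L2 h_borel h_L2]])
  note H = lift_test[OF u]
  have Hp: "\<psi> \<in> F.H" by (rule Z.Hcl_smooth[where D = DL, OF \<psi>])
  have "F.En (lift u) \<psi> = F.bf (\<lambda>z. snd (prod_jet u (grad u) f h z)) (weak_grad CY \<psi>)"
    unfolding F.En_def by (rule F.bf_cong_AE[OF Z.Hcl_L2(2)[OF H(1)] PL H(2) Z.Hcl_L2(2)[OF Hp]])
  also have "\<dots> = F.bf (weak_grad CY \<psi>) (\<lambda>z. snd (prod_jet u (grad u) f h z))" by (rule F.bf_sym)
  also have "\<dots> = F.bf (grad \<psi>) (\<lambda>z. snd (prod_jet u (grad u) f h z))"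
    by (rule F.bf_cong_AE[OF Z.Hcl_L2(2)[OF Hp] Z.smooth_grad_L2[OF \<psi>(1)] Z.weak_grad_smooth[OF \<psi>(1)] PL])
  also have "\<dots> = F.bf (\<lambda>z. snd (prod_jet u (grad u) f h z)) (grad \<psi>)" by (rule F.bf_sym)
  also have "\<dots> = (LINT z|Z.M. Q1 z + Q2 z)"
    unfolding F.bf_def ip_def
  proof (rule Bochner_Integration.integral_cong[OF refl])
    fix z assume "z \<in> space Z.M"
    then have "fst z \<in> \<Omega>" unfolding Z.space_M by (auto simp: cylinder_def)
    then show "bold_A A z (snd (prod_jet u (grad u) f h z)) \<bullet> grad \<psi> z = Q1 z + Q2 z"
      by (simp add: bold_A_def prod_jet_def inner_prod_def Q1_def Q2_def q_def gx_def gy_def matrix_vector_mult_scaleR mult.assoc)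
  qed
  also have "\<dots> = (LINT z|Z.M. Q1 z) + (LINT z|Z.M. Q2 z)" using i by simp
  finally have En: "F.En (lift u) \<psi> = (LINT z|Z.M. Q1 z) + (LINT z|Z.M. Q2 z)" .
  have sl: "(LINT x|N. Q1 (x, y)) = f y * E.En u (slice \<psi> y)" "(LINT x|N. Q3 (x, y)) = f y * ip N u (slice \<psi> y)"
    if "y \<in> space W.M" for y
  proof -
    have y: "0 \<le> y" "y \<le> Y" using that by (auto simp: W.space_M)
    have "(LINT x|N. q x \<bullet> gx (x, y)) = E.En u (slice \<psi> y)"
      unfolding En_smooth[OF u slice_test(1)[OF \<psi> y]]
      by (rule Bochner_Integration.integral_cong) (auto simp: q_def gx_def slice_test(2)[OF \<psi> y])
    then show "(LINT x|N. Q1 (x, y)) = f y * E.En u (slice \<psi> y)" by (simp add: Q1_def)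
    have "(LINT x|N. u x * \<psi> (x, y)) = ip N u (slice \<psi> y)"
      unfolding ip_def by (rule Bochner_Integration.integral_cong) (auto simp: slice_def)
    then show "(LINT x|N. Q3 (x, y)) = f y * ip N u (slice \<psi> y)" by (simp add: Q3_def)
  qed
  have i13: "integrable W.M (\<lambda>y. (LINT x|N. Q1 (x, y)) - lam * (LINT x|N. Q3 (x, y)))"
    by (intro Bochner_Integration.integrable_diff integrable_mult_right fubini(4) m i)
  have eq13: "(LINT x|N. Q1 (x, y)) - lam * (LINT x|N. Q3 (x, y)) = f y * (E.En u (slice \<psi> y) - lam * ip N u (slice \<psi> y))"
    if "y \<in> space W.M" for y
    using sl[OF that] by (simp add: algebra_simps)
  show "integrable W.M (\<lambda>y. f y * (E.En u (slice \<psi> y) - lam * ip N u (slice \<psi> y)))"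
    using i13 by (subst (asm) Bochner_Integration.integrable_cong[OF refl eq13]) auto
  have "(LINT y|W.M. f y * (E.En u (slice \<psi> y) - lam * ip N u (slice \<psi> y)))
      = (LINT y|W.M. (LINT x|N. Q1 (x, y)) - lam * (LINT x|N. Q3 (x, y)))"
    by (rule Bochner_Integration.integral_cong) (auto simp: eq13)
  also have "\<dots> = (LINT z|Z.M. Q1 z) - lam * (LINT z|Z.M. Q3 z)"
    using fubini(4)[OF m(1) i(1)] fubini(4)[OF m(3) i(3)] by (simp add: fubini(2)[OF m(1) i(1)] fubini(2)[OF m(3) i(3)])
  finally have R: "(LINT y|W.M. f y * (E.En u (slice \<psi> y) - lam * ip N u (slice \<psi> y)))
      = (LINT z|Z.M. Q1 z) - lam * (LINT z|Z.M. Q3 z)" .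
  have m32: "(\<lambda>z. lam * Q3 z + Q2 z) \<in> borel_measurable borel" and i32: "integrable Z.M (\<lambda>z. lam * Q3 z + Q2 z)"
    using m i by auto
  have "lam * (LINT z|Z.M. Q3 z) + (LINT z|Z.M. Q2 z) = (LINT z|Z.M. lam * Q3 z + Q2 z)"
    using i by simp
  also have "\<dots> = (LINT x|N. LINT y|W.M. lam * Q3 (x, y) + Q2 (x, y))"
    by (rule fubini(1)[OF m32 i32])
  also have "\<dots> = (LINT x|N. d * (u x * \<psi> (x, 0)))"
  proof (rule Bochner_Integration.integral_cong[OF refl])
    fix x assume "x \<in> space N"
    then have x: "x \<in> \<Omega>" by simp
    have "(LINT y|W.M. lam * Q3 (x, y) + Q2 (x, y)) = (LINT y|W.M. u x * (lam * f y * \<psi> (x, y) + h y * gy (x, y)))"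
      by (simp add: Q3_def Q2_def algebra_simps)
    also have "\<dots> = u x * (d * \<psi> (x, 0))"
      using profile_weak_fiber[OF smooth_line_derivative[OF \<psi>(1)] smooth_line_continuous[OF \<psi>(1)] DL_top[OF \<psi>(2) x]]
      by (simp add: gy_def)
    finally show "(LINT y|W.M. lam * Q3 (x, y) + Q2 (x, y)) = d * (u x * \<psi> (x, 0))" by simp
  qed
  also have "\<dots> = d * ip N u (\<lambda>x. \<psi> (x, 0))" by (simp add: ip_def)
  finally show "F.En (lift u) \<psi> = d * ip N u (\<lambda>x. \<psi> (x, 0)) +
      (LINT y|W.M. f y * (E.En u (slice \<psi> y) - lam * ip N u (slice \<psi> y)))"
    unfolding R En by simp
qed

lemma slice_bound:
  assumes \<psi>: "smooth \<psi>" "DL \<psi>"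
  obtains B where "0 \<le> B" "\<And>y. 0 \<le> y \<Longrightarrow> y \<le> Y \<Longrightarrow> nrm N (slice \<psi> y) \<le> B \<and> nrm N (grad (slice \<psi> y)) \<le> B"
proof -
  have "compact (closure \<Omega> \<times> {0..Y})" using bounded_\<Omega> by (intro compact_Times) auto
  moreover have "continuous_on (closure \<Omega> \<times> {0..Y}) (cjet \<psi>)"
    unfolding cjet_def[abs_def] by (intro continuous_intros smooth_continuous smooth_grad_continuous \<psi>)
  ultimately have "bounded (cjet \<psi> ` (closure \<Omega> \<times> {0..Y}))"
    using compact_continuous_image compact_imp_bounded by blast
  then obtain b where b: "\<And>z. z \<in> closure \<Omega> \<times> {0..Y} \<Longrightarrow> norm (cjet \<psi> z) \<le> b" by (auto simp: bounded_iff)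
  have one: "(\<lambda>_. b) \<in> L2 N" using G.bounded_L2[of "\<lambda>_. b" "\<bar>b\<bar>"] by (simp add: weighted_one)
  have le: "nrm N q \<le> nrm N (\<lambda>_. b)" if q: "q \<in> L2 N" "\<And>x. x \<in> \<Omega> \<Longrightarrow> norm (q x) \<le> norm (cjet \<psi> (x, y))"
    and y: "0 \<le> y" "y \<le> Y" for q :: "real^'n \<Rightarrow> 'b::euclidean_space" and y
  proof (rule nrm_mono[OF L2_measurable[OF q(1)] one])
    have "norm (q x) \<le> norm b" if "x \<in> \<Omega>" for x
      using q(2)[OF that] b[of "(x, y)"] that y closure_subset[of \<Omega>] by force
    then show "AE x in N. norm (q x) \<le> norm b" by (intro AE_I2) simp
  qed
  have "nrm N (slice \<psi> y) \<le> nrm N (\<lambda>_. b) \<and> nrm N (grad (slice \<psi> y)) \<le> nrm N (\<lambda>_. b)"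
    if y: "0 \<le> y" "y \<le> Y" for y
  proof -
    note t = slice_test[OF \<psi> y]
    note L = smooth_borel_L2[OF test_function_smooth[OF t(1)]]
    have "norm (slice \<psi> y x) \<le> norm (cjet \<psi> (x, y))" if "x \<in> \<Omega>" for x
      using norm_fst_snd_le(1)[of "cjet \<psi> (x, y)"] that by (simp add: slice_def cjet_def)
    moreover have "norm (grad (slice \<psi> y) x) \<le> norm (cjet \<psi> (x, y))" if "x \<in> \<Omega>" for x
      using norm_fst_snd_le(2)[of "cjet \<psi> (x, y)"] norm_fst_snd_le(1)[of "grad \<psi> (x, y)"] that
      by (simp add: t(2) cjet_def)
    ultimately show ?thesis using le[OF L(2) _ y] le[OF L(4) _ y] by blast
  qed
  then show ?thesis using that[of "nrm N (\<lambda>_. b)"] by auto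
qed

text \<open>Test functions u n tending to \<phi> are lifted. Their residuals tend to zero uniformly
  in y because \<phi> satisfies the eigenvalue equation exactly. The identity is obtained for smooth
  test functions on the cylinder and extended by density and continuity of the trace.\<close>

lemma eigen_lift:
  assumes \<phi>: "\<phi> \<in> E.H" and eig: "\<And>w. w \<in> E.H \<Longrightarrow> E.En \<phi> w = lam * ip N \<phi> w"
  shows "\<exists>V. V \<in> F.H \<and> (AE x in N. T V x = f 0 * \<phi> x) \<and> (\<forall>w\<in>F.H. F.En V w = d * ip N \<phi> (T w))"
proof -
  obtain u where u: "\<And>n. smooth (u n)" "\<And>n. test_function \<Omega> (u n)"
    "(\<lambda>n. nrm N (\<lambda>x. cjet (u n) x - wjet \<Omega> \<phi> x)) \<longlonglongrightarrow> 0"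
    using G.Hcl_approx[OF \<phi>] unfolding weighted_one by blast
  obtain V where V: "V \<in> Z.Hcl DL" "(\<lambda>n. nrm Z.M (\<lambda>z. wjet CY (lift (u n)) z - wjet CY V z)) \<longlonglongrightarrow> 0"
    "AE x in N. T V x = f 0 * \<phi> x"
    using lift_H10[OF \<phi> u(2,3)] by blast
  have phL: "\<phi> \<in> L2 N" and Jphi: "wjet \<Omega> \<phi> \<in> L2 N" using G.Hcl_L2(1,4)[OF \<phi>] by (simp_all add: weighted_one)
  have JL: "cjet (u n) \<in> L2 N" for n using G.cjet_L2[OF u(1)] by (simp add: weighted_one)
  have uL: "u n \<in> L2 N" for n by (rule smooth_borel_L2(2)[OF u(1)])
  have uH: "u n \<in> E.H" for n by (rule G.Hcl_smooth[where D = "test_function \<Omega>", OF u(1,2)])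
  have l: "(\<lambda>n. nrm N (\<lambda>x. u n x - \<phi> x)) \<longlonglongrightarrow> 0"
    by (rule lim0_squeeze[OF _ u(3)]) (use nrm_fst_le[OF L2_diff[OF JL Jphi]] in \<open>simp add: cjet_def wjet_def\<close>)
  have smooth_case: "F.En V \<psi> = d * ip N \<phi> (\<lambda>x. \<psi> (x, 0))" if \<psi>: "smooth \<psi>" "DL \<psi>" for \<psi>
  proof -
    define R where "R n = (LINT y|W.M. f y * (E.En (u n) (slice \<psi> y) - lam * ip N (u n) (slice \<psi> y)))" for n
    obtain B where B: "0 \<le> B" "\<And>y. 0 \<le> y \<Longrightarrow> y \<le> Y \<Longrightarrow> nrm N (slice \<psi> y) \<le> B \<and> nrm N (grad (slice \<psi> y)) \<le> B"
      using slice_bound[OF \<psi>] by blast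
    define e where "e n = nrm N (\<lambda>x. cjet (u n) x - wjet \<Omega> \<phi> x)" for n
    have Rb: "\<bar>R n\<bar> \<le> (LINT y|W.M. f 0 * ((C + lam) * e n * B))" for n
      unfolding R_def
    proof (rule order_trans[OF integral_abs_bound integral_mono])
      show "integrable W.M (\<lambda>y. \<bar>f y * (E.En (u n) (slice \<psi> y) - lam * ip N (u n) (slice \<psi> y))\<bar>)"
        using energy_lift_smooth(2)[OF u(2) \<psi>] by (rule integrable_abs)
      show "integrable W.M (\<lambda>y. f 0 * ((C + lam) * e n * B))" by (rule finite_measure.integrable_const[OF W.finite_M])
      fix y assume "y \<in> space W.M"
      then have y: "0 \<le> y" "y \<le> Y" by (auto simp: W.space_M)
      note t = slice_test(1)[OF \<psi> y]
      note sL = smooth_borel_L2[OF test_function_smooth[OF t]]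
      have sH: "slice \<psi> y \<in> E.H" by (rule G.Hcl_smooth[where D = "test_function \<Omega>", OF test_function_smooth[OF t] t])
      have dH: "(\<lambda>x. u n x - \<phi> x) \<in> E.H" by (rule G.Hcl_diff(1)[OF lin_test uH \<phi>])
      \<comment> \<open>Subtracting the vanishing residual of \<phi> leaves the residual of u n -
        \<phi>, which is small in H1.\<close>
      have "E.En (u n) (slice \<psi> y) - lam * ip N (u n) (slice \<psi> y)
          = E.En (\<lambda>x. u n x - \<phi> x) (slice \<psi> y) - lam * ip N (\<lambda>x. u n x - \<phi> x) (slice \<psi> y)"
        unfolding E.En_diff_left[OF uH \<phi> sH] ip_diff_left[OF uL phL sL(2)] eig[OF sH] by (simp add: algebra_simps)
      moreover have "\<bar>E.En (\<lambda>x. u n x - \<phi> x) (slice \<psi> y)\<bar> \<le> C * e n * B"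
      proof -
        have "nrm N (weak_grad \<Omega> (\<lambda>x. u n x - \<phi> x)) = nrm N (\<lambda>x. grad (u n) x - weak_grad \<Omega> \<phi> x)"
        proof (rule nrm_cong_AE)
          have "AE x in N. weak_grad \<Omega> (u n) x = grad (u n) x"
            using G.weak_grad_smooth[OF u(1), of n] unfolding G_M .
          moreover have "AE x in N. weak_grad \<Omega> (\<lambda>x. u n x - \<phi> x) x = weak_grad \<Omega> (u n) x - weak_grad \<Omega> \<phi> x"
            using G.Hcl_diff(2)[OF lin_test uH \<phi>] unfolding G_M .
          ultimately show "AE x in N. weak_grad \<Omega> (\<lambda>x. u n x - \<phi> x) x = grad (u n) x - weak_grad \<Omega> \<phi> x"
            by eventually_elim simp
          show "weak_grad \<Omega> (\<lambda>x. u n x - \<phi> x) \<in> borel_measurable N"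
            using L2_measurable[OF G.Hcl_L2(2)[OF dH]] by (simp add: weighted_one)
          show "(\<lambda>x. grad (u n) x - weak_grad \<Omega> \<phi> x) \<in> borel_measurable N"
            using L2_measurable[OF L2_diff[OF smooth_borel_L2(4)[OF u(1)] G.Hcl_L2(2)[OF \<phi>, unfolded weighted_one]]] .
        qed
        also have "\<dots> \<le> e n"
          unfolding e_def using nrm_snd_le[OF L2_diff[OF JL Jphi], of n] by (simp add: cjet_def wjet_def)
        finally have 1: "nrm N (weak_grad \<Omega> (\<lambda>x. u n x - \<phi> x)) \<le> e n" .
        have "nrm N (weak_grad \<Omega> (slice \<psi> y)) = nrm N (grad (slice \<psi> y))"
          using G.weak_grad_smooth[OF test_function_smooth[OF t]] L2_measurable[OF G.Hcl_L2(2)[OF sH]] L2_measurable[OF sL(4)]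
          unfolding G_M by (intro nrm_cong_AE)
        then have 2: "nrm N (weak_grad \<Omega> (slice \<psi> y)) \<le> B" using B(2)[OF y] by simp
        have "\<bar>E.En (\<lambda>x. u n x - \<phi> x) (slice \<psi> y)\<bar> \<le> C * nrm N (weak_grad \<Omega> (\<lambda>x. u n x - \<phi> x)) * nrm N (weak_grad \<Omega> (slice \<psi> y))"
          using E.En_bound[OF dH sH] C_nonneg by (simp add: weighted_one)
        also have "\<dots> \<le> C * e n * B"
          using 1 2 C_nonneg by (intro mult_mono mult_nonneg_nonneg) (auto simp: e_def)
        finally show ?thesis .
      qed
      moreover have "\<bar>lam * ip N (\<lambda>x. u n x - \<phi> x) (slice \<psi> y)\<bar> \<le> lam * e n * B"
      proof -
        have "\<bar>ip N (\<lambda>x. u n x - \<phi> x) (slice \<psi> y)\<bar> \<le> nrm N (\<lambda>x. u n x - \<phi> x) * nrm N (slice \<psi> y)"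
          by (rule ip_Cauchy_Schwarz[OF L2_diff[OF uL phL] sL(2)])
        also have "\<dots> \<le> e n * B"
          using nrm_fst_le[OF L2_diff[OF JL Jphi], of n] B(2)[OF y]
          by (intro mult_mono) (auto simp: e_def cjet_def wjet_def)
        finally show ?thesis using lam by (simp add: abs_mult mult_left_mono mult.assoc)
      qed
      ultimately have "\<bar>E.En (u n) (slice \<psi> y) - lam * ip N (u n) (slice \<psi> y)\<bar> \<le> (C + lam) * e n * B"
        by (simp add: algebra_simps)
      then show "\<bar>f y * (E.En (u n) (slice \<psi> y) - lam * ip N (u n) (slice \<psi> y))\<bar> \<le> f 0 * ((C + lam) * e n * B)"
        using prof_bounds[OF y] unfolding abs_mult by (intro mult_mono) auto
    qed
    have "(\<lambda>n. f 0 * ((C + lam) * e n * B) * (LINT y|W.M. 1)) \<longlonglongrightarrow> f 0 * ((C + lam) * 0 * B) * (LINT y|W.M. 1)"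
      unfolding e_def by (intro tendsto_intros u(3))
    then have "R \<longlonglongrightarrow> 0"
      by (intro lim0_squeeze[OF Rb]) (simp add: mult_ac)
    moreover have "(\<lambda>n. d * ip N (u n) (\<lambda>x. \<psi> (x, 0))) \<longlonglongrightarrow> d * ip N \<phi> (\<lambda>x. \<psi> (x, 0))"
      by (intro tendsto_mult_left ip_tendsto[OF uL phL smooth_trace_L2[OF \<psi>(1)] l])
    ultimately have "(\<lambda>n. d * ip N (u n) (\<lambda>x. \<psi> (x, 0)) + R n) \<longlonglongrightarrow> d * ip N \<phi> (\<lambda>x. \<psi> (x, 0)) + 0"
      by (intro tendsto_add)
    moreover have "F.En (lift (u n)) \<psi> = d * ip N (u n) (\<lambda>x. \<psi> (x, 0)) + R n" for n
      unfolding R_def by (rule energy_lift_smooth(1)[OF u(2) \<psi>])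
    moreover have "(\<lambda>n. F.En (lift (u n)) \<psi>) \<longlonglongrightarrow> F.En V \<psi>"
      by (rule F.En_tendsto[OF lift_test(1)[OF u(2)] V(1) Z.Hcl_smooth[where D = DL, OF \<psi>] V(2)])
    ultimately show ?thesis using LIMSEQ_unique by simp
  qed
  have "F.En V w = d * ip N \<phi> (T w)" if w: "w \<in> F.H" for w
  proof -
    obtain \<psi> where p: "\<And>k. smooth (\<psi> k)" "\<And>k. DL (\<psi> k)" "(\<lambda>k. nrm Z.M (\<lambda>x. cjet (\<psi> k) x - wjet CY w x)) \<longlonglongrightarrow> 0"
      using Z.Hcl_approx[OF w] by blast
    have pH: "\<psi> k \<in> F.H" for k by (rule Z.Hcl_smooth[where D = DL, OF p(1,2)])
    have eq: "nrm Z.M (\<lambda>x. wjet CY (\<psi> k) x - wjet CY w x) = nrm Z.M (\<lambda>x. cjet (\<psi> k) x - wjet CY w x)" for k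
      by (rule nrm_cong_AE[OF L2_measurable[OF L2_diff[OF Z.Hcl_L2(4)[OF pH] Z.Hcl_L2(4)[OF w]]]
            L2_measurable[OF L2_diff[OF Z.cjet_L2[OF p(1)] Z.Hcl_L2(4)[OF w]]]])
        (use Z.weak_grad_smooth[OF p(1)] in \<open>auto elim: eventually_mono simp: wjet_def cjet_def\<close>)
    have "(\<lambda>k. F.En (\<psi> k) V) \<longlonglongrightarrow> F.En w V"
      by (rule F.En_tendsto[OF pH w V(1)]) (simp add: eq p(3))
    moreover have "F.En (\<psi> k) V = d * ip N (\<lambda>x. \<psi> k (x, 0)) \<phi>" for k
      using smooth_case[OF p(1,2)] by (simp add: F.En_sym[of "\<psi> k"] ip_commute[of N \<phi>])
    moreover have "(\<lambda>k. d * ip N (\<lambda>x. \<psi> k (x, 0)) \<phi>) \<longlonglongrightarrow> d * ip N (T w) \<phi>"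
      by (intro tendsto_mult_left ip_tendsto[OF smooth_trace_L2[OF p(1)] tr_L2[OF w] phL tr_limit[OF w p(1,3)]])
    ultimately have "F.En w V = d * ip N (T w) \<phi>" using LIMSEQ_unique by simp
    then show ?thesis by (simp add: F.En_sym[of V] ip_commute[of N \<phi>])
  qed
  with V show ?thesis by blast
qed

end

context cyl_coeff
begin

lemma eigen_extension:
  assumes d: "0 < d" and lam: "0 \<le> lam" and \<phi>: "\<phi> \<in> E.H"
    and eig: "\<And>w. w \<in> E.H \<Longrightarrow> E.En \<phi> w = lam * ip N \<phi> w"
  shows "\<exists>V \<sigma>. V \<in> F.H \<and> (AE x in N. T V x = \<sigma> * \<phi> x) \<and> (\<forall>w\<in>F.H. F.En V w = d * ip N \<phi> (T w)) \<and>
    0 \<le> \<sigma> \<and> \<sigma> \<le> d * Y powr (2 * s) / (2 * s) \<and>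
    lam powr s * \<sigma> \<le> (4 * (1 - s) * d * (d / s) powr ((1 - s) / s)) powr s"
proof -
  obtain f0 g0 where "profile s Y d lam f0 g0" using profile_exists[OF s Y d lam] by blast
  then obtain f g where p: "profile s Y d lam f g" "continuous_on UNIV f" "continuous_on UNIV g"
    using profile_extend[OF _ Y] by blast
  interpret lifting \<Omega> s Y A C c d lam f g
    by unfold_locales (use d lam p in auto)
  show ?thesis
    using eigen_lift[OF \<phi> eig] profile_bounds[OF s Y d lam p(1)] prof_bounds(1)[of 0] Y by auto
qed

end

subsection \<open>Series in weighted Sobolev spaces\<close>

context weighted_domain
begin

text \<open>A bound valid for every finite index set controls the blocks between m and n, so the
  partial sums are Cauchy.\<close>

lemma Hcl_series:
  assumes D: "lin D" and e: "\<And>k. e k \<in> Hcl D" and b: "summable b"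
    and bound: "\<And>I. finite I \<Longrightarrow> (nrm M (wjet U (\<lambda>x. \<Sum>k\<in>I. a k * e k x)))\<^sup>2 \<le> (\<Sum>k\<in>I. b k)"
  obtains w where "w \<in> Hcl D" "(\<lambda>n. nrm M (\<lambda>x. wjet U (\<lambda>x. \<Sum>k<n. a k * e k x) x - wjet U w x)) \<longlonglongrightarrow> 0"
proof -
  define S where "S n x = (\<Sum>k<n. a k * e k x)" for n :: nat and x
  have SH: "S n \<in> Hcl D" for n
    unfolding S_def[abs_def] by (rule Hcl_sum[OF D e])
  have eq: "nrm M (wjet U (\<lambda>x. S m x - S n x)) = nrm M (\<lambda>x. wjet U (S m) x - wjet U (S n) x)" for m n
    by (rule nrm_cong_AE[OF L2_measurable[OF Hcl_L2(4)[OF Hcl_diff(1)[OF D SH SH]]]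
          L2_measurable[OF L2_diff[OF Hcl_L2(4)[OF SH] Hcl_L2(4)[OF SH]]] wjet_diff_AE[OF D SH SH]])
  have sym: "nrm M (wjet U (\<lambda>x. S m x - S n x)) = nrm M (wjet U (\<lambda>x. S n x - S m x))" for m n
    unfolding eq by (rule nrm_minus_commute)
  have tail: "(nrm M (wjet U (\<lambda>x. S n x - S m x)))\<^sup>2 \<le> (\<Sum>k\<in>{m..<n}. b k)" if "m \<le> n" for m n
  proof -
    have "S n x - S m x = (\<Sum>k\<in>{m..<n}. a k * e k x)" for x
      unfolding S_def using sum_diff_nat_ivl[of 0 m n "\<lambda>k. a k * e k x"] that by (simp add: atLeast0LessThan)
    then show ?thesis using bound[of "{m..<n}"] by simp
  qed
  obtain w where "w \<in> Hcl D" "(\<lambda>n. nrm M (\<lambda>x. wjet U (S n) x - wjet U w x)) \<longlonglongrightarrow> 0"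
  proof (rule Hcl_complete[OF D SH])
    fix r :: real assume r: "0 < r"
    then obtain M0 where M0: "\<And>m n. m \<ge> M0 \<Longrightarrow> norm (sum b {m..<n}) < r\<^sup>2"
      using b[unfolded summable_Cauchy] zero_less_power[of r 2] by blast
    have *: "nrm M (wjet U (\<lambda>x. S n x - S m x)) < r" if "M0 \<le> m" "m \<le> n" for m n
    proof -
      have "(nrm M (wjet U (\<lambda>x. S n x - S m x)))\<^sup>2 < r\<^sup>2"
        using tail[OF that(2)] M0[OF that(1), of n] by (simp add: abs_less_iff)
      then show ?thesis using r by (simp add: power_less_imp_less_base)
    qed
    have "nrm M (wjet U (\<lambda>x. S m x - S n x)) < r" if "M0 \<le> m" "M0 \<le> n" for m n
      using *[of m n] *[of n m] sym[of m n] that by (cases "m \<le> n") auto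
    then show "\<exists>N. \<forall>m\<ge>N. \<forall>n\<ge>N. nrm M (wjet U (\<lambda>x. S m x - S n x)) < r" by blast
  qed
  then show ?thesis using that by (simp add: S_def[abs_def])
qed

lemma wjet_limits:
  assumes w: "\<And>n. w n \<in> Hcl D" "w' \<in> Hcl D" and lim: "(\<lambda>n. nrm M (\<lambda>x. wjet U (w n) x - wjet U w' x)) \<longlonglongrightarrow> 0"
  shows "(\<lambda>n. nrm M (\<lambda>x. w n x - w' x)) \<longlonglongrightarrow> 0"
  by (rule lim0_squeeze[OF _ lim])
    (use nrm_fst_le[OF L2_diff[OF Hcl_L2(4)[OF w(1)] Hcl_L2(4)[OF w(2)]]] in \<open>simp add: wjet_def\<close>)

lemma nrm_wjet_power2:
  assumes "w \<in> Hcl D"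
  shows "(nrm M (wjet U w))\<^sup>2 = (nrm M w)\<^sup>2 + (nrm M (weak_grad U w))\<^sup>2"
  unfolding wjet_def[abs_def] by (rule nrm_Pair[OF Hcl_L2(1,2)[OF assms]])

end

subsection \<open>The maximum principle\<close>

text \<open>A smooth increasing approximation of the positive part of t - b, shifted to vanish at t
  = 0 so that composition maps test functions to test functions. Its derivative is a logistic
  function with values in [0,1].\<close>

definition softplus :: "real \<Rightarrow> nat \<Rightarrow> real \<Rightarrow> real" where
  "softplus b m t = (ln (1 + exp (real m * (t - b))) - ln (1 + exp (- real m * b))) / real m"

definition logistic :: "real \<Rightarrow> real" where
  "logistic t = inverse (1 + exp (- t))"

lemma logistic_deriv: "(logistic has_real_derivative logistic t * (1 + (-1) * logistic t)) (at t)"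
proof -
  have "1 + exp (- t) \<noteq> 0" using exp_gt_zero[of "- t"] by linarith
  then show ?thesis
    unfolding logistic_def[abs_def]
    by (auto intro!: derivative_eq_intros simp: field_simps power2_eq_square)
qed

lemma smooth_logistic: "smooth logistic"
proof -
  have "Ck k logistic" for k
  proof (induction k)
    case 0
    show ?case
      unfolding Ck.simps by (rule DERIV_continuous_on, rule has_field_derivative_at_within, rule logistic_deriv)
  next
    case (Suc k)
    then show ?case by (intro Ck_SucI_real[OF logistic_deriv] Ck_mult Ck_add Ck_const)
  qed
  then show ?thesis by (simp add: smooth_def)
qed

lemma logistic_bounds: "0 \<le> logistic t" "logistic t \<le> 1"
proof -
  have "1 \<le> 1 + exp (- t)" by simp
  then show "0 \<le> logistic t" "logistic t \<le> 1" unfolding logistic_def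
    by (auto intro: inverse_le_1_iff[THEN iffD2])
qed

lemma softplus_deriv:
  assumes "0 < m"
  shows "(softplus b m has_real_derivative logistic (real m * t + (- real m * b))) (at t)"
proof -
  have p: "0 < 1 + exp x" for x :: real using exp_gt_zero[of x] by linarith
  have "inverse (1 + exp (- x)) = exp x / (1 + exp x)" for x :: real
    using p[of x] p[of "- x"] by (simp add: field_simps exp_minus)
  moreover have "real m * t + (- real m * b) = real m * (t - b)" by (simp add: algebra_simps)
  ultimately have e: "logistic (real m * t + (- real m * b)) = exp (real m * (t - b)) / (1 + exp (real m * (t - b)))"
    unfolding logistic_def by (simp only:)
  define E where "E = exp (real m * (t - b))"
  have d: "((\<lambda>t. ln (1 + exp (real m * (t - b)))) has_real_derivative inverse (1 + E) * (E * real m)) (at t)"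
    using p[of "real m * (t - b)"] unfolding E_def by (auto intro!: derivative_eq_intros simp: divide_inverse)
  have "(inverse (1 + E) * (E * real m) - 0) / real m = E / (1 + E)"
    using assms by (simp add: divide_inverse)
  then show ?thesis
    unfolding e softplus_def[abs_def] E_def[symmetric]
    using DERIV_cdivide[OF DERIV_diff[OF d DERIV_const]] by (rule DERIV_cong[rotated])
qed

lemma smooth_softplus:
  assumes "0 < m" shows "smooth (softplus b m)"
proof -
  have "Ck k (softplus b m)" for k
    using Ck_SucI_real[OF softplus_deriv[OF assms] smooth_Ck[OF smooth_compose[OF smooth_logistic smooth_affine_real], of k]] Ck_SucD by blast
  then show ?thesis by (simp add: smooth_def)
qed

lemma softplus_0 [simp]: "softplus b m 0 = 0"
  by (simp add: softplus_def)

lemma softplus_lipschitz: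
  assumes "0 < m"
  shows "\<bar>softplus b m t - softplus b m u\<bar> \<le> \<bar>t - u\<bar>"
proof -
  have *: "\<bar>softplus b m t - softplus b m u\<bar> \<le> \<bar>t - u\<bar>" if ut: "u < t" for u t
  proof -
    obtain z where "softplus b m t - softplus b m u = (t - u) * logistic (real m * z + (- real m * b))"
      using MVT2[OF ut softplus_deriv[OF assms]] by blast
    then show ?thesis
      using ut logistic_bounds by (auto simp: abs_mult intro: mult_right_le_one_le)
  qed
  show ?thesis
    using *[of u t] *[of t u] by (cases t u rule: linorder_cases) (auto simp: abs_minus_commute)
qed

text \<open>The condition on b makes the shift \<open>ln (1 + exp (- m * b))\<close> lie between 0
  and 1; so does the error of the unshifted function, before division by m.\<close>

lemma softplus_approx:
  assumes m: "0 < m" and b: "0 \<le> b"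
  shows "\<bar>softplus b m t - max (t - b) 0\<bar> \<le> 1 / real m"
proof -
  have ln2: "ln 2 \<le> (1 :: real)" using ln_le_minus_one[of "2::real"] by simp
  have bd: "max x 0 \<le> ln (1 + exp x) \<and> ln (1 + exp x) \<le> max x 0 + 1" for x :: real
  proof -
    have p: "0 < 1 + exp x" using exp_gt_zero[of x] by linarith
    have "exp (max x 0) \<le> 1 + exp x" by (cases "0 \<le> x") (auto simp: max_def)
    then have 1: "max x 0 \<le> ln (1 + exp x)" using p by (simp add: ln_ge_iff)
    have "1 + exp x \<le> 2 * exp (max x 0)" by (cases "0 \<le> x") (auto simp: max_def)
    then have "ln (1 + exp x) \<le> ln (2 * exp (max x 0))" using p by (subst ln_le_cancel_iff) auto
    also have "\<dots> = ln 2 + max x 0" by (simp add: ln_mult)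
    finally show ?thesis using 1 ln2 by linarith
  qed
  have k: "max (real m * (t - b)) 0 = real m * max (t - b) 0"
    using m max_mult_distrib_left[of "real m" "t - b" 0] by simp
  have "max (- real m * b) 0 = 0" using b by (simp add: max_def)
  then have "\<bar>(ln (1 + exp (real m * (t - b))) - ln (1 + exp (- real m * b))) - real m * max (t - b) 0\<bar> \<le> 1"
    using bd[of "real m * (t - b)"] bd[of "- real m * b"] unfolding k by linarith
  moreover have "softplus b m t - max (t - b) 0 =
      ((ln (1 + exp (real m * (t - b))) - ln (1 + exp (- real m * b))) - real m * max (t - b) 0) / real m"
    using m by (simp add: softplus_def diff_divide_distrib)
  moreover have "\<bar>x / real m\<bar> \<le> 1 / real m" if "\<bar>x\<bar> \<le> 1" for x
    using m that by (simp add: abs_divide divide_right_mono)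
  ultimately show ?thesis by (simp only:)
qed

context cyl_coeff
begin

text \<open>Stampacchia's argument: test with the positive part p of z - b. The energy term is
  nonnegative, so the integral of p (r - z) is nonnegative, while r - z is at most -p wherever p is
  positive. The smooth surrogate \<open>softplus\<close> replaces the chain rule for p.\<close>

lemma max_principle:
  assumes z: "z \<in> E.H" and r: "r \<in> L2 N" and \<epsilon>: "0 < \<epsilon>" and b: "0 \<le> b"
    and eq: "\<And>w. w \<in> E.H \<Longrightarrow> ip N z w + \<epsilon> * E.En z w = ip N r w"
    and rb: "AE x in N. r x \<le> b"
  shows "AE x in N. z x \<le> b"
proof -
  obtain u where u: "\<And>n. smooth (u n)" "\<And>n. test_function \<Omega> (u n)"
    "(\<lambda>n. nrm N (\<lambda>x. cjet (u n) x - wjet \<Omega> z x)) \<longlonglongrightarrow> 0"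
    using G.Hcl_approx[OF z] unfolding weighted_one by blast
  have zL: "z \<in> L2 N" and gzL: "weak_grad \<Omega> z \<in> L2 N" and Jz: "wjet \<Omega> z \<in> L2 N"
    using G.Hcl_L2(1,2,4)[OF z] by (simp_all add: weighted_one)
  have JL: "cjet (u n) \<in> L2 N" and uL: "u n \<in> L2 N" and guL: "grad (u n) \<in> L2 N" for n
    using G.cjet_L2[OF u(1)] G.smooth_L2[OF u(1)] G.smooth_grad_L2[OF u(1)] by (simp_all add: weighted_one)
  have l1: "(\<lambda>n. nrm N (\<lambda>x. u n x - z x)) \<longlonglongrightarrow> 0"
    by (rule lim0_squeeze[OF _ u(3)]) (use nrm_fst_le[OF L2_diff[OF JL Jz]] in \<open>simp add: cjet_def wjet_def\<close>)
  have l2: "(\<lambda>n. nrm N (\<lambda>x. grad (u n) x - weak_grad \<Omega> z x)) \<longlonglongrightarrow> 0"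
    by (rule lim0_squeeze[OF _ u(3)]) (use nrm_snd_le[OF L2_diff[OF JL Jz]] in \<open>simp add: cjet_def wjet_def\<close>)
  have rz: "(\<lambda>x. r x - z x) \<in> L2 N" by (rule L2_diff[OF r zL])
  have spL: "(\<lambda>x. softplus b m (v x)) \<in> L2 N" if m: "0 < m" and v: "v \<in> L2 N" for m v
  proof (rule L2_dominated[OF _ L2_integrable_norm[OF v]])
    have "softplus b m \<in> borel_measurable borel"
      using smooth_continuous[OF smooth_softplus[OF m]] by (rule borel_measurable_continuous_onI)
    then show "(\<lambda>x. softplus b m (v x)) \<in> borel_measurable N"
      using L2_measurable[OF v] by (rule measurable_compose[rotated])
    show "AE x in N. (norm (softplus b m (v x)))\<^sup>2 \<le> (norm (v x))\<^sup>2"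
      using softplus_lipschitz[OF m, of b _ 0] by (intro AE_I2 power_mono) auto
  qed
  \<comment> \<open>By the resolvent equation this pairing is formally \<epsilon> times the energy
    of z against \<open>softplus\<close> of z. The composition is differentiated only for the smooth
    approximants u n.\<close>
  have step: "0 \<le> ip N (\<lambda>x. r x - z x) (\<lambda>x. softplus b m (z x))" if m: "0 < m" for m
  proof -
    define w where "w n x = softplus b m (u n x)" for n x
    define k where "k n x = logistic (real m * u n x + (- real m * b))" for n x
    have tw: "test_function \<Omega> (w n)" for n
      unfolding w_def[abs_def] by (rule test_function_compose[OF smooth_softplus[OF m] softplus_0 u(2)])
    have sw: "smooth (w n)" for n by (rule test_function_smooth[OF tw])
    have wH: "w n \<in> E.H" for n by (rule G.Hcl_smooth[where D = "test_function \<Omega>", OF sw tw])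
    have gw: "grad (w n) x = k n x *\<^sub>R grad (u n) x" for n x
      unfolding w_def[abs_def] k_def by (rule grad_compose[OF softplus_deriv[OF m] u(1)])
    have gwL: "grad (w n) \<in> L2 N" for n using G.smooth_grad_L2[OF sw] by (simp add: weighted_one)
    have gwle: "nrm N (grad (w n)) \<le> nrm N (grad (u n))" for n
    proof (rule nrm_mono[OF L2_measurable[OF gwL] guL])
      have "norm (k n x *\<^sub>R grad (u n) x) \<le> norm (grad (u n) x)" for x
        using logistic_bounds unfolding k_def by (simp add: mult_left_le_one_le)
      then show "AE x in N. norm (grad (w n) x) \<le> norm (grad (u n) x)" by (simp add: gw)
    qed
    have En: "E.En z (w n) = E.bf (weak_grad \<Omega> z) (grad (w n))" for n
      unfolding E.En_def E.bf_sym[of "weak_grad \<Omega> z"]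
      by (rule E.bf_cong_AE[OF G.Hcl_L2(2)[OF wH] G.smooth_grad_L2[OF sw] G.weak_grad_smooth[OF sw] G.Hcl_L2(2)[OF z]])
    have pos: "0 \<le> E.bf (grad (u n)) (grad (w n))" for n
      unfolding E.bf_def ip_def gw
    proof (rule integral_nonneg_AE, rule AE_I2)
      fix x assume "x \<in> space G.M"
      then have x: "x \<in> \<Omega>" by (simp add: weighted_one)
      have "0 \<le> (A x *v grad (u n) x) \<bullet> grad (u n) x"
        using coercive_A(2)[OF x, of "grad (u n) x"] coercive_A(1) by (meson order_trans mult_nonneg_nonneg less_imp_le zero_le_power2)
      then show "0 \<le> (A x *v grad (u n) x) \<bullet> (k n x *\<^sub>R grad (u n) x)"
        using logistic_bounds by (simp add: k_def)
    qed
    \<comment> \<open>z is replaced by u n in the energy at the price of an error tending to zero;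
      the energy of u n against w n is nonnegative since the gradient of w n is a nonnegative
      multiple of that of u n.\<close>
    have low: "- (C * nrm N (\<lambda>x. grad (u n) x - weak_grad \<Omega> z x) * nrm N (grad (u n))) \<le> E.En z (w n)" for n
    proof -
      have "E.bf (\<lambda>x. grad (u n) x - weak_grad \<Omega> z x) (grad (w n)) = E.bf (grad (u n)) (grad (w n)) - E.En z (w n)"
        unfolding En by (rule E.bf_diff_left[OF G.smooth_grad_L2[OF u(1)] G.Hcl_L2(2)[OF z] G.smooth_grad_L2[OF sw]])
      moreover have "\<bar>E.bf (\<lambda>x. grad (u n) x - weak_grad \<Omega> z x) (grad (w n))\<bar>
          \<le> C * nrm N (\<lambda>x. grad (u n) x - weak_grad \<Omega> z x) * nrm N (grad (w n))"
        using E.bf_bound[OF L2_diff[OF G.smooth_grad_L2[OF u(1)] G.Hcl_L2(2)[OF z]] G.smooth_grad_L2[OF sw]] C_nonneg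
        by (simp add: weighted_one)
      moreover have "C * nrm N (\<lambda>x. grad (u n) x - weak_grad \<Omega> z x) * nrm N (grad (w n))
          \<le> C * nrm N (\<lambda>x. grad (u n) x - weak_grad \<Omega> z x) * nrm N (grad (u n))"
        using C_nonneg by (intro mult_left_mono gwle) auto
      ultimately show ?thesis using pos[of n] by linarith
    qed
    have "(\<lambda>n. nrm N (\<lambda>x. softplus b m (u n x) - softplus b m (z x))) \<longlonglongrightarrow> 0"
    proof (rule lim0_squeeze[OF _ l1])
      show "\<bar>nrm N (\<lambda>x. softplus b m (u n x) - softplus b m (z x))\<bar> \<le> nrm N (\<lambda>x. u n x - z x)" for n
        using nrm_mono[OF L2_measurable[OF L2_diff[OF spL[OF m uL] spL[OF m zL]]] L2_diff[OF uL zL], of n] softplus_lipschitz[OF m]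
        by auto
    qed
    then have "(\<lambda>n. ip N (\<lambda>x. softplus b m (u n x)) (\<lambda>x. r x - z x)) \<longlonglongrightarrow> ip N (\<lambda>x. softplus b m (z x)) (\<lambda>x. r x - z x)"
      by (rule ip_tendsto[OF spL[OF m uL] spL[OF m zL] rz])
    then have A1: "(\<lambda>n. ip N (w n) (\<lambda>x. r x - z x)) \<longlonglongrightarrow> ip N (\<lambda>x. softplus b m (z x)) (\<lambda>x. r x - z x)"
      by (simp add: w_def[abs_def])
    have A2: "(\<lambda>n. \<epsilon> * - (C * nrm N (\<lambda>x. grad (u n) x - weak_grad \<Omega> z x) * nrm N (grad (u n))))
        \<longlonglongrightarrow> \<epsilon> * - (C * 0 * nrm N (weak_grad \<Omega> z))"
      by (intro tendsto_intros l2 nrm_tendsto[OF guL gzL l2])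
    have le: "\<epsilon> * - (C * nrm N (\<lambda>x. grad (u n) x - weak_grad \<Omega> z x) * nrm N (grad (u n))) \<le> ip N (w n) (\<lambda>x. r x - z x)" for n
    proof -
      have wL: "w n \<in> L2 N" using G.smooth_L2[OF sw] by (simp add: weighted_one)
      have "ip N (w n) (\<lambda>x. r x - z x) = \<epsilon> * E.En z (w n)"
        using eq[OF wH, of n] ip_diff_left[OF r zL wL] unfolding ip_commute[of N "w n"] by linarith
      then show ?thesis using mult_left_mono[OF low[of n], of \<epsilon>] \<epsilon> by simp
    qed
    have "\<epsilon> * - (C * 0 * nrm N (weak_grad \<Omega> z)) \<le> ip N (\<lambda>x. softplus b m (z x)) (\<lambda>x. r x - z x)"
      using le by (intro LIMSEQ_le[OF A2 A1]) auto
    then show ?thesis by (simp add: ip_commute)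
  qed
  define p where "p x = max (z x - b) 0" for x
  have pL: "p \<in> L2 N"
  proof (rule L2_dominated[OF _ L2_integrable_norm[OF zL]])
    show "p \<in> borel_measurable N" unfolding p_def[abs_def] using L2_measurable[OF zL] by measurable
    have "\<bar>max (z x - b) 0\<bar> \<le> \<bar>z x\<bar>" for x using b by (auto simp: max_def)
    then show "AE x in N. (norm (p x))\<^sup>2 \<le> (norm (z x))\<^sup>2" by (intro AE_I2 power_mono) (auto simp: p_def)
  qed
  have one: "(\<lambda>_. 1 :: real) \<in> L2 N" using G.bounded_L2[of "\<lambda>_. 1 :: real" 1] by (simp add: weighted_one)
  have "(\<lambda>m. nrm N (\<lambda>x. softplus b (Suc m) (z x) - p x)) \<longlonglongrightarrow> 0"
  proof (rule lim0_squeeze)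
    show "\<bar>nrm N (\<lambda>x. softplus b (Suc m) (z x) - p x)\<bar> \<le> inverse (real (Suc m)) * nrm N (\<lambda>_. 1 :: real)" for m
    proof -
      have "nrm N (\<lambda>x. softplus b (Suc m) (z x) - p x) \<le> nrm N (\<lambda>x. inverse (real (Suc m)) *\<^sub>R (1 :: real))"
        by (rule nrm_mono[OF L2_measurable[OF L2_diff[OF spL[OF _ zL] pL]] L2_scaleR[OF one]])
          (use softplus_approx[of "Suc m" b] b in \<open>auto simp: p_def divide_inverse simp del: of_nat_Suc\<close>)
      then show ?thesis unfolding nrm_scaleR by simp
    qed
    show "(\<lambda>m. inverse (real (Suc m)) * nrm N (\<lambda>_. 1 :: real)) \<longlonglongrightarrow> 0"
      using tendsto_mult_right[OF LIMSEQ_inverse_real_of_nat] by simp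
  qed
  from ip_tendsto[OF spL[OF _ zL] pL rz this]
  have "(\<lambda>m. ip N (\<lambda>x. softplus b (Suc m) (z x)) (\<lambda>x. r x - z x)) \<longlonglongrightarrow> ip N p (\<lambda>x. r x - z x)" by simp
  then have "0 \<le> ip N p (\<lambda>x. r x - z x)"
    by (rule LIMSEQ_le_const) (use step in \<open>auto simp: ip_commute\<close>)
  \<comment> \<open>Where p is positive, r - z is at most b - z, which is -p. Hence the square norm
    of p is at most 0.\<close>
  also have "\<dots> \<le> ip N p (\<lambda>x. - p x)"
    unfolding ip_def
  proof (rule integral_mono_AE)
    show "integrable N (\<lambda>x. p x \<bullet> (r x - z x))" by (rule L2_inner_integrable[OF pL rz])
    show "integrable N (\<lambda>x. p x \<bullet> - p x)"
      using L2_inner_integrable[OF pL L2_scaleR[OF pL, of "-1"]] by simp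
    show "AE x in N. p x \<bullet> (r x - z x) \<le> p x \<bullet> - p x"
      using rb
    proof eventually_elim
      fix x assume "r x \<le> b"
      then show "p x \<bullet> (r x - z x) \<le> p x \<bullet> - p x"
        by (cases "z x \<le> b") (auto simp: p_def max_def intro!: mult_left_mono)
    qed
  qed
  also have "\<dots> = - (nrm N p)\<^sup>2" using ip_scaleR_right[of N p "-1" p] by (simp add: nrm_power2)
  finally have "nrm N p = 0" by simp
  from nrm_zero_AE[OF pL this] show ?thesis
    by eventually_elim (auto simp: p_def max_def split: if_splits)
qed

end

subsection \<open>The optimal control problem\<close>

text \<open>The exceptional set is open and null, hence empty. This upgrades almost-everywhere
  conditions on a continuous coefficient to pointwise ones.\<close>

lemma AE_open_all:
  fixes U :: "'a::euclidean_space set"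
  assumes U: "open U" and ae: "AE x in lebesgue_on U. P x" and op: "open {x \<in> U. \<not> P x}" and x: "x \<in> U"
  shows "P x"
proof (rule ccontr)
  assume "\<not> P x"
  then have ne: "{x \<in> U. \<not> P x} \<noteq> {}" using x by auto
  have "AE x in lebesgue. x \<in> U \<longrightarrow> P x"
    using ae U by (simp add: AE_restrict_space_iff)
  then have "AE x in lebesgue. x \<notin> {x \<in> U. \<not> P x}" by eventually_elim auto
  then have "{x \<in> U. \<not> P x} \<in> null_sets lebesgue"
    using op by (subst (asm) AE_iff_null_sets[symmetric]) auto
  then show False using open_not_negligible[OF op ne] by (simp add: negligible_iff_null_sets)
qed

text \<open>If \<open>q1\<close> were negative, a small t would make the quadratic term at most half
  of the linear one; the witness below is chosen accordingly and kept within (0,1].\<close>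

lemma quadratic_first_order:
  fixes q1 q2 :: real
  assumes "\<And>t. 0 < t \<Longrightarrow> t \<le> 1 \<Longrightarrow> 0 \<le> t * q1 + t\<^sup>2 * q2"
  shows "0 \<le> q1"
proof (rule ccontr)
  assume "\<not> 0 \<le> q1"
  then have q1: "q1 < 0" by simp
  define t where "t = min 1 (- q1 / (2 * (\<bar>q2\<bar> + 1)))"
  have t: "0 < t" "t \<le> 1" using q1 by (auto simp: t_def divide_neg_pos)
  have "0 \<le> t * (q1 + t * q2)" using assms[OF t] by (simp add: power2_eq_square algebra_simps)
  then have 1: "0 \<le> q1 + t * q2" using t by (simp add: zero_le_mult_iff)
  have "t * q2 \<le> t * (\<bar>q2\<bar> + 1)" using t by (intro mult_left_mono) auto
  also have "\<dots> \<le> - q1 / (2 * (\<bar>q2\<bar> + 1)) * (\<bar>q2\<bar> + 1)"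
    by (intro mult_right_mono) (auto simp: t_def)
  also have "\<dots> = - q1 / 2"
  proof -
    have *: "x / (2 * y) * y = x / 2" if "0 < y" for x y :: real using that by simp
    show ?thesis by (rule *) simp
  qed
  finally show False using 1 q1 by simp
qed

lemma H10_eq_Hcl:
  assumes "weighted_domain (\<lambda>_. 1) U"
  shows "H10 U = weighted_domain.Hcl (\<lambda>_. 1) U (test_function U)"
  unfolding H10_def weighted_domain.Hcl_def[OF assms] by simp

locale control_problem = cyl_coeff \<Omega> s Y A C c for \<Omega> :: "(real^'n) set" and s Y A C c +
  fixes lam :: "nat \<Rightarrow> real" and \<phi> :: "nat \<Rightarrow> real^'n \<Rightarrow> real"
  assumes eigenbasis: "dirichlet_eigenbasis \<Omega> A lam \<phi>"
begin

lemma H10_eq: "H10 \<Omega> = E.H"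
  by (rule H10_eq_Hcl) unfold_locales

lemma phi_H: "\<phi> k \<in> E.H"
  using eigenbasis by (simp add: dirichlet_eigenbasis_def dirichlet_eigenpair_def H10_eq)

lemma phi_L2: "\<phi> k \<in> L2 N"
  using eigenbasis by (simp add: dirichlet_eigenbasis_def orthonormal_basis_L2_def)

lemma phi_orthonormal: "ip N (\<phi> j) (\<phi> k) = (if j = k then 1 else 0)"
  using eigenbasis by (simp add: dirichlet_eigenbasis_def orthonormal_basis_L2_def inner_L2_eq_ip)

lemma En_eq_LINT: "E.En u w = (LINT x|N. (A x *v weak_grad \<Omega> u x) \<bullet> weak_grad \<Omega> w x)"
  by (simp add: E.En_def E.bf_def ip_def weighted_one)

lemma phi_eigen: "w \<in> E.H \<Longrightarrow> E.En (\<phi> k) w = lam k * ip N (\<phi> k) w"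
  using eigenbasis by (simp add: dirichlet_eigenbasis_def dirichlet_eigenpair_def H10_eq En_eq_LINT inner_L2_eq_ip)

lemma lam_nonneg: "0 \<le> lam k"
  using phi_eigen[OF phi_H, of k k] E.En_nonneg[OF phi_H, of k] by (simp add: phi_orthonormal)

section \<open>Eigenfunction expansions and the resolvent\<close>

definition coef :: "(real^'n \<Rightarrow> real) \<Rightarrow> nat \<Rightarrow> real" where
  "coef w k = ip N w (\<phi> k)"

lemma H_L2: "w \<in> E.H \<Longrightarrow> w \<in> L2 N"
  using G.Hcl_L2(1)[of w] by (simp add: weighted_one)

lemma parseval:
  assumes "v \<in> L2 N" "w \<in> L2 N"
  shows "(\<lambda>k. coef v k * coef w k) sums ip N v w"
proof -
  have S: "(\<lambda>x. \<Sum>k<n. coef v k * \<phi> k x) \<in> L2 N" for n by (intro L2_sum L2_cmult phi_L2)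
  have "(\<lambda>n. nrm N (\<lambda>x. v x - (\<Sum>k<n. coef v k * \<phi> k x))) \<longlonglongrightarrow> 0"
    using eigenbasis assms(1)
    by (simp add: dirichlet_eigenbasis_def orthonormal_basis_L2_def norm_L2_eq_nrm inner_L2_eq_ip coef_def)
  then have "(\<lambda>n. nrm N (\<lambda>x. (\<Sum>k<n. coef v k * \<phi> k x) - v x)) \<longlonglongrightarrow> 0"
    by (simp add: nrm_minus_commute[of N v])
  from ip_tendsto[OF S assms this]
  have "(\<lambda>n. ip N (\<lambda>x. \<Sum>k<n. coef v k * \<phi> k x) w) \<longlonglongrightarrow> ip N v w" .
  moreover have "ip N (\<lambda>x. \<Sum>k<n. coef v k * \<phi> k x) w = (\<Sum>k<n. coef v k * coef w k)" for n
    by (subst ip_sum_left[OF L2_cmult[OF phi_L2] assms(2)])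
      (simp add: ip_cmult_left coef_def ip_commute[of N w])
  ultimately show ?thesis unfolding sums_def by simp
qed

lemma coef_square_summable: "w \<in> L2 N \<Longrightarrow> summable (\<lambda>k. (coef w k)\<^sup>2)"
  using parseval[of w w] by (auto simp: sums_iff power2_eq_square)

lemma coef_unique:
  assumes "v \<in> L2 N" "w \<in> L2 N" "\<And>k. coef v k = coef w k"
  shows "AE x in N. v x = w x"
proof -
  have "coef (\<lambda>x. v x - w x) k = 0" for k
    unfolding coef_def using ip_diff_left[OF assms(1,2) phi_L2] assms(3)[of k] by (simp add: coef_def)
  then have "ip N (\<lambda>x. v x - w x) (\<lambda>x. v x - w x) = 0"
    using parseval[OF L2_diff[OF assms(1,2)] L2_diff[OF assms(1,2)]] by (simp add: sums_iff)
  then have "nrm N (\<lambda>x. v x - w x) = 0" by (simp add: nrm_def)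
  from nrm_zero_AE[OF L2_diff[OF assms(1,2)] this] show ?thesis by simp
qed

lemma ip_partial_sum: "ip N (\<lambda>x. \<Sum>k\<in>I. a k * \<phi> k x) (\<phi> j) = (if j \<in> I then a j else 0)" if "finite I"
  using that by (subst ip_sum_left[OF L2_cmult[OF phi_L2] phi_L2])
    (simp add: ip_cmult_left phi_orthonormal if_distrib cong: if_cong)

text \<open>The eigenfunctions are orthogonal both in L2 and in energy, so norms of finite sums
  become sums of squares, and coercivity controls the gradient.\<close>

lemma H10_series:
  assumes "summable (\<lambda>k. (1 + lam k) * (a k)\<^sup>2)"
  obtains z where "z \<in> E.H" "\<And>k. coef z k = a k" "\<And>w. w \<in> E.H \<Longrightarrow> (\<lambda>k. lam k * (a k * coef w k)) sums E.En z w"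
proof -
  \<comment> \<open>The factor comes from coercivity: 1 + lam/c is at most (1 + 1/c)(1 +
    lam).\<close>
  define b where "b k = (1 + 1 / c) * ((1 + lam k) * (a k)\<^sup>2)" for k
  have c0: "0 < c" by (rule coercive_A(1))
  have b: "summable b" unfolding b_def[abs_def] by (rule summable_mult[OF assms])
  have bound: "(nrm G.M (wjet \<Omega> (\<lambda>x. \<Sum>k\<in>I. a k * \<phi> k x)))\<^sup>2 \<le> (\<Sum>k\<in>I. b k)" if I: "finite I" for I
  proof -
    define S where "S x = (\<Sum>k\<in>I. a k * \<phi> k x)" for x
    have SH: "S \<in> E.H" unfolding S_def[abs_def] by (rule G.Hcl_sum[OF lin_test phi_H])
    have coS: "ip N (\<phi> k) S = a k" if "k \<in> I" for k
      using ip_partial_sum[OF I, of a k] that by (simp add: S_def[abs_def] ip_commute)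
    have n1: "(nrm N S)\<^sup>2 = (\<Sum>k\<in>I. (a k)\<^sup>2)"
    proof -
      have "(nrm N S)\<^sup>2 = (\<Sum>k\<in>I. a k * ip N (\<phi> k) S)"
        unfolding nrm_power2 by (subst (1) S_def[abs_def], subst ip_sum_left[OF L2_cmult[OF phi_L2] H_L2[OF SH]]) (simp add: ip_cmult_left)
      then show ?thesis using coS by (simp add: power2_eq_square)
    qed
    have n2: "E.En S S = (\<Sum>k\<in>I. lam k * (a k)\<^sup>2)"
    proof -
      have "E.En S S = (\<Sum>k\<in>I. a k * E.En (\<phi> k) S)"
        by (subst (1) S_def[abs_def], rule E.En_sum_left[OF phi_H SH])
      then show ?thesis using coS phi_eigen[OF SH] by (simp add: power2_eq_square mult_ac)
    qed
    have "(nrm N (weak_grad \<Omega> S))\<^sup>2 \<le> E.En S S / c"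
      using E.En_coercive[OF SH] c0 by (simp add: weighted_one pos_le_divide_eq mult.commute)
    then have "(nrm N (wjet \<Omega> S))\<^sup>2 \<le> (\<Sum>k\<in>I. (a k)\<^sup>2) + (\<Sum>k\<in>I. lam k * (a k)\<^sup>2) / c"
      using G.nrm_wjet_power2[OF SH] n1 n2 by (simp add: weighted_one)
    also have "\<dots> = (\<Sum>k\<in>I. (1 + lam k / c) * (a k)\<^sup>2)"
      by (simp add: sum_divide_distrib sum.distrib[symmetric] algebra_simps)
    also have "\<dots> \<le> (\<Sum>k\<in>I. b k)"
    proof (rule sum_mono)
      fix k
      have "1 + lam k / c \<le> (1 + 1 / c) * (1 + lam k)"
        using lam_nonneg[of k] c0 by (simp add: algebra_simps)
      then show "(1 + lam k / c) * (a k)\<^sup>2 \<le> b k"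
        unfolding b_def mult.assoc[symmetric] by (rule mult_right_mono) simp
    qed
    finally show ?thesis by (simp add: S_def[abs_def] weighted_one)
  qed
  obtain z where z: "z \<in> E.H" "(\<lambda>n. nrm G.M (\<lambda>x. wjet \<Omega> (\<lambda>x. \<Sum>k<n. a k * \<phi> k x) x - wjet \<Omega> z x)) \<longlonglongrightarrow> 0"
    using G.Hcl_series[OF lin_test phi_H b bound] by blast
  have SH: "(\<lambda>x. \<Sum>k<n. a k * \<phi> k x) \<in> E.H" for n by (rule G.Hcl_sum[OF lin_test phi_H])
  have l: "(\<lambda>n. nrm N (\<lambda>x. (\<Sum>k<n. a k * \<phi> k x) - z x)) \<longlonglongrightarrow> 0"
    using G.wjet_limits[OF SH z] by (simp add: weighted_one)
  show ?thesis
  proof (rule that[OF z(1)])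
    fix k
    have "(\<lambda>n. ip N (\<lambda>x. \<Sum>k<n. a k * \<phi> k x) (\<phi> k)) \<longlonglongrightarrow> coef z k"
      unfolding coef_def by (rule ip_tendsto[OF H_L2[OF SH] H_L2[OF z(1)] phi_L2 l])
    moreover have "(\<lambda>n. ip N (\<lambda>x. \<Sum>k<n. a k * \<phi> k x) (\<phi> k)) \<longlonglongrightarrow> a k"
      by (rule tendsto_eventually) (auto simp: ip_partial_sum eventually_at_top_dense intro!: exI[of _ k])
    ultimately show "coef z k = a k" by (rule LIMSEQ_unique)
  next
    fix w assume w: "w \<in> E.H"
    have "(\<lambda>n. E.En (\<lambda>x. \<Sum>k<n. a k * \<phi> k x) w) \<longlonglongrightarrow> E.En z w"
      by (rule E.En_tendsto[OF SH z(1) w z(2)])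
    moreover have "E.En (\<lambda>x. \<Sum>k<n. a k * \<phi> k x) w = (\<Sum>k<n. lam k * (a k * coef w k))" for n
      unfolding E.En_sum_left[OF phi_H w] by (simp add: phi_eigen[OF w] coef_def ip_commute[of N w] mult_ac)
    ultimately show "(\<lambda>k. lam k * (a k * coef w k)) sums E.En z w" by (simp add: sums_def)
  qed
qed

text \<open>The operator is diagonal, so z is written down by its coefficients. Dividing by 1 +
  \<epsilon> lam gains enough decay for the series to converge in \<open>H10\<close>, and the weak
  equation is checked term by term.\<close>

lemma resolvent:
  assumes r: "r \<in> L2 N" and \<epsilon>: "0 < \<epsilon>"
  obtains z where "z \<in> E.H" "\<And>k. coef z k = coef r k / (1 + \<epsilon> * lam k)"
    "\<And>w. w \<in> E.H \<Longrightarrow> ip N z w + \<epsilon> * E.En z w = ip N r w"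
proof -
  have p: "0 < 1 + \<epsilon> * lam k" for k using \<epsilon> lam_nonneg[of k] by (simp add: add_pos_nonneg)
  have "summable (\<lambda>k. (1 + lam k) * (coef r k / (1 + \<epsilon> * lam k))\<^sup>2)"
  proof (rule summable_comparison_test')
    show "summable (\<lambda>k. (1 + 1 / \<epsilon>) * (coef r k)\<^sup>2)" by (intro summable_mult coef_square_summable r)
    fix k
    have q: "1 \<le> 1 + \<epsilon> * lam k" using \<epsilon> lam_nonneg[of k] by simp
    have "1 + lam k \<le> (1 + 1 / \<epsilon>) * (1 + \<epsilon> * lam k)"
      using \<epsilon> lam_nonneg[of k] by (simp add: algebra_simps)
    also have "\<dots> \<le> (1 + 1 / \<epsilon>) * (1 + \<epsilon> * lam k)\<^sup>2"
      using \<epsilon> q self_le_power[OF q, of 2] by (intro mult_left_mono) auto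
    finally have "(1 + lam k) / (1 + \<epsilon> * lam k)\<^sup>2 \<le> 1 + 1 / \<epsilon>"
      using p[of k] by (simp add: pos_divide_le_eq)
    then have "(1 + lam k) / (1 + \<epsilon> * lam k)\<^sup>2 * (coef r k)\<^sup>2 \<le> (1 + 1 / \<epsilon>) * (coef r k)\<^sup>2"
      by (rule mult_right_mono) simp
    then show "norm ((1 + lam k) * (coef r k / (1 + \<epsilon> * lam k))\<^sup>2) \<le> (1 + 1 / \<epsilon>) * (coef r k)\<^sup>2"
      using lam_nonneg[of k] by (simp add: power_divide abs_mult)
  qed
  then obtain z where z: "z \<in> E.H" "\<And>k. coef z k = coef r k / (1 + \<epsilon> * lam k)"
    "\<And>w. w \<in> E.H \<Longrightarrow> (\<lambda>k. lam k * (coef r k / (1 + \<epsilon> * lam k) * coef w k)) sums E.En z w"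
    using H10_series[where a = "\<lambda>k. coef r k / (1 + \<epsilon> * lam k)"] by blast
  show ?thesis
  proof (rule that[OF z(1,2)])
    fix w assume w: "w \<in> E.H"
    have "(\<lambda>k. coef z k * coef w k + \<epsilon> * (lam k * (coef r k / (1 + \<epsilon> * lam k) * coef w k))) sums (ip N z w + \<epsilon> * E.En z w)"
      by (intro sums_add sums_mult parseval H_L2 z w)
    moreover have "coef z k * coef w k + \<epsilon> * (lam k * (coef r k / (1 + \<epsilon> * lam k) * coef w k)) = coef r k * coef w k" for k
    proof -
      have "coef z k * coef w k + \<epsilon> * (lam k * (coef r k / (1 + \<epsilon> * lam k) * coef w k))
          = (1 + \<epsilon> * lam k) * (coef r k / (1 + \<epsilon> * lam k)) * coef w k"
        unfolding z(2) by (simp add: algebra_simps add_divide_distrib)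
      also have "(1 + \<epsilon> * lam k) * (coef r k / (1 + \<epsilon> * lam k)) = coef r k" using p[of k] by simp
      finally show ?thesis .
    qed
    ultimately have "(\<lambda>k. coef r k * coef w k) sums (ip N z w + \<epsilon> * E.En z w)" by simp
    then show "ip N z w + \<epsilon> * E.En z w = ip N r w"
      using parseval[OF r H_L2[OF w]] sums_unique2 by blast
  qed
qed

text \<open>The maximum principle for z with the bound b and for -z with the bound -a. It requires
  nonnegative bounds, which is where the signs of a and b enter.\<close>

lemma resolvent_Z_ad:
  assumes r: "r \<in> Z_ad \<Omega> a b" and ab: "a < 0" "0 < b" and \<epsilon>: "0 < \<epsilon>" and z: "z \<in> E.H"
    and eq: "\<And>w. w \<in> E.H \<Longrightarrow> ip N z w + \<epsilon> * E.En z w = ip N r w"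
  shows "z \<in> Z_ad \<Omega> a b"
proof -
  have rL: "r \<in> L2 N" and rab: "AE x in N. a \<le> r x \<and> r x \<le> b" using r by (auto simp: Z_ad_def)
  have "AE x in N. r x \<le> b" using rab by eventually_elim simp
  then have 1: "AE x in N. z x \<le> b" using max_principle[OF z rL \<epsilon> _ eq, of b] ab by simp
  have z': "(\<lambda>x. -1 * z x) \<in> E.H" by (rule G.Hcl_cmult(1)[OF lin_test z])
  have r': "(\<lambda>x. -1 * r x) \<in> L2 N" by (rule L2_cmult[OF rL])
  have eq': "ip N (\<lambda>x. -1 * z x) w + \<epsilon> * E.En (\<lambda>x. -1 * z x) w = ip N (\<lambda>x. -1 * r x) w" if "w \<in> E.H" for w
    unfolding ip_cmult_left E.En_cmult_left[OF z that] using eq[OF that] by simp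
  have "AE x in N. -1 * r x \<le> - a" using rab by eventually_elim simp
  then have 2: "AE x in N. -1 * z x \<le> - a" using max_principle[OF z' r' \<epsilon> _ eq', of "- a"] ab by simp
  have "AE x in N. a \<le> z x \<and> z x \<le> b" using 1 2 by eventually_elim simp
  then show ?thesis using H_L2[OF z] by (simp add: Z_ad_def)
qed

section \<open>Extended eigenfunctions and the control-to-trace map\<close>

lemma d_pos: "0 < d_const s"
  using s by (simp add: d_const_def Gamma_real_pos)

text \<open>The two bounds of \<open>eigen_extension\<close> for the flux d =
  \<open>d_const s\<close>. This flux cancels the factor \<open>1 / d_const s\<close> in
  \<open>a_Y\<close>, so that \<open>V k\<close> is exactly the state of the control \<phi>
  k.\<close>

definition C1 :: real where "C1 = d_const s * Y powr (2 * s) / (2 * s)"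
definition C2 :: real where
  "C2 = (4 * (1 - s) * d_const s * (d_const s / s) powr ((1 - s) / s)) powr s"

definition extension :: "nat \<Rightarrow> ((real^'n) \<times> real \<Rightarrow> real) \<times> real" where
  "extension k = (SOME (v, t). v \<in> F.H \<and> (AE x in N. T v x = t * \<phi> k x) \<and>
     (\<forall>w\<in>F.H. F.En v w = d_const s * ip N (\<phi> k) (T w)) \<and>
     0 \<le> t \<and> t \<le> C1 \<and> lam k powr s * t \<le> C2)"

definition V :: "nat \<Rightarrow> (real^'n) \<times> real \<Rightarrow> real" where "V k = fst (extension k)"

definition \<sigma> :: "nat \<Rightarrow> real" where "\<sigma> k = snd (extension k)"

lemma extension:
  "V k \<in> F.H" "AE x in N. T (V k) x = \<sigma> k * \<phi> k x"
  "w \<in> F.H \<Longrightarrow> F.En (V k) w = d_const s * ip N (\<phi> k) (T w)"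
  "0 \<le> \<sigma> k" "\<sigma> k \<le> C1" "lam k powr s * \<sigma> k \<le> C2"
proof -
  have "\<exists>p. case p of (v, t) \<Rightarrow> v \<in> F.H \<and> (AE x in N. T v x = t * \<phi> k x) \<and>
     (\<forall>w\<in>F.H. F.En v w = d_const s * ip N (\<phi> k) (T w)) \<and> 0 \<le> t \<and> t \<le> C1 \<and> lam k powr s * t \<le> C2"
    using eigen_extension[OF d_pos lam_nonneg phi_H phi_eigen, of k] by (auto simp: C1_def C2_def)
  from someI_ex[OF this]
  have "case extension k of (v, t) \<Rightarrow> v \<in> F.H \<and> (AE x in N. T v x = t * \<phi> k x) \<and>
     (\<forall>w\<in>F.H. F.En v w = d_const s * ip N (\<phi> k) (T w)) \<and> 0 \<le> t \<and> t \<le> C1 \<and> lam k powr s * t \<le> C2"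
    unfolding extension_def .
  then show "V k \<in> F.H" "AE x in N. T (V k) x = \<sigma> k * \<phi> k x"
    "w \<in> F.H \<Longrightarrow> F.En (V k) w = d_const s * ip N (\<phi> k) (T w)"
    "0 \<le> \<sigma> k" "\<sigma> k \<le> C1" "lam k powr s * \<sigma> k \<le> C2"
    by (auto simp: V_def \<sigma>_def case_prod_beta)
qed

lemma ip_trace_V: "q \<in> L2 N \<Longrightarrow> ip N q (T (V k)) = \<sigma> k * coef q k"
proof -
  assume q: "q \<in> L2 N"
  have "ip N q (T (V k)) = ip N q (\<lambda>x. \<sigma> k * \<phi> k x)"
    by (rule ip_cong_AE[OF L2_measurable[OF q] L2_measurable[OF q] _ L2_measurable[OF tr_L2[OF extension(1)]]
          L2_measurable[OF L2_cmult[OF phi_L2]] extension(2)]) simp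
  then show ?thesis by (simp add: ip_cmult_right coef_def)
qed

lemma a_Y_eq:
  assumes "v \<in> F.H" "w \<in> F.H"
  shows "a_Y s \<Omega> A Y v w = F.En v w / d_const s"
proof -
  have "(\<lambda>z. bold_A A z (weak_grad CY v z) \<bullet> weak_grad CY w z) \<in> borel_measurable Z.M"
    using L2_inner_integrable[OF F.B_L2[OF Z.Hcl_L2(2)[OF assms(1)]] Z.Hcl_L2(2)[OF assms(2)]] by blast
  then show ?thesis
    unfolding a_Y_def F.En_def F.bf_def ip_def
    by (subst Z.LINT_M) (auto simp: Z.meas_M)
qed

lemma is_state_iff:
  "is_state s \<Omega> A Y r v \<longleftrightarrow> v \<in> F.H \<and> (\<forall>w\<in>F.H. F.En v w = d_const s * ip N r (T w))"
proof -
  have "F.En v w / d_const s = q \<longleftrightarrow> F.En v w = d_const s * q" for w q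
    using d_pos by (auto simp: field_simps)
  then show ?thesis by (auto simp: is_state_def H1L_eq a_Y_eq inner_L2_eq_ip)
qed

text \<open>Test the equation of v with \<open>V k\<close> and that of \<open>V k\<close> with v; by
  symmetry both left-hand sides are the same energy.\<close>

lemma state_coefficients:
  assumes r: "r \<in> L2 N" and v: "is_state s \<Omega> A Y r v"
  shows "coef (T v) k = \<sigma> k * coef r k"
proof -
  have vH: "v \<in> F.H" and eq: "F.En v (V k) = d_const s * ip N r (T (V k))"
    using v extension(1)[of k] by (auto simp: is_state_iff)
  have "d_const s * coef (T v) k = F.En (V k) v"
    using extension(3)[OF vH, of k] by (simp add: coef_def ip_commute[of N "T v"])
  also have "\<dots> = d_const s * (\<sigma> k * coef r k)"
    using eq ip_trace_V[OF r, of k] by (simp add: F.En_sym[of "V k"])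
  finally show ?thesis using d_pos by simp
qed

text \<open>The state is built as the series of \<open>coef z k * V k\<close>; a competitor in the
  optimality condition has to come with a state. The \<open>V k\<close> are orthogonal in energy,
  their energies are bounded by \<open>d_const s * C1\<close>, and the Poincare inequality bounds
  the full norm by the energy.\<close>

lemma state_exists:
  assumes z: "z \<in> L2 N"
  obtains v where "is_state s \<Omega> A Y z v"
proof -
  define P where "P = K * (LINT y|W.M. 1) + 1"
  define c' where "c' = min c 1"
  have c': "0 < c'" using coercive_A(1) by (simp add: c'_def)
  have P: "0 \<le> P" using K_pos by (simp add: P_def add_nonneg_nonneg)
  define b where "b k = P / c' * d_const s * C1 * (coef z k)\<^sup>2" for k
  have b: "summable b" unfolding b_def[abs_def] by (intro summable_mult coef_square_summable z)
  have bound: "(nrm Z.M (wjet CY (\<lambda>x. \<Sum>k\<in>I. coef z k * V k x)))\<^sup>2 \<le> (\<Sum>k\<in>I. b k)" if I: "finite I" for I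
  proof -
    define S where "S x = (\<Sum>k\<in>I. coef z k * V k x)" for x
    have SH: "S \<in> F.H" unfolding S_def[abs_def] by (rule Z.Hcl_sum[OF lin_DL extension(1)])
    have VV: "F.En (V j) (V k) = (if j = k then d_const s * \<sigma> k else 0)" for j k
      unfolding extension(3)[OF extension(1)] ip_trace_V[OF phi_L2] by (simp add: coef_def phi_orthonormal)
    have VS: "F.En (V k) S = coef z k * (d_const s * \<sigma> k)" if "k \<in> I" for k
    proof -
      have "F.En S (V k) = (\<Sum>j\<in>I. coef z j * F.En (V j) (V k))"
        unfolding S_def[abs_def] by (rule F.En_sum_left[OF extension(1) extension(1)])
      also have "\<dots> = coef z k * (d_const s * \<sigma> k)"
        using I that by (simp add: VV if_distrib cong: if_cong)
      finally show ?thesis by (simp add: F.En_sym)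
    qed
    have "F.En S S = (\<Sum>k\<in>I. coef z k * F.En (V k) S)"
      by (subst (1) S_def[abs_def], rule F.En_sum_left[OF extension(1) SH])
    also have "\<dots> = (\<Sum>k\<in>I. d_const s * \<sigma> k * (coef z k)\<^sup>2)"
      using VS by (simp add: power2_eq_square mult_ac)
    also have "\<dots> \<le> (\<Sum>k\<in>I. d_const s * C1 * (coef z k)\<^sup>2)"
      using d_pos extension(5) by (intro sum_mono mult_right_mono mult_left_mono) auto
    finally have En: "F.En S S \<le> (\<Sum>k\<in>I. d_const s * C1 * (coef z k)\<^sup>2)" .
    have "c' * (nrm Z.M (weak_grad CY S))\<^sup>2 \<le> F.En S S"
      using F.En_coercive[OF SH] by (simp add: c'_def)
    then have gr: "(nrm Z.M (weak_grad CY S))\<^sup>2 \<le> F.En S S / c'"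
      using c' by (simp add: pos_le_divide_eq mult.commute)
    have "(nrm Z.M (wjet CY S))\<^sup>2 \<le> P * (nrm Z.M (weak_grad CY S))\<^sup>2"
      using Z.nrm_wjet_power2[OF SH] poincare[OF SH] by (simp add: P_def algebra_simps)
    also have "\<dots> \<le> P * ((\<Sum>k\<in>I. d_const s * C1 * (coef z k)\<^sup>2) / c')"
      using P gr En c' by (intro mult_left_mono order_trans[OF gr] divide_right_mono) auto
    also have "\<dots> = (\<Sum>k\<in>I. b k)"
      by (simp add: b_def sum_distrib_left sum_divide_distrib mult_ac)
    finally show ?thesis by (simp add: S_def[abs_def])
  qed
  obtain v where v: "v \<in> F.H" "(\<lambda>n. nrm Z.M (\<lambda>x. wjet CY (\<lambda>x. \<Sum>k<n. coef z k * V k x) x - wjet CY v x)) \<longlonglongrightarrow> 0"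
    using Z.Hcl_series[OF lin_DL extension(1) b bound] by blast
  have SH: "(\<lambda>x. \<Sum>k<n. coef z k * V k x) \<in> F.H" for n by (rule Z.Hcl_sum[OF lin_DL extension(1)])
  have "F.En v w = d_const s * ip N z (T w)" if w: "w \<in> F.H" for w
  proof -
    have "(\<lambda>n. F.En (\<lambda>x. \<Sum>k<n. coef z k * V k x) w) \<longlonglongrightarrow> F.En v w"
      by (rule F.En_tendsto[OF SH v(1) w v(2)])
    moreover have "F.En (\<lambda>x. \<Sum>k<n. coef z k * V k x) w = (\<Sum>k<n. d_const s * (coef z k * coef (T w) k))" for n
      unfolding F.En_sum_left[OF extension(1) w] by (simp add: extension(3)[OF w] coef_def ip_commute[of N "T w"] mult_ac)
    ultimately have "(\<lambda>k. d_const s * (coef z k * coef (T w) k)) sums F.En v w" by (simp add: sums_def)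
    moreover have "(\<lambda>k. d_const s * (coef z k * coef (T w) k)) sums (d_const s * ip N z (T w))"
      by (intro sums_mult parseval z tr_L2[OF w])
    ultimately show ?thesis by (rule sums_unique2)
  qed
  then show ?thesis using v(1) that is_state_iff by blast
qed

section \<open>First order optimality and regularity of the control\<close>

lemma state_combination:
  assumes "r \<in> L2 N" "r' \<in> L2 N" "is_state s \<Omega> A Y r v" "is_state s \<Omega> A Y r' v'"
  shows "is_state s \<Omega> A Y (\<lambda>x. r x + t * (r' x - r x)) (\<lambda>z. v z + t * (v' z - v z))"
    "AE x in N. T (\<lambda>z. v z + t * (v' z - v z)) x = T v x + t * (T v' x - T v x)"
proof -
  have H: "v \<in> F.H" "v' \<in> F.H" using assms by (auto simp: is_state_iff)
  have D: "(\<lambda>z. v' z - v z) \<in> F.H" by (rule Z.Hcl_diff(1)[OF lin_DL H(2,1)])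
  have tD: "(\<lambda>z. t * (v' z - v z)) \<in> F.H" by (rule Z.Hcl_cmult(1)[OF lin_DL D])
  have "(\<lambda>z. v z + t * (v' z - v z)) \<in> F.H" by (rule Z.Hcl_add(1)[OF lin_DL H(1) tD])
  moreover have "F.En (\<lambda>z. v z + t * (v' z - v z)) w = d_const s * ip N (\<lambda>x. r x + t * (r' x - r x)) (T w)"
    if w: "w \<in> F.H" for w
  proof -
    have "F.En (\<lambda>z. v z + t * (v' z - v z)) w = F.En v w + t * (F.En v' w - F.En v w)"
      by (simp add: F.En_add_left[OF H(1) tD w] F.En_cmult_left[OF D w] F.En_diff_left[OF H(2,1) w])
    also have "\<dots> = d_const s * (ip N r (T w) + t * (ip N r' (T w) - ip N r (T w)))"
      using assms(3,4) w by (simp add: is_state_iff algebra_simps)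
    also have "ip N r (T w) + t * (ip N r' (T w) - ip N r (T w)) = ip N (\<lambda>x. r x + t * (r' x - r x)) (T w)"
      by (simp add: ip_add_left[OF assms(1) L2_cmult[OF L2_diff[OF assms(2,1)]] tr_L2[OF w]]
          ip_cmult_left ip_diff_left[OF assms(2,1) tr_L2[OF w]])
    finally show ?thesis .
  qed
  ultimately show "is_state s \<Omega> A Y (\<lambda>x. r x + t * (r' x - r x)) (\<lambda>z. v z + t * (v' z - v z))"
    by (simp add: is_state_iff)
  have "AE x in N. T (\<lambda>z. v' z - v z) x = T v' x - T v x"
    using tr_add[OF lin_DL D H(1)] by eventually_elim simp
  then show "AE x in N. T (\<lambda>z. v z + t * (v' z - v z)) x = T v x + t * (T v' x - T v x)"
    using tr_add[OF lin_DL H(1) tD] tr_cmult[OF lin_DL D, of t] by eventually_elim simp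
qed

text \<open>Along the segment from r to z the cost is a quadratic polynomial in t that is minimal at
  t = 0, and its linear coefficient is the expression claimed to be nonnegative.\<close>

lemma variational_inequality:
  assumes opt: "is_optimal_pair s \<Omega> A Y \<theta> ud a b v r" and ud: "ud \<in> L2 N"
    and z: "z \<in> Z_ad \<Omega> a b" and v': "is_state s \<Omega> A Y z v'"
  shows "0 \<le> ip N (\<lambda>x. T v x - ud x) (\<lambda>x. T v' x - T v x) + \<theta> * ip N r (\<lambda>x. z x - r x)"
proof -
  have r: "r \<in> Z_ad \<Omega> a b" and v: "is_state s \<Omega> A Y r v"
    and min: "\<And>r' v'. r' \<in> Z_ad \<Omega> a b \<Longrightarrow> is_state s \<Omega> A Y r' v' \<Longrightarrow> cost s \<Omega> Y \<theta> ud v r \<le> cost s \<Omega> Y \<theta> ud v' r'"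
    using opt by (auto simp: is_optimal_pair_def)
  have L: "r \<in> L2 N" "z \<in> L2 N" using r z by (auto simp: Z_ad_def)
  have TL: "T v \<in> L2 N" "T v' \<in> L2 N" using v v' by (auto simp: is_state_iff intro: tr_L2)
  define e where "e x = T v x - ud x" for x
  define f where "f x = T v' x - T v x" for x
  define g where "g x = z x - r x" for x
  have eL: "e \<in> L2 N" and fL: "f \<in> L2 N" and gL: "g \<in> L2 N"
    unfolding e_def[abs_def] f_def[abs_def] g_def[abs_def] by (intro L2_diff TL ud L)+
  have expand: "(nrm N (\<lambda>x. p x + t * q x))\<^sup>2 = (nrm N p)\<^sup>2 + 2 * t * ip N p q + t\<^sup>2 * (nrm N q)\<^sup>2"
    if "p \<in> L2 N" "q \<in> L2 N" for p q :: "real^'n \<Rightarrow> real" and t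
    unfolding nrm_power2
    using that by (simp add: ip_add_left ip_add_right L2_add L2_cmult ip_cmult_left ip_cmult_right
        ip_commute[of N q p] power2_eq_square algebra_simps)
  have q: "0 \<le> t * (ip N e f + \<theta> * ip N r g) + t\<^sup>2 * ((nrm N f)\<^sup>2 / 2 + \<theta> * (nrm N g)\<^sup>2 / 2)"
    if t: "0 < t" "t \<le> 1" for t
  proof -
    note st = state_combination[OF L v v', of t]
    have rt: "(\<lambda>x. r x + t * (z x - r x)) \<in> Z_ad \<Omega> a b"
    proof -
      have conv: "a \<le> x + t * (y - x) \<and> x + t * (y - x) \<le> b" if "a \<le> x" "x \<le> b" "a \<le> y" "y \<le> b" for x y
      proof -
        have "x + t * (y - x) = (1 - t) * x + t * y" by (simp add: algebra_simps)
        moreover have "(1 - t) * a + t * a \<le> (1 - t) * x + t * y"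
          using t that by (intro add_mono mult_left_mono) auto
        moreover have "(1 - t) * x + t * y \<le> (1 - t) * b + t * b"
          using t that by (intro add_mono mult_left_mono) auto
        ultimately show ?thesis by (simp add: algebra_simps)
      qed
      have "AE x in N. a \<le> r x \<and> r x \<le> b" "AE x in N. a \<le> z x \<and> z x \<le> b"
        using r z by (auto simp: Z_ad_def)
      then have "AE x in N. a \<le> r x + t * (z x - r x) \<and> r x + t * (z x - r x) \<le> b"
        by eventually_elim (use conv in auto)
      then show ?thesis using L by (simp add: Z_ad_def L2_add L2_cmult L2_diff)
    qed
    have sH: "(\<lambda>z. v z + t * (v' z - v z)) \<in> F.H" using st(1) by (simp add: is_state_iff)
    have "nrm N (\<lambda>x. T (\<lambda>z. v z + t * (v' z - v z)) x - ud x) = nrm N (\<lambda>x. e x + t * f x)"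
      by (rule nrm_cong_AE[OF L2_measurable[OF L2_diff[OF tr_L2[OF sH] ud]] L2_measurable[OF L2_add[OF eL L2_cmult[OF fL]]]])
        (use st(2) in \<open>auto elim: eventually_mono simp: e_def f_def\<close>)
    then have "1/2 * (nrm N e)\<^sup>2 + \<theta>/2 * (nrm N r)\<^sup>2
        \<le> 1/2 * (nrm N (\<lambda>x. e x + t * f x))\<^sup>2 + \<theta>/2 * (nrm N (\<lambda>x. r x + t * g x))\<^sup>2"
      using min[OF rt st(1)] by (simp add: cost_def norm_L2_eq_nrm e_def[abs_def] g_def)
    then show ?thesis
      unfolding expand[OF eL fL] expand[OF L(1) gL] by (simp add: algebra_simps)
  qed
  show ?thesis
    using quadratic_first_order[OF q] by (simp add: e_def[abs_def] f_def[abs_def] g_def[abs_def])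
qed

lemma optimal_control_regular:
  assumes opt: "is_optimal_pair s \<Omega> A Y \<theta> ud a b v r" and ud: "ud \<in> L2 N" and \<theta>: "0 < \<theta>"
    and ab: "a < 0" "0 < b"
    and reg: "summable (\<lambda>k. lam k powr (1 - s) * (coef ud k)\<^sup>2)"
  shows "summable (\<lambda>k. lam k * (coef r k)\<^sup>2)"
proof -
  have r: "r \<in> Z_ad \<Omega> a b" and v: "is_state s \<Omega> A Y r v" using opt by (auto simp: is_optimal_pair_def)
  have rL: "r \<in> L2 N" using r by (simp add: Z_ad_def)
  have TvL: "T v \<in> L2 N" using v by (auto simp: is_state_iff intro: tr_L2)
  define R where "R = (\<Sum>k. lam k powr (1 - s) * (coef ud k)\<^sup>2)"
  define Q where "Q = C1 * C2 / (2 * \<theta>)"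
  have C1: "0 \<le> C1" using extension(4,5) order_trans by blast
  have main: "(\<Sum>k<n. lam k / (1 + \<epsilon> * lam k) * (coef r k)\<^sup>2) \<le> 2 * Q * R / \<theta>" if \<epsilon>: "0 < \<epsilon>" for \<epsilon> n
  proof -
    have p: "1 \<le> 1 + \<epsilon> * lam k" for k using \<epsilon> lam_nonneg[of k] by simp
    \<comment> \<open>The fraction of the k-th mode removed by the resolvent. Being at most 1 it
      gives summability, being at most \<open>\<epsilon> * lam k\<close> it gives the scaling in
      \<epsilon>.\<close>
    define m where "m k = \<epsilon> * lam k / (1 + \<epsilon> * lam k)" for k
    have m: "0 \<le> m k" "m k \<le> 1" "m k \<le> \<epsilon> * lam k" for k
    proof -
      show "0 \<le> m k" using p[of k] \<epsilon> lam_nonneg[of k] by (simp add: m_def)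
      show "m k \<le> 1" using p[of k] by (simp add: m_def pos_divide_le_eq)
      have "\<epsilon> * lam k * 1 \<le> \<epsilon> * lam k * (1 + \<epsilon> * lam k)" using p[of k] \<epsilon> lam_nonneg[of k] by (intro mult_left_mono) auto
      then show "m k \<le> \<epsilon> * lam k" using p[of k] by (simp add: m_def pos_divide_le_eq)
    qed
    obtain z where z: "z \<in> E.H" "\<And>k. coef z k = coef r k / (1 + \<epsilon> * lam k)"
      "\<And>w. w \<in> E.H \<Longrightarrow> ip N z w + \<epsilon> * E.En z w = ip N r w"
      using resolvent[OF rL \<epsilon>] by blast
    have zZ: "z \<in> Z_ad \<Omega> a b" by (rule resolvent_Z_ad[OF r ab \<epsilon> z(1,3)])
    have zL: "z \<in> L2 N" by (rule H_L2[OF z(1)])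
    obtain v' where v': "is_state s \<Omega> A Y z v'" using state_exists[OF zL] by blast
    have TvL': "T v' \<in> L2 N" using v' by (auto simp: is_state_iff intro: tr_L2)
    have zr: "coef z k - coef r k = - m k * coef r k" for k
    proof -
      have "x / y - x = - ((y - 1) / y) * x" if "1 \<le> y" for x y :: real
        using that by (simp add: field_simps)
      from this[OF p[of k]] show ?thesis by (simp add: z(2) m_def)
    qed
    \<comment> \<open>The k-th term of the variational inequality, expanded by Parseval.\<close>
    define t where "t k = (\<sigma> k * coef r k - coef ud k) * (\<sigma> k * (- m k * coef r k)) + \<theta> * (coef r k * (- m k * coef r k))" for k
    have codiff: "coef (\<lambda>x. p x - q x) k = coef p k - coef q k" if "p \<in> L2 N" "q \<in> L2 N" for p q k
      unfolding coef_def by (rule ip_diff_left[OF that phi_L2])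
    have "(\<lambda>k. coef (\<lambda>x. T v x - ud x) k * coef (\<lambda>x. T v' x - T v x) k + \<theta> * (coef r k * coef (\<lambda>x. z x - r x) k))
        sums (ip N (\<lambda>x. T v x - ud x) (\<lambda>x. T v' x - T v x) + \<theta> * ip N r (\<lambda>x. z x - r x))"
      by (intro sums_add sums_mult parseval L2_diff TvL TvL' ud rL zL)
    moreover have "coef (\<lambda>x. T v x - ud x) k * coef (\<lambda>x. T v' x - T v x) k + \<theta> * (coef r k * coef (\<lambda>x. z x - r x) k) = t k" for k
      unfolding codiff[OF TvL ud] codiff[OF TvL' TvL] codiff[OF zL rL] state_coefficients[OF rL v] state_coefficients[OF zL v']
        right_diff_distrib[symmetric] zr t_def by simp
    ultimately have t: "summable t" "0 \<le> (\<Sum>k. t k)"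
      using variational_inequality[OF opt ud zZ v'] by (auto simp: sums_iff)
    \<comment> \<open>Young's inequality splits the product of u and r so that half of the control
      cost absorbs the r part; the state term \<open>- m k * (\<sigma> k * coef r k)^2\<close> has
      the right sign and is dropped.\<close>
    have young: "t k + \<theta> / 2 * (m k * (coef r k)\<^sup>2) \<le> \<epsilon> * Q * (lam k powr (1 - s) * (coef ud k)\<^sup>2)" for k
    proof -
      define x where "x = coef r k"
      define u where "u = coef ud k"
      have "0 \<le> (\<theta> * x - \<sigma> k * u)\<^sup>2" by simp
      then have y: "2 * \<theta> * (\<sigma> k * u * x) \<le> \<theta>\<^sup>2 * x\<^sup>2 + (\<sigma> k)\<^sup>2 * u\<^sup>2"
        by (simp add: power2_diff power_mult_distrib algebra_simps)
      have y2: "\<sigma> k * u * x \<le> \<theta> / 2 * x\<^sup>2 + (\<sigma> k)\<^sup>2 * u\<^sup>2 / (2 * \<theta>)"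
      proof -
        have "\<sigma> k * u * x = (2 * \<theta> * (\<sigma> k * u * x)) / (2 * \<theta>)" using \<theta> by simp
        also have "\<dots> \<le> (\<theta>\<^sup>2 * x\<^sup>2 + (\<sigma> k)\<^sup>2 * u\<^sup>2) / (2 * \<theta>)" using y \<theta> by (intro divide_right_mono) auto
        also have "\<dots> = \<theta> / 2 * x\<^sup>2 + (\<sigma> k)\<^sup>2 * u\<^sup>2 / (2 * \<theta>)" using \<theta> by (simp add: add_divide_distrib power2_eq_square)
        finally show ?thesis .
      qed
      have "t k + \<theta> / 2 * (m k * x\<^sup>2) = m k * (\<sigma> k * u * x - \<theta> / 2 * x\<^sup>2) - m k * (\<sigma> k * x)\<^sup>2"
        unfolding t_def x_def[symmetric] u_def[symmetric] by (simp add: algebra_simps power2_eq_square)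
      also have "\<dots> \<le> m k * ((\<sigma> k)\<^sup>2 * u\<^sup>2 / (2 * \<theta>))"
        using mult_left_mono[of "\<sigma> k * u * x - \<theta> / 2 * x\<^sup>2" "(\<sigma> k)\<^sup>2 * u\<^sup>2 / (2 * \<theta>)" "m k"] y2 m(1)[of k]
          mult_nonneg_nonneg[OF m(1)[of k] zero_le_power2[of "\<sigma> k * x"]] by linarith
      also have "\<dots> \<le> (\<epsilon> * lam k) * ((\<sigma> k)\<^sup>2 * u\<^sup>2 / (2 * \<theta>))"
        using m(3)[of k] \<theta> by (intro mult_right_mono) auto
      also have "\<dots> = \<epsilon> * (lam k * (\<sigma> k)\<^sup>2) * u\<^sup>2 / (2 * \<theta>)" by simp
      \<comment> \<open>One factor \<open>\<sigma> k\<close> is bounded by \<open>C1\<close>, the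
        other together with \<open>lam k powr s\<close> by \<open>C2\<close>; the power
        \<open>lam k powr (1 - s)\<close> left over is matched by the regularity of the desired
        state.\<close>
      also have "\<dots> \<le> \<epsilon> * (C1 * C2 * lam k powr (1 - s)) * u\<^sup>2 / (2 * \<theta>)"
      proof (intro divide_right_mono mult_right_mono mult_left_mono)
        have "lam k = lam k powr (1 - s) * lam k powr s"
          using lam_nonneg[of k] by (simp add: powr_add[symmetric])
        then have "lam k * (\<sigma> k)\<^sup>2 = lam k powr (1 - s) * (\<sigma> k * (lam k powr s * \<sigma> k))"
          by (simp add: power2_eq_square mult_ac)
        also have "\<dots> \<le> lam k powr (1 - s) * (C1 * C2)"
          using extension(4-6)[of k] C1 by (intro mult_left_mono mult_mono) auto
        finally show "lam k * (\<sigma> k)\<^sup>2 \<le> C1 * C2 * lam k powr (1 - s)" by (simp add: mult_ac)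
      qed (use \<epsilon> \<theta> in auto)
      also have "\<dots> = \<epsilon> * Q * (lam k powr (1 - s) * u\<^sup>2)" by (simp add: Q_def)
      finally show ?thesis by (simp add: x_def u_def)
    qed
    have smr: "summable (\<lambda>k. m k * (coef r k)\<^sup>2)"
      by (rule summable_comparison_test'[OF coef_square_summable[OF rL]])
        (use m in \<open>auto simp: abs_mult intro: mult_left_le_one_le\<close>)
    have "\<theta> / 2 * (\<Sum>k. m k * (coef r k)\<^sup>2) \<le> (\<Sum>k. t k) + \<theta> / 2 * (\<Sum>k. m k * (coef r k)\<^sup>2)" using t(2) by simp
    also have "\<dots> = (\<Sum>k. t k + \<theta> / 2 * (m k * (coef r k)\<^sup>2))"
      using suminf_add[OF t(1) summable_mult[OF smr, of "\<theta> / 2"]] suminf_mult[OF smr, of "\<theta> / 2"] by simp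
    also have "\<dots> \<le> (\<Sum>k. \<epsilon> * Q * (lam k powr (1 - s) * (coef ud k)\<^sup>2))"
      by (intro suminf_le young summable_add t summable_mult smr reg)
    also have "\<dots> = \<epsilon> * Q * R" unfolding R_def by (rule suminf_mult[OF reg])
    finally have fin: "\<theta> / 2 * (\<Sum>k. m k * (coef r k)\<^sup>2) \<le> \<epsilon> * Q * R" .
    have "(\<Sum>k<n. m k * (coef r k)\<^sup>2) \<le> (\<Sum>k. m k * (coef r k)\<^sup>2)"
      by (rule sum_le_suminf[OF smr]) (use m in auto)
    then have "\<theta> / 2 * (\<Sum>k<n. m k * (coef r k)\<^sup>2) \<le> \<theta> / 2 * (\<Sum>k. m k * (coef r k)\<^sup>2)"
      using \<theta> by (intro mult_left_mono) auto
    also note fin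
    finally have "\<theta> / 2 * (\<Sum>k<n. m k * (coef r k)\<^sup>2) \<le> \<epsilon> * Q * R" .
    moreover have "(\<Sum>k<n. m k * (coef r k)\<^sup>2) = \<epsilon> * (\<Sum>k<n. lam k / (1 + \<epsilon> * lam k) * (coef r k)\<^sup>2)"
      by (simp add: m_def sum_distrib_left mult.assoc)
    ultimately have "\<epsilon> * (\<theta> / 2 * (\<Sum>k<n. lam k / (1 + \<epsilon> * lam k) * (coef r k)\<^sup>2)) \<le> \<epsilon> * (Q * R)"
      by (simp add: mult_ac)
    then have "\<theta> / 2 * (\<Sum>k<n. lam k / (1 + \<epsilon> * lam k) * (coef r k)\<^sup>2) \<le> Q * R" using \<epsilon> by simp
    then show ?thesis using \<theta> by (simp add: field_simps)
  qed
  have "(\<Sum>k<n. lam k * (coef r k)\<^sup>2) \<le> 2 * Q * R / \<theta>" for n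
  \<comment> \<open>The bound does not depend on \<epsilon> or n, so \<epsilon> can tend to 0 term
    by term in a finite sum.\<close>
  proof (rule LIMSEQ_le_const2)
    have "(\<lambda>j. \<Sum>k<n. lam k / (1 + inverse (real (Suc j)) * lam k) * (coef r k)\<^sup>2)
        \<longlonglongrightarrow> (\<Sum>k<n. lam k / (1 + 0 * lam k) * (coef r k)\<^sup>2)"
      by (intro tendsto_intros LIMSEQ_inverse_real_of_nat) auto
    then show "(\<lambda>j. \<Sum>k<n. lam k / (1 + inverse (real (Suc j)) * lam k) * (coef r k)\<^sup>2)
        \<longlonglongrightarrow> (\<Sum>k<n. lam k * (coef r k)\<^sup>2)" by simp
    show "\<exists>N. \<forall>j\<ge>N. (\<Sum>k<n. lam k / (1 + inverse (real (Suc j)) * lam k) * (coef r k)\<^sup>2) \<le> 2 * Q * R / \<theta>"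
      using main by (meson inverse_positive_iff_positive of_nat_0_less_iff zero_less_Suc)
  qed
  then show ?thesis
    by (intro bounded_imp_summable[of _ "2 * Q * R / \<theta>"])
      (use lam_nonneg in \<open>auto simp: lessThan_Suc_atMost[symmetric] simp del: sum.lessThan_Suc\<close>)
qed

text \<open>Summability gives an element of \<open>H10\<close> with the same coefficients, hence
  equal to w almost everywhere. Conversely, nonnegativity of the energy of w minus its partial sums
  is Bessel's inequality for the energy form.\<close>

lemma H10_iff_summable:
  assumes "w \<in> L2 N"
  shows "w \<in> E.H \<longleftrightarrow> summable (\<lambda>k. lam k * (coef w k)\<^sup>2)"
proof
  assume sm: "summable (\<lambda>k. lam k * (coef w k)\<^sup>2)"
  have "summable (\<lambda>k. (1 + lam k) * (coef w k)\<^sup>2)"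
    using summable_add[OF coef_square_summable[OF assms] sm] by (simp add: algebra_simps)
  then obtain z where z: "z \<in> E.H" "\<And>k. coef z k = coef w k" using H10_series by blast
  have "AE x in N. z x = w x" by (rule coef_unique[OF H_L2[OF z(1)] assms z(2)])
  then have "AE x in G.M. z x = w x" unfolding G_M .
  moreover have "w \<in> borel_measurable G.M" using L2_measurable[OF assms] by (simp add: weighted_one)
  ultimately show "w \<in> E.H" using G.Hcl_AE_cong(1)[OF z(1)] by blast
next
  assume w: "w \<in> E.H"
  have bessel: "(\<Sum>k<n. lam k * (coef w k)\<^sup>2) \<le> E.En w w" for n
  proof -
    define S where "S x = (\<Sum>k<n. coef w k * \<phi> k x)" for x
    have SH: "S \<in> E.H" unfolding S_def[abs_def] by (rule G.Hcl_sum[OF lin_test phi_H])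
    have Su: "E.En S u = (\<Sum>k<n. coef w k * (lam k * ip N (\<phi> k) u))" if "u \<in> E.H" for u
      unfolding S_def[abs_def] E.En_sum_left[OF phi_H that] by (simp add: phi_eigen[OF that])
    have 1: "E.En S w = (\<Sum>k<n. lam k * (coef w k)\<^sup>2)"
      unfolding Su[OF w] by (simp add: coef_def ip_commute[of N w] power2_eq_square mult_ac)
    have "ip N (\<phi> k) S = coef w k" if "k < n" for k
      using ip_partial_sum[of "{..<n}" "coef w" k] that by (simp add: S_def[abs_def] ip_commute)
    then have 2: "E.En S S = (\<Sum>k<n. lam k * (coef w k)\<^sup>2)"
      unfolding Su[OF SH] by (simp add: power2_eq_square mult_ac)
    have dH: "(\<lambda>x. w x - S x) \<in> E.H" by (rule G.Hcl_diff(1)[OF lin_test w SH])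
    have "0 \<le> E.En (\<lambda>x. w x - S x) (\<lambda>x. w x - S x)" by (rule E.En_nonneg[OF dH])
    also have "\<dots> = E.En w (\<lambda>x. w x - S x) - E.En S (\<lambda>x. w x - S x)" by (rule E.En_diff_left[OF w SH dH])
    also have "\<dots> = E.En w w - E.En S w - (E.En w S - E.En S S)"
      unfolding E.En_sym[of w "\<lambda>x. w x - S x"] E.En_sym[of S "\<lambda>x. w x - S x"] E.En_diff_left[OF w SH w]
        E.En_diff_left[OF w SH SH] ..
    finally show ?thesis using 1 2 by (simp add: E.En_sym[of w S])
  qed
  show "summable (\<lambda>k. lam k * (coef w k)\<^sup>2)"
    by (rule bounded_imp_summable[of _ "E.En w w"])
      (use lam_nonneg bessel in \<open>auto simp: lessThan_Suc_atMost[symmetric] simp del: sum.lessThan_Suc\<close>)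
qed

text \<open>Testing the adjoint equation with \<open>V k\<close> applies \<sigma> k to the
  coefficients of the tracking error, which are known from
  \<open>state_coefficients\<close>.\<close>

lemma adjoint_coefficients:
  assumes r: "r \<in> L2 N" and ud: "ud \<in> L2 N" and v: "is_state s \<Omega> A Y r v" and p: "is_adjoint_state s \<Omega> A Y ud v p"
  shows "coef (T p) k = \<sigma> k * (\<sigma> k * coef r k - coef ud k)"
proof -
  have pH: "p \<in> F.H" and eq: "a_Y s \<Omega> A Y (V k) p = ip N (\<lambda>x. T v x - ud x) (T (V k))"
    using p extension(1)[of k] by (auto simp: is_adjoint_state_def H1L_eq inner_L2_eq_ip)
  have TL: "T v \<in> L2 N" using v by (auto simp: is_state_iff intro: tr_L2)
  have "coef (T p) k = F.En (V k) p / d_const s"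
    using extension(3)[OF pH, of k] d_pos by (simp add: coef_def ip_commute[of N "T p"])
  also have "\<dots> = ip N (\<lambda>x. T v x - ud x) (T (V k))"
    using eq by (simp add: a_Y_eq[OF extension(1) pH])
  also have "\<dots> = \<sigma> k * coef (\<lambda>x. T v x - ud x) k" by (rule ip_trace_V[OF L2_diff[OF TL ud]])
  also have "coef (\<lambda>x. T v x - ud x) k = \<sigma> k * coef r k - coef ud k"
    unfolding coef_def ip_diff_left[OF TL ud phi_L2] using state_coefficients[OF r v, of k] by (simp add: coef_def)
  finally show ?thesis .
qed

text \<open>The outer factor \<sigma> k supplies 2s orders of decay in the squared coefficients, and
  both r and the desired state contribute one order by lying in \<open>H10\<close>.\<close>

lemma adjoint_regular:
  assumes r: "r \<in> E.H" and ud: "ud \<in> E.H" and v: "is_state s \<Omega> A Y r v" and p: "is_adjoint_state s \<Omega> A Y ud v p"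
  shows "summable (\<lambda>k. lam k powr min (1 + 2 * s) 2 * (coef (T p) k)\<^sup>2)"
proof (rule summable_comparison_test')
  note L = H_L2[OF r] H_L2[OF ud]
  have s1: "summable (\<lambda>k. (1 + lam k) * (coef w k)\<^sup>2)" if "w \<in> E.H" for w
    using summable_add[OF coef_square_summable[OF H_L2[OF that]] H10_iff_summable[OF H_L2[OF that], THEN iffD1, OF that]]
    by (simp add: distrib_right)
  define B where "B = C1\<^sup>2 + C2\<^sup>2"
  show "summable (\<lambda>k. B * (2 * C1\<^sup>2 * ((1 + lam k) * (coef r k)\<^sup>2) + 2 * ((1 + lam k) * (coef ud k)\<^sup>2)))"
    by (intro summable_mult summable_add s1 r ud)
  fix k
  define l where "l = lam k"
  define \<kappa> where "\<kappa> = min (1 + 2 * s) 2"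
  have l: "0 \<le> l" by (simp add: l_def lam_nonneg)
  have sg: "0 \<le> \<sigma> k" "\<sigma> k \<le> C1" "l powr s * \<sigma> k \<le> C2" using extension(4-6)[of k] by (auto simp: l_def)
  have sg2: "(\<sigma> k)\<^sup>2 \<le> C1\<^sup>2" "(l powr s * \<sigma> k)\<^sup>2 \<le> C2\<^sup>2" using sg by (auto intro!: power_mono)
  \<comment> \<open>For small l the bound \<open>C1\<close> suffices. For large l the factor
    \<open>l powr (2 * s)\<close> is absorbed by \<open>C2\<close>, and the remaining exponent is at
    most 1 by the choice of \<kappa>.\<close>
  have weight: "l powr \<kappa> * (\<sigma> k)\<^sup>2 \<le> B * (1 + l)"
  proof (cases "l \<le> 1")
    case True
    have "l powr \<kappa> \<le> 1 powr \<kappa>" using True l s by (intro powr_mono2) (auto simp: \<kappa>_def)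
    then have "l powr \<kappa> * (\<sigma> k)\<^sup>2 \<le> 1 * C1\<^sup>2" using sg2 by (intro mult_mono) auto
    also have "\<dots> \<le> B * 1" by (simp add: B_def)
    also have "\<dots> \<le> B * (1 + l)" using l by (intro mult_left_mono) (auto simp: B_def)
    finally show ?thesis .
  next
    case False
    then have l1: "1 < l" by simp
    have "l powr \<kappa> = l powr (\<kappa> - 2 * s) * (l powr s)\<^sup>2"
      using l1 by (simp add: power2_eq_square powr_add[symmetric])
    then have "l powr \<kappa> * (\<sigma> k)\<^sup>2 = l powr (\<kappa> - 2 * s) * (l powr s * \<sigma> k)\<^sup>2"
      by (simp add: power_mult_distrib)
    also have "\<dots> \<le> l powr 1 * C2\<^sup>2"
      using l1 sg2 by (intro mult_mono powr_mono) (auto simp: \<kappa>_def)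
    also have "\<dots> \<le> B * (1 + l)" using l1 by (simp add: B_def algebra_simps)
    finally show ?thesis .
  qed
  have "(\<sigma> k * coef r k - coef ud k)\<^sup>2 \<le> 2 * (\<sigma> k * coef r k)\<^sup>2 + 2 * (coef ud k)\<^sup>2"
    using sum_squares_bound[of "\<sigma> k * coef r k" "- coef ud k"] by (simp add: power2_diff)
  also have "\<dots> \<le> 2 * C1\<^sup>2 * (coef r k)\<^sup>2 + 2 * (coef ud k)\<^sup>2"
    using sg2(1) by (simp add: power_mult_distrib mult_right_mono)
  finally have sq: "(\<sigma> k * coef r k - coef ud k)\<^sup>2 \<le> 2 * C1\<^sup>2 * (coef r k)\<^sup>2 + 2 * (coef ud k)\<^sup>2" .
  have "l powr \<kappa> * (coef (T p) k)\<^sup>2 = (l powr \<kappa> * (\<sigma> k)\<^sup>2) * (\<sigma> k * coef r k - coef ud k)\<^sup>2"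
    unfolding adjoint_coefficients[OF L v p] by (simp add: power_mult_distrib)
  also have "\<dots> \<le> (B * (1 + l)) * (2 * C1\<^sup>2 * (coef r k)\<^sup>2 + 2 * (coef ud k)\<^sup>2)"
    by (rule mult_mono[OF weight sq]) (use l in \<open>auto simp: B_def\<close>)
  finally show "norm (lam k powr min (1 + 2 * s) 2 * (coef (T p) k)\<^sup>2)
      \<le> B * (2 * C1\<^sup>2 * ((1 + lam k) * (coef r k)\<^sup>2) + 2 * ((1 + lam k) * (coef ud k)\<^sup>2))"
    by (simp add: l_def \<kappa>_def algebra_simps)
qed

end

theorem proposition4p1:
  fixes \<Omega> :: "(real^'n) set"
    and A :: "real^'n \<Rightarrow> real^'n^'n"
    and lam :: "nat \<Rightarrow> real" and \<phi> :: "nat \<Rightarrow> real^'n \<Rightarrow> real"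
    and s Y \<theta> a b :: real
    and u\<^sub>d r :: "real^'n \<Rightarrow> real"
    and v p :: "(real^'n) \<times> real \<Rightarrow> real"
  assumes domain: "open \<Omega>" "bounded \<Omega>" "connected \<Omega>" "\<Omega> \<noteq> {}" "lipschitz_boundary \<Omega>"
    and coefficients: "elliptic_coefficients \<Omega> A"
    and eigenbasis: "dirichlet_eigenbasis \<Omega> A lam \<phi>"
    and s: "0 < s" "s < 1"
    and Y: "1 \<le> Y"
    and \<theta>: "0 < \<theta>"
    and u\<^sub>d: "u\<^sub>d \<in> L2 (lebesgue_on \<Omega>)"
    and ab: "a < b"
    and optimal: "is_optimal_pair s \<Omega> A Y \<theta> u\<^sub>d a b v r"
    and adjoint: "is_adjoint_state s \<Omega> A Y u\<^sub>d v p"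
    and convex: "convex \<Omega>"
    and A_lipschitz: "\<exists>L. L-lipschitz_on (closure \<Omega>) A"
    and signs: "a < 0" "0 < b"
    and u\<^sub>d_regular: "u\<^sub>d \<in> spectral_space \<Omega> lam \<phi> (1 - s)"
  shows "r \<in> H10 \<Omega> \<and>
         (u\<^sub>d \<in> H10 \<Omega> \<longrightarrow> tr s \<Omega> Y p \<in> spectral_space \<Omega> lam \<phi> (min (1 + 2 * s) 2))"
proof -
  have cont_cl: "continuous_on (closure \<Omega>) A"
    using A_lipschitz lipschitz_on_continuous_on by blast
  then have cont: "continuous_on \<Omega> A" by (rule continuous_on_subset[OF _ closure_subset])
  have mv: "continuous_on \<Omega> (\<lambda>x. A x *v w)" for w
    by (intro continuous_on_matrix_vector_mult cont continuous_on_const)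
  \<comment> \<open>Symmetry and, below, ellipticity are given almost everywhere and hold at every
    point because A is continuous.\<close>
  have sym: "transpose (A x) = A x" if "x \<in> \<Omega>" for x
  proof (rule AE_open_all[OF domain(1) _ _ that])
    show "AE x in lebesgue_on \<Omega>. transpose (A x) = A x" using coefficients by (simp add: elliptic_coefficients_def)
    have "continuous_on \<Omega> (\<lambda>x. transpose (A x) - A x)"
      unfolding transpose_def by (intro continuous_intros cont)
    then have "open (\<Omega> \<inter> (\<lambda>x. transpose (A x) - A x) -` (- {0}))"
      using domain(1) by (subst (asm) continuous_on_open_vimage) (auto simp: Int_commute)
    moreover have "\<Omega> \<inter> (\<lambda>x. transpose (A x) - A x) -` (- {0}) = {x \<in> \<Omega>. transpose (A x) \<noteq> A x}" by auto
    ultimately show "open {x \<in> \<Omega>. transpose (A x) \<noteq> A x}" by simp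
  qed
  obtain c where c: "0 < c" "AE x in lebesgue_on \<Omega>. \<forall>\<xi>. c * (norm \<xi>)\<^sup>2 \<le> \<xi> \<bullet> (A x *v \<xi>)"
    using coefficients by (auto simp: elliptic_coefficients_def)
  have coer: "\<forall>\<xi>. c * (norm \<xi>)\<^sup>2 \<le> \<xi> \<bullet> (A x *v \<xi>)" if "x \<in> \<Omega>" for x
  proof (rule AE_open_all[OF domain(1) c(2) _ that])
    have "open (\<Omega> \<inter> (\<lambda>x. \<xi> \<bullet> (A x *v \<xi>)) -` {..<c * (norm \<xi>)\<^sup>2})" for \<xi>
      using continuous_on_inner[OF continuous_on_const mv, of \<xi> \<xi>] domain(1)
      by (subst (asm) continuous_on_open_vimage) (auto simp: Int_commute)
    \<comment> \<open>The set where ellipticity fails for some \<xi> is an arbitrary union of open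
      sets, one for each \<xi>; no countable dense set of directions has to be chosen.\<close>
    then have "open (\<Union>\<xi>. \<Omega> \<inter> (\<lambda>x. \<xi> \<bullet> (A x *v \<xi>)) -` {..<c * (norm \<xi>)\<^sup>2})" by (intro open_UN) auto
    moreover have "(\<Union>\<xi>. \<Omega> \<inter> (\<lambda>x. \<xi> \<bullet> (A x *v \<xi>)) -` {..<c * (norm \<xi>)\<^sup>2})
        = {x \<in> \<Omega>. \<not> (\<forall>\<xi>. c * (norm \<xi>)\<^sup>2 \<le> \<xi> \<bullet> (A x *v \<xi>))}"
      by (auto simp: not_le)
    ultimately show "open {x \<in> \<Omega>. \<not> (\<forall>\<xi>. c * (norm \<xi>)\<^sup>2 \<le> \<xi> \<bullet> (A x *v \<xi>))}" by simp
  qed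
  obtain B where B: "0 < B" "\<And>x. x \<in> closure \<Omega> \<Longrightarrow> norm (A x) \<le> B"
  proof -
    have "compact (A ` closure \<Omega>)" using domain(2) by (intro compact_continuous_image cont_cl) simp
    then show ?thesis using that compact_imp_bounded[of "A ` closure \<Omega>"] by (auto simp: bounded_pos)
  qed
  \<comment> \<open>An operator norm bound for a square matrix whose entries are all bounded by
    B.\<close>
  define C where "C = real CARD('n) * real CARD('n) * B"
  have bound: "norm (A x *v w) \<le> C * norm w" if "x \<in> \<Omega>" for x w
  proof -
    have "\<bar>A x $ i $ j\<bar> \<le> B" for i j
      using component_le_norm_cart[of "A x $ i" j] Finite_Cartesian_Product.norm_nth_le[of "A x" i] B(2)[of x] that closure_subset[of \<Omega>] by force
    then have "onorm ((*v) (A x)) \<le> C" unfolding C_def by (rule onorm_le_matrix_component)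
    then show ?thesis
      using onorm[OF matrix_vector_mul_bounded_linear, of "A x" w] mult_right_mono[of "onorm ((*v) (A x))" C "norm w"] by simp
  qed
  interpret control_problem \<Omega> s Y A C c lam \<phi>
  proof unfold_locales
    show "(A x *v w) \<bullet> w' = w \<bullet> (A x *v w')" if "x \<in> \<Omega>" for x w w'
      using sym[OF that] by (metis dot_lmul_matrix vector_transpose_matrix)
    show "c * (norm w)\<^sup>2 \<le> (A x *v w) \<bullet> w" if "x \<in> \<Omega>" for x w
      using coer[OF that] by (simp add: inner_commute)
  qed (use domain s Y cont bound c eigenbasis B in \<open>auto simp: C_def\<close>)
  have r: "r \<in> Z_ad \<Omega> a b" and v: "is_state s \<Omega> A Y r v" using optimal by (auto simp: is_optimal_pair_def)
  have rL: "r \<in> L2 N" using r by (simp add: Z_ad_def)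
  have spec: "w \<in> spectral_space \<Omega> lam \<phi> q \<longleftrightarrow> w \<in> L2 N \<and> summable (\<lambda>k. lam k powr q * (coef w k)\<^sup>2)" for w q
    by (simp add: spectral_space_def coef_def inner_L2_eq_ip)
  have "summable (\<lambda>k. lam k * (coef r k)\<^sup>2)"
    by (rule optimal_control_regular[OF optimal u\<^sub>d \<theta> signs]) (use u\<^sub>d_regular spec in blast)
  then have rH: "r \<in> E.H" using H10_iff_summable[OF rL] by simp
  have "T p \<in> spectral_space \<Omega> lam \<phi> (min (1 + 2 * s) 2)" if "u\<^sub>d \<in> E.H"
    unfolding spec using adjoint_regular[OF rH that v adjoint] adjoint
    by (auto simp: is_adjoint_state_def H1L_eq intro: tr_L2)
  then show ?thesis using rH by (simp add: H10_eq)
qed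

end
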